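(* Let $n\ge1$, $\beta>0$, let $\mu$ be chosen from the Killip–Nenciu law with parameters $\beta,n$, let $\tilde\mu$ be the uniform probability measure on the support of $\mu$, and let $\nu$ be $\mu$ biased by the weight of $1$. Let $X$ be picked from $\mu$ and let $Y$ be picked from $\tilde\mu$. Then $\operatorname{supp}\mu(X\cdot)$, $\operatorname{supp}\tilde\mu(Y\cdot)$ and $\operatorname{supp}\nu(\cdot)$ all have the same law. The modified Verblunsky coefficients $\gamma_k'$, $0\le k\le n-1$, of $\nu$ are independent, with $\gamma'_k$ having density on $\mathbb U=\{|z|<1\}$ proportional to $$(1-|z|^2)^{\frac\beta2(n-k-1)}\,|1-z|^{-2},\qquad 0\le k\le n-2,$$ and $\gamma_{n-1}'=1$.
   Context: Killip–Nenciu law with parameters $\beta,n$: the law of the random probability measure on the unit circle $\partial\mathbb U$ whose support is the size $n$ circular beta-ensemble ($n$ points with joint density proportional to $\prod_{j<k\le n}|z_j-z_k|^\beta$ with respect to the uniform measure on $(\partial\mathbb U)^n$), and whose weights have Dirichlet$(\beta/2,\dots,\beta/2)$ joint distribution and are independent of the support. For a measure $m$ on $\partial\mathbb U$ and $x\in\partial\mathbb U$, $m(x\,\cdot)$ denotes the measure $B\mapsto m(xB)$. "$X$ picked from $\mu$" means that conditionally on the random measure $\mu$ the point $X$ has distribution $\mu$ (similarly for $Y$). Biasing by the weight of $1$: for $\varepsilon>0$ let $\mu_\varepsilon$ have the law with Radon–Nikodym derivative $\mu(B_\varepsilon)/E\mu(B_\varepsilon)$ with respect to the law of $\mu$, where $B_\varepsilon$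 is the $\varepsilon$-neighbourhood of $1$ in $\partial\mathbb U$; $\mu$ biased by the weight of $1$ is the limit in distribution of $\mu_\varepsilon$ as $\varepsilon\to0$ (the existence of the limit being part of the claim). Modified Verblunsky coefficients: for a probability measure on $\partial\mathbb U$ with exactly $n$ support points, let $\Phi_k$, $0\le k\le n$, be the monic orthogonal polynomials ($\Phi_n$ vanishing on the support), $\Phi_k^*(z)=z^k\overline{\Phi_k(1/\bar z)}$, and define $\alpha_k$ by $\Phi_{k+1}(z)=z\Phi_k(z)-\bar\alpha_k\Phi_k^*(z)$, $0\le k\le n-1$. Then $\gamma_0=\bar\alpha_0$ and $\gamma_k=\bar\alpha_k\prod_{j=0}^{k-1}\frac{1-\bar\gamma_j}{1-\gamma_j}$, $1\le k\le n-1$. *)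

theory Defs
  imports "HOL-Probability.Probability" "HOL-Computational_Algebra.Polynomial"
begin

definition circle_borel :: "complex measure" where
  "circle_borel = restrict_space borel (sphere 0 1)"

definition circle_uniform :: "complex measure" where
  "circle_uniform = distr (uniform_measure lborel {0..<2 * pi}) circle_borel cis"

abbreviation circle_measures :: "complex measure measure" where
  "circle_measures \<equiv> prob_algebra circle_borel"

definition supp :: "complex measure \<Rightarrow> complex set" where
  "supp m = {x \<in> space m. \<forall>U. open U \<longrightarrow> x \<in> U \<longrightarrow> emeasure m (U \<inter> space m) > 0}"

text \<open>
  \<open>rotate_measure x m\<close> is the measure \<open>m(x \<cdot>)\<close>, that is, \<open>B \<mapsto> m(xB)\<close>: for \<open>x\<close> and \<open>z\<close> on the
  circle, \<open>z / x \<in> B\<close> holds iff \<open>z \<in> xB\<close>.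
\<close>
definition rotate_measure :: "complex \<Rightarrow> complex measure \<Rightarrow> complex measure" where
  "rotate_measure x m = distr m circle_borel (\<lambda>z. z / x)"

text \<open>
  The value \<open>m\<close> when the support is infinite is arbitrary (the law considered below
  charges only measures with finite support); it makes the map total on probability measures.
\<close>
definition uniform_on_supp :: "complex measure \<Rightarrow> complex measure" where
  "uniform_on_supp m =
     (if finite (supp m) then distr (uniform_count_measure (supp m)) circle_borel (\<lambda>z. z) else m)"

text \<open>
  The measurable space in which supports live: closed subsets of the circle with the
  sigma-algebra generated by the events that the random set hits an open set \<open>U\<close>
  (Effros, equivalently the Borel sigma-algebra of the Fell topology). A probability measure on
  this space is the law of a random closed set.
\<close>
definition closed_subsets :: "complex set measure" where
  "closed_subsets =
     sigma {S. closed S \<and> S \<subseteq> sphere 0 1}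
       {{S. closed S \<and> S \<subseteq> sphere 0 1 \<and> S \<inter> U \<noteq> {}} | U. open U}"

definition normalized_density :: "'a measure \<Rightarrow> ('a \<Rightarrow> ennreal) \<Rightarrow> 'a measure" where
  "normalized_density M f = density M (\<lambda>x. f x / (\<integral>\<^sup>+ y. f y \<partial>M))"

definition circular_beta_ensemble :: "nat \<Rightarrow> real \<Rightarrow> (nat \<Rightarrow> complex) measure" where
  "circular_beta_ensemble n \<beta> =
     normalized_density (\<Pi>\<^sub>M i\<in>{..<n}. circle_uniform)
       (\<lambda>z. ennreal (\<Prod>k<n. \<Prod>j<k. cmod (z j - z k) powr \<beta>))"

definition prob_simplex :: "nat \<Rightarrow> (nat \<Rightarrow> real) measure" where
  "prob_simplex n = restrict_space (\<Pi>\<^sub>M i\<in>{..<n}. borel)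
     {w. (\<forall>i<n. 0 \<le> w i) \<and> (\<Sum>i<n. w i) = 1}"

text \<open>
  The first \<open>n - 1\<close> coordinates have density proportional to
  \<open>(\<Prod>i<n-1. v\<^sub>i powr (a\<^sub>i - 1)) * (1 - \<Sum>i<n-1. v\<^sub>i) powr (a\<^sub>n\<^sub>-\<^sub>1 - 1)\<close>
  with respect to Lebesgue measure, and the last coordinate is \<open>1\<close> minus their sum.
  For \<open>n = 1\<close> the reference measure is the point mass of the empty product and the single weight
  is \<open>1\<close>.
\<close>
definition dirichlet :: "nat \<Rightarrow> (nat \<Rightarrow> real) \<Rightarrow> (nat \<Rightarrow> real) measure" where
  "dirichlet n a =
     distr
       (normalized_density
         (restrict_space (\<Pi>\<^sub>M i\<in>{..<n - 1}. lborel)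
            {v. (\<forall>i<n - 1. 0 < v i) \<and> (\<Sum>i<n - 1. v i) < 1})
         (\<lambda>v. ennreal ((\<Prod>i<n - 1. v i powr (a i - 1))
                * (1 - (\<Sum>i<n - 1. v i)) powr (a (n - 1) - 1))))
       (prob_simplex n)
       (\<lambda>v. v(n - 1 := 1 - (\<Sum>i<n - 1. v i)))"

text \<open>The measure \<open>\<Sum>i<n. w\<^sub>i \<delta>(z\<^sub>i)\<close>.\<close>
definition weighted_points :: "nat \<Rightarrow> (nat \<Rightarrow> complex) \<Rightarrow> (nat \<Rightarrow> real) \<Rightarrow> complex measure" where
  "weighted_points n z w = distr (point_measure {..<n} (\<lambda>i. ennreal (w i))) circle_borel z"

definition killip_nenciu :: "nat \<Rightarrow> real \<Rightarrow> complex measure measure" where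
  "killip_nenciu n \<beta> =
     distr (circular_beta_ensemble n \<beta> \<Otimes>\<^sub>M dirichlet n (\<lambda>_. \<beta> / 2)) circle_measures
       (\<lambda>(z, w). weighted_points n z w)"

text \<open>
  Conditionally on the random measure \<open>\<kappa>\<close>, the random point \<open>X\<close> has distribution \<open>\<kappa>\<close>.
\<close>
definition picked_from ::
    "'w measure \<Rightarrow> ('w \<Rightarrow> complex) \<Rightarrow> ('w \<Rightarrow> complex measure) \<Rightarrow> bool" where
  "picked_from \<Omega> X \<kappa> \<longleftrightarrow>
     \<kappa> \<in> \<Omega> \<rightarrow>\<^sub>M circle_measures \<and> X \<in> \<Omega> \<rightarrow>\<^sub>M circle_borel \<and>
     (\<forall>A\<in>sets circle_measures. \<forall>B\<in>sets circle_borel.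
        emeasure \<Omega> {\<omega> \<in> space \<Omega>. \<kappa> \<omega> \<in> A \<and> X \<omega> \<in> B} =
        (\<integral>\<^sup>+ \<omega>. emeasure (\<kappa> \<omega>) B * indicator {\<omega> \<in> space \<Omega>. \<kappa> \<omega> \<in> A} \<omega> \<partial>\<Omega>))"

definition weak_topology :: "complex measure topology" where
  "weak_topology = topology_generated_by
     {{m \<in> space circle_measures. (\<integral>z. f z \<partial>m) \<in> V} | (f :: complex \<Rightarrow> real) V.
        continuous_on (sphere 0 1) f \<and> open V}"

definition converges_in_distribution ::
    "'a topology \<Rightarrow> ('i \<Rightarrow> 'a measure) \<Rightarrow> 'a measure \<Rightarrow> 'i filter \<Rightarrow> bool" where
  "converges_in_distribution T L N F \<longleftrightarrow>
     (\<forall>g :: 'a \<Rightarrow> real. continuous_map T euclideanreal g \<and> bounded (g ` topspace T) \<longrightarrow>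
        ((\<lambda>i. \<integral>m. g m \<partial>(L i)) \<longlongrightarrow> (\<integral>m. g m \<partial>N)) F)"

definition nbhd_of_one :: "real \<Rightarrow> complex set" where
  "nbhd_of_one \<epsilon> = {z \<in> sphere 0 1. dist z 1 < \<epsilon>}"

text \<open>
  \<open>L\<close> is the law of a random probability measure \<open>\<mu>\<close>, and \<open>biased_approx \<epsilon> L\<close> is the law with
  Radon--Nikodym derivative \<open>\<mu>(B\<^sub>\<epsilon>) / E \<mu>(B\<^sub>\<epsilon>)\<close> with respect to \<open>L\<close>.
\<close>
definition biased_approx :: "real \<Rightarrow> complex measure measure \<Rightarrow> complex measure measure" where
  "biased_approx \<epsilon> L = normalized_density L (\<lambda>m. emeasure m (nbhd_of_one \<epsilon>))"

definition is_biased_by_weight_of_one ::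
    "complex measure measure \<Rightarrow> complex measure measure \<Rightarrow> bool" where
  "is_biased_by_weight_of_one L N \<longleftrightarrow>
     prob_space N \<and> sets N = sets circle_measures \<and>
     converges_in_distribution weak_topology (\<lambda>\<epsilon>. biased_approx \<epsilon> L) N (at_right 0)"

text \<open>
  For a probability measure with exactly \<open>n\<close> support points, the monic orthogonal polynomials of
  degrees \<open>0, \<dots>, n\<close> are unique; for degree \<open>n\<close>, orthogonality to all lower powers
  forces the polynomial to vanish in \<open>L\<^sup>2(m)\<close>, that is, on the support.
\<close>
definition monic_ortho_poly :: "complex measure \<Rightarrow> nat \<Rightarrow> complex poly" where
  "monic_ortho_poly m k =
     (THE p. degree p = k \<and> lead_coeff p = 1 \<and> (\<forall>j<k. (\<integral>z. poly p z * cnj (z ^ j) \<partial>m) = 0))"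

definition verblunsky :: "complex measure \<Rightarrow> nat \<Rightarrow> complex" where
  "verblunsky m k =
     (THE \<alpha>. \<forall>z. z \<noteq> 0 \<longrightarrow>
        poly (monic_ortho_poly m (Suc k)) z =
          z * poly (monic_ortho_poly m k) z
            - cnj \<alpha> * (z ^ k * cnj (poly (monic_ortho_poly m k) (1 / cnj z))))"

fun modified_coeffs :: "(nat \<Rightarrow> complex) \<Rightarrow> nat \<Rightarrow> complex" where
  "modified_coeffs \<alpha> k =
     cnj (\<alpha> k) * (\<Prod>j<k. (1 - cnj (modified_coeffs \<alpha> j)) / (1 - modified_coeffs \<alpha> j))"

declare modified_coeffs.simps [simp del]

text \<open>
  The coefficients are meaningful for measures with exactly \<open>n\<close> support points and
  \<open>k < n\<close>; the value \<open>0\<close> elsewhere is arbitrary and makes them functions on all of the space of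
  probability measures.
\<close>
definition modified_verblunsky :: "nat \<Rightarrow> complex measure \<Rightarrow> nat \<Rightarrow> complex" where
  "modified_verblunsky n m k =
     (if finite (supp m) \<and> card (supp m) = n then modified_coeffs (verblunsky m) k else 0)"

end

theory Submission
  imports Defs
begin

text \<open>
  Exchangeability reduces a point picked from the random measure to the last one, and rotation
  invariance turns it to \<open>1\<close>: picking a point and rotating it to \<open>1\<close> gives an independent uniform
  angle and the law \<open>N\<close> of a configuration with a point at \<open>1\<close>, size-biased by the weight of that
  point. This Palm formula yields the biased limit and the support laws; uniform picking
  only changes the weights, which are independent of the support.

  For the coefficients, a Cayley transform sends the point \<open>1\<close> to infinity and the other points to
  \<open>x\<^sub>0 < \<dots> < x\<^sub>m\<^sub>-\<^sub>1\<close> on the line. Stripping the first modified coefficient maps points and weights to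
  an interlacing configuration with one point fewer, through the partial fraction expansion of a
  Herglotz function; the coefficient itself is read off from the two remaining parameters \<open>(a, b)\<close>
  of the upper half-plane. The Jacobian of this map is explicit, and the product of
  \<open>(1 - \<bar>\<gamma>\<^sub>k\<bar>\<^sup>2) ^ (m - k)\<close> is the squared Vandermonde determinant times the weights, so
  the density factorises. The half-plane measure becomes \<open>\<bar>1 - z\<bar>\<^sup>-\<^sup>2 dz\<close> on the disk.
\<close>

text \<open>No determinant is computed. Every change of variables is composed of one-dimensional
  substitutions and coordinatewise scalings, applied to nonnegative integrals. This shapes the
  real-line part: the passage from residues to zeros is built up one pole at a time, and a stripping
  step is compared in the coordinates total mass, outer points and inner points, through which both
  the outer weights and the triple of \<open>a\<close>, \<open>b\<close> and inner weights can be
  expressed. No normalising constant is evaluated either. Since the given law is a probability law,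
  the integrals of its two densities are finite and positive; the Palm formula then makes the biased
  law a probability law, and its total mass forces each factor on the disk to be finite and positive
  in turn. The modified coefficients are the natural parameters once 1 lies at infinity: stripping
  merely shifts them, whereas the Verblunsky coefficients differ from them by phases that depend on
  all earlier coefficients.\<close>

abbreviation leb_nn (binder "Leb " 10) where "leb_nn \<equiv> nn_integral lborel"

section \<open>Lagrange interpolation and partial fractions\<close>

text \<open>The difference of the two sides has degree below \<open>m\<close> and the
  \<open>m\<close> distinct zeros \<open>x i\<close>. The disjunct \<open>T = 0\<close> admits
  \<open>m = 0\<close>, where no degree is below \<open>m\<close>.\<close>

lemma lagrange_interpolation:
 fixes x :: "nat => 'a :: field"
 assumes inj: "inj_on x {..<m}" and deg: "T = 0 \<or> degree T < m"
 shows "T = (\<Sum>i<m. smult (poly T (x i) / (\<Prod>j\<in>{..<m}-{i}. x i - x j)) (\<Prod>j\<in>{..<m}-{i}. [:-x j, 1:]))"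
  (is "T = ?U")
proof (rule ccontr)
 assume ne: "T ~= ?U"
 define d where "d = T - ?U"
 have d0: "d ~= 0" using ne by (simp add: d_def)
 have m: "m > 0" using ne deg by (cases m) auto
 let ?f = "%i k. poly T (x i) / (\<Prod>j\<in>{..<m}-{i}. x i - x j) * (\<Prod>j\<in>{..<m}-{i}. x k - x j)"
 have eval: "poly ?U (x k) = poly T (x k)" if "k < m" for k
 proof -
  have "poly ?U (x k) = (\<Sum>i<m. ?f i k)"
   by (simp add: poly_sum poly_prod)
  also have "... = (\<Sum>i<m. if i = k then poly T (x k) else 0)"
  proof (rule sum.cong[OF refl])
   fix i assume i: "i \<in> {..<m}"
   show "?f i k = (if i = k then poly T (x k) else 0)"
   proof (cases "i = k")
    case True
    have "(\<Prod>j\<in>{..<m}-{k}. x k - x j) ~= 0"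
     using inj that by (auto simp: inj_on_def)
    then show ?thesis using True by simp
   next
    case False
    have "(\<Prod>j\<in>{..<m}-{i}. x k - x j) = 0"
     using False that by (intro prod_zero) auto
    then show ?thesis using False by simp
   qed
  qed
  also have "... = poly T (x k)" using that by simp
  finally show ?thesis .
 qed
 have roots: "x ` {..<m} \<subseteq> {z. poly d z = 0}"
  using eval by (auto simp: d_def)
 have "m = card (x ` {..<m})" using card_image[OF inj] by simp
 also have "... \<le> card {z. poly d z = 0}"
  using roots d0 by (intro card_mono poly_roots_finite) auto
 also have "... \<le> degree d" using d0 by (rule card_poly_roots_bound)
 finally have "m \<le> degree d" .
 have "degree ?U < m"
 proof -
  have "degree (smult a (\<Prod>j\<in>{..<m}-{i}. [:-x j, 1:])) \<le> m - 1" if "i < m" for a i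
  proof -
   have "degree (\<Prod>j\<in>{..<m}-{i}. [:-x j, 1:]) \<le> (\<Sum>j\<in>{..<m}-{i}. degree [:-x j, 1:])"
    using degree_prod_sum_le[of "{..<m}-{i}" "%j. [:-x j, 1:]"] by (simp add: o_def)
   also have "... = m - 1" using that by simp
   finally show ?thesis by (meson degree_smult_le le_trans)
  qed
  then have "degree ?U \<le> m - 1" by (intro degree_sum_le) (auto simp del: degree_smult_eq)
  with m show ?thesis by linarith
 qed
 moreover have "degree T < m" using deg m by auto
 ultimately have "degree d < m" unfolding d_def by (intro degree_diff_less)
 with \<open>m \<le> degree d\<close> show False by simp
qed

lemma lagrange_partial_fractions:
 fixes x :: "nat => 'a :: field"
 assumes inj: "inj_on x {..<m}" and deg: "T = 0 \<or> degree T < m" and t: "!!i. i < m ==> t ~= x i"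
 shows "poly T t / (\<Prod>i<m. t - x i) = (\<Sum>i<m. poly T (x i) / (\<Prod>j\<in>{..<m}-{i}. x i - x j) / (t - x i))"
proof -
 have "poly T t = (\<Sum>i<m. poly T (x i) / (\<Prod>j\<in>{..<m}-{i}. x i - x j) * (\<Prod>j\<in>{..<m}-{i}. t - x j))"
  by (subst lagrange_interpolation[OF inj deg]) (simp add: poly_sum poly_prod)
 also have "... = (\<Sum>i<m. poly T (x i) / (\<Prod>j\<in>{..<m}-{i}. x i - x j) / (t - x i) * (\<Prod>i<m. t - x i))"
 proof (intro sum.cong refl)
  fix i assume i: "i \<in> {..<m}"
  have "(\<Prod>i<m. t - x i) = (t - x i) * (\<Prod>j\<in>{..<m}-{i}. t - x j)"
   using i by (intro prod.remove) auto
  then show "poly T (x i) / (\<Prod>j\<in>{..<m}-{i}. x i - x j) * (\<Prod>j\<in>{..<m}-{i}. t - x j)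
   = poly T (x i) / (\<Prod>j\<in>{..<m}-{i}. x i - x j) / (t - x i) * (\<Prod>i<m. t - x i)"
   using t[of i] i by simp
 qed
 finally have "poly T t = (\<Sum>i<m. poly T (x i) / (\<Prod>j\<in>{..<m}-{i}. x i - x j) / (t - x i)) * (\<Prod>i<m. t - x i)"
  by (simp only: sum_distrib_right)
 moreover have nz: "(\<Prod>i<m. t - x i) ~= 0" using t by simp
 ultimately show ?thesis unfolding nonzero_divide_eq_eq[OF nz] by blast
qed

text \<open>Each Lagrange basis polynomial is monic of degree \<open>m - 1\<close>. The left-hand
  side is the sum of the residues of \<open>T / (\<Prod>i<m. t - x i)\<close>; both the
  orthogonality relations and the total mass of the outer weights come from this identity.\<close>

lemma lagrange_top_coeff:
 fixes x :: "nat => 'a :: field"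
 assumes inj: "inj_on x {..<m}" and deg: "degree T < m"
 shows "(\<Sum>i<m. poly T (x i) / (\<Prod>j\<in>{..<m}-{i}. x i - x j)) = coeff T (m - 1)"
proof -
 let ?f = "%i. \<Prod>j\<in>{..<m}-{i}. [:-x j, 1:]"
 have c: "coeff (?f i) (m - 1) = 1" if "i < m" for i
 proof -
  have "degree (?f i) = (\<Sum>j\<in>{..<m}-{i}. degree [:-x j, 1:])"
   by (intro degree_prod_eq_sum_degree) auto
  also have "... = m - 1" using that by simp
  finally have "coeff (?f i) (m - 1) = lead_coeff (?f i)"
   by simp
  also have "... = 1" by (simp add: lead_coeff_prod)
  finally show ?thesis .
 qed
 have "coeff T (m - 1) = (\<Sum>i<m. poly T (x i) / (\<Prod>j\<in>{..<m}-{i}. x i - x j) * coeff (?f i) (m - 1))"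
  by (subst lagrange_interpolation[OF inj disjI2[OF deg]]) (simp add: coeff_sum)
 then show ?thesis using c by simp
qed

lemma degree_prod_linear: "finite I ==> degree (\<Prod>i\<in>I. [:- x i, 1 :: 'a :: field:]) = card I"
 by (subst degree_prod_eq_sum_degree) auto

lemma monic_prod_linear: "lead_coeff (\<Prod>i\<in>I. [:- x i, 1 :: 'a :: field:]) = 1"
 by (simp add: lead_coeff_prod)

text \<open>Numerator and denominator are both monic of degree \<open>m\<close>, so their difference
  has lower degree and a proper partial fraction expansion; at a pole the denominator contributes
  nothing to that difference.\<close>

lemma partial_fractions_balanced:
 fixes x y :: "nat => 'a :: field"
 assumes inj: "inj_on y {..<m}" and t: "!!i. i < m ==> t ~= y i"
 shows "(\<Prod>i<m. t - x i) / (\<Prod>i<m. t - y i)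
  = 1 + (\<Sum>k<m. (\<Prod>i<m. y k - x i) / (\<Prod>j\<in>{..<m}-{k}. y k - y j) / (t - y k))"
proof -
 define X Y where "X = (\<Prod>i<m. [:- x i, 1:])" and "Y = (\<Prod>i<m. [:- y i, 1:])"
 have dX: "degree X = m" and dY: "degree Y = m" unfolding X_def Y_def by (simp_all add: degree_prod_linear)
 have "X - Y = 0 \<or> degree (X - Y) < m"
 proof (cases "m = 0")
  case False
  have "coeff (X - Y) m = 0"
   using dX dY monic_prod_linear[of x "{..<m}"] monic_prod_linear[of y "{..<m}"] by (simp add: X_def Y_def)
  moreover have "degree (X - Y) \<le> m" using dX dY by (metis degree_diff_le order_refl)
  ultimately show ?thesis
   by (metis leading_coeff_0_iff le_neq_implies_less)
 qed (simp add: X_def Y_def)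
 from lagrange_partial_fractions[OF inj this t]
 have "poly (X - Y) t / (\<Prod>i<m. t - y i) = (\<Sum>k<m. poly (X - Y) (y k) / (\<Prod>j\<in>{..<m}-{k}. y k - y j) / (t - y k))" .
 also have "... = (\<Sum>k<m. (\<Prod>i<m. y k - x i) / (\<Prod>j\<in>{..<m}-{k}. y k - y j) / (t - y k))"
 proof (intro sum.cong refl)
  fix k assume "k \<in> {..<m}"
  then have "(\<Prod>i<m. y k - y i) = 0" by (intro prod_zero) auto
  then show "poly (X - Y) (y k) / (\<Prod>j\<in>{..<m}-{k}. y k - y j) / (t - y k)
    = (\<Prod>i<m. y k - x i) / (\<Prod>j\<in>{..<m}-{k}. y k - y j) / (t - y k)"
   by (simp add: X_def Y_def poly_prod)
 qed
 finally have *: "poly (X - Y) t / (\<Prod>i<m. t - y i) = (\<Sum>k<m. (\<Prod>i<m. y k - x i) / (\<Prod>j\<in>{..<m}-{k}. y k - y j) / (t - y k))" .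
 have "(\<Prod>i<m. t - y i) ~= 0" using t by simp
 then have "poly (X - Y) t / (\<Prod>i<m. t - y i) = (\<Prod>i<m. t - x i) / (\<Prod>i<m. t - y i) - 1"
  by (simp add: X_def Y_def poly_prod diff_divide_distrib)
 then show ?thesis using * by (simp add: algebra_simps)
qed

section \<open>One-dimensional substitution and scaling\<close>

lemma einterval_ivl:
 assumes "x \<in> einterval a b" "y \<in> einterval a b" "x \<le> z" "z \<le> y"
 shows "z \<in> einterval a b"
proof -
 have "ereal x \<le> ereal z" "ereal z \<le> ereal y" using assms by auto
 with assms(1,2) show ?thesis unfolding einterval_def
  using le_less_trans[of "ereal z" "ereal y" b] less_le_trans[of a "ereal x" "ereal z"] by auto
qed

text \<open>Exhausting the open interval by compact ones reduces the claim to the substitution rule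
  on compact intervals and monotone convergence. The endpoints may be infinite and \<open>g\<close>
  may be unbounded near them, as happens for zeros that run off to a pole or to infinity.\<close>

lemma nn_integral_substitution_open:
 fixes g g' :: "real => real" and f :: "real => ennreal" and a b :: ereal
 assumes [measurable]: "f \<in> borel_measurable borel" "g \<in> borel_measurable borel" "g' \<in> borel_measurable borel"
  and ab: "a < b"
  and der: "!!x. x \<in> einterval a b ==> (g has_real_derivative g' x) (at x)"
  and cont: "continuous_on (einterval a b) g'"
  and nonneg: "!!x. x \<in> einterval a b ==> 0 \<le> g' x"
 shows "(Leb x. f (g x) * ennreal (g' x) * indicator (einterval a b) x)
    = (Leb x. f x * indicator (g ` einterval a b) x)"
proof -
 let ?S = "einterval a b"
 obtain u l :: "nat => real" where
  S: "?S = (\<Union>i. {l i .. u i})" and inc: "incseq u" and dec: "decseq l" and lu: "!!i. l i < u i"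
  by (rule einterval_Icc_approximation[OF ab]) blast
 have sub: "{l i..u i} \<subseteq> ?S" for i using S by blast
 have mono: "g x \<le> g y" if "x \<in> ?S" "y \<in> ?S" "x \<le> y" for x y
 proof (rule DERIV_nonneg_imp_nondecreasing[OF that(3)])
  fix z assume "x \<le> z" "z \<le> y"
  then have "z \<in> ?S" using einterval_ivl that(1,2) by blast
  then show "\<exists>d. (g has_real_derivative d) (at z) & 0 \<le> d" using der nonneg by blast
 qed
 have img: "g ` {l i..u i} = {g (l i)..g (u i)}" for i
 proof -
  have "continuous_on {l i..u i} g"
   using der sub by (meson DERIV_isCont continuous_at_imp_continuous_on subsetD)
  moreover have "connected {l i..u i}" by simp
  ultimately have con: "connected (g ` {l i..u i})" by (rule connected_continuous_image)
  show ?thesis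
  proof
   show "g ` {l i..u i} \<subseteq> {g (l i)..g (u i)}"
   proof
    fix z assume "z \<in> g ` {l i..u i}"
    then obtain x where x: "x \<in> {l i..u i}" "z = g x" by blast
    have "l i \<in> ?S" "u i \<in> ?S" "x \<in> ?S" using sub[of i] lu[of i] x(1) by auto
    then show "z \<in> {g (l i)..g (u i)}" using mono x by auto
   qed
   show "{g (l i)..g (u i)} \<subseteq> g ` {l i..u i}"
    using lu[of i] by (intro connected_contains_Icc[OF con]) auto
  qed
 qed
 have T: "g ` ?S = (\<Union>i. {g (l i)..g (u i)})"
  unfolding S image_UN img ..
 have [measurable]: "?S \<in> sets borel" by simp
 have Tm[measurable]: "g ` ?S \<in> sets borel" unfolding T by measurable
 let ?h = "density lborel (%x. ennreal (g' x) * indicator ?S x)"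
 define M where "M = distr ?h borel g"
 define N where "N = density lborel (indicator (g ` ?S) :: real => ennreal)"
 have incS: "incseq (%i. {l i..u i})"
  unfolding incseq_def
 proof (intro allI impI)
  fix i j :: nat assume "i \<le> j"
  then have "l j \<le> l i" "u i \<le> u j" using inc dec by (auto simp: incseq_def decseq_def)
  then show "{l i..u i} \<subseteq> {l j..u j}" by auto
 qed
 have incT: "incseq (%i. {g (l i)..g (u i)})"
  unfolding incseq_def img[symmetric]
 proof (intro allI impI image_mono)
  fix i j :: nat assume "i \<le> j"
  with incS show "{l i..u i} \<subseteq> {l j..u j}" unfolding incseq_def by blast
 qed
 have ind: "(SUP i. indicator (A i) x :: ennreal) = indicator (\<Union>i. A i) x" for A :: "nat => real set" and x
 proof (cases "x \<in> (\<Union>i. A i)")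
  case True
  then obtain i where "x \<in> A i" by blast
  then have "1 \<le> (SUP i. indicator (A i) x :: ennreal)" by (intro SUP_upper2[of i]) auto
  moreover have "(SUP i. indicator (A i) x :: ennreal) \<le> 1" by (intro SUP_least) (auto simp: indicator_def)
  ultimately show ?thesis using True by auto
 qed auto
 have incind: "incseq (%i x. c x * indicator (A i) x :: ennreal)"
  if "incseq A" for A :: "nat => real set" and c
  unfolding incseq_def le_fun_def
 proof (intro allI impI mult_left_mono)
  fix i j :: nat and x assume "i \<le> j"
  then have "A i \<subseteq> A j" using that by (simp add: incseq_def)
  then show "indicator (A i) x \<le> (indicator (A j) x :: ennreal)" by (auto simp: indicator_def)
 qed simp
 let ?f = "%A x i. indicator A x * indicator {g (l i)..g (u i)} x"
 let ?g = "%A x i. indicator A (g x) * ennreal (g' x) * indicator {l i..u i} x"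
 have "M = N"
 proof (rule measure_eqI)
  show "sets M = sets N" by (simp add: M_def N_def)
  fix A assume "A \<in> sets M"
  then have [measurable]: "A \<in> sets borel" by (simp add: M_def)
  have "emeasure M A = (Leb x. indicator A (g x) * ennreal (g' x) * indicator ?S x)"
  proof -
   have gA: "g -` A \<in> sets lborel"
    using measurable_sets[OF assms(2) \<open>A \<in> sets borel\<close>] by simp
   have "emeasure M A = emeasure ?h (g -` A)"
    by (simp add: M_def emeasure_distr)
   also have "... = (Leb x. ennreal (g' x) * indicator ?S x * indicator (g -` A) x)"
    using gA by (intro emeasure_density) auto
   finally show ?thesis by (simp add: indicator_vimage mult_ac)
  qed
  also have "... = (Leb x. SUP i. ?g A x i)"
   by (simp add: SUP_mult_left_ennreal[symmetric] ind S)
  also have "... = (SUP i. Leb x. ?g A x i)"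
   by (intro nn_integral_monotone_convergence_SUP incind[OF incS]) simp
  also have "... = (SUP i. Leb x. ?f A x i)"
  proof (intro SUP_cong refl)
   fix i
   have "(Leb x. ennreal (?f A x i)) = (Leb x. ennreal (indicator A (g x) * g' x * indicator {l i..u i} x))"
   proof (rule nn_integral_substitution)
    show "set_borel_measurable borel {g (l i)..g (u i)} (indicator A :: real => real)"
     unfolding set_borel_measurable_def by measurable
    show "continuous_on {l i..u i} g'" using cont sub continuous_on_subset by blast
   qed (use der nonneg sub lu[of i] in \<open>auto simp: subset_iff\<close>)
   note subst = this
   show "(Leb x. ?g A x i) = (Leb x. ?f A x i)"
   proof -
    have "ennreal (indicator A y * indicator B y) = indicator A y * indicator B y" for y and B :: "real set"
     by (simp add: indicator_def)
    moreover have "ennreal (indicator A (g y) * g' y * indicator B y) = indicator A (g y) * ennreal (g' y) * indicator B y"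
     for y and B :: "real set" by (simp add: indicator_def)
    ultimately show ?thesis using subst by simp
   qed
  qed
  also have "... = (Leb x. SUP i. ?f A x i)"
   by (intro nn_integral_monotone_convergence_SUP[symmetric] incind[OF incT]) simp
  also have "... = emeasure N A"
   by (simp add: SUP_mult_left_ennreal[symmetric] ind T[symmetric] N_def emeasure_density mult.commute)
  finally show "emeasure M A = emeasure N A" .
 qed
 then have "(\<integral>\<^sup>+x. f x \<partial>M) = (\<integral>\<^sup>+x. f x \<partial>N)" by simp
 then show ?thesis
  by (simp add: M_def N_def nn_integral_distr nn_integral_density mult_ac)
qed

text \<open>Reflecting the target line turns \<open>g\<close> into an increasing function.\<close>

lemma nn_integral_substitution_open_decreasing:
 fixes g g' :: "real => real" and f :: "real => ennreal" and a b :: ereal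
 assumes [measurable]: "f \<in> borel_measurable borel" "g \<in> borel_measurable borel" "g' \<in> borel_measurable borel"
  and ab: "a < b"
  and der: "!!x. x \<in> einterval a b ==> (g has_real_derivative - g' x) (at x)"
  and cont: "continuous_on (einterval a b) g'"
  and nonneg: "!!x. x \<in> einterval a b ==> 0 \<le> g' x"
 shows "(Leb x. f (g x) * ennreal (g' x) * indicator (einterval a b) x)
    = (Leb x. f x * indicator (g ` einterval a b) x)"
proof -
 let ?S = "einterval a b"
 have "(Leb x. f (- (- g x)) * ennreal (g' x) * indicator ?S x) = (Leb x. f (- x) * indicator ((%x. - g x) ` ?S) x)"
 proof (rule nn_integral_substitution_open[where f="%x. f (- x)" and g="%x. - g x"])
  show "((%x. - g x) has_real_derivative g' x) (at x)" if "x \<in> ?S" for x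
   using DERIV_minus[OF der[OF that]] by simp
 qed (use assms in auto)
 also have "... = (Leb x. f (- x) * indicator (g ` ?S) (- x))"
 proof (intro nn_integral_cong)
  fix x
  have "x \<in> (%x. - g x) ` ?S \<longleftrightarrow> - x \<in> g ` ?S" by force
  then show "f (- x) * indicator ((%x. - g x) ` ?S) x = f (- x) * indicator (g ` ?S) (- x)"
   by (simp add: indicator_def)
 qed
 also have "... = (Leb x. f x * indicator (g ` ?S) x)"
 proof -
  have "connected (g ` ?S)"
  proof (rule connected_continuous_image)
   show "continuous_on ?S g"
    using der by (meson DERIV_isCont continuous_at_imp_continuous_on)
   show "connected ?S"
    unfolding is_interval_connected_1[symmetric] is_interval_1 using einterval_ivl by blast
  qed
  then have [measurable]: "g ` ?S \<in> sets borel"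
   by (simp add: is_interval_connected_1[symmetric] real_interval_borel_measurable)
  show ?thesis
   by (subst (2) nn_integral_real_affine[where c="-1" and t=0]) auto
 qed
 finally show ?thesis by simp
qed

section \<open>Products of Lebesgue measure over initial segments\<close>

abbreviation leb :: "nat => (nat => real) measure" where
 "leb m \<equiv> PiM {..<m} (%_. lborel)"

abbreviation Leb_n where "Leb_n m \<equiv> nn_integral (leb m)"

interpretation lebP: product_sigma_finite "%_::nat. lborel :: real measure"
 by standard

text \<open>Outside \<open>I\<close> every point of the product takes the fixed value
  \<open>undefined\<close>, so the coordinate is constant there. Admitting all indices keeps index
  bounds out of the later measurability goals.\<close>

lemma measurable_coordinate [measurable]:
 "(%x. x i) \<in> borel_measurable (PiM I (%_. lborel :: real measure))"
proof (cases "i \<in> I")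
 case True
 then have "(%x. x i) \<in> PiM I (%_. lborel :: real measure) \<rightarrow>\<^sub>M lborel" by measurable
 then show ?thesis by simp
next
 case False
 have "(%x. x i) \<in> borel_measurable (PiM I (%_. lborel :: real measure)) \<longleftrightarrow>
   (%x. undefined :: real) \<in> borel_measurable (PiM I (%_. lborel :: real measure))"
  using False by (intro measurable_cong) (auto simp: space_PiM PiE_def extensional_def)
 then show ?thesis by simp
qed

interpretation lebn: sigma_finite_measure "leb m" for m
 by (intro lebP.sigma_finite) simp

lemma measurable_to_lborel_n:
 assumes "!!i. i < m ==> (%x. f x i) \<in> borel_measurable M"
  and "!!x i. x \<in> space M ==> \<not> i < m ==> f x i = undefined"
 shows "f \<in> M \<rightarrow>\<^sub>M leb m"
proof (rule measurable_PiM_single')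
 show "(%x. f x i) \<in> M \<rightarrow>\<^sub>M lborel" if "i \<in> {..<m}" for i using assms(1) that by simp
 show "f \<in> space M \<rightarrow> (\<Pi>\<^sub>E i\<in>{..<m}. space lborel)"
  using assms(2) by (auto simp: PiE_def extensional_def)
qed

lemma nn_integral_lborel_0: "(\<integral>\<^sup>+x. f x \<partial>leb 0) = f (%_. undefined)"
 by (simp add: PiM_empty nn_integral_count_space_finite)

lemma nn_integral_lborel_Suc:
 assumes [measurable]: "f \<in> borel_measurable (leb (Suc m))"
 shows "Leb_n (Suc m) (%x. f x) = Leb_n m (%x. Leb t. f (x(m := t)))"
 unfolding lessThan_Suc by (rule lebP.product_nn_integral_insert) (use assms in \<open>auto simp: lessThan_Suc\<close>)

lemma nn_integral_lborel_Suc_rev: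
 assumes [measurable]: "f \<in> borel_measurable (leb (Suc m))"
 shows "Leb_n (Suc m) (%x. f x) = (Leb t. Leb_n m (%x. f (x(m := t))))"
 unfolding lessThan_Suc by (rule lebP.product_nn_integral_insert_rev) (use assms in \<open>auto simp: lessThan_Suc\<close>)

lemma measurable_fun_upd_lborel [measurable (raw)]:
 assumes "g \<in> M \<rightarrow>\<^sub>M leb m" "t \<in> borel_measurable M"
 shows "(%w. (g w)(m := t w)) \<in> M \<rightarrow>\<^sub>M leb (Suc m)"
proof (rule measurable_to_lborel_n)
 show "(%w. ((g w)(m := t w)) i) \<in> borel_measurable M" if "i < Suc m" for i
 proof (cases "i = m")
  case False
  have "(%w. g w i) \<in> borel_measurable M"
   using measurable_compose[OF assms(1) measurable_coordinate] .
  then show ?thesis using False by simp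
 qed (use assms in simp)
 show "((g x)(m := t x)) i = undefined" if "x \<in> space M" "\<not> i < Suc m" for x i
  using measurable_space[OF assms(1) that(1)] that(2) by (auto simp: space_PiM PiE_def extensional_def)
qed

lemma nn_integral_lborel_swap:
 assumes "(%(x, y). f x y) \<in> borel_measurable (M \<Otimes>\<^sub>M N)" "sigma_finite_measure M" "sigma_finite_measure N"
 shows "(\<integral>\<^sup>+x. (\<integral>\<^sup>+y. f x y \<partial>N) \<partial>M) = (\<integral>\<^sup>+y. (\<integral>\<^sup>+x. f x y \<partial>M) \<partial>N)"
proof -
 interpret M: sigma_finite_measure M by fact
 interpret N: sigma_finite_measure N by fact
 interpret pair_sigma_finite M N ..
 show ?thesis using Fubini'[OF assms(1)] by simp
qed

lemma nn_integral_lborel_scale: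
 assumes f[measurable]: "f \<in> borel_measurable (leb m)" and r: "!!k. k < m ==> 0 < r k"
 shows "Leb_n m (%x. f x)
    = ennreal (\<Prod>k<m. r k) * (Leb_n m (%x. f (\<lambda>k\<in>{..<m}. r k * x k)))"
 using assms
proof (induction m arbitrary: f)
 case 0
 have "(\<lambda>k\<in>{}. r k * x k) = (%_. undefined)" for x :: "nat => real" by auto
 then show ?case unfolding nn_integral_lborel_0 by simp
next
 case (Suc m)
 note [measurable] = Suc.prems(1)
 have rm: "0 < r m" and rp: "0 \<le> (\<Prod>k<m. r k)" using Suc.prems(2) by (auto intro!: prod_nonneg) (simp add: less_imp_le)
 have [measurable]: "(%x. \<lambda>k\<in>{..<m}. r k * x k) \<in> leb m \<rightarrow>\<^sub>M leb m"
  by (rule measurable_to_lborel_n) auto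
 have [measurable]: "(%x. \<lambda>k\<in>{..<Suc m}. r k * x k) \<in> leb (Suc m) \<rightarrow>\<^sub>M leb (Suc m)"
  by (rule measurable_to_lborel_n) auto
 have "Leb_n (Suc m) (%x. f x) = (Leb t. Leb_n m (%x. f (x(m := t))))"
  by (rule nn_integral_lborel_Suc_rev) simp
 also have "... = (Leb t. ennreal (\<Prod>k<m. r k) * (Leb_n m (%x. f ((\<lambda>k\<in>{..<m}. r k * x k)(m := t)))))"
 proof (intro nn_integral_cong Suc.IH)
  show "(%x. f (x(m := t))) \<in> borel_measurable (leb m)" for t by measurable
 qed (use Suc.prems(2) in auto)
 also have "... = ennreal (\<Prod>k<m. r k) * (Leb t. Leb_n m (%x. f ((\<lambda>k\<in>{..<m}. r k * x k)(m := t))))"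
  by (intro nn_integral_cmult) measurable
 also have "(Leb t. Leb_n m (%x. f ((\<lambda>k\<in>{..<m}. r k * x k)(m := t)))) = ennreal \<bar>r m\<bar> * (Leb t. Leb_n m (%x. f ((\<lambda>k\<in>{..<m}. r k * x k)(m := 0 + r m * t))))"
 proof (rule nn_integral_real_affine)
  have "(%t. Leb_n m (%x. f ((\<lambda>k\<in>{..<m}. r k * x k)(m := t)))) \<in> borel_measurable lborel" by measurable
  then show "(%t. Leb_n m (%x. f ((\<lambda>k\<in>{..<m}. r k * x k)(m := t)))) \<in> borel_measurable borel" by simp
 qed (use rm in simp)
 also have "(Leb t. Leb_n m (%x. f ((\<lambda>k\<in>{..<m}. r k * x k)(m := 0 + r m * t)))) = (Leb t. Leb_n m (%x. f (\<lambda>k\<in>{..<Suc m}. r k * (x(m := t)) k)))"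
  by (intro nn_integral_cong arg_cong[where f=f]) (auto simp: fun_eq_iff restrict_def)
 also have "... = (Leb_n (Suc m) (%x. f (\<lambda>k\<in>{..<Suc m}. r k * x k)))"
  by (rule nn_integral_lborel_Suc_rev[symmetric]) simp
 finally have *: "Leb_n (Suc m) (%x. f x) = ennreal (\<Prod>k<m. r k) * (ennreal \<bar>r m\<bar> * (Leb_n (Suc m) (%x. f (\<lambda>k\<in>{..<Suc m}. r k * x k))))" .
 have "ennreal (\<Prod>k<Suc m. r k) = ennreal (\<Prod>k<m. r k) * ennreal \<bar>r m\<bar>"
  using rm rp by (simp add: ennreal_mult)
 then show ?case unfolding * by (simp only: mult.assoc)
qed

section \<open>The substitution from residues to zeros\<close>

definition ordered :: "nat => (nat => real) => bool" where
 "ordered m x \<longleftrightarrow> (\<forall>j<m. \<forall>i<j. x i < x j)"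

definition vandermonde :: "nat => (nat => real) => real" where
 "vandermonde m x = (\<Prod>j<m. \<Prod>i<j. x j - x i)"

text \<open>The possible positions of the zeros of \<open>C + (\<Sum>k<m. d k / (t - y k))\<close>
  for positive \<open>C\<close> and \<open>d k\<close>: the function decreases between poles, so
  each gap below a pole contains one zero, the lowest gap being unbounded, and there is no zero
  above the last pole.\<close>

definition zeros_below :: "nat => (nat => real) => (nat => real) => bool" where
 "zeros_below m y x \<longleftrightarrow> (\<forall>k<m. x k < y k & (0 < k --> y (k - 1) < x k))"

text \<open>The residues at the \<open>y k\<close> of the function \<open>C * (\<Prod>i<m. (t - x i) / (t - y i))\<close>, up to sign.\<close>
definition residues_of :: "nat => real => (nat => real) => (nat => real) => nat => real" where
 "residues_of m C y x = (\<lambda>k\<in>{..<m}. C * (\<Prod>i<m. y k - x i) / (\<Prod>j\<in>{..<m}-{k}. y k - y j))"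

lemma ordered_less: "ordered m x ==> i < j ==> j < m ==> x i < x j"
 by (auto simp: ordered_def)

lemma ordered_inj: "ordered m x ==> inj_on x {..<m}"
 by (auto simp: inj_on_def ordered_def) (metis less_irrefl linorder_neqE_nat)

lemma ordered_Suc: "ordered (Suc m) x \<longleftrightarrow> ordered m x & (\<forall>i<m. x i < x m)"
 by (auto simp: ordered_def less_Suc_eq)

lemma vandermonde_pos: "ordered m x ==> 0 < vandermonde m x"
 unfolding vandermonde_def by (intro prod_pos) (auto simp: ordered_def)

lemma vandermonde_Suc: "vandermonde (Suc m) x = vandermonde m x * (\<Prod>i<m. x m - x i)"
 by (simp add: vandermonde_def)

lemma vandermonde_cong: "(!!i. i < m ==> x i = y i) ==> vandermonde m x = vandermonde m y"
 unfolding vandermonde_def by (intro prod.cong) auto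

lemma zeros_below_Suc:
 "zeros_below (Suc m) y x \<longleftrightarrow> zeros_below m y x & x m < y m & (0 < m --> y (m - 1) < x m)"
 by (auto simp: zeros_below_def less_Suc_eq)

lemma zeros_below_ordered:
 assumes "zeros_below m y x" "ordered m y" shows "ordered m x"
 unfolding ordered_def
proof (intro allI impI)
 fix i j assume "j < m" "i < j"
 then have "x i < y i" "y (j - 1) < x j" using assms(1) by (auto simp: zeros_below_def)
 moreover have "y i \<le> y (j - 1)"
 proof (cases "i = j - 1")
  case False
  with \<open>i < j\<close> \<open>j < m\<close> have "i < j - 1" "j - 1 < m" by auto
  then show ?thesis using ordered_less[OF assms(2)] by (simp add: less_imp_le)
 qed simp
 ultimately show "x i < x j" by linarith
qed

lemma residues_sum:
 assumes inj: "inj_on y {..<m}" and t: "!!i. i < m ==> t ~= y i"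
 shows "C + (\<Sum>k<m. residues_of m C y x k / (t - y k)) = C * (\<Prod>i<m. t - x i) / (\<Prod>i<m. t - y i)"
proof -
 have "C * (\<Prod>i<m. t - x i) / (\<Prod>i<m. t - y i) = C * ((\<Prod>i<m. t - x i) / (\<Prod>i<m. t - y i))" by simp
 also have "... = C + (\<Sum>k<m. C * ((\<Prod>i<m. y k - x i) / (\<Prod>j\<in>{..<m}-{k}. y k - y j) / (t - y k)))"
  by (subst partial_fractions_balanced[OF inj t]) (auto simp: algebra_simps sum_distrib_left)
 finally show ?thesis by (simp add: residues_of_def)
qed

text \<open>A new pole \<open>y m\<close> and a new zero \<open>z\<close> multiply the rational
  function by \<open>(t - z) / (t - y m)\<close>. An old residue is multiplied by the value of this
  factor at its pole, and the new residue is \<open>y m - z\<close> times the old function at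
  \<open>y m\<close>.\<close>

lemma residues_of_Suc:
 assumes "ordered (Suc m) y"
 shows "k < m ==> residues_of (Suc m) C y (x(m := z)) k = (z - y k) / (y m - y k) * residues_of m C y x k"
  and "residues_of (Suc m) C y (x(m := z)) m = (y m - z) * (C + (\<Sum>k<m. residues_of m C y x k / (y m - y k)))"
proof -
 assume k: "k < m"
 have "y k < y m" using assms k by (auto simp: ordered_def)
 have "{..<Suc m} - {k} = insert m ({..<m} - {k})" using k by auto
 then have e: "(\<Prod>j\<in>{..<Suc m} - {k}. y k - y j) = (y k - y m) * (\<Prod>j\<in>{..<m} - {k}. y k - y j)"
  by simp
 have n: "(\<Prod>i<Suc m. y k - (x(m := z)) i) = (\<Prod>i<m. y k - x i) * (y k - z)"
  by simp
 have "residues_of (Suc m) C y (x(m := z)) k = C * ((\<Prod>i<m. y k - x i) * (y k - z)) / ((y k - y m) * (\<Prod>j\<in>{..<m} - {k}. y k - y j))"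
  using k by (simp add: residues_of_def e)
 also have "... = (y k - z) / (y k - y m) * residues_of m C y x k"
  using k by (simp add: residues_of_def mult_ac)
 also have "(y k - z) / (y k - y m) = (z - y k) / (y m - y k)"
  using minus_divide_divide[of "z - y k" "y m - y k"] by simp
 finally show "residues_of (Suc m) C y (x(m := z)) k = (z - y k) / (y m - y k) * residues_of m C y x k" .
next
 have ne: "y m ~= y i" if "i < m" for i using ordered_less[OF assms that] by simp
 have "{..<Suc m} - {m} = {..<m}" by auto
 then have "residues_of (Suc m) C y (x(m := z)) m = (y m - z) * (C * (\<Prod>i<m. y m - x i) / (\<Prod>j<m. y m - y j))"
  by (simp add: residues_of_def)
 also have "C * (\<Prod>i<m. y m - x i) / (\<Prod>j<m. y m - y j) = C + (\<Sum>k<m. residues_of m C y x k / (y m - y k))"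
  using assms ne by (intro residues_sum[symmetric] ordered_inj) (auto simp: ordered_Suc)
 finally show "residues_of (Suc m) C y (x(m := z)) m = (y m - z) * (C + (\<Sum>k<m. residues_of m C y x k / (y m - y k)))" .
qed

text \<open>With the lower residues \<open>d k\<close> held fixed, the argument of \<open>f\<close>
  is the residue at the highest pole \<open>eta\<close> for which \<open>z\<close> is a zero. It
  grows from 0 to infinity as \<open>z\<close> descends from \<open>eta\<close> through the gap
  below it, so it may serve as a coordinate in place of \<open>z\<close>.\<close>

lemma top_zero_substitution:
 fixes y d :: "nat => real" and C eta :: real and m :: nat
 defines "a \<equiv> (if m = 0 then -\<infinity> else ereal (y (m - 1)))"
 assumes y: "!!k. k < m ==> y k < eta" "!!k. k < m ==> y k \<le> y (m - 1)" and d: "!!k. k < m ==> 0 < d k" and C: "0 < C"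
  and [measurable]: "f \<in> borel_measurable borel"
 shows "(Leb z. f ((eta - z) * (C + (\<Sum>k<m. d k / (z - y k))))
      * ennreal (C + (\<Sum>k<m. d k * (eta - y k) / (z - y k)\<^sup>2)) * indicator (einterval a eta) z)
    = (Leb t. f t * indicator {0<..} t)"
proof -
 let ?f = "%z. \<Sum>k<m. d k / (z - y k)"
 define g where "g = (%z. (eta - z) * (C + ?f z))"
 define g' where "g' = (%z. C + (\<Sum>k<m. d k * (eta - y k) / (z - y k)\<^sup>2))"
 have a_less: "a < eta" using y(1)[of "m - 1"] by (auto simp: a_def)
 have above: "y k < z" if "z \<in> einterval a eta" "k < m" for z k
  using that y(2)[of k] by (auto simp: a_def einterval_def split: if_splits)
 have top: "z < eta" if "z \<in> einterval a eta" for z using that by (auto simp: einterval_def)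
 have pos: "0 < C + ?f z" if "z \<in> einterval a eta" for z
  using above[OF that] d C by (intro add_pos_nonneg sum_nonneg) (auto intro!: divide_nonneg_pos less_imp_le[of 0])
 have img: "g ` einterval a eta = {0<..}"
 proof
  show "g ` einterval a eta \<subseteq> {0<..}" using pos top by (auto simp: g_def)
  show "{0<..} \<subseteq> g ` einterval a eta"
  proof
   fix t :: real assume "t \<in> {0<..}"
   then have t: "0 < t" by simp
   \<comment> \<open>A point of the gap where \<open>g\<close> is at least \<open>t\<close>, for the
     intermediate value theorem. Without lower poles \<open>g\<close> is linear and the equation is
     solved exactly; otherwise only the term of the nearest pole is kept and
     \<open>(eta - z) * e / (z - l) = t\<close> is solved.\<close>
   obtain z1 where z1: "z1 \<in> einterval a eta" "t \<le> g z1"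
   proof (cases "m = 0")
    case True
    show ?thesis
    proof (rule that[of "eta - t / C"])
     show "eta - t / C \<in> einterval a eta" using True t C by (simp add: a_def einterval_def)
     show "t \<le> g (eta - t / C)" using True C by (simp add: g_def)
    qed
   next
    case False
    define l where "l = y (m - 1)"
    define e where "e = d (m - 1)"
    have l: "l < eta" and e: "0 < e" using y(1)[of "m - 1"] d[of "m - 1"] False by (auto simp: l_def e_def)
    define z where "z = l + (eta - l) * e / (t + e)"
    have z1: "l < z" using l e t by (simp add: z_def)
    have z2: "eta - z = (eta - l) * t / (t + e)" using t e by (simp add: z_def field_simps)
    have "0 < eta - z" unfolding z2 using l t e by simp
    have mem: "z \<in> einterval a eta" using z1 \<open>0 < eta - z\<close> False by (simp add: a_def l_def einterval_def)
    have "e / (z - l) \<le> ?f z"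
     unfolding e_def l_def using False above[OF mem] d
     by (intro member_le_sum[of "m - 1" "{..<m}" "%k. d k / (z - y k)"]) (auto intro!: divide_nonneg_pos less_imp_le[of 0])
    then have "(eta - z) * (e / (z - l)) \<le> g z"
     unfolding g_def using \<open>0 < eta - z\<close> C by (intro mult_left_mono) auto
    moreover have "(eta - z) * (e / (z - l)) = t"
     unfolding z2 using l e t by (simp add: z_def)
    ultimately show ?thesis using that[OF mem] by simp
   qed
   have cont: "continuous_on {z1..eta} g"
   proof -
    have "z ~= y k" if "z \<in> {z1..eta}" "k < m" for z k using above[OF z1(1) that(2)] that(1) by auto
    then show ?thesis unfolding g_def by (intro continuous_intros) auto
   qed
   have "\<exists>z\<ge>z1. z \<le> eta & g z = t"
    using z1 t top[OF z1(1)] by (intro IVT2'[OF _ _ _ cont]) (auto simp: g_def)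
   then obtain z where z: "z1 \<le> z" "z \<le> eta" "g z = t" by blast
   have "z ~= eta" using z(3) t by (auto simp: g_def)
   with z have "z < eta" by simp
   moreover have "a < ereal z" using z1(1) z(1) by (auto simp: einterval_def intro: less_le_trans)
   ultimately have "z \<in> einterval a eta" by (simp add: einterval_def)
   then show "t \<in> g ` einterval a eta" using z(3) by blast
  qed
 qed
 let ?g = "%z. 0 + (\<Sum>k<m. (0 * (z - y k) - d k * (1 - 0)) / ((z - y k) * (z - y k)))"
 have der: "(g has_real_derivative - g' z) (at z)" if z: "z \<in> einterval a eta" for z
 proof -
  have ne: "z - y k ~= 0" if "k < m" for k using above[OF z that] by simp
  have "(g has_real_derivative (0 - 1) * (C + ?f z) + ?g z * (eta - z)) (at z)"
   unfolding g_def using ne by (intro DERIV_mult DERIV_diff DERIV_add DERIV_sum DERIV_divide DERIV_const DERIV_ident) auto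
  also have "(0 - 1) * (C + ?f z) + ?g z * (eta - z) = - g' z"
  proof -
   have "d k / (z - y k) + d k / ((z - y k) * (z - y k)) * (eta - z) = d k * (eta - y k) / (z - y k)\<^sup>2" if "k < m" for k
   proof -
    have "d k / u + d k / (u * u) * v = d k * (v + u) / u\<^sup>2" if "u ~= 0" for u v
     using that by (simp add: field_simps power2_eq_square)
    from this[OF ne[OF that], of "eta - z"] show ?thesis by simp
   qed
   then have "?f z + (\<Sum>k<m. d k / ((z - y k) * (z - y k))) * (eta - z) = (\<Sum>k<m. d k * (eta - y k) / (z - y k)\<^sup>2)"
    by (simp add: sum_distrib_right sum.distrib[symmetric])
   then show ?thesis by (simp add: g'_def sum_negf algebra_simps)
  qed
  finally show ?thesis .
 qed
 have "(Leb z. f (g z) * ennreal (g' z) * indicator (einterval a eta) z) = (Leb t. f t * indicator (g ` einterval a eta) t)"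
 proof (rule nn_integral_substitution_open_decreasing)
  show "g \<in> borel_measurable borel" "g' \<in> borel_measurable borel" unfolding g_def g'_def by measurable
  have "z ~= y k" if "z \<in> einterval a eta" "k < m" for z k using above[OF that] by simp
  then show "continuous_on (einterval a eta) g'"
   unfolding g'_def by (intro continuous_intros) auto
  show "0 \<le> g' z" if "z \<in> einterval a eta" for z
   unfolding g'_def using C d y(1) by (intro add_nonneg_nonneg sum_nonneg divide_nonneg_nonneg) (auto intro: less_imp_le)
 qed (use a_less der in auto)
 then show ?thesis unfolding img by (simp add: g_def g'_def)
qed

lemma measurable_residues_of [measurable]:
 "residues_of m C y \<in> leb m \<rightarrow>\<^sub>M leb m"
 by (rule measurable_to_lborel_n) (auto simp: residues_of_def)

text \<open>The Jacobian of the residues as functions of the zeros, the poles being fixed. The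
  induction removes the highest pole: its residue is traded for the highest zero \<open>z\<close>
  while the other residues stay fixed, and these are then freed of the factors contributed by
  \<open>z\<close> and the pole, which leaves the residues of the smaller function.\<close>

lemma nn_integral_residues_to_zeros:
 assumes "ordered m y" "0 < C" and h: "h \<in> borel_measurable (leb m)"
 shows "Leb_n m (%d. if \<forall>k<m. 0 < d k then h d else 0)
  = Leb_n m (%x. if zeros_below m y x
    then h (residues_of m C y x) * ennreal (C ^ m * vandermonde m x / vandermonde m y) else 0)"
 using assms(1) h
proof (induction m arbitrary: h)
 case 0
 have "residues_of 0 C y (%_. undefined) = (%_. undefined)" by (simp add: residues_of_def fun_eq_iff)
 then show ?case unfolding nn_integral_lborel_0 by (simp add: zeros_below_def vandermonde_def)
next
 case (Suc m)
 note [measurable] = Suc.prems(2)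
 define eta where "eta = y m"
 have om: "ordered m y" and ylt: "!!k. k < m ==> y k < eta" using Suc.prems(1) by (auto simp: ordered_Suc eta_def)
 have yle: "y k \<le> y (m - 1)" if "k < m" for k
 proof (cases "k = m - 1")
  case False
  then have "k < m - 1" "m - 1 < m" using that by auto
  then show ?thesis using ordered_less[OF om, of k "m - 1"] by simp
 qed simp
 define a where "a = (if m = 0 then -\<infinity> else ereal (y (m - 1)))"
 define S where "S = einterval a eta"
 have above: "y k < z" if "z \<in> S" "k < m" for z k
  using that yle[of k] by (auto simp: a_def S_def einterval_def split: if_splits)
 have [measurable]: "S \<in> sets borel" by (simp add: S_def)
 define g where "g d z = (eta - z) * (C + (\<Sum>k<m. d k / (z - y k)))" for d :: "nat => real" and z
 define g' where "g' d z = C + (\<Sum>k<m. d k * (eta - y k) / (z - y k)\<^sup>2)" for d :: "nat => real" and z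
 define r where "r z k = (z - y k) / (eta - y k)" for z k
 have r_pos: "0 < r z k" if "z \<in> S" "k < m" for z k using above[OF that] ylt[OF that(2)] by (simp add: r_def)
 have c1[measurable]: "(%p. fst p k) \<in> borel_measurable (leb m \<Otimes>\<^sub>M N)" for k and N :: "real measure"
  by (rule measurable_compose[OF measurable_fst measurable_coordinate])
 have gm[measurable]: "(%p. g (fst p) (snd p)) \<in> borel_measurable (leb m \<Otimes>\<^sub>M lborel)"
  "(%p. g' (fst p) (snd p)) \<in> borel_measurable (leb m \<Otimes>\<^sub>M lborel)"
  unfolding g_def g'_def by measurable
 have gz[measurable]: "(%d. g d z) \<in> borel_measurable (leb m)" "(%d. g' d z) \<in> borel_measurable (leb m)" for z
  unfolding g_def g'_def by measurable
 let ?P = "%d. \<forall>k<m. 0 < d k"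
 have "Leb_n (Suc m) (%d. if \<forall>k<Suc m. 0 < d k then h d else 0) = Leb_n m (%d. Leb t. if \<forall>k<Suc m. 0 < (d(m := t)) k then h (d(m := t)) else 0)"
  by (rule nn_integral_lborel_Suc) measurable
 also have "... = Leb_n m (%d. Leb z. if ?P d then h (d(m := g d z)) * ennreal (g' d z) * indicator S z else 0)"
 proof (rule nn_integral_cong)
  fix d assume [measurable]: "d \<in> space (leb m)"
  let ?f = "%m d. Leb t. if \<forall>k<Suc m. 0 < (d(m := t)) k then h (d(m := t)) else 0"
  show "?f m d = (Leb z. if ?P d then h (d(m := g d z)) * ennreal (g' d z) * indicator S z else 0)"
  proof (cases "?P d")
   case True
   have "(Leb z. h (d(m := g d z)) * ennreal (g' d z) * indicator S z) = (Leb t. h (d(m := t)) * indicator {0<..} t)"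
    unfolding g_def g'_def S_def a_def
    by (rule top_zero_substitution[where f="%t. h (d(m := t))"]) (use True ylt yle \<open>0 < C\<close> in auto)
   also have "... = ?f m d"
    using True by (intro nn_integral_cong) (auto simp: indicator_def less_Suc_eq)
   finally show ?thesis using True by simp
  next
   case False
   then have "\<not> (\<forall>k<Suc m. 0 < (d(m := t)) k)" for t by (metis fun_upd_other less_SucI less_irrefl)
   then show ?thesis by (simp only: if_not_P[OF False] if_False)
  qed
 qed
 also have "... = (Leb z. Leb_n m (%d. if ?P d then h (d(m := g d z)) * ennreal (g' d z) * indicator S z else 0))"
  by (rule nn_integral_lborel_swap) (measurable, intro_locales)
 also have "... = (Leb z. Leb_n m (%x. if zeros_below (Suc m) y (x(m := z)) then h (residues_of (Suc m) C y (x(m := z))) * ennreal (C ^ Suc m * vandermonde (Suc m) (x(m := z)) / vandermonde (Suc m) y) else 0))"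
 proof (rule nn_integral_cong)
  fix z :: real
  let ?q = "%m x z. C ^ Suc m * vandermonde (Suc m) (x(m := z)) / vandermonde (Suc m) y"
  let ?r = "%m x. C ^ m * vandermonde m x / vandermonde m y"
  have zb: "zeros_below (Suc m) y (x(m := z)) \<longleftrightarrow> zeros_below m y x & z \<in> S" for x
   by (auto simp: zeros_below_Suc S_def a_def einterval_def eta_def) (auto simp: zeros_below_def)
  let ?g = "%m x z. h (residues_of (Suc m) C y (x(m := z))) * ennreal (?q m x z)"
  let ?h = "%m x F s. if zeros_below m y x then F (s (residues_of m C y x)) * ennreal (?r m x) else 0"
  let ?p = "%m z x. C * (\<Prod>i<m. z - x i) / (\<Prod>i<m. z - y i)"
  let ?s = "%m x z. if zeros_below (Suc m) y (x(m := z)) then ?g m x z else 0"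
  let ?t = "%m g z g' S. Leb_n m (%d. if ?P d then h (d(m := g d z)) * ennreal (g' d z) * indicator S z else 0)"
  show "?t m g z g' S = Leb_n m (%x. ?s m x z)"
  proof (cases "z \<in> S")
   case False
   then show ?thesis unfolding zb by (simp cong: if_cong)
  next
   case True
   define F where "F d = h (d(m := g d z)) * ennreal (g' d z)" for d
   \<comment> \<open>\<open>s\<close> restores the factors \<open>r z k\<close> that the pole
     \<open>eta\<close> and the zero \<open>z\<close> contribute to the lower residues; passing to
     the smaller residues costs the product of these factors.\<close>
   define s where "s d = (\<lambda>k\<in>{..<m}. r z k * d k)" for d :: "nat => real"
   have [measurable]: "F \<in> borel_measurable (leb m)" unfolding F_def by measurable
   have [measurable]: "s \<in> leb m \<rightarrow>\<^sub>M leb m"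
    unfolding s_def by (rule measurable_to_lborel_n) auto
   have R: "0 < (\<Prod>k<m. r z k)" using r_pos[OF True] by (intro prod_pos) auto
   have "?t m g z g' S = Leb_n m (%d. if ?P d then F d else 0)"
    using True by (intro nn_integral_cong) (auto simp: F_def)
   also have "... = ennreal (\<Prod>k<m. r z k) * Leb_n m (%d. if ?P (s d) then F (s d) else 0)"
    unfolding s_def by (rule nn_integral_lborel_scale) (use r_pos[OF True] in measurable)
   also have "Leb_n m (%d. if ?P (s d) then F (s d) else 0) = Leb_n m (%d. if ?P d then F (s d) else 0)"
   proof -
    have "0 < r z k * d k \<longleftrightarrow> 0 < d k" if "k < m" for d :: "nat => real" and k
     using mult_less_cancel_left_pos[OF r_pos[OF True that], of 0 "d k"] by simp
    then have "?P (s d) \<longleftrightarrow> ?P d" for d by (simp add: s_def)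
    then show ?thesis by simp
   qed
   also have "... = Leb_n m (%x. ?h m x F s)"
    by (rule Suc.IH[OF om]) measurable
   also have "ennreal (\<Prod>k<m. r z k) * ... = Leb_n m (%x. ennreal (\<Prod>k<m. r z k) * ?h m x F s)"
    unfolding zeros_below_def vandermonde_def by (rule nn_integral_cmult[symmetric]) measurable
   also have "... = Leb_n m (%x. ?s m x z)"
   proof (rule nn_integral_cong)
    fix x assume x: "x \<in> space (leb m)"
    show "ennreal (\<Prod>k<m. r z k) * ?h m x F s = ?s m x z"
    proof (cases "zeros_below m y x")
     case zx: True
     define w where "w = residues_of m C y x"
     have zne: "z - y k ~= 0" "eta - y k ~= 0" if "k < m" for k using above[OF True that] ylt[OF that] by auto
     have sw: "s w k = (z - y k) / (eta - y k) * w k" if "k < m" for k using that by (simp add: s_def r_def)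
     have gs: "g (s w) z = (eta - z) * (C + (\<Sum>k<m. w k / (eta - y k)))"
      unfolding g_def using zne by (intro arg_cong2[where f="(*)"] arg_cong2[where f="(+)"] sum.cong refl) (auto simp: sw)
     \<comment> \<open>In the rescaled residues the derivative is the value at \<open>z\<close> of
       the smaller rational function, hence a quotient of products. Its denominator cancels against
       the product of the \<open>r z k\<close>, and the factors that complete the two larger
       Vandermonde products are left.\<close>
     have "g' (s w) z = C + (\<Sum>k<m. w k / (z - y k))"
      unfolding g'_def using zne by (intro arg_cong2[where f="(+)"] sum.cong refl) (auto simp: sw power2_eq_square)
     also have "... = ?p m z x"
      unfolding w_def using zne by (intro residues_sum ordered_inj om) auto
     finally have g's: "g' (s w) z = ?p m z x" .
     have res: "(s w)(m := g (s w) z) = residues_of (Suc m) C y (x(m := z))"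
     proof
      fix k
      consider "k < m" | "k = m" | "k > m" by linarith
      then show "((s w)(m := g (s w) z)) k = residues_of (Suc m) C y (x(m := z)) k"
      proof cases
       case 1
       then show ?thesis using residues_of_Suc(1)[OF Suc.prems(1) 1, of C x z]
        by (simp add: sw[OF 1] w_def[symmetric] eta_def[symmetric])
      next
       case 2
       then show ?thesis using residues_of_Suc(2)[OF Suc.prems(1), of C x z]
        by (simp add: gs w_def[symmetric] eta_def[symmetric])
      next
       case 3
       then show ?thesis by (simp add: s_def residues_of_def)
      qed
     qed
     have xz: "x i < z" if "i < m" for i
      using zx above[OF True that] that by (auto simp: zeros_below_def intro: less_trans)
     have pz: "0 < (\<Prod>i<m. z - x i)" "0 < (\<Prod>i<m. z - y i)" "0 < (\<Prod>i<m. eta - y i)"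
      using xz above[OF True] ylt by (auto intro!: prod_pos)
     have vx: "0 < vandermonde m x" and vy: "0 < vandermonde m y"
      using zeros_below_ordered[OF zx om] om by (auto intro: vandermonde_pos)
     have v: "vandermonde (Suc m) (x(m := z)) = vandermonde m x * (\<Prod>i<m. z - x i)"
      unfolding vandermonde_Suc by (auto intro!: arg_cong2[where f="(*)"] vandermonde_cong prod.cong)
     have "(\<Prod>k<m. r z k) * ?p m z x * ?r m x = ?q m x z"
     proof -
      have "B / H * (C * A / B) * (C ^ m * V / W) = C ^ Suc m * (V * A) / (W * H)"
       if "0 < B" "0 < H" "0 < W" for A B H V W :: real
       using that by (simp add: field_simps)
      from this[OF pz(2,3) vy] show ?thesis
       unfolding v unfolding vandermonde_Suc r_def prod_dividef eta_def[symmetric] .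
     qed
     then have "ennreal (\<Prod>k<m. r z k) * (ennreal (?p m z x) * ennreal (?r m x)) = ennreal (?q m x z)"
      using pz vx vy R \<open>0 < C\<close> by (simp add: ennreal_mult[symmetric] mult.assoc del: power_Suc)
     note jac = this
     have "ennreal (\<Prod>k<m. r z k) * (F (s w) * ennreal (?r m x)) = ?g m x z"
     proof -
      have "A * (H * B * D) = H * (A * (B * D))" for A H B D :: ennreal by (simp only: mult_ac)
      then show ?thesis unfolding F_def res g's jac[symmetric] .
     qed
     then show ?thesis using zx True by (simp only: zb w_def simp_thms if_True)
    next
     case False
     then show ?thesis unfolding zb by simp
    qed
   qed
   finally show ?thesis .
  qed
 qed
 also have "... = Leb_n (Suc m) (%x. if zeros_below (Suc m) y x then h (residues_of (Suc m) C y x) * ennreal (C ^ Suc m * vandermonde (Suc m) x / vandermonde (Suc m) y) else 0)"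
  unfolding zeros_below_def vandermonde_def by (rule nn_integral_lborel_Suc_rev[symmetric]) measurable
 finally show ?case .
qed

section \<open>The Szego recursion driven by a moment sequence\<close>

definition moment_functional :: "(nat => complex) => complex poly => complex" where
 "moment_functional c p = (\<Sum>i\<le>degree p. coeff p i * c i)"

text \<open>The polynomial written Phi_k^* in the theory of orthogonal polynomials on the circle;
  the reversal is taken at the prescribed degree \<open>k\<close>.\<close>

definition reversed_poly :: "nat => complex poly => complex poly" where
 "reversed_poly k p = (\<Sum>i\<le>k. monom (cnj (coeff p (k - i))) i)"

text \<open>The quotient is chosen so that the functional annihilates the new polynomial, which is
  orthogonality to 1. Building the polynomials from the moments alone lets one recursion serve both
  point configurations and arbitrary measures on the circle, and makes the coefficients measurable
  functions of the moments.\<close>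

fun szego :: "(nat => complex) => nat => complex poly" where
 "szego c 0 = 1"
| "szego c (Suc k) = pCons 0 (szego c k)
   - smult (moment_functional c (pCons 0 (szego c k)) / moment_functional c (reversed_poly k (szego c k)))
     (reversed_poly k (szego c k))"

definition szego_alpha :: "(nat => complex) => nat => complex" where
 "szego_alpha c k = cnj (moment_functional c (pCons 0 (szego c k)) / moment_functional c (reversed_poly k (szego c k)))"

lemma szego_Suc_alpha: "szego c (Suc k) = pCons 0 (szego c k) - smult (cnj (szego_alpha c k)) (reversed_poly k (szego c k))"
 by (simp add: szego_alpha_def)

lemma coeff_reversed_poly: "coeff (reversed_poly k p) i = (if i \<le> k then cnj (coeff p (k - i)) else 0)"
 by (simp add: reversed_poly_def coeff_sum)

lemma degree_reversed_poly: "degree (reversed_poly k p) \<le> k"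
 by (rule degree_le) (simp add: coeff_reversed_poly)

lemma reversed_poly_smult: "reversed_poly k (smult a p) = smult (cnj a) (reversed_poly k p)"
 by (rule poly_eqI) (simp add: coeff_reversed_poly)

lemma poly_altdef_le: "degree p \<le> k ==> poly p z = (\<Sum>i\<le>k. coeff p i * z ^ i)" for z :: complex
 unfolding poly_altdef by (rule sum.mono_neutral_left) (auto simp: coeff_eq_0)

lemma poly_reversed_poly:
 assumes "degree p \<le> k" "z ~= 0"
 shows "poly (reversed_poly k p) z = z ^ k * cnj (poly p (1 / cnj z))"
proof -
 have "poly (reversed_poly k p) z = (\<Sum>i\<le>k. cnj (coeff p (k - i)) * z ^ i)"
  by (simp add: reversed_poly_def poly_sum poly_monom)
 also have "... = (\<Sum>i\<le>k. cnj (coeff p i) * z ^ (k - i))"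
  by (rule sum.reindex_bij_witness[of _ "%i. k - i" "%i. k - i"]) auto
 also have "... = (\<Sum>i\<le>k. z ^ k * (cnj (coeff p i) * (1 / z) ^ i))"
  using assms(2) by (intro sum.cong refl) (simp add: power_diff power_one_over)
 also have "... = z ^ k * cnj (poly p (1 / cnj z))"
  by (simp add: poly_altdef_le[OF assms(1)] sum_distrib_left)
 finally show ?thesis .
qed

lemma inverse_cnj_unit: "cmod z = 1 ==> 1 / cnj z = z"
 by (metis complex_norm_square divide_eq_eq complex_cnj_zero_iff mult.commute norm_zero of_real_1 one_power2 zero_neq_one)

lemma poly_reversed_poly_circle:
 assumes "degree p \<le> k" "cmod z = 1"
 shows "poly (reversed_poly k p) z = z ^ k * cnj (poly p z)"
 using poly_reversed_poly[OF assms(1), of z] inverse_cnj_unit[OF assms(2)] assms(2) by force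

lemma moment_functional_le: "degree p \<le> k ==> moment_functional c p = (\<Sum>i\<le>k. coeff p i * c i)"
 unfolding moment_functional_def by (rule sum.mono_neutral_left) (auto simp: coeff_eq_0)

lemma degree_szego: "degree (szego c k) = k" and lead_coeff_szego: "coeff (szego c k) k = 1"
proof -
 have "degree (szego c k) = k & coeff (szego c k) k = 1"
 proof (induction k)
  case (Suc k)
  have "coeff (szego c (Suc k)) (Suc k) = 1"
   unfolding szego.simps using Suc by (simp add: coeff_reversed_poly del: One_nat_def)
  moreover have "degree (szego c (Suc k)) \<le> Suc k"
   unfolding szego.simps using Suc degree_reversed_poly[of k "szego c k"]
   by (intro degree_diff_le degree_smult_le[THEN le_trans]) (auto simp: degree_pCons_le intro: le_trans[OF degree_pCons_le])
  ultimately show ?case by (metis le_antisym le_degree zero_neq_one)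
 qed simp
 then show "degree (szego c k) = k" "coeff (szego c k) k = 1" by auto
qed

section \<open>Coefficient stripping\<close>

definition cayley :: "real => complex" where
 "cayley t = (of_real t - \<i>) / (of_real t + \<i>)"

lemma of_real_ne_i [simp]: "of_real t ~= \<i>" "of_real t + \<i> ~= 0" "\<i> + of_real t ~= 0"
 by (simp_all add: complex_eq_iff)

lemma norm_cayley [simp]: "cmod (cayley t) = 1"
proof -
 have "cmod (of_real t - \<i>) = cmod (of_real t + \<i>)" by (simp add: cmod_def)
 then show ?thesis by (simp add: cayley_def norm_divide)
qed

lemma cayley_nz [simp]: "cayley t ~= 0" by (simp add: cayley_def)

lemma cnj_cayley: "cnj (cayley t) = (of_real t + \<i>) / (of_real t - \<i>)"
 by (simp add: cayley_def)

text \<open>The Cayley transform of \<open>- a + \<i> * b\<close>: a point of the upper half-plane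
  stands for a coefficient in the disk, and infinity stands for the value 1.\<close>

definition halfplane_coeff :: "real => real => complex" where
 "halfplane_coeff a b = (Complex (- a) b - \<i>) / (Complex (- a) b + \<i>)"

lemma Complex_plus_i_nz: "0 < b ==> Complex a b + \<i> ~= 0"
 by (auto simp: complex_eq_iff)

lemma one_minus_halfplane_coeff: "0 < b ==> 1 - halfplane_coeff a b = 2 * \<i> / (Complex (- a) b + \<i>)"
 using Complex_plus_i_nz[of b "- a"] by (simp add: halfplane_coeff_def diff_divide_eq_iff)

lemma halfplane_coeff_ne_1: "0 < b ==> halfplane_coeff a b ~= 1"
 using one_minus_halfplane_coeff[of b a] Complex_plus_i_nz[of b "- a"] by auto

lemma norm_halfplane_coeff: "0 < b ==> 1 - (cmod (halfplane_coeff a b))\<^sup>2 = 4 * b / (a\<^sup>2 + (b + 1)\<^sup>2)"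
proof -
 assume b: "0 < b"
 have "(cmod (halfplane_coeff a b))\<^sup>2 = (a\<^sup>2 + (b - 1)\<^sup>2) / (a\<^sup>2 + (b + 1)\<^sup>2)"
  by (simp add: halfplane_coeff_def norm_divide power_divide cmod_power2)
 moreover have "a\<^sup>2 + (b + 1)\<^sup>2 > 0" using b by (intro add_nonneg_pos) auto
 ultimately show ?thesis by (simp add: field_simps power2_eq_square)
qed

text \<open>One step \<open>z * w - g * cnj w\<close> of the recursion, divided by
  \<open>1 - g\<close>, for \<open>z = cayley t\<close> and \<open>g = halfplane_coeff a b\<close>,
  after the denominator \<open>t + \<i>\<close> has been cleared. The conjugate makes it only
  real-linear in \<open>w\<close>, hence the formula in real and imaginary parts.\<close>

definition transfer_step :: "real => real => real => complex => complex" where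
 "transfer_step a b t w = Complex ((t + a) * Re w + (1 - a * t) * Im w) (b * (t * Im w - Re w))"

fun transfer :: "(nat => real) => (nat => real) => nat => real => complex => complex" where
 "transfer a b 0 t w = w"
| "transfer a b (Suc k) t w = transfer_step (a k) (b k) t (transfer a b k t w)"

text \<open>The recursion applies the newest step last, whereas stripping removes the oldest one;
  this form exposes the oldest.\<close>

lemma transfer_Suc_shift:
 "transfer a b (Suc k) t w = transfer (%k. a (Suc k)) (%k. b (Suc k)) k t (transfer_step (a 0) (b 0) t w)"
 by (induction k) auto

lemma transfer_step_linear:
 "transfer_step a b t (of_real r * u + of_real s * w) = of_real r * transfer_step a b t u + of_real s * transfer_step a b t w"
 by (simp add: transfer_step_def complex_eq_iff algebra_simps)

lemma transfer_linear:
 "transfer a b k t (of_real r * u + of_real s * w) = of_real r * transfer a b k t u + of_real s * transfer a b k t w"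
 by (induction k) (simp_all add: transfer_step_linear)

lemma transfer_shift_1:
 "transfer a b (Suc k) t 1 = of_real (t + a 0) * transfer (%k. a (Suc k)) (%k. b (Suc k)) k t 1
   - of_real (b 0) * transfer (%k. a (Suc k)) (%k. b (Suc k)) k t \<i>"
proof -
 have "transfer_step (a 0) (b 0) t 1 = of_real (t + a 0) * 1 + of_real (- b 0) * \<i>"
  by (simp add: transfer_step_def complex_eq_iff)
 then show ?thesis by (simp only: transfer_Suc_shift transfer_linear) simp
qed

lemma transfer_shift_i:
 "transfer a b (Suc k) t \<i> = of_real (1 - a 0 * t) * transfer (%k. a (Suc k)) (%k. b (Suc k)) k t 1
   + of_real (b 0 * t) * transfer (%k. a (Suc k)) (%k. b (Suc k)) k t \<i>"
proof -
 have "transfer_step (a 0) (b 0) t \<i> = of_real (1 - a 0 * t) * 1 + of_real (b 0 * t) * \<i>"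
  by (simp add: transfer_step_def complex_eq_iff)
 then show ?thesis by (simp only: transfer_Suc_shift transfer_linear)
qed

definition denom_poly :: "nat => (nat => real) => complex => complex" where
 "denom_poly m x t = (\<Prod>i<m. t - of_real (x i))"

definition numer_poly :: "nat => (nat => real) => (nat => real) => complex => complex" where
 "numer_poly m x v t = (\<Sum>i<m. of_real (v i) * (\<Prod>j\<in>{..<m}-{i}. t - of_real (x j)))"

text \<open>The quotient of \<open>nevanlinna_numer\<close> by \<open>denom_poly\<close> is, up to the factor \<open>\<i>\<close>, the
 Caratheodory function of \<open>w \<delta>\<^sub>1 + (\<Sum>i<m. v\<^sub>i \<delta>(cayley x\<^sub>i))\<close>, \<open>w = 1 - (\<Sum>i<m. v\<^sub>i)\<close>, in the half-plane
 coordinate in which the point \<open>1\<close> of the circle is sent to infinity.\<close>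
definition nevanlinna_numer :: "nat => (nat => real) => (nat => real) => complex => complex" where
 "nevanlinna_numer m x v t = t * denom_poly m x t - (1 + t\<^sup>2) * numer_poly m x v t"

text \<open>A certificate, stable under stripping, that \<open>a\<close> and \<open>b\<close>
  describe the coefficients of the configuration. The factor \<open>(1 + t\<^sup>2) ^ k\<close>
  encodes orthogonality of the polynomial of degree \<open>k\<close> to the lower powers, since \<i>
  and - \<i> are the half-plane positions of 0 and infinity in the circle coordinate. The top
  coefficient of \<open>U\<close> records the weight of the point 1.\<close>

definition has_transfer :: "nat => (nat => real) => (nat => real) => (nat => real) => (nat => real) => bool" where
 "has_transfer m x v a b \<longleftrightarrow> (\<forall>k\<le>m. \<exists>U. degree U \<le> m - k & coeff U (m - k) = of_real (1 - (\<Sum>i<m. v i)) &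
   (\<forall>t::real. transfer a b k t 1 * nevanlinna_numer m x v (of_real t) + transfer a b k t \<i> * denom_poly m x (of_real t)
    = (1 + (of_real t)\<^sup>2) ^ k * (of_real t + \<i>) * poly U (of_real t)))"

text \<open>For F = \<open>nevanlinna_numer\<close> / \<open>denom_poly\<close> of the outer and the
  inner configuration, the two identities say that F_outer = t - (1 + t^2) / (a + t + b F_inner):
  one step of a continued fraction, the half-plane form of the Schur algorithm. They are stated
  without division so that they hold at the poles too.\<close>

definition stripping :: "nat => (nat => real) => (nat => real) => (nat => real) => (nat => real) => real => real => real => bool" where
 "stripping m x v y v' a b C \<longleftrightarrow> 0 < C & 0 < b &
   (\<forall>t. of_real C * denom_poly (Suc m) x t = (of_real a + t) * denom_poly m y t + of_real b * nevanlinna_numer m y v' t) &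
   (\<forall>t. of_real C * numer_poly (Suc m) x v t = denom_poly m y t) &
   1 - (\<Sum>i<Suc m. v i) = b * (1 - (\<Sum>i<m. v' i)) / C"

text \<open>Since 1 + t^2 = (t + \<i>)(t - \<i>), the factor t + \<i> splits off and leaves
  \<open>U = D - [:- \<i>, 1:] * E\<close>, with \<open>D\<close> the denominator and
  \<open>E\<close> the numerator of the weighted sum of simple poles. \<open>D\<close> is monic and
  \<open>E\<close> has the sum of the weights as its top coefficient.\<close>

lemma has_transfer_base:
 "\<exists>U. degree U \<le> m & coeff U m = of_real (1 - (\<Sum>i<m. v i)) &
   (\<forall>t. nevanlinna_numer m x v t + \<i> * denom_poly m x t = (t + \<i>) * poly U t)"
proof -
 define D where "D = (\<Prod>i<m. [:- of_real (x i), 1 :: complex:])"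
 define Ei where "Ei i = (\<Prod>j\<in>{..<m}-{i}. [:- of_real (x j), 1 :: complex:])" for i
 define E where "E = (\<Sum>i<m. smult (of_real (v i)) (Ei i))"
 define U where "U = D - [:- \<i>, 1:] * E"
 have dD: "degree D = m" "coeff D m = 1"
  using degree_prod_linear[of "{..<m}" "%i. complex_of_real (x i)"] monic_prod_linear[of "%i. complex_of_real (x i)" "{..<m}"]
  by (simp_all add: D_def)
 have dEi: "degree (Ei i) = m - 1" "coeff (Ei i) (m - 1) = 1" if "i < m" for i
  using that degree_prod_linear[of "{..<m}-{i}" "%i. complex_of_real (x i)"] monic_prod_linear[of "%i. complex_of_real (x i)" "{..<m}-{i}"]
  by (simp_all add: Ei_def)
 have dE: "degree E \<le> m - 1"
  unfolding E_def using dEi(1) by (intro degree_sum_le) (auto intro: le_trans[OF degree_smult_le])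
 have cE: "coeff E (m - 1) = of_real (\<Sum>i<m. v i)"
  unfolding E_def using dEi(2) by (simp add: coeff_sum)
 have "degree U \<le> m & coeff U m = of_real (1 - (\<Sum>i<m. v i))"
 proof (cases m)
  case 0
  then show ?thesis by (simp add: U_def D_def E_def)
 next
  case (Suc n)
  have "degree ([:- \<i>, 1:] * E) \<le> degree [:- \<i>, 1:] + degree E" by (rule degree_mult_le)
  also have "... \<le> m" using dE Suc by simp
  finally have "degree U \<le> m" unfolding U_def using dD by (intro degree_diff_le) auto
  moreover have "coeff E m = 0" using dE Suc by (intro coeff_eq_0) auto
  then have "coeff U m = of_real (1 - (\<Sum>i<m. v i))"
   using dD cE Suc by (simp add: U_def coeff_pCons)
  ultimately show ?thesis by simp
 qed
 moreover have "nevanlinna_numer m x v t + \<i> * denom_poly m x t = (t + \<i>) * poly U t" for t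
 proof -
  have "poly D t = denom_poly m x t" "poly E t = numer_poly m x v t"
   by (simp_all add: D_def E_def Ei_def denom_poly_def numer_poly_def poly_prod poly_sum)
  then have U: "poly U t = denom_poly m x t - (t - \<i>) * numer_poly m x v t" by (simp add: U_def algebra_simps)
  have "(t + \<i>) * (t - \<i>) = 1 + t\<^sup>2" by (simp add: algebra_simps power2_eq_square)
  then have "(t + \<i>) * poly U t = (t + \<i>) * denom_poly m x t - (1 + t\<^sup>2) * numer_poly m x v t"
   unfolding U by (metis mult.assoc right_diff_distrib)
  then show ?thesis by (simp add: nevanlinna_numer_def algebra_simps)
 qed
 ultimately show ?thesis by blast
qed

lemma has_transfer_stripping:
 assumes s: "stripping m x v y v' a0 b0 C" and h: "has_transfer m y v' a b"
 shows "has_transfer (Suc m) x v (case_nat a0 a) (case_nat b0 b)"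
 unfolding has_transfer_def
proof (intro allI impI)
 fix k assume k: "k \<le> Suc m"
 let ?a = "case_nat a0 a" and ?b = "case_nat b0 b"
 have C: "C ~= 0" using s by (simp add: stripping_def)
 have sD: "of_real C * denom_poly (Suc m) x t = (of_real a0 + t) * denom_poly m y t + of_real b0 * nevanlinna_numer m y v' t"
  and sE: "of_real C * numer_poly (Suc m) x v t = denom_poly m y t" for t using s by (auto simp: stripping_def)
 let ?f = "%T P R. (1 - of_real a0 * T) * P + of_real b0 * T * R"
 let ?g = "%T P R. (T + of_real a0) * P - of_real b0 * R"
 show "\<exists>U. degree U \<le> Suc m - k & coeff U (Suc m - k) = of_real (1 - (\<Sum>i<Suc m. v i)) & (\<forall>t::real. transfer ?a ?b k t 1 * nevanlinna_numer (Suc m) x v (of_real t) + transfer ?a ?b k t \<i> * denom_poly (Suc m) x (of_real t) = (1 + (of_real t)\<^sup>2) ^ k * (of_real t + \<i>) * poly U (of_real t))"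
 proof (cases k)
  case 0
  then show ?thesis using has_transfer_base[of "Suc m" v x] by (auto simp del: sum.lessThan_Suc)
 next
  case (Suc l)
  then have "l \<le> m" using k by simp
  then obtain U where U: "degree U \<le> m - l" "coeff U (m - l) = of_real (1 - (\<Sum>i<m. v' i))"
   "!!t::real. transfer a b l t 1 * nevanlinna_numer m y v' (of_real t) + transfer a b l t \<i> * denom_poly m y (of_real t) = (1 + (of_real t)\<^sup>2) ^ l * (of_real t + \<i>) * poly U (of_real t)"
   using h unfolding has_transfer_def by blast
  define q where "q = complex_of_real b0 / complex_of_real C"
  have eq: "transfer ?a ?b k t 1 * nevanlinna_numer (Suc m) x v (of_real t) + transfer ?a ?b k t \<i> * denom_poly (Suc m) x (of_real t) = (1 + (of_real t)\<^sup>2) ^ k * (of_real t + \<i>) * poly (smult q U) (of_real t)" for t :: real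
  proof -
   define P R where "P = transfer a b l t 1" and "R = transfer a b l t \<i>"
   define T where "T = complex_of_real t"
   define D N E D1 N1 where "D = denom_poly (Suc m) x T" and "N = nevanlinna_numer (Suc m) x v T"
    and "E = numer_poly (Suc m) x v T" and "D1 = denom_poly m y T" and "N1 = nevanlinna_numer m y v' T"
   define c where "c = complex_of_real C"
   have cD: "c * D = (of_real a0 + T) * D1 + of_real b0 * N1" and cE: "c * E = D1"
    using sD[of T] sE[of T] by (simp_all add: c_def D_def D1_def N1_def E_def)
   have N: "N = T * D - (1 + T\<^sup>2) * E" by (simp add: N_def D_def E_def nevanlinna_numer_def)
   have P': "transfer ?a ?b k t 1 = ?g T P R"
    and R': "transfer ?a ?b k t \<i> = ?f T P R"
    unfolding Suc transfer_shift_1 transfer_shift_i by (simp_all add: P_def R_def T_def)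
   \<comment> \<open>Eliminating the outer numerator and denominator through the stripping
     identities produces the additional factor \<open>1 + T\<^sup>2\<close> that raises the exponent
     from \<open>l\<close> to \<open>k\<close>; the terms in \<open>a0\<close> cancel.\<close>
   have "c * (?g T P R * N + ?f T P R * D) = ?g T P R * (T * (c * D) - (1 + T\<^sup>2) * (c * E)) + ?f T P R * (c * D)"
    unfolding N by (simp add: algebra_simps)
   also have "... = of_real b0 * (1 + T\<^sup>2) * (P * N1 + R * D1)"
    unfolding cD cE by (simp add: algebra_simps power2_eq_square)
   also have "P * N1 + R * D1 = (1 + T\<^sup>2) ^ l * (T + \<i>) * poly U T"
    using U(3)[of t] by (simp add: P_def R_def N1_def D1_def T_def)
   finally have "c * (?g T P R * N + ?f T P R * D) = c * ((1 + T\<^sup>2) ^ k * (T + \<i>) * poly (smult q U) T)"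
    using C by (simp add: q_def c_def Suc field_simps)
   then show ?thesis using C unfolding P' R' by (simp add: c_def N_def D_def T_def)
  qed
  have "coeff (smult q U) (Suc m - k) = of_real (1 - (\<Sum>i<Suc m. v i))"
   using U(2) s Suc by (simp add: stripping_def q_def)
  moreover have "degree (smult q U) \<le> Suc m - k" using U(1) Suc by (auto intro: le_trans[OF degree_smult_le])
  ultimately show ?thesis using eq by blast
 qed
qed

section \<open>Orthogonality and identification of the coefficients of a configuration\<close>

definition config_moment :: "nat => (nat => real) => (nat => real) => nat => complex" where
 "config_moment m x v j = (\<Sum>i<m. of_real (v i) * cayley (x i) ^ j) + of_real (1 - (\<Sum>i<m. v i))"

lemma moment_functional_config:
 "moment_functional (config_moment m x v) p = (\<Sum>i<m. of_real (v i) * poly p (cayley (x i))) + of_real (1 - (\<Sum>i<m. v i)) * poly p 1"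
proof -
 let ?w = "complex_of_real (1 - (\<Sum>i<m. v i))"
 let ?f = "\<Sum>j\<le>degree p. \<Sum>i<m. coeff p j * (of_real (v i) * cayley (x i) ^ j)"
 have "moment_functional (config_moment m x v) p = ?f + (\<Sum>j\<le>degree p. coeff p j * ?w)"
  by (simp add: moment_functional_def config_moment_def ring_distribs sum.distrib sum_distrib_left sum_subtractf del: of_real_sum)
 also have "?f = (\<Sum>i<m. \<Sum>j\<le>degree p. coeff p j * (of_real (v i) * cayley (x i) ^ j))" by (rule sum.swap)
 also have "... = (\<Sum>i<m. of_real (v i) * poly p (cayley (x i)))"
  by (simp add: poly_altdef sum_distrib_left mult_ac)
 also have "(\<Sum>j\<le>degree p. coeff p j * ?w) = ?w * poly p 1"
  unfolding sum_distrib_right[symmetric] by (simp add: poly_altdef)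
 finally show ?thesis .
qed

text \<open>Orthogonal polynomials normalised to take the value \<open>1\<close> at \<open>1\<close>; their recursion involves the
 modified coefficients instead of the Verblunsky coefficients.\<close>
fun modified_szego :: "(nat => complex) => nat => complex poly" where
 "modified_szego g 0 = 1"
| "modified_szego g (Suc k) = smult (1 / (1 - g k))
   (pCons 0 (modified_szego g k) - smult (g k) (reversed_poly k (modified_szego g k)))"

lemma degree_modified_szego: "degree (modified_szego g k) \<le> k"
proof (induction k)
 case (Suc k)
 have "degree (pCons 0 (modified_szego g k)) \<le> Suc k"
  using Suc degree_pCons_le[of 0 "modified_szego g k"] by linarith
 moreover have "degree (smult (g k) (reversed_poly k (modified_szego g k))) \<le> Suc k"
  using degree_reversed_poly[of k "modified_szego g k"] degree_smult_le[of "g k" "reversed_poly k (modified_szego g k)"] by linarith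
 ultimately show ?case
  unfolding modified_szego.simps by (rule order.trans[OF degree_smult_le degree_diff_le])
qed simp

lemma poly_modified_szego_1:
 assumes "!!j. j < k ==> g j ~= 1" shows "poly (modified_szego g k) 1 = 1"
 using assms
proof (induction k)
 case (Suc k)
 then show ?case using poly_reversed_poly_circle[OF degree_modified_szego[of g k], of 1] by (simp add: divide_simps)
qed simp

lemma transfer_step_cayley:
 assumes "0 < b"
 shows "(of_real t - \<i>) * w - halfplane_coeff a b * (of_real t + \<i>) * cnj w = (1 - halfplane_coeff a b) * transfer_step a b t w"
proof -
 define c where "c = Complex (- a) b"
 have c: "c + \<i> ~= 0" using Complex_plus_i_nz[OF assms] by (simp add: c_def)
 let ?f = "(c + \<i>) * (of_real t - \<i>) * w - (c - \<i>) * (of_real t + \<i>) * cnj w"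
 have "?f = 2 * \<i> * transfer_step a b t w"
  by (simp add: c_def transfer_step_def complex_eq_iff algebra_simps)
 then have "?f / (c + \<i>) = 2 * \<i> / (c + \<i>) * transfer_step a b t w"
  by simp
 moreover have "?f / (c + \<i>) = (of_real t - \<i>) * w - halfplane_coeff a b * (of_real t + \<i>) * cnj w"
  unfolding halfplane_coeff_def c_def[symmetric] using c by (simp add: field_simps)
 ultimately show ?thesis unfolding one_minus_halfplane_coeff[OF assms] c_def[symmetric] by metis
qed

text \<open>On the circle reversal is conjugation up to the factor \<open>z ^ k\<close>, and the
  factor \<open>cayley t ^ k\<close> turns the conjugate denominator \<open>(t - \<i>) ^ k\<close>
  back into \<open>(t + \<i>) ^ k\<close>. Thus the polynomial recursion and \<open>transfer\<close>
  are the same recursion.\<close>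

lemma poly_modified_szego_cayley:
 assumes "!!j. j < k ==> 0 < b j"
 shows "poly (modified_szego (%j. halfplane_coeff (a j) (b j)) k) (cayley t) = transfer a b k t 1 / (of_real t + \<i>) ^ k"
 using assms
proof (induction k)
 case (Suc k)
 let ?g = "%j. halfplane_coeff (a j) (b j)"
 let ?P = "transfer a b k t 1"
 let ?T = "complex_of_real t + \<i>"
 have IH: "poly (modified_szego ?g k) (cayley t) = ?P / ?T ^ k" using Suc by simp
 have bk: "0 < b k" using Suc.prems by simp
 have rev: "poly (reversed_poly k (modified_szego ?g k)) (cayley t) = cnj ?P / ?T ^ k"
  by (simp add: poly_reversed_poly_circle[OF degree_modified_szego] IH) (simp add: cayley_def power_divide)
 have "poly (modified_szego ?g (Suc k)) (cayley t) = 1 / (1 - ?g k) * (cayley t * (?P / ?T ^ k) - ?g k * (cnj ?P / ?T ^ k))"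
  by (simp add: IH rev)
 also have "cayley t * (?P / ?T ^ k) - ?g k * (cnj ?P / ?T ^ k) = ((of_real t - \<i>) * ?P - ?g k * ?T * cnj ?P) / ?T ^ Suc k"
 proof -
  have "u / p * (P / p ^ k) - g * (R / p ^ k) = (u * P - g * p * R) / p ^ Suc k" if "p ~= 0" for u p P g R :: complex
   using that by (simp add: field_simps)
  then show ?thesis unfolding cayley_def using of_real_ne_i(2) by blast
 qed
 also have "... = (1 - ?g k) * transfer_step (a k) (b k) t ?P / ?T ^ Suc k"
  unfolding transfer_step_cayley[OF bk] ..
 also have "1 / (1 - ?g k) * ... = transfer a b (Suc k) t 1 / ?T ^ Suc k"
  using halfplane_coeff_ne_1[OF bk, of "a k"] by simp
 finally show ?case .
qed simp

lemma coeff_mult_top: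
 assumes "degree q \<le> d" shows "coeff (p * q) (degree p + d) = lead_coeff p * coeff q d"
proof (cases "degree q = d")
 case True
 then show ?thesis using coeff_mult_degree_sum[of p q] by simp
next
 case False
 then have "degree (p * q) < degree p + d" using degree_mult_le[of p q] assms by linarith
 then show ?thesis using False assms by (simp add: coeff_eq_0)
qed

text \<open>At a point of the configuration \<open>denom_poly\<close> vanishes, so the certificate
  expresses the weighted value of the polynomial as minus a Lagrange residue of a polynomial
  \<open>T\<close> of degree below \<open>m\<close>. These residues add up to the coefficient of
  \<open>T\<close> at \<open>m - 1\<close>, the weight of the point 1, and so cancel the
  contribution of that point, where the polynomial takes the value 1.\<close>

lemma has_transfer_orthogonal:
 assumes x: "inj_on x {..<m}" and h: "has_transfer m x v a b" and b: "!!k. k < m ==> 0 < b k" and jk: "j < k" "k \<le> m"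
 shows "(\<Sum>i<m. of_real (v i) * (poly (modified_szego (%j. halfplane_coeff (a j) (b j)) k) (cayley (x i)) * cnj (cayley (x i)) ^ j))
   + of_real (1 - (\<Sum>i<m. v i)) = 0"
proof -
 obtain U where U: "degree U \<le> m - k" "coeff U (m - k) = of_real (1 - (\<Sum>i<m. v i))"
  "!!t::real. transfer a b k t 1 * nevanlinna_numer m x v (of_real t) + transfer a b k t \<i> * denom_poly m x (of_real t) = (1 + (of_real t)\<^sup>2) ^ k * (of_real t + \<i>) * poly U (of_real t)"
  using h jk unfolding has_transfer_def by blast
 \<comment> \<open>\<open>V\<close> is what remains of the powers of \<open>X i + \<i>\<close> and
   \<open>X i - \<i>\<close> in the \<open>i\<close>-th term. Its degree \<open>k - 1\<close> and
   the bound \<open>m - k\<close> for \<open>U\<close> are just small enough for Lagrange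
   interpolation at \<open>m\<close> points.\<close>
 define V where "V = [:\<i>, 1:] ^ j * [:- \<i>, 1:] ^ (k - 1 - j)"
 define T where "T = V * U"
 have "degree V = k - 1" using jk by (simp add: V_def degree_mult_eq degree_power_eq)
 moreover have "lead_coeff V = 1" unfolding V_def by (simp only: lead_coeff_mult lead_coeff_power) simp
 ultimately have dV: "degree V = k - 1" "lead_coeff V = 1" by auto
 have "degree T \<le> degree V + degree U" unfolding T_def by (rule degree_mult_le)
 then have dT: "degree T < m" using dV U(1) jk by linarith
 have "m - 1 = degree V + (m - k)" using dV jk by simp
 then have cT: "coeff T (m - 1) = of_real (1 - (\<Sum>i<m. v i))"
  unfolding T_def using coeff_mult_top[OF U(1), of V] U(2) dV(2) by simp
 define X where "X i = complex_of_real (x i)" for i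
 have injX: "inj_on X {..<m}" using x by (auto simp: inj_on_def X_def)
 let ?f = "%i k. of_real (v i) * (poly (modified_szego (%j. halfplane_coeff (a j) (b j)) k) (cayley (x i)) * cnj (cayley (x i)) ^ j)"
 have "?f i k = - (poly T (X i) / (\<Prod>j\<in>{..<m}-{i}. X i - X j))" if i: "i < m" for i
 proof -
  define p q where "p = X i + \<i>" and "q = X i - \<i>"
  have p: "p ~= 0" and q: "q ~= 0" by (simp_all add: p_def q_def X_def)
  have pq: "1 + (X i)\<^sup>2 = p * q" by (simp add: p_def q_def algebra_simps power2_eq_square)
  define \<pi> where "\<pi> = (\<Prod>j\<in>{..<m}-{i}. X i - X j)"
  have \<pi>: "\<pi> ~= 0" unfolding \<pi>_def using injX i by (auto simp: inj_on_def)
  define P where "P = transfer a b k (x i) 1"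
  have D: "denom_poly m x (X i) = 0" unfolding denom_poly_def using i by (intro prod_zero) (auto simp: X_def)
  let ?g = "%i. p * q * (of_real (v i) * \<pi>)"
  have "numer_poly m x v (X i) = (\<Sum>l<m. if l = i then of_real (v i) * \<pi> else 0)"
   unfolding numer_poly_def
  proof (intro sum.cong refl)
   fix l assume "l \<in> {..<m}"
   show "of_real (v l) * (\<Prod>j\<in>{..<m}-{l}. X i - of_real (x j)) = (if l = i then of_real (v i) * \<pi> else 0)"
   proof (cases "l = i")
    case False
    then have "(\<Prod>j\<in>{..<m}-{l}. X i - of_real (x j)) = 0" using i by (intro prod_zero) (auto simp: X_def)
    then show ?thesis using False by simp
   qed (simp add: \<pi>_def X_def)
  qed
  then have "numer_poly m x v (X i) = of_real (v i) * \<pi>" using i by simp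
  then have N: "nevanlinna_numer m x v (X i) = - (?g i)"
   unfolding nevanlinna_numer_def D pq by simp
  have "P * - (?g i) = (p * q) ^ k * p * poly U (X i)"
   using U(3)[of "x i"] N D by (simp add: P_def X_def[symmetric] pq p_def[symmetric])
  moreover have "(p * q) ^ k = (p * q) * (p * q) ^ (k - 1)" using jk by (metis Suc_diff_1 gr_implies_not0 power_Suc neq0_conv)
  ultimately have "P * - (?g i) = (p * q) * (p * q) ^ (k - 1) * p * poly U (X i)" by (simp only:)
  then have "- (P * - (?g i)) = - ((p * q) * (p * q) ^ (k - 1) * p * poly U (X i))" by (simp only:)
  then have "p * q * (P * (of_real (v i) * \<pi>)) = p * q * - ((p * q) ^ (k - 1) * p * poly U (X i))"
   by (simp only: mult_minus_right mult_minus_left minus_minus mult_ac)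
  then have "P * (of_real (v i) * \<pi>) = - ((p * q) ^ (k - 1) * p * poly U (X i))"
   using p q mult_left_cancel[of "p * q"] no_zero_divisors[of p q] by blast
  then have e: "P * of_real (v i) * \<pi> = - ((p * q) ^ (k - 1) * p * poly U (X i))" by (simp only: mult.assoc)
  have "?f i k = P * of_real (v i) * \<pi> / \<pi> * (1 / p ^ k) * (p ^ j / q ^ j)"
   using b jk \<pi> by (subst poly_modified_szego_cayley) (auto simp: P_def cnj_cayley p_def q_def X_def power_divide)
  also have "... = - ((p * q) ^ (k - 1) * p * (1 / p ^ k) * (p ^ j / q ^ j) * poly U (X i) / \<pi>)"
   unfolding e by (simp add: mult_ac)
  also have "(p * q) ^ (k - 1) * p * (1 / p ^ k) * (p ^ j / q ^ j) = p ^ j * q ^ (k - 1 - j)"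
  proof -
   have "p ^ (k - 1) * p = p ^ k" using jk by (metis Suc_diff_1 gr_implies_not0 power_Suc2 neq0_conv)
   then have "(p * q) ^ (k - 1) * p = p ^ k * q ^ (k - 1)" by (simp add: power_mult_distrib mult_ac)
   moreover have "q ^ (k - 1) = q ^ (k - 1 - j) * q ^ j" using jk by (simp add: power_add[symmetric])
   ultimately show ?thesis using p q by simp
  qed
  also have "p ^ j * q ^ (k - 1 - j) * poly U (X i) = poly T (X i)"
   by (simp add: T_def V_def p_def q_def add.commute)
  finally show ?thesis by (simp add: \<pi>_def)
 qed
 then have "(\<Sum>i<m. ?f i k) = - (\<Sum>i<m. poly T (X i) / (\<Prod>j\<in>{..<m}-{i}. X i - X j))"
  by (simp add: sum_negf)
 then show ?thesis using lagrange_top_coeff[OF injX dT] cT by simp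
qed

definition config_coeff :: "nat => (nat => real) => (nat => real) => nat => complex" where
 "config_coeff m x v k = modified_coeffs (szego_alpha (config_moment m x v)) k"

lemma moment_functional_smult: "moment_functional c (smult a p) = a * moment_functional c p"
 by (cases "a = 0") (simp_all add: moment_functional_def sum_distrib_left mult_ac)

text \<open>Orthogonality identifies the polynomials \<open>Q k\<close> with the Szego polynomials
  up to the factor \<open>kappa k\<close>, the product of the \<open>1 - g j\<close>. The conjugate
  Verblunsky coefficients are therefore \<open>g k\<close> times the phase
  \<open>kappa k / cnj (kappa k)\<close>, which the definition of the modified coefficients
  removes.\<close>

lemma has_transfer_config_coeff:
 assumes x: "inj_on x {..<m}" and v: "!!i. i < m ==> 0 < v i" "(\<Sum>i<m. v i) < 1"
  and h: "has_transfer m x v a b" and b: "!!k. k < m ==> 0 < b k" and k: "k < m"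
 shows "config_coeff m x v k = halfplane_coeff (a k) (b k)"
proof -
 define g where "g j = halfplane_coeff (a j) (b j)" for j
 define c where "c = config_moment m x v"
 define w where "w = 1 - (\<Sum>i<m. v i)"
 define Q where "Q = modified_szego g"
 define kappa where "kappa k = (\<Prod>j<k. 1 - g j)" for k
 have g1: "g j ~= 1" if "j < m" for j using halfplane_coeff_ne_1[OF b[OF that]] by (simp add: g_def)
 have Q1: "poly (Q k) 1 = 1" if "k \<le> m" for k unfolding Q_def using g1 that by (intro poly_modified_szego_1) auto
 have kappa: "kappa k ~= 0" if "k \<le> m" for k unfolding kappa_def using g1 that by (auto simp: eq_commute[of 1])
 define ip where "ip k j = (\<Sum>i<m. of_real (v i) * (poly (Q k) (cayley (x i)) * cnj (cayley (x i)) ^ j)) + of_real w" for k j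
 have ip0: "ip k j = 0" if "j < k" "k \<le> m" for j k
  using has_transfer_orthogonal[OF x h b that] by (simp add: ip_def Q_def g_def[abs_def] w_def)
 let ?f = "%k. \<Sum>j\<le>k. \<Sum>i<m. cnj (coeff (Q k) j) * (of_real (v i) * (poly (Q k) (cayley (x i)) * cnj (cayley (x i)) ^ j))"
 let ?g = "%k. \<Sum>i<m. v i * (cmod (poly (Q k) (cayley (x i))))\<^sup>2"
 let ?h = "%k. \<Sum>i<m. of_real (v i) * (poly (Q k) (cayley (x i)) * cnj (poly (Q k) (cayley (x i))))"
 let ?p = "%k. \<Sum>j\<le>k. cnj (coeff (Q k) j) * ip k j"
 \<comment> \<open>Otherwise \<open>Q k\<close> would be orthogonal to all powers up to
   \<open>k\<close>, hence to itself, although its squared norm is at least the weight of the point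
   1, where its value is 1.\<close>
 have ipk: "ip k k ~= 0" if "k \<le> m" for k
 proof
  assume "ip k k = 0"
  then have z: "ip k j = 0" if "j \<le> k" for j using ip0[of j k] that \<open>k \<le> m\<close> by (cases "j = k") auto
  have "?p k = ?h k + of_real w * cnj (poly (Q k) 1)"
  proof -
   have dQ: "degree (Q k) \<le> k" unfolding Q_def by (rule degree_modified_szego)
   have "?p k = ?f k + (\<Sum>j\<le>k. cnj (coeff (Q k) j) * of_real w)"
    by (simp add: ip_def distrib_left sum.distrib sum_distrib_left)
   also have "?f k = ?h k"
    by (subst sum.swap) (simp add: poly_altdef_le[OF dQ] sum_distrib_left mult_ac)
   also have "(\<Sum>j\<le>k. cnj (coeff (Q k) j) * of_real w) = of_real w * cnj (poly (Q k) 1)"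
    by (simp add: poly_altdef_le[OF dQ] sum_distrib_left mult_ac)
   finally show ?thesis .
  qed
  moreover have "?p k = 0" using z by simp
  ultimately have "of_real (?g k + w) = (0 :: complex)"
   using Q1[OF that] by (simp add: complex_norm_square[symmetric] del: of_real_power)
  then have "?g k + w = 0" using of_real_eq_0_iff by blast
  moreover have "0 \<le> ?g k"
   using v(1) by (intro sum_nonneg mult_nonneg_nonneg) (auto intro: less_imp_le)
  ultimately show False using v(2) by (simp add: w_def)
 qed
 have L: "moment_functional c p = (\<Sum>i<m. of_real (v i) * poly p (cayley (x i))) + of_real w * poly p 1" for p
  unfolding c_def w_def by (rule moment_functional_config)
 have Lrev: "moment_functional c (reversed_poly k (Q k)) ~= 0" if "k \<le> m" for k
 proof -
  have dQ: "degree (Q k) \<le> k" unfolding Q_def by (rule degree_modified_szego)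
  have "moment_functional c (reversed_poly k (Q k)) = cnj (ip k k)"
   unfolding L ip_def using Q1[OF that] by (simp add: poly_reversed_poly_circle[OF dQ] mult_ac)
  then show ?thesis using ipk[OF that] by simp
 qed
 \<comment> \<open>This is orthogonality of \<open>Q (Suc k)\<close> to 1, solved for
   \<open>g k\<close>.\<close>
 have ratio: "moment_functional c (pCons 0 (Q k)) = g k * moment_functional c (reversed_poly k (Q k))" if "k < m" for k
 proof -
  have "moment_functional c (Q (Suc k)) = ip (Suc k) 0"
   unfolding L ip_def using Q1[of "Suc k"] that by simp
  also have "... = 0" using ip0 that by simp
  finally have "moment_functional c (Q (Suc k)) = 0" .
  moreover have "moment_functional c (Q (Suc k)) = 1 / (1 - g k) * (moment_functional c (pCons 0 (Q k)) - g k * moment_functional c (reversed_poly k (Q k)))"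
   unfolding L by (simp add: Q_def diff_divide_distrib sum_subtractf sum_distrib_left sum_divide_distrib algebra_simps)
  ultimately show ?thesis using g1[OF that] by (simp add: eq_commute[of 1])
 qed
 have sz: "szego c k = smult (kappa k) (Q k) & (k < m --> cnj (szego_alpha c k) = g k * kappa k / cnj (kappa k))" if "k \<le> m" for k
  using that
 proof (induction k)
  case 0
  have "szego c 0 = smult (kappa 0) (Q 0)" by (simp add: kappa_def Q_def)
  moreover have "cnj (szego_alpha c 0) = g 0 * kappa 0 / cnj (kappa 0)" if "0 < m"
   using ratio[OF that] Lrev[of 0] unfolding szego_alpha_def by (simp add: kappa_def Q_def)
  ultimately show ?case by blast
 next
  case (Suc k)
  then have IH: "szego c k = smult (kappa k) (Q k)" "cnj (szego_alpha c k) = g k * kappa k / cnj (kappa k)" by auto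
  have km: "k < m" using Suc.prems by simp
  have kappa0: "cnj (kappa k) ~= 0" using kappa[of k] km by simp
  have kappaS: "kappa (Suc k) = kappa k * (1 - g k)" by (simp add: kappa_def)
  have "szego c (Suc k) = smult (kappa k) (pCons 0 (Q k) - smult (g k) (reversed_poly k (Q k)))"
   unfolding szego_Suc_alpha IH reversed_poly_smult using kappa0 by (simp add: smult_diff_right mult_ac)
  also have "... = smult (kappa (Suc k)) (Q (Suc k))"
   using g1[OF km] by (simp add: Q_def kappaS eq_commute[of 1])
  finally have 1: "szego c (Suc k) = smult (kappa (Suc k)) (Q (Suc k))" .
  have "cnj (szego_alpha c (Suc k)) = g (Suc k) * kappa (Suc k) / cnj (kappa (Suc k))" if "Suc k < m"
  proof -
   have "pCons 0 (smult (kappa (Suc k)) (Q (Suc k))) = smult (kappa (Suc k)) (pCons 0 (Q (Suc k)))" by simp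
   then show ?thesis
    using ratio[OF that] Lrev[of "Suc k"] that kappa[of "Suc k"]
    unfolding szego_alpha_def 1 reversed_poly_smult by (simp only: moment_functional_smult) (simp add: field_simps)
  qed
  with 1 show ?case by blast
 qed
 have "modified_coeffs (szego_alpha c) k = g k" if "k < m" for k
  using that
 proof (induction k rule: less_induct)
  case (less k)
  have "(\<Prod>j<k. (1 - cnj (modified_coeffs (szego_alpha c) j)) / (1 - modified_coeffs (szego_alpha c) j)) = (\<Prod>j<k. (1 - cnj (g j)) / (1 - g j))"
   using less by (intro prod.cong) auto
  also have "... = cnj (kappa k) / kappa k" by (simp add: kappa_def prod_dividef)
  finally show ?case
   using sz[of k] less.prems kappa[of k] by (subst modified_coeffs.simps) simp
 qed
 then show ?thesis using k by (simp add: config_coeff_def c_def g_def)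
qed

section \<open>Interlacing configurations\<close>

definition interlacing :: "nat => (nat => real) => (nat => real) => bool" where
 "interlacing m x y \<longleftrightarrow> (\<forall>k<m. x k < y k & y k < x (Suc k))"

text \<open>Weights of the configuration with points \<open>x 0, ..., x m\<close> whose stripped points are the \<open>y k\<close>;
 \<open>C\<close> is the reciprocal of their sum.\<close>
definition outer_weight :: "nat => real => (nat => real) => (nat => real) => nat => real" where
 "outer_weight m C x y = (\<lambda>i\<in>{..<Suc m}. (\<Prod>k<m. x i - y k) / (C * (\<Prod>j\<in>{..<Suc m}-{i}. x i - x j)))"

text \<open>Minus the residue at \<open>y k\<close> of
  \<open>C * (\<Prod>i<Suc m. t - x i) / (\<Prod>l<m. t - y l)\<close>; under interlacing it is
  positive.\<close>

definition inner_residue :: "nat => real => (nat => real) => (nat => real) => nat => real" where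
 "inner_residue m C x y k = - C * (\<Prod>i<Suc m. y k - x i) / (\<Prod>l\<in>{..<m}-{k}. y k - y l)"

text \<open>Found by comparing the expansion of
  \<open>C * denom_poly (Suc m) x t / denom_poly m y t\<close> with a + t + b F_inner. As (1 + t^2)
  / (t - y) = t + y + (1 + y^2) / (t - y), the coefficient of t determines \<open>strip_b\<close>,
  the constant term determines \<open>strip_a\<close>, and the residues determine
  \<open>inner_weight\<close>.\<close>

definition strip_b :: "nat => real => (nat => real) => (nat => real) => real" where
 "strip_b m C x y = C - 1 + (\<Sum>k<m. inner_residue m C x y k / (1 + (y k)\<^sup>2))"

definition strip_a :: "nat => real => (nat => real) => (nat => real) => real" where
 "strip_a m C x y = - C * x m + (\<Sum>k<m. inner_residue m C x y k / (x m - y k)) + (\<Sum>k<m. inner_residue m C x y k * y k / (1 + (y k)\<^sup>2))"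

definition inner_weight :: "nat => real => (nat => real) => (nat => real) => nat => real" where
 "inner_weight m C x y = (\<lambda>k\<in>{..<m}. inner_residue m C x y k / (strip_b m C x y * (1 + (y k)\<^sup>2)))"

lemma interlacing_less:
 assumes "interlacing m x y" "ordered (Suc m) x" "i \<le> k" "k < m" shows "x i < y k"
proof -
 have "x i \<le> x k" using ordered_less[OF assms(2), of i k] assms by (cases "i = k") auto
 then show ?thesis using assms by (auto simp: interlacing_def intro: le_less_trans)
qed

lemma interlacing_greater:
 assumes "interlacing m x y" "ordered (Suc m) x" "k < i" "i \<le> m" shows "y k < x i"
proof -
 have "x (Suc k) \<le> x i" using ordered_less[OF assms(2), of "Suc k" i] assms by (cases "Suc k = i") auto
 then show ?thesis using assms by (auto simp: interlacing_def intro: less_le_trans)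
qed

lemma interlacing_ordered_inner:
 assumes "interlacing m x y" "ordered (Suc m) x" shows "ordered m y"
 unfolding ordered_def using interlacing_less[OF assms] interlacing_greater[OF assms]
 by (metis Suc_leI less_imp_le less_trans order_refl less_imp_le_nat)

lemma interlacing_zeros_below:
 assumes "interlacing m x y" "ordered (Suc m) x" shows "zeros_below m y x"
 unfolding zeros_below_def using assms(1)
 by (auto simp: interlacing_def) (metis Suc_pred less_imp_diff_less)

text \<open>For \<open>i\<close> other than \<open>k\<close> the zero \<open>x i\<close> and the
  pole \<open>y i\<close> lie on the same side of \<open>y k\<close>, so each quotient of
  corresponding factors is positive.\<close>

lemma residues_of_pos:
 assumes z: "zeros_below m y x" and y: "ordered m y" and C: "0 < C" and k: "k < m"
 shows "0 < residues_of m C y x k"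
proof -
 have e: "(\<Prod>i<m. y k - x i) = (y k - x k) * (\<Prod>i\<in>{..<m}-{k}. y k - x i)"
  using k by (intro prod.remove) auto
 have "0 < (y k - x i) / (y k - y i)" if "i \<in> {..<m}-{k}" for i
 proof (cases "i < k")
  case True
  then have "y i < y k" "x i < y i" using ordered_less[OF y] k z by (auto simp: zeros_below_def)
  then show ?thesis by (intro divide_pos_pos) auto
 next
  case False
  then have i: "k < i" "i < m" using that by auto
  have "y k \<le> y (i - 1)"
  proof (cases "k = i - 1")
   case False
   then have "k < i - 1" "i - 1 < m" using i by auto
   then show ?thesis using ordered_less[OF y] by (simp add: less_imp_le)
  qed simp
  moreover have "y (i - 1) < x i" using z i by (auto simp: zeros_below_def)
  ultimately show ?thesis using ordered_less[OF y i] by (intro divide_neg_neg) auto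
 qed
 then have "0 < (\<Prod>i\<in>{..<m}-{k}. (y k - x i) / (y k - y i))" by (rule prod_pos)
 then have "0 < C * (y k - x k) * (\<Prod>i\<in>{..<m}-{k}. (y k - x i) / (y k - y i))"
  using C z k by (auto simp: zeros_below_def)
 then show ?thesis using k by (simp add: residues_of_def e prod_dividef mult.assoc)
qed

lemma inner_residue_eq: "k < m ==> inner_residue m C x y k = residues_of m C y x k * (x m - y k)"
 by (simp add: inner_residue_def residues_of_def minus_divide_left algebra_simps)

context
 fixes m :: nat and C :: real and x y :: "nat => real"
 assumes il: "interlacing m x y" and ox: "ordered (Suc m) x" and C: "1 < C"
begin

lemma inner_residue_pos: "k < m ==> 0 < inner_residue m C x y k"
 using residues_of_pos[OF interlacing_zeros_below[OF il ox] interlacing_ordered_inner[OF il ox]]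
  interlacing_greater[OF il ox, of k m] C by (simp add: inner_residue_eq)

lemma strip_b_pos: "0 < strip_b m C x y"
 unfolding strip_b_def using C inner_residue_pos
 by (intro add_pos_nonneg sum_nonneg divide_nonneg_nonneg) (auto intro: less_imp_le)

lemma inner_weight_pos: "k < m ==> 0 < inner_weight m C x y k"
 using inner_residue_pos strip_b_pos by (simp add: inner_weight_def add_pos_nonneg)

lemma strip_b_inner_weight: "k < m ==> strip_b m C x y * inner_weight m C x y k * (1 + (y k)\<^sup>2) = inner_residue m C x y k"
proof -
 assume "k < m"
 moreover have "1 + (y k)\<^sup>2 ~= 0" using sum_power2_eq_zero_iff[of 1 "y k"] by auto
 ultimately show ?thesis using strip_b_pos by (simp add: inner_weight_def)
qed

lemma sum_inner_weight: "strip_b m C x y * (1 - (\<Sum>k<m. inner_weight m C x y k)) = C - 1"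
proof -
 have "strip_b m C x y * inner_weight m C x y k = inner_residue m C x y k / (1 + (y k)\<^sup>2)" if "k < m" for k
  using that strip_b_pos by (simp add: inner_weight_def)
 then have "strip_b m C x y * (\<Sum>k<m. inner_weight m C x y k) = (\<Sum>k<m. inner_residue m C x y k / (1 + (y k)\<^sup>2))"
  by (simp add: sum_distrib_left)
 then show ?thesis by (simp add: right_diff_distrib) (simp add: strip_b_def)
qed

lemma sum_inner_weight_less: "(\<Sum>k<m. inner_weight m C x y k) < 1"
 using sum_inner_weight strip_b_pos C by (metis diff_gt_0_iff_gt zero_less_mult_pos)

text \<open>Lagrange interpolation of \<open>\<Prod>k<m. t - y k\<close> at the outer points;
  \<open>C\<close> times an outer weight is the corresponding interpolation coefficient.\<close>

lemma numer_poly_outer: "of_real C * numer_poly (Suc m) x (outer_weight m C x y) t = denom_poly m y t"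
proof -
 define X where "X i = complex_of_real (x i)" for i
 define T where "T = (\<Prod>k<m. [:- of_real (y k), 1 :: complex:])"
 have inj: "inj_on X {..<Suc m}" using ordered_inj[OF ox] by (auto simp: inj_on_def X_def)
 have dT: "degree T < Suc m" unfolding T_def by (subst degree_prod_linear) auto
 let ?f = "%i. \<Prod>j\<in>{..<Suc m}-{i}. t - X j"
 let ?g = "%i. \<Prod>j\<in>{..<Suc m}-{i}. X i - X j"
 have "poly T t = (\<Sum>i<Suc m. poly T (X i) / ?g i * ?f i)"
  by (subst lagrange_interpolation[OF inj disjI2[OF dT]]) (simp add: poly_sum poly_prod del: sum.lessThan_Suc)
 also have "... = (\<Sum>i<Suc m. of_real (C * outer_weight m C x y i) * ?f i)"
 proof (intro sum.cong refl)
  fix i assume "i \<in> {..<Suc m}"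
  then have "poly T (X i) / ?g i = of_real (C * outer_weight m C x y i)"
   using C by (simp add: outer_weight_def T_def poly_prod X_def)
  then show "poly T (X i) / ?g i * ?f i = of_real (C * outer_weight m C x y i) * ?f i" by simp
 qed
 also have "... = of_real C * numer_poly (Suc m) x (outer_weight m C x y) t"
  by (simp add: numer_poly_def sum_distrib_left X_def mult_ac del: sum.lessThan_Suc)
 finally show ?thesis by (simp add: T_def poly_prod denom_poly_def)
qed

lemma sum_outer_weight: "(\<Sum>i<Suc m. outer_weight m C x y i) = 1 / C"
proof -
 define T where "T = (\<Prod>k<m. [:- y k, 1 :: real:])"
 have dT: "degree T = m" unfolding T_def by (subst degree_prod_linear) auto
 have "coeff T m = 1" using monic_prod_linear[of y "{..<m}"] dT by (simp add: T_def)
 then have "(\<Sum>i<Suc m. poly T (x i) / (\<Prod>j\<in>{..<Suc m}-{i}. x i - x j)) = 1"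
  using lagrange_top_coeff[OF ordered_inj[OF ox], of T] dT by simp
 then have "1 / C = (\<Sum>i<Suc m. poly T (x i) / (\<Prod>j\<in>{..<Suc m}-{i}. x i - x j)) / C" by simp
 also have "... = (\<Sum>i<Suc m. poly T (x i) / (\<Prod>j\<in>{..<Suc m}-{i}. x i - x j) / C)" by (rule sum_divide_distrib)
 also have "... = (\<Sum>i<Suc m. outer_weight m C x y i)"
  by (intro sum.cong refl) (simp add: outer_weight_def T_def poly_prod)
 finally show ?thesis by simp
qed

text \<open>Away from the inner points this compares two partial fraction expansions and multiplies
  by \<open>denom_poly m y\<close>. At an inner point one cannot divide, but there the numerator sum
  has a single nonzero term, and the definition of the residue gives the identity.\<close>

lemma denom_poly_strip:
 "of_real C * denom_poly (Suc m) x t = (of_real (strip_a m C x y) + t) * denom_poly m y t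
   + of_real (strip_b m C x y) * nevanlinna_numer m y (inner_weight m C x y) t"
proof -
 define c where "c = inner_residue m C x y"
 define b a where "b = strip_b m C x y" and "a = strip_a m C x y"
 define X Y where "X i = complex_of_real (x i)" and "Y i = complex_of_real (y i)" for i
 have oy: "ordered m y" by (rule interlacing_ordered_inner[OF il ox])
 have injY: "inj_on Y {..<m}" using ordered_inj[OF oy] by (auto simp: inj_on_def Y_def)
 let ?f = "%k t. of_real (c k / (1 + (y k)\<^sup>2)) * (\<Prod>j\<in>{..<m}-{k}. t - Y j)"
 let ?g = "%t. of_real b * numer_poly m y (inner_weight m C x y) t"
 have bn: "?g t = (\<Sum>k<m. ?f k t)" for t
 proof -
  have "b * inner_weight m C x y k = c k / (1 + (y k)\<^sup>2)" if "k < m" for k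
   using that strip_b_pos by (simp add: inner_weight_def b_def c_def)
  then have "complex_of_real b * (of_real (inner_weight m C x y k) * p) = of_real (c k / (1 + (y k)\<^sup>2)) * p" if "k < m" for k p
   using that by (simp only: mult.assoc[symmetric] of_real_mult[symmetric])
  then show ?thesis by (simp add: numer_poly_def sum_distrib_left Y_def)
 qed
 let ?h = "%k. c k / (1 + (y k)\<^sup>2) * (\<Prod>j\<in>{..<m}-{k}. y k - y j)"
 let ?p = "%t. \<Sum>k<m. (1 + t\<^sup>2) * (of_real (c k / (1 + (y k)\<^sup>2)) / (t - Y k))"
 let ?q = "%t d. of_real C * t - of_real C * X m + (\<Sum>k<m. d k - of_real (c k) / (t - Y k))"
 let ?r = "%d t. of_real C + (\<Sum>k<m. d k / (t - Y k))"
 let ?s = "%t. of_real b * nevanlinna_numer m y (inner_weight m C x y) t"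
 show ?thesis
 proof (cases "\<exists>k<m. t = Y k")
  case True
  then obtain k where k: "k < m" "t = Y k" by blast
  have D0: "denom_poly m y t = 0" unfolding denom_poly_def k(2) using k(1) by (intro prod_zero) (auto simp: Y_def)
  have y1: "1 + (y k)\<^sup>2 ~= 0" using sum_power2_eq_zero_iff[of 1 "y k"] by auto
  have "(\<Sum>l<m. ?f l t) = (\<Sum>l<m. if l = k then ?f k t else 0)"
  proof (intro sum.cong refl)
   fix l assume "l \<in> {..<m}"
   have "(\<Prod>j\<in>{..<m}-{l}. t - Y j) = 0" if "l ~= k" using k that by (intro prod_zero) auto
   then show "?f l t = (if l = k then ?f k t else 0)" by auto
  qed
  also have "... = ?f k t" using k by simp
  also have "... = of_real (?h k)"
   by (simp only: k(2) Y_def of_real_mult of_real_prod of_real_diff)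
  finally have n: "?g t = of_real (?h k)"
   unfolding bn .
  have "?s t = - ((1 + t\<^sup>2) * ?g t)"
   unfolding nevanlinna_numer_def D0 by simp
  also have "... = of_real (- ((1 + (y k)\<^sup>2) * ?h k))"
   unfolding n by (simp only: k(2) Y_def of_real_minus of_real_mult of_real_add of_real_1 of_real_power)
  also have "- ((1 + (y k)\<^sup>2) * ?h k) = C * (\<Prod>i<Suc m. y k - x i)"
  proof -
   have "(\<Prod>j\<in>{..<m}-{k}. y k - y j) ~= 0" using ordered_inj[OF oy] k(1) by (auto simp: inj_on_def)
   then have "c k * (\<Prod>j\<in>{..<m}-{k}. y k - y j) = - (C * (\<Prod>i<Suc m. y k - x i))"
    by (simp add: c_def inner_residue_def del: prod.lessThan_Suc)
   then show ?thesis using y1 by (simp del: prod.lessThan_Suc)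
  qed
  also have "complex_of_real ... = of_real C * denom_poly (Suc m) x t"
   by (simp add: denom_poly_def k(2) Y_def)
  finally show ?thesis unfolding D0 by (simp add: b_def)
 next
  case False
  then have ne: "t ~= Y k" if "k < m" for k using that by auto
  define D where "D = denom_poly m y t"
  have D: "D = (\<Prod>k<m. t - Y k)" by (simp add: D_def denom_poly_def Y_def)
  have D0: "D ~= 0" unfolding D using ne by auto
  define d where "d k = complex_of_real (residues_of m C y x k)" for k
  have cd: "complex_of_real (c k) = d k * (X m - Y k)" if "k < m" for k
   by (simp add: c_def inner_residue_eq[OF that] d_def X_def Y_def)
  have "of_real C * ((\<Prod>i<m. t - X i) / D) = ?r d t"
   unfolding D using ne
   by (subst partial_fractions_balanced[OF injY]) (auto simp: distrib_left sum_distrib_left d_def residues_of_def X_def Y_def)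
  then have "of_real C * (\<Prod>i<m. t - X i) = ?r d t * D" using D0 by (simp add: field_simps)
  then have "of_real C * denom_poly (Suc m) x t = (t - X m) * ?r d t * D"
   by (simp add: denom_poly_def X_def mult_ac)
  also have "(t - X m) * ?r d t = ?q t d"
  proof -
   have "(t - X m) * (d k / (t - Y k)) = d k - of_real (c k) / (t - Y k)" if "k < m" for k
    unfolding cd[OF that] using ne[OF that] by (simp add: field_simps)
   then have "(\<Sum>k<m. (t - X m) * (d k / (t - Y k))) = (\<Sum>k<m. d k - of_real (c k) / (t - Y k))"
    by (intro sum.cong) auto
   moreover have "(t - X m) * ?r d t = (t - X m) * of_real C + (\<Sum>k<m. (t - X m) * (d k / (t - Y k)))"
    by (simp only: distrib_left sum_distrib_left)
   ultimately show ?thesis by (simp add: algebra_simps)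
  qed
  finally have 1: "of_real C * denom_poly (Suc m) x t = ?q t d * D" .
  have "?g t = (\<Sum>k<m. of_real (c k / (1 + (y k)\<^sup>2)) / (t - Y k)) * D"
   unfolding bn sum_distrib_right
  proof (intro sum.cong refl)
   fix k assume k: "k \<in> {..<m}"
   have "D = (t - Y k) * (\<Prod>j\<in>{..<m}-{k}. t - Y j)" unfolding D using k by (intro prod.remove) auto
   then show "?f k t = of_real (c k / (1 + (y k)\<^sup>2)) / (t - Y k) * D"
    using ne[of k] k by simp
  qed
  note nb = this
  have "?s t = of_real b * t * D - (1 + t\<^sup>2) * ?g t"
   by (simp add: nevanlinna_numer_def D_def[symmetric] algebra_simps)
  also have "... = (of_real b * t - (?p t)) * D"
   unfolding nb sum_distrib_left[symmetric] by (simp only: left_diff_distrib mult.assoc)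
  finally have "?s t = (of_real b * t - (?p t)) * D" .
  moreover have "of_real b * t - (?p t) + (of_real a + t) = ?q t d"
  proof -
   define e where "e k = complex_of_real (c k / (1 + (y k)\<^sup>2))" for k
   have ce: "of_real (c k) = e k * (1 + (Y k)\<^sup>2)" for k
   proof -
    have "1 + (y k)\<^sup>2 ~= 0" using sum_power2_eq_zero_iff[of 1 "y k"] by auto
    then have "c k = c k / (1 + (y k)\<^sup>2) * (1 + (y k)\<^sup>2)" by simp
    then have "complex_of_real (c k) = of_real (c k / (1 + (y k)\<^sup>2) * (1 + (y k)\<^sup>2))" by simp
    then show ?thesis by (simp only: e_def Y_def of_real_mult of_real_add of_real_power of_real_1)
   qed
   have B: "complex_of_real b = of_real C - 1 + (\<Sum>k<m. e k)"
    by (simp add: b_def strip_b_def c_def[symmetric] e_def)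
   have "c k / (x m - y k) = residues_of m C y x k" if "k < m" for k
    using interlacing_greater[OF il ox, of k m] that by (simp add: c_def inner_residue_eq)
   then have A: "complex_of_real a = - of_real C * X m + (\<Sum>k<m. d k) + (\<Sum>k<m. e k * Y k)"
    by (simp add: a_def strip_a_def c_def[symmetric] d_def e_def X_def Y_def)
   \<comment> \<open>The identity (1 + t^2) / (t - y) = t + y + (1 + y^2) / (t - y), multiplied by
     \<open>e k\<close>; the polynomial part is what \<open>a\<close> and \<open>b\<close> have to
     absorb.\<close>
   have k: "e k * t + e k * Y k - (1 + t\<^sup>2) * (e k / (t - Y k)) = - (of_real (c k) / (t - Y k))" if "k < m" for k
   proof -
    have "(e k * t + e k * Y k) * (t - Y k) - (1 + t\<^sup>2) * e k = - of_real (c k)"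
     unfolding ce by (simp add: algebra_simps power2_eq_square)
    then have "((e k * t + e k * Y k) * (t - Y k) - (1 + t\<^sup>2) * e k) / (t - Y k) = - of_real (c k) / (t - Y k)" by simp
    then show ?thesis using ne[OF that] by (simp add: diff_divide_distrib)
   qed
   have "(\<Sum>k<m. e k * t + e k * Y k - (1 + t\<^sup>2) * (e k / (t - Y k))) = (\<Sum>k<m. - (of_real (c k) / (t - Y k)))"
    using k by (intro sum.cong) auto
   then have "(\<Sum>k<m. e k) * t + (\<Sum>k<m. e k * Y k) - (\<Sum>k<m. (1 + t\<^sup>2) * (e k / (t - Y k))) = - (\<Sum>k<m. of_real (c k) / (t - Y k))"
    by (simp add: sum.distrib sum_subtractf sum_distrib_right sum_negf)
   then show ?thesis unfolding A B e_def[symmetric] by (simp add: sum_subtractf algebra_simps)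
  qed
  ultimately show ?thesis unfolding 1 D_def[symmetric] a_def[symmetric] b_def[symmetric]
   by (metis (no_types, lifting) add.commute distrib_right)
 qed
qed

lemma stripping_interlacing:
 "stripping m x (outer_weight m C x y) y (inner_weight m C x y) (strip_a m C x y) (strip_b m C x y) C"
 unfolding stripping_def
 using C strip_b_pos denom_poly_strip numer_poly_outer sum_outer_weight sum_inner_weight
 by (auto simp: diff_divide_distrib)

end

text \<open>The numerator \<open>E\<close> of the sum of \<open>v i / (t - x i)\<close> changes sign
  between consecutive points because the weights are positive. Its zeros are the inner points and
  its leading coefficient is the total weight, which recovers the weights as interpolation
  coefficients.\<close>

lemma interlacing_exists:
 assumes x: "ordered (Suc m) x" and v: "!!i. i < Suc m ==> 0 < v i"
 shows "\<exists>y. interlacing m x y & (\<forall>i<Suc m. v i = outer_weight m (1 / (\<Sum>i<Suc m. v i)) x y i)"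
proof -
 define S where "S = (\<Sum>i<Suc m. v i)"
 have S: "0 < S" unfolding S_def using v by (intro sum_pos) auto
 let ?h = "%i. \<Prod>j\<in>{..<Suc m}-{i}. [:- x j, 1:]"
 define E where "E = (\<Sum>i<Suc m. smult (v i) (?h i))"
 let ?f = "%k. \<Prod>j\<in>{..<Suc m}-{k}. x k - x j"
 have Ex: "poly E (x k) = v k * ?f k" if k: "k < Suc m" for k
 proof -
  have "poly E (x k) = (\<Sum>i<Suc m. v i * (\<Prod>j\<in>{..<Suc m}-{i}. x k - x j))"
   by (simp add: E_def poly_sum poly_prod del: sum.lessThan_Suc)
  also have "... = (\<Sum>i<Suc m. if i = k then v k * ?f k else 0)"
  proof (intro sum.cong refl)
   fix i assume "i \<in> {..<Suc m}"
   have "(\<Prod>j\<in>{..<Suc m}-{i}. x k - x j) = 0" if "i ~= k" using k that by (intro prod_zero) auto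
   then show "v i * (\<Prod>j\<in>{..<Suc m}-{i}. x k - x j) = (if i = k then v k * ?f k else 0)" by auto
  qed
  also have "... = v k * ?f k" using k by (simp del: sum.lessThan_Suc)
  finally show ?thesis .
 qed
 have "\<exists>y. x k < y & y < x (Suc k) & poly E y = 0" if k: "k < m" for k
 proof (rule poly_IVT)
  show lt: "x k < x (Suc k)" using ordered_less[OF x, of k "Suc k"] k by simp
  define J where "J = {..<Suc m} - {k} - {Suc k}"
  have f: "finite J" by (simp add: J_def)
  have "{..<Suc m} - {k} = insert (Suc k) J" using k by (auto simp: J_def)
  moreover have "Suc k \<notin> J" by (simp add: J_def)
  ultimately have p1: "?f k = (x k - x (Suc k)) * (\<Prod>j\<in>J. x k - x j)" using f by simp
  have "{..<Suc m} - {Suc k} = insert k J" using k by (auto simp: J_def)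
  moreover have "k \<notin> J" by (simp add: J_def)
  ultimately have p2: "(\<Prod>j\<in>{..<Suc m}-{Suc k}. x (Suc k) - x j) = (x (Suc k) - x k) * (\<Prod>j\<in>J. x (Suc k) - x j)" using f by simp
  have "0 < (x k - x j) * (x (Suc k) - x j)" if "j \<in> J" for j
  proof (cases "j < k")
   case True
   then have "x j < x k" "x j < x (Suc k)" using ordered_less[OF x] k by auto
   then show ?thesis by simp
  next
   case False
   then have "k < j" "Suc k < j" "j < Suc m" using that by (auto simp: J_def)
   then have "x k < x j" "x (Suc k) < x j" using ordered_less[OF x] by auto
   then show ?thesis by (intro mult_neg_neg) auto
  qed
  then have J: "0 < (\<Prod>j\<in>J. x k - x j) * (\<Prod>j\<in>J. x (Suc k) - x j)" unfolding prod.distrib[symmetric] by (rule prod_pos)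
  have "poly E (x k) * poly E (x (Suc k)) = - (v k * v (Suc k) * (x (Suc k) - x k)\<^sup>2 * ((\<Prod>j\<in>J. x k - x j) * (\<Prod>j\<in>J. x (Suc k) - x j)))"
   using k by (simp add: Ex p1 p2 power2_eq_square algebra_simps)
  also have "... < 0" using J v[of k] v[of "Suc k"] k lt by simp
  finally show "poly E (x k) * poly E (x (Suc k)) < 0" .
 qed
 then obtain y where y: "!!k. k < m ==> x k < y k" "!!k. k < m ==> y k < x (Suc k)" "!!k. k < m ==> poly E (y k) = 0" by metis
 have il: "interlacing m x y" using y by (simp add: interlacing_def)
 have oy: "inj_on y {..<m}" by (rule ordered_inj[OF interlacing_ordered_inner[OF il x]])
 define Y where "Y = (\<Prod>k<m. [:- y k, 1:])"
 have dY: "degree Y = m" "coeff Y m = 1"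
  using degree_prod_linear[of "{..<m}" y] monic_prod_linear[of y "{..<m}"] by (simp_all add: Y_def)
 have dEi: "degree (?h i) = m" "coeff (?h i) m = 1" if "i < Suc m" for i
  using that degree_prod_linear[of "{..<Suc m}-{i}" x] monic_prod_linear[of x "{..<Suc m}-{i}"] by simp_all
 have dE: "degree E \<le> m" unfolding E_def using dEi by (intro degree_sum_le) (auto intro!: order.trans[OF degree_smult_le])
 have cE: "coeff E m = S" unfolding E_def S_def by (simp add: coeff_sum dEi del: sum.lessThan_Suc)
 let ?g = "%y i. smult (poly (E - smult S Y) (y i) / (\<Prod>j\<in>{..<m}-{i}. y i - y j)) (\<Prod>j\<in>{..<m}-{i}. [:- y j, 1:])"
 have "E - smult S Y = 0 \<or> degree (E - smult S Y) < m"
 proof -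
  have "degree (E - smult S Y) \<le> m" using dE dY S by (intro degree_diff_le) auto
  moreover have "coeff (E - smult S Y) m = 0" using cE dY by simp
  ultimately show ?thesis by (metis leading_coeff_0_iff le_neq_implies_less)
 qed
 then have "E - smult S Y = (\<Sum>i<m. ?g y i)"
  by (rule lagrange_interpolation[OF oy])
 also have "... = 0"
 proof (intro sum.neutral ballI)
  fix i assume i: "i \<in> {..<m}"
  have "poly Y (y i) = 0" unfolding Y_def poly_prod using i by (intro prod_zero) auto
  then show "?g y i = 0"
   using i y(3) by simp
 qed
 finally have EY: "E = smult S Y" by simp
 have "v i = outer_weight m (1 / S) x y i" if i: "i < Suc m" for i
 proof -
  have ne: "(?f i) ~= 0" using ordered_inj[OF x] i by (auto simp: inj_on_def)
  have "v i * ?f i = S * (\<Prod>k<m. x i - y k)"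
   using Ex[OF i] unfolding EY by (simp add: Y_def poly_prod)
  then have "v i = S * (\<Prod>k<m. x i - y k) / ?f i" using ne by (simp add: nonzero_eq_divide_eq)
  then show ?thesis using i S by (simp add: outer_weight_def)
 qed
 then show ?thesis using il unfolding S_def by blast
qed

lemma has_transfer_cong:
 assumes "!!i. i < m ==> v i = v' i" shows "has_transfer m x v a b \<longleftrightarrow> has_transfer m x v' a b"
proof -
 have "numer_poly m x v = numer_poly m x v'" unfolding numer_poly_def using assms by (intro ext sum.cong) auto
 then have "nevanlinna_numer m x v = nevanlinna_numer m x v'" unfolding nevanlinna_numer_def by simp
 moreover have "(\<Sum>i<m. v i) = (\<Sum>i<m. v' i)" using assms by (intro sum.cong) auto
 ultimately show ?thesis unfolding has_transfer_def by (simp only:)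
qed

lemma config_moment_cong:
 assumes "!!i. i < m ==> v i = v' i" shows "config_moment m x v = config_moment m x v'"
 unfolding config_moment_def using assms by (intro ext arg_cong2[where f="(+)"] arg_cong[where f=of_real] arg_cong2[where f="(-)"] sum.cong refl) auto

lemma one_less_inverse_sum: "0 < S ==> S < 1 ==> 1 < 1 / (S :: real)"
 by simp

text \<open>Stripping leaves an inner configuration whose weights are again positive with sum below
  1, so the parameters are collected one pair at a time.\<close>

lemma has_transfer_exists:
 assumes "ordered m x" "!!i. i < m ==> 0 < v i" "(\<Sum>i<m. v i) < 1"
 shows "\<exists>a b. (\<forall>k<m. 0 < b k) & has_transfer m x v a b"
 using assms
proof (induction m arbitrary: x v)
 case 0
 then show ?case unfolding has_transfer_def using has_transfer_base[of 0 v x] by auto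
next
 case (Suc m)
 define C where "C = 1 / (\<Sum>i<Suc m. v i)"
 have "0 < (\<Sum>i<Suc m. v i)" using Suc.prems(2) by (intro sum_pos) auto
 then have C: "1 < C" unfolding C_def using Suc.prems(3) by (rule one_less_inverse_sum)
 obtain y where il: "interlacing m x y" and v: "\<forall>i<Suc m. v i = outer_weight m C x y i"
  using interlacing_exists[OF Suc.prems(1), of v] Suc.prems(2) unfolding C_def by blast
 obtain a b where ab: "\<forall>k<m. 0 < b k" "has_transfer m y (inner_weight m C x y) a b"
  using Suc.IH[OF interlacing_ordered_inner[OF il Suc.prems(1)] inner_weight_pos[OF il Suc.prems(1) C] sum_inner_weight_less[OF il Suc.prems(1) C]] by blast
 have "has_transfer (Suc m) x (outer_weight m C x y) (case_nat (strip_a m C x y) a) (case_nat (strip_b m C x y) b)"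
  by (rule has_transfer_stripping[OF stripping_interlacing[OF il Suc.prems(1) C] ab(2)])
 then have "has_transfer (Suc m) x v (case_nat (strip_a m C x y) a) (case_nat (strip_b m C x y) b)"
  using has_transfer_cong[of "Suc m" v "outer_weight m C x y"] v by blast
 moreover have "\<forall>k<Suc m. 0 < case_nat (strip_b m C x y) b k"
  using ab(1) strip_b_pos[OF il Suc.prems(1) C] by (auto split: nat.split)
 ultimately show ?case by blast
qed

lemma outer_weight_pos:
 assumes il: "interlacing m x y" and ox: "ordered (Suc m) x" and C: "0 < C" and i: "i < Suc m"
 shows "0 < outer_weight m C x y i"
proof -
 \<comment> \<open>\<open>f\<close> enumerates the indices other than \<open>i\<close> in such a way
   that \<open>y k\<close> and \<open>x (f k)\<close> lie on the same side of
   \<open>x i\<close>.\<close>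
 define f where "f k = (if k < i then k else Suc k)" for k
 have img: "bij_betw f {..<m} ({..<Suc m} - {i})"
  by (rule bij_betwI[where g="%j. if j < i then j else j - 1"]) (use i in \<open>auto simp: f_def split: if_splits\<close>)
 have "(\<Prod>j\<in>{..<Suc m}-{i}. x i - x j) = (\<Prod>k<m. x i - x (f k))"
  using prod.reindex_bij_betw[OF img, of "%j. x i - x j"] by simp
 then have ow: "outer_weight m C x y i = (\<Prod>k<m. (x i - y k) / (x i - x (f k))) / C"
  using i by (simp add: outer_weight_def prod_dividef)
 have "0 < (x i - y k) / (x i - x (f k))" if k: "k < m" for k
 proof (cases "k < i")
  case True
  then have "y k < x i" "x k < x i" using interlacing_greater[OF il ox] ordered_less[OF ox] i k by auto
  then show ?thesis using True by (simp add: f_def)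
 next
  case False
  then have "x i < y k" "x i < x (Suc k)" using interlacing_less[OF il ox] ordered_less[OF ox] i k by auto
  then show ?thesis using False by (simp add: f_def divide_neg_neg)
 qed
 then have "0 < (\<Prod>k<m. (x i - y k) / (x i - x (f k)))" by (intro prod_pos) auto
 with ow show ?thesis using C by simp
qed

text \<open>Prefixing the stripped parameters to a certificate of the inner configuration yields a
  certificate of the outer one, and a certificate determines all coefficients.\<close>

lemma config_coeff_strip:
 assumes il: "interlacing m x y" and ox: "ordered (Suc m) x" and C: "1 < C"
 shows "config_coeff (Suc m) x (outer_weight m C x y) 0 = halfplane_coeff (strip_a m C x y) (strip_b m C x y)"
  and "k < m ==> config_coeff (Suc m) x (outer_weight m C x y) (Suc k) = config_coeff m y (inner_weight m C x y) k"
proof -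
 have oy: "ordered m y" by (rule interlacing_ordered_inner[OF il ox])
 obtain a b where ab: "\<forall>k<m. 0 < b k" "has_transfer m y (inner_weight m C x y) a b"
  using has_transfer_exists[OF oy inner_weight_pos[OF il ox C] sum_inner_weight_less[OF il ox C]] by blast
 let ?a = "case_nat (strip_a m C x y) a" and ?b = "case_nat (strip_b m C x y) b"
 have h: "has_transfer (Suc m) x (outer_weight m C x y) ?a ?b"
  by (rule has_transfer_stripping[OF stripping_interlacing[OF il ox C] ab(2)])
 have b: "0 < ?b k" if "k < Suc m" for k
  using that ab(1) strip_b_pos[OF il ox C] by (auto split: nat.split)
 have "(\<Sum>i<Suc m. outer_weight m C x y i) < 1" unfolding sum_outer_weight[OF il ox C] using C by simp
 then have "config_coeff (Suc m) x (outer_weight m C x y) k = halfplane_coeff (?a k) (?b k)" if "k < Suc m" for k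
  using outer_weight_pos[OF il ox] C by (intro has_transfer_config_coeff[OF ordered_inj[OF ox] _ _ h b that]) auto
 note outer = this
 show "config_coeff (Suc m) x (outer_weight m C x y) 0 = halfplane_coeff (strip_a m C x y) (strip_b m C x y)"
  using outer[of 0] by simp
 assume k: "k < m"
 have "config_coeff m y (inner_weight m C x y) k = halfplane_coeff (a k) (b k)"
  using ab(1) by (intro has_transfer_config_coeff[OF ordered_inj[OF oy] inner_weight_pos[OF il ox C] sum_inner_weight_less[OF il ox C] ab(2) _ k]) auto
 then show "config_coeff (Suc m) x (outer_weight m C x y) (Suc k) = config_coeff m y (inner_weight m C x y) k"
  using outer[of "Suc k"] k by simp
qed

section \<open>The Vandermonde identity\<close>

text \<open>The squared Vandermonde determinant of all \<open>Suc m\<close> points, the point 1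
  included, times the product of all weights; this is the Toeplitz determinant of the
  moments.\<close>

definition config_disc :: "nat => (nat => real) => (nat => real) => real" where
 "config_disc m x v = (\<Prod>j<m. (cmod (1 - cayley (x j)))\<^sup>2 * (\<Prod>i<j. (cmod (cayley (x j) - cayley (x i)))\<^sup>2))
   * (\<Prod>i<m. v i) * (1 - (\<Sum>i<m. v i))"

lemma one_plus_square_pos [simp]: "0 < 1 + (t::real)\<^sup>2"
 by (simp add: add_pos_nonneg)

lemma one_plus_square_nz [simp]: "1 + (t::real)\<^sup>2 ~= 0"
 using one_plus_square_pos[of t] by linarith

lemma norm_real_plus_i: "(cmod (of_real t + \<i>))\<^sup>2 = 1 + t\<^sup>2"
 by (simp add: cmod_power2)

lemma norm_one_minus_cayley: "(cmod (1 - cayley t))\<^sup>2 = 4 / (1 + t\<^sup>2)"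
proof -
 have "1 - cayley t = 2 * \<i> / (of_real t + \<i>)" by (simp add: cayley_def diff_divide_eq_iff)
 then show ?thesis by (simp add: norm_divide norm_mult power_divide norm_real_plus_i)
qed

lemma norm_diff_cayley: "(cmod (cayley s - cayley t))\<^sup>2 = 4 * (s - t)\<^sup>2 / ((1 + s\<^sup>2) * (1 + t\<^sup>2))"
proof -
 have "cayley s - cayley t = 2 * \<i> * of_real (s - t) / ((of_real s + \<i>) * (of_real t + \<i>))"
  by (simp add: cayley_def diff_frac_eq) (simp add: algebra_simps)
 then show ?thesis by (simp add: norm_divide norm_mult power_divide power_mult_distrib norm_real_plus_i flip: of_real_diff)
qed

text \<open>Each point takes part in \<open>m\<close> pairs, the pair with 1 included, and every
  pair contributes one factor \<open>1 + (x i)\<^sup>2\<close> to the denominator; hence the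
  exponent \<open>m\<close>.\<close>

lemma config_disc_eq:
 "config_disc m x v = (\<Prod>j<m. 4 ^ Suc j) * (vandermonde m x)\<^sup>2 / (\<Prod>i<m. 1 + (x i)\<^sup>2) ^ m * (\<Prod>i<m. v i) * (1 - (\<Sum>i<m. v i))"
proof -
 let ?f = "%j. \<Prod>i<j. (cmod (cayley (x j) - cayley (x i)))\<^sup>2"
 have "(\<Prod>j<m. (cmod (1 - cayley (x j)))\<^sup>2 * ?f j) = (\<Prod>j<m. 4 ^ Suc j) * (vandermonde m x)\<^sup>2 / (\<Prod>i<m. 1 + (x i)\<^sup>2) ^ m"
 proof (induction m)
  case (Suc m)
  define p where "p = (\<Prod>i<m. 1 + (x i)\<^sup>2)"
  define q where "q = 1 + (x m)\<^sup>2"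
  have p: "0 < p" unfolding p_def by (intro prod_pos) auto
  have q: "0 < q" by (simp add: q_def)
  have "?f m = (\<Prod>i<m. 4 * (x m - x i)\<^sup>2 / (q * (1 + (x i)\<^sup>2)))"
   by (simp add: norm_diff_cayley q_def)
  also have "... = 4 ^ m * (\<Prod>i<m. x m - x i)\<^sup>2 / (q ^ m * p)"
   by (simp add: prod_dividef prod.distrib p_def prod_power_distrib)
  finally have 1: "?f m = 4 ^ m * (\<Prod>i<m. x m - x i)\<^sup>2 / (q ^ m * p)" .
  have 2: "(cmod (1 - cayley (x m)))\<^sup>2 = 4 / q" by (simp add: norm_one_minus_cayley q_def)
  have "f * v\<^sup>2 / p ^ m * (4 / q * (4 ^ m * w\<^sup>2 / (q ^ m * p))) = f * 4 ^ Suc m * (v * w)\<^sup>2 / (p * q) ^ Suc m" for f v w :: real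
   using p q by (simp add: field_simps)
  then show ?case unfolding prod.lessThan_Suc Suc 1 2 vandermonde_Suc p_def[symmetric] q_def[symmetric] by blast
 qed (simp add: vandermonde_def)
 then show ?thesis by (simp add: config_disc_def)
qed

lemma prod_differences:
 assumes "ordered m x"
 shows "(\<Prod>i<m. \<Prod>j\<in>{..<m}-{i}. \<bar>x i - x j\<bar>) = (vandermonde m x)\<^sup>2"
 using assms
proof (induction m)
 case (Suc m)
 have "(\<Prod>j\<in>{..<Suc m}-{i}. \<bar>x i - x j\<bar>) = \<bar>x i - x m\<bar> * (\<Prod>j\<in>{..<m}-{i}. \<bar>x i - x j\<bar>)" if "i < m" for i
 proof -
  have "{..<Suc m} - {i} = insert m ({..<m} - {i})" using that by auto
  then show ?thesis by simp
 qed
 moreover have "{..<Suc m} - {m} = {..<m}" by auto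
 ultimately have "(\<Prod>i<Suc m. \<Prod>j\<in>{..<Suc m}-{i}. \<bar>x i - x j\<bar>) = (\<Prod>i<m. \<bar>x i - x m\<bar>) * (\<Prod>i<m. \<Prod>j\<in>{..<m}-{i}. \<bar>x i - x j\<bar>) * (\<Prod>j<m. \<bar>x m - x j\<bar>)"
  by (simp add: prod.distrib)
 moreover have "(\<Prod>i<m. \<bar>x i - x m\<bar>) = (\<Prod>i<m. x m - x i)" "(\<Prod>i<m. \<bar>x m - x i\<bar>) = (\<Prod>i<m. x m - x i)"
  using Suc.prems by (auto intro!: prod.cong simp: ordered_Suc)
 ultimately show ?case using Suc by (simp add: ordered_Suc vandermonde_Suc power2_eq_square mult_ac)
qed (simp add: vandermonde_def)

definition cross_prod :: "nat => (nat => real) => (nat => real) => real" where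
 "cross_prod m x y = (\<Prod>i<Suc m. \<Prod>k<m. \<bar>x i - y k\<bar>)"

context
 fixes m :: nat and C :: real and x y :: "nat => real"
 assumes il: "interlacing m x y" and ox: "ordered (Suc m) x" and C: "1 < C"
begin

lemma cross_prod_pos: "0 < cross_prod m x y"
 unfolding cross_prod_def
proof (intro prod_pos ballI)
 fix i k assume ik: "i \<in> {..<Suc m}" "k \<in> {..<m}"
 show "0 < \<bar>x i - y k\<bar>"
  using interlacing_less[OF il ox, of i k] interlacing_greater[OF il ox, of k i] ik by (cases "i \<le> k") auto
qed

text \<open>Positivity of the weights permits absolute values throughout, which avoids counting
  signs. The same cross product occurs in the product of the inner residues, and eliminating it
  links the two configurations.\<close>

lemma prod_outer_weight: "(\<Prod>i<Suc m. outer_weight m C x y i) * (vandermonde (Suc m) x)\<^sup>2 = cross_prod m x y / C ^ Suc m"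
proof -
 let ?f = "%i. (\<Prod>k<m. \<bar>x i - y k\<bar>) / (\<Prod>j\<in>{..<Suc m}-{i}. \<bar>x i - x j\<bar>) / C"
 have "outer_weight m C x y i = ?f i" if "i < Suc m" for i
 proof -
  have "outer_weight m C x y i = \<bar>outer_weight m C x y i\<bar>" using outer_weight_pos[OF il ox _ that, of C] C by simp
  also have "... = ?f i"
   using that C by (simp add: outer_weight_def abs_mult abs_prod)
  finally show ?thesis .
 qed
 then have "(\<Prod>i<Suc m. outer_weight m C x y i) = (\<Prod>i<Suc m. ?f i)"
  by (intro prod.cong) auto
 also have "... = cross_prod m x y / (vandermonde (Suc m) x)\<^sup>2 / C ^ Suc m"
  by (simp only: prod_dividef prod_differences[OF ox] cross_prod_def prod_constant card_lessThan)
 finally show ?thesis using vandermonde_pos[OF ox] by simp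
qed

lemma prod_inner_residue: "(\<Prod>k<m. inner_residue m C x y k) * (vandermonde m y)\<^sup>2 = C ^ m * cross_prod m x y"
proof -
 let ?f = "%k. \<Prod>i<Suc m. \<bar>x i - y k\<bar>"
 let ?g = "%k. \<Prod>l\<in>{..<m}-{k}. \<bar>y k - y l\<bar>"
 have "inner_residue m C x y k = C * (?f k / ?g k)" if "k < m" for k
 proof -
  have "inner_residue m C x y k = \<bar>inner_residue m C x y k\<bar>" using inner_residue_pos[OF il ox C that] by simp
  also have "... = C * ((\<Prod>i<Suc m. \<bar>y k - x i\<bar>) / ?g k)"
   using that C by (simp add: inner_residue_def abs_mult abs_prod del: prod.lessThan_Suc)
  finally show ?thesis by (simp add: abs_minus_commute)
 qed
 then have "(\<Prod>k<m. inner_residue m C x y k) = (\<Prod>k<m. C * (?f k / ?g k))"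
  by (intro prod.cong) auto
 also have "... = C ^ m * ((\<Prod>k<m. ?f k) / (vandermonde m y)\<^sup>2)"
  by (simp only: prod.distrib prod_dividef prod_differences[OF interlacing_ordered_inner[OF il ox]] prod_constant card_lessThan)
 also have "(\<Prod>k<m. ?f k) = cross_prod m x y"
  unfolding cross_prod_def by (rule prod.swap)
 finally show ?thesis using vandermonde_pos[OF interlacing_ordered_inner[OF il ox]] by simp
qed

lemma norm_denom_poly_i: "(cmod (denom_poly k z \<i>))\<^sup>2 = (\<Prod>i<k. 1 + (z i)\<^sup>2)"
proof -
 have "(cmod (\<i> - of_real t))\<^sup>2 = 1 + t\<^sup>2" for t by (simp add: cmod_power2)
 then show ?thesis by (simp add: denom_poly_def prod_norm[symmetric] power2_eq_square prod.distrib[symmetric])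
qed

text \<open>The stripping identity at \<open>t = \<i>\<close>: there \<open>1 + t\<^sup>2\<close>
  vanishes, the Nevanlinna numerator is \<i> times the denominator, and squared moduli give the
  claim.\<close>

lemma prod_square_strip:
 "C\<^sup>2 * (\<Prod>i<Suc m. 1 + (x i)\<^sup>2) = ((strip_a m C x y)\<^sup>2 + (strip_b m C x y + 1)\<^sup>2) * (\<Prod>i<m. 1 + (y i)\<^sup>2)"
proof -
 have "of_real C * denom_poly (Suc m) x \<i> = Complex (strip_a m C x y) (strip_b m C x y + 1) * denom_poly m y \<i>"
  unfolding denom_poly_strip[OF il ox C] nevanlinna_numer_def by (simp add: complex_eq_iff algebra_simps)
 then have "(cmod (of_real C * denom_poly (Suc m) x \<i>))\<^sup>2 = (cmod (Complex (strip_a m C x y) (strip_b m C x y + 1) * denom_poly m y \<i>))\<^sup>2" by simp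
 then show ?thesis unfolding norm_mult power_mult_distrib norm_denom_poly_i by (simp add: cmod_power2)
qed

text \<open>Eliminating the cross product expresses the outer quantity through the inner weights,
  and \<open>prod_square_strip\<close> converts the products of \<open>1 + (x i)\<^sup>2\<close>.
  What remains are powers of \<open>4 * b / (a\<^sup>2 + (b + 1)\<^sup>2)\<close>, which is 1 minus
  the squared modulus of the coefficient.\<close>

lemma config_disc_strip:
 "config_disc (Suc m) x (outer_weight m C x y)
   = (1 - (cmod (halfplane_coeff (strip_a m C x y) (strip_b m C x y)))\<^sup>2) ^ Suc m * config_disc m y (inner_weight m C x y)"
proof -
 define b a where "b = strip_b m C x y" and "a = strip_a m C x y"
 have b: "0 < b" unfolding b_def by (rule strip_b_pos[OF il ox C])
 define q where "q = a\<^sup>2 + (b + 1)\<^sup>2"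
 have q: "0 < q" unfolding q_def using b by (intro add_nonneg_pos) auto
 define A where "A = cross_prod m x y"
 define X Y where "X = (\<Prod>i<Suc m. 1 + (x i)\<^sup>2)" and "Y = (\<Prod>i<m. 1 + (y i)\<^sup>2)"
 have X: "0 < X" and Y: "0 < Y" unfolding X_def Y_def by (auto intro!: prod_pos simp del: prod.lessThan_Suc)
 have XY: "X = q * Y / C\<^sup>2" using prod_square_strip C by (simp add: X_def Y_def q_def a_def b_def field_simps del: prod.lessThan_Suc)
 define w V Vy where "w = 1 - (\<Sum>k<m. inner_weight m C x y k)" and "V = (\<Prod>k<m. inner_weight m C x y k)" and "Vy = (vandermonde m y)\<^sup>2"
 have Vy: "0 < Vy" using vandermonde_pos[OF interlacing_ordered_inner[OF il ox]] by (simp add: Vy_def)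
 have w: "b * w = C - 1" unfolding b_def w_def by (rule sum_inner_weight[OF il ox C])
 have "(\<Prod>k<m. inner_residue m C x y k) = (\<Prod>k<m. b * inner_weight m C x y k * (1 + (y k)\<^sup>2))"
  unfolding b_def using strip_b_inner_weight[OF il ox C] by (intro prod.cong) auto
 also have "... = b ^ m * V * Y" by (simp add: prod.distrib V_def Y_def)
 finally have i: "b ^ m * V * Y * Vy = C ^ m * A" using prod_inner_residue by (simp add: Vy_def A_def)
 then have VV: "V * Vy = C ^ m * A / (b ^ m * Y)" using b Y by (simp add: field_simps)
 define f where "f = (\<Prod>j<m. 4 ^ Suc j :: real)"
 have w2: "1 - (\<Sum>i<Suc m. outer_weight m C x y i) = b * w / C"
  unfolding sum_outer_weight[OF il ox C] w using C by (simp add: field_simps)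
 have "config_disc (Suc m) x (outer_weight m C x y) = f * 4 ^ Suc m * ((\<Prod>i<Suc m. outer_weight m C x y i) * (vandermonde (Suc m) x)\<^sup>2) / X ^ Suc m * (b * w / C)"
  unfolding config_disc_eq w2 X_def f_def by (simp del: prod.lessThan_Suc power_Suc) (simp)
 also have "... = f * 4 ^ Suc m * (A / C ^ Suc m) / (q * Y / C\<^sup>2) ^ Suc m * (b * w / C)"
  unfolding prod_outer_weight A_def XY ..
 also have "... = f * 4 ^ Suc m * (A * C ^ m) * (b * w) / (q * Y) ^ Suc m"
 proof -
  have e: "(q * Y / C\<^sup>2) ^ Suc m = (q * Y) ^ Suc m / (C ^ Suc m * C ^ Suc m)"
   by (simp only: power_divide power2_eq_square power_mult_distrib)
  have "F * (A / (C * D)) / (Z / ((C * D) * (C * D))) * (B / C) = F * (A * D) * B / Z" if "0 < D" "0 < Z" for D Z F B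
   using that C by (simp add: field_simps)
  from this[of "C ^ m" "(q * Y) ^ Suc m"] show ?thesis
   unfolding e power_Suc[of C] using C q Y by simp
 qed
 also have "... = (4 * b / q) ^ Suc m * (f * (V * Vy) / Y ^ m * w)"
  unfolding VV using b q Y by (simp add: power_divide power_mult_distrib field_simps)
 also have "f * (V * Vy) / Y ^ m * w = config_disc m y (inner_weight m C x y)"
  unfolding config_disc_eq by (simp add: f_def V_def Vy_def Y_def w_def)
 finally show ?thesis unfolding norm_halfplane_coeff[OF b[unfolded b_def]] by (simp add: q_def a_def b_def)
qed

end

lemma config_coeff_cong: "(!!i. i < m ==> v i = v' i) ==> config_coeff m x v = config_coeff m x v'"
 unfolding config_coeff_def by (subst config_moment_cong[of m v v']) auto

lemma config_disc_coeff:
 assumes "ordered m x" "!!i. i < m ==> 0 < v i" "(\<Sum>i<m. v i) < 1"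
 shows "config_disc m x v = (\<Prod>k<m. (1 - (cmod (config_coeff m x v k))\<^sup>2) ^ (m - k))"
 using assms
proof (induction m arbitrary: x v)
 case 0
 then show ?case by (simp add: config_disc_def)
next
 case (Suc m)
 define C where "C = 1 / (\<Sum>i<Suc m. v i)"
 have "0 < (\<Sum>i<Suc m. v i)" using Suc.prems(2) by (intro sum_pos) auto
 then have C: "1 < C" unfolding C_def using Suc.prems(3) by (rule one_less_inverse_sum)
 obtain y where il: "interlacing m x y" and v: "!!i. i < Suc m ==> v i = outer_weight m C x y i"
  using interlacing_exists[OF Suc.prems(1), of v] Suc.prems(2) unfolding C_def by blast
 note ox = Suc.prems(1)
 have "config_disc (Suc m) x v = config_disc (Suc m) x (outer_weight m C x y)"
 proof -
  have "(\<Prod>i<Suc m. v i) = (\<Prod>i<Suc m. outer_weight m C x y i)" "(\<Sum>i<Suc m. v i) = (\<Sum>i<Suc m. outer_weight m C x y i)"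
   using v by (auto intro!: prod.cong sum.cong simp del: prod.lessThan_Suc sum.lessThan_Suc)
  then show ?thesis unfolding config_disc_def by (simp only:)
 qed
 also have "... = (1 - (cmod (config_coeff (Suc m) x (outer_weight m C x y) 0))\<^sup>2) ^ Suc m * (\<Prod>k<m. (1 - (cmod (config_coeff (Suc m) x (outer_weight m C x y) (Suc k)))\<^sup>2) ^ (m - k))"
 proof -
  have "config_disc m y (inner_weight m C x y) = (\<Prod>k<m. (1 - (cmod (config_coeff m y (inner_weight m C x y) k))\<^sup>2) ^ (m - k))"
   by (rule Suc.IH[OF interlacing_ordered_inner[OF il ox] inner_weight_pos[OF il ox C] sum_inner_weight_less[OF il ox C]])
  then show ?thesis
   unfolding config_disc_strip[OF il ox C] using config_coeff_strip[OF il ox C] by simp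
 qed
 also have "... = (\<Prod>k<Suc m. (1 - (cmod (config_coeff (Suc m) x (outer_weight m C x y) k))\<^sup>2) ^ (Suc m - k))"
  by (subst prod.lessThan_Suc_shift) simp
 also have "config_coeff (Suc m) x (outer_weight m C x y) = config_coeff (Suc m) x v"
  using v by (intro config_coeff_cong) auto
 finally show ?case .
qed

section \<open>Changes of variables for one stripping step\<close>

lemma measurable_coordinate_pair [measurable]:
 "(%p. fst p k) \<in> borel_measurable (PiM I (%_. lborel :: real measure) \<Otimes>\<^sub>M N)"
 "(%p. snd p k) \<in> borel_measurable (N \<Otimes>\<^sub>M PiM I (%_. lborel :: real measure))"
 "(%p. fst (fst p) k) \<in> borel_measurable ((PiM I (%_. lborel :: real measure) \<Otimes>\<^sub>M N) \<Otimes>\<^sub>M N')"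
 "(%p. snd (fst p) k) \<in> borel_measurable ((N \<Otimes>\<^sub>M PiM I (%_. lborel :: real measure)) \<Otimes>\<^sub>M N')"
 "(%p. fst (snd p) k) \<in> borel_measurable (N' \<Otimes>\<^sub>M (PiM I (%_. lborel :: real measure) \<Otimes>\<^sub>M N))"
 "(%p. snd (snd p) k) \<in> borel_measurable (N' \<Otimes>\<^sub>M (N \<Otimes>\<^sub>M PiM I (%_. lborel :: real measure)))"
 by (rule measurable_compose[OF _ measurable_coordinate], measurable)+

lemma measurable_curry3:
 assumes "(%(a, b, v). G a b v) \<in> borel_measurable (borel \<Otimes>\<^sub>M (borel \<Otimes>\<^sub>M N))"
  and "f \<in> M \<rightarrow>\<^sub>M borel" "g \<in> M \<rightarrow>\<^sub>M borel" "v \<in> M \<rightarrow>\<^sub>M N"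
 shows "(%w. G (f w) (g w) (v w)) \<in> borel_measurable M"
proof -
 have "(%w. (f w, g w, v w)) \<in> M \<rightarrow>\<^sub>M borel \<Otimes>\<^sub>M (borel \<Otimes>\<^sub>M N)" using assms(2-) by measurable
 from measurable_compose[OF this assms(1)] show ?thesis by simp
qed

lemma measurable_restrict_lborel [measurable (raw)]:
 assumes "!!i. i < m ==> (%w. f w i) \<in> borel_measurable M"
 shows "(%w. \<lambda>i\<in>{..<m}. f w i) \<in> M \<rightarrow>\<^sub>M leb m"
 using assms by (intro measurable_to_lborel_n) auto

lemma case_nat_in_space: "w \<in> space (leb m) ==> case_nat t w = (\<lambda>i\<in>{..<Suc m}. case_nat t w i)"
 by (auto simp: space_PiM PiE_def extensional_def fun_eq_iff split: nat.split)

lemma measurable_case_nat_lborel [measurable (raw)]: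
 assumes "t \<in> borel_measurable M" and g: "g \<in> M \<rightarrow>\<^sub>M leb m"
 shows "(%w. case_nat (t w) (g w)) \<in> M \<rightarrow>\<^sub>M leb (Suc m)"
proof (rule measurable_to_lborel_n)
 show "(%w. case_nat (t w) (g w) i) \<in> borel_measurable M" for i
  using assms(1) measurable_compose[OF g measurable_coordinate] by (cases i) auto
 show "case_nat (t x) (g x) i = undefined" if "x \<in> space M" "\<not> i < Suc m" for x i
  using measurable_space[OF g that(1)] that(2) by (cases i) (auto simp: space_PiM PiE_def extensional_def)
qed

lemma nn_integral_lborel_shift:
 assumes [measurable]: "f \<in> borel_measurable (leb (Suc m))"
 shows "Leb_n (Suc m) (%x. f x) = (Leb t. Leb_n m (%w. f (case_nat t w)))"
 using assms
proof (induction m arbitrary: f)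
 case 0
 have "(%_. undefined)(0 := t) = case_nat t (%_. undefined)" for t :: real
  by (auto simp: fun_eq_iff split: nat.split)
 then show ?case by (simp only: nn_integral_lborel_Suc_rev[OF 0] nn_integral_lborel_0)
next
 case (Suc m)
 note [measurable] = Suc.prems
 have "(\<integral>\<^sup>+x. f x \<partial>leb (Suc (Suc m))) = (Leb s. Leb_n (Suc m) (%x. f (x(Suc m := s))))"
  by (rule nn_integral_lborel_Suc_rev) measurable
 also have "... = (Leb s. Leb t. Leb_n m (%w. f ((case_nat t w)(Suc m := s))))"
  by (intro nn_integral_cong Suc.IH) measurable
 also have "... = (Leb t. Leb s. Leb_n m (%w. f ((case_nat t w)(Suc m := s))))"
  by (rule nn_integral_lborel_swap) (measurable, intro_locales)
 also have "... = (Leb t. Leb s. Leb_n m (%w. f (case_nat t (w(m := s)))))"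
  by (intro nn_integral_cong arg_cong[where f=f]) (auto simp: fun_eq_iff split: nat.split)
 also have "... = (Leb t. Leb_n (Suc m) (%w. f (case_nat t w)))"
  by (intro nn_integral_cong nn_integral_lborel_Suc_rev[symmetric]) measurable
 finally show ?case .
qed

lemma vandermonde_shift: "vandermonde (Suc m) x = vandermonde m (%k. x (Suc k)) * (\<Prod>k<m. x (Suc k) - x 0)"
proof (induction m)
 case (Suc m)
 have "vandermonde (Suc (Suc m)) x = vandermonde m (%k. x (Suc k)) * (\<Prod>k<m. x (Suc k) - x 0) * (\<Prod>i<Suc m. x (Suc m) - x i)"
  unfolding vandermonde_Suc[of "Suc m"] Suc ..
 also have "(\<Prod>i<Suc m. x (Suc m) - x i) = (x (Suc m) - x 0) * (\<Prod>i<m. x (Suc m) - x (Suc i))"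
  by (rule prod.lessThan_Suc_shift)
 finally show ?case by (simp add: vandermonde_Suc mult_ac)
qed (simp add: vandermonde_def)

text \<open>Multiplying the sum of \<open>v i / (t - x i)\<close> by \<open>t - x 0\<close> cancels
  the lowest pole. The result has value \<open>S\<close> at infinity, zeros \<open>y\<close> and
  residues \<open>(x (Suc k) - x 0) * v (Suc k)\<close>, so the weights become residues in the sense
  of \<open>residues_of\<close>, and the weight at \<open>x 0\<close> is the rest of the mass
  \<open>S\<close>.\<close>

lemma outer_weight_shift:
 fixes x y :: "nat => real" and S :: real
 assumes ox: "ordered (Suc m) x" and S: "0 < S"
 defines "d \<equiv> residues_of m S (%k. x (Suc k)) y"
 defines "w \<equiv> (\<lambda>k\<in>{..<m}. 1 / (x (Suc k) - x 0) * d k)"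
 shows "case_nat (S - (\<Sum>k<m. w k)) w = outer_weight m (1 / S) x y"
proof
 fix i
 show "case_nat (S - (\<Sum>k<m. w k)) w i = outer_weight m (1 / S) x y i"
 proof (cases i)
  case 0
  have lt: "x 0 < x (Suc k)" if "k < m" for k using ordered_less[OF ox] that by simp
  have inj: "inj_on (%k. x (Suc k)) {..<m}" using ordered_inj[OF ox] by (auto simp: inj_on_def)
  have "S - (\<Sum>k<m. w k) = S + (\<Sum>k<m. d k / (x 0 - x (Suc k)))"
  proof -
   have "- w k = d k / (x 0 - x (Suc k))" if "k < m" for k
    using lt[OF that] that by (simp add: w_def divide_simps algebra_simps)
   then have "(\<Sum>k<m. - w k) = (\<Sum>k<m. d k / (x 0 - x (Suc k)))" by (intro sum.cong) auto
   then show ?thesis by (simp add: sum_negf)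
  qed
  also have "... = S * (\<Prod>i<m. x 0 - y i) / (\<Prod>i<m. x 0 - x (Suc i))"
   unfolding d_def using lt by (intro residues_sum inj) force
  also have "(\<Prod>i<m. x 0 - x (Suc i)) = (\<Prod>j\<in>{..<Suc m}-{0}. x 0 - x j)"
   by (intro prod.reindex_bij_witness[of _ "%j. j - 1" Suc]) auto
  finally show ?thesis using 0 by (simp add: outer_weight_def)
 next
  case (Suc k)
  show ?thesis
  proof (cases "k < m")
   case True
   have "(\<Prod>j\<in>{..<Suc m}-{Suc k}. x (Suc k) - x j) = (x (Suc k) - x 0) * (\<Prod>j\<in>{..<Suc m}-{Suc k}-{0}. x (Suc k) - x j)"
    by (intro prod.remove) auto
   also have "(\<Prod>j\<in>{..<Suc m}-{Suc k}-{0}. x (Suc k) - x j) = (\<Prod>l\<in>{..<m}-{k}. x (Suc k) - x (Suc l))"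
    by (intro prod.reindex_bij_witness[of _ Suc "%j. j - 1"]) auto
   finally show ?thesis using Suc True by (simp add: outer_weight_def w_def d_def residues_of_def mult_ac)
  qed (use Suc in \<open>simp add: outer_weight_def w_def\<close>)
 qed
qed

text \<open>At fixed outer points the lowest weight is traded for the total mass \<open>S\<close>,
  the other weights are rescaled to residues, and these are traded for the inner points.\<close>

lemma nn_integral_weights_to_zeros:
 assumes ox: "ordered (Suc m) x" and f[measurable]: "f \<in> borel_measurable (leb (Suc m))"
 shows "Leb_n (Suc m) (%v. if (\<forall>i<Suc m. 0 < v i) & (\<Sum>i<Suc m. v i) < 1 then f v * ennreal (\<Prod>i<Suc m. 1 / v i) else 0)
  = (Leb S. Leb_n m (%y. if 0 < S & S < 1 & interlacing m x y
     then f (outer_weight m (1 / S) x y) * ennreal (1 / S * vandermonde (Suc m) x * vandermonde m y / cross_prod m x y) else 0))"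
proof -
 define F where "F v = (if (\<forall>i<Suc m. 0 < v i) & (\<Sum>i<Suc m. v i) < 1 then f v * ennreal (\<Prod>i<Suc m. 1 / v i) else 0)" for v
 have [measurable]: "F \<in> borel_measurable (leb (Suc m))" unfolding F_def by measurable
 define z where "z k = x (Suc k)" for k
 have oz: "ordered m z" using ox by (auto simp: ordered_def z_def)
 have z0: "x 0 < z k" if "k < m" for k using ordered_less[OF ox, of 0 "Suc k"] that by (simp add: z_def)
 define r where "r k = 1 / (z k - x 0)" for k
 let ?r = "%S w. F (case_nat (S - (\<Sum>k<m. w k)) w)"
 have r: "0 < r k" if "k < m" for k using z0[OF that] by (simp add: r_def)
 let ?f = "%S y. if 0 < S & S < 1 & interlacing m x y then f (outer_weight m (1 / S) x y) * ennreal (1 / S * vandermonde (Suc m) x * vandermonde m y / cross_prod m x y) else 0"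
 let ?g = "%g S y. g (residues_of m S z y) * ennreal (S ^ m * vandermonde m y / vandermonde m z)"
 let ?h = "%S. Leb_n m (%w. ?r S w)"
 let ?p = "%w. Leb t. F (case_nat t w)"
 let ?q = "%S. Leb_n m (%y. ?f S y)"
 let ?s = "%S w. \<Sum>i<Suc m. case_nat (S - (\<Sum>k<m. w k)) w i"
 have "Leb_n (Suc m) (%v. F v) = (Leb t. Leb_n m (%w. F (case_nat t w)))"
  by (rule nn_integral_lborel_shift) measurable
 also have "... = Leb_n m (%w. ?p w)"
  by (rule nn_integral_lborel_swap) (measurable, intro_locales)
 also have "... = Leb_n m (%w. Leb S. ?r S w)"
 proof (rule nn_integral_cong)
  fix w assume w: "w \<in> space (leb m)"
  have "(%t. case_nat t w) \<in> lborel \<rightarrow>\<^sub>M leb (Suc m)"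
   by (rule measurable_case_nat_lborel[OF _ measurable_const[OF w]]) simp
  then have "(%t. F (case_nat t w)) \<in> borel_measurable lborel" by (rule measurable_compose) measurable
  then have "?p w = ennreal \<bar>1\<bar> * (Leb S. F (case_nat (- (\<Sum>k<m. w k) + 1 * S) w))"
   by (intro nn_integral_real_affine) auto
  then show "?p w = (Leb S. ?r S w)" by simp
 qed
 also have "... = (Leb S. ?h S)"
  by (rule nn_integral_lborel_swap) (measurable, intro_locales)
 also have "... = (Leb S. ?q S)"
 proof (rule nn_integral_cong)
  fix S :: real
  show "?h S = ?q S"
  proof (cases "0 < S & S < 1")
   case False
   have "?r S w = 0" for w
   proof -
    have "\<not> ((\<forall>i<Suc m. 0 < case_nat (S - (\<Sum>k<m. w k)) w i) & (?s S w) < 1)"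
    proof
     assume *: "(\<forall>i<Suc m. 0 < case_nat (S - (\<Sum>k<m. w k)) w i) & (?s S w) < 1"
     then have "S < 1" by (simp add: sum.lessThan_Suc_shift del: sum.lessThan_Suc)
     moreover have "0 < (?s S w)" using * by (intro sum_pos) auto
     then have "0 < S" by (simp add: sum.lessThan_Suc_shift del: sum.lessThan_Suc)
     ultimately show False using False by simp
    qed
    then show ?thesis unfolding F_def by (rule if_not_P)
   qed
   then show ?thesis using False by (simp only: conj_assoc[symmetric] simp_thms if_False)
  next
   case S: True
   define s where "s d = (\<lambda>k\<in>{..<m}. r k * d k)" for d :: "nat => real"
   have [measurable]: "s \<in> leb m \<rightarrow>\<^sub>M leb m" unfolding s_def by measurable
   define g where "g d = F (case_nat (S - (\<Sum>k<m. s d k)) (s d))" for d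
   have [measurable]: "(%d. s d k) \<in> borel_measurable (leb m)" for k
    by (rule measurable_compose[OF _ measurable_coordinate]) measurable
   have [measurable]: "g \<in> borel_measurable (leb m)" unfolding g_def by measurable
   have R: "0 < (\<Prod>k<m. r k)" using r by (intro prod_pos) auto
   have "?h S = ennreal (\<Prod>k<m. r k) * Leb_n m (%d. g d)"
    unfolding g_def s_def by (rule nn_integral_lborel_scale) (use r in measurable)
   also have "Leb_n m (%d. g d) = Leb_n m (%d. if \<forall>k<m. 0 < d k then g d else 0)"
   proof (intro nn_integral_cong)
    fix d
    have "\<forall>k<m. 0 < d k" if "\<forall>i<Suc m. 0 < case_nat (S - (\<Sum>k<m. s d k)) (s d) i"
    proof (intro allI impI)
     fix k assume k: "k < m"
     have "0 < s d k" using that[rule_format, of "Suc k"] k by simp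
     then show "0 < d k" using r[OF k] k by (simp add: s_def zero_less_mult_iff)
    qed
    then show "g d = (if \<forall>k<m. 0 < d k then g d else 0)" by (auto simp: g_def F_def)
   qed
   also have "... = Leb_n m (%y. if zeros_below m z y then ?g g S y else 0)"
    using S by (intro nn_integral_residues_to_zeros oz) auto
   also have "ennreal (\<Prod>k<m. r k) * ... = Leb_n m (%y. ennreal (\<Prod>k<m. r k) * (if zeros_below m z y then ?g g S y else 0))"
    unfolding zeros_below_def vandermonde_def by (rule nn_integral_cmult[symmetric]) measurable
   also have "... = ?q S"
   proof (rule nn_integral_cong)
    fix y assume y: "y \<in> space (leb m)"
    define v where "v = outer_weight m (1 / S) x y"
    have gv: "g (residues_of m S z y) = F v"
     using outer_weight_shift[OF ox, where S=S and y=y] S unfolding g_def s_def r_def z_def v_def by simp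
    have sumv: "(\<Sum>i<Suc m. v i) = S"
    proof -
     have "v = case_nat (S - (\<Sum>k<m. s (residues_of m S z y) k)) (s (residues_of m S z y))"
      using outer_weight_shift[OF ox, where S=S and y=y] S unfolding s_def r_def z_def v_def by simp
     then show ?thesis by (simp add: sum.lessThan_Suc_shift del: sum.lessThan_Suc)
    qed
    show "ennreal (\<Prod>k<m. r k) * (if zeros_below m z y then ?g g S y else 0) = ?f S y"
    proof (cases "interlacing m x y")
     case il: True
     then have zb: "zeros_below m z y" by (auto simp: interlacing_def zeros_below_def z_def)
     have C: "1 < 1 / S" using S by simp
     have vp: "0 < v i" if "i < Suc m" for i unfolding v_def using S by (intro outer_weight_pos[OF il ox _ that]) simp
     define A where "A = cross_prod m x y"
     have A: "0 < A" unfolding A_def by (rule cross_prod_pos[OF il ox C])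
     define V where "V = (\<Prod>i<Suc m. v i)"
     have V: "0 < V" unfolding V_def using vp by (intro prod_pos) auto
     define X where "X = vandermonde (Suc m) x"
     have X: "0 < X" unfolding X_def by (rule vandermonde_pos[OF ox])
     define Y where "Y = vandermonde m y"
     have Y: "0 < Y" unfolding Y_def by (rule vandermonde_pos[OF interlacing_ordered_inner[OF il ox]])
     define Z where "Z = vandermonde m z"
     have Z: "0 < Z" unfolding Z_def by (rule vandermonde_pos[OF oz])
     define P where "P = (\<Prod>k<m. z k - x 0)"
     have P: "0 < P" unfolding P_def using z0 by (intro prod_pos) auto
     have XZ: "X = Z * P" by (simp add: X_def Z_def P_def vandermonde_shift z_def[abs_def])
     have "V * X\<^sup>2 = A / (1 / S) ^ Suc m"
      unfolding V_def X_def A_def v_def by (rule prod_outer_weight[OF il ox C])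
     then have VX: "V * X\<^sup>2 = A * S ^ Suc m" using S by (simp add: power_divide)
     have "(\<Prod>k<m. r k) = 1 / P" by (simp add: r_def P_def prod_dividef)
     have eq: "1 / P * (1 / V) * (S ^ m * Y / Z) = 1 / S * X * Y / A"
     proof -
      have "1 / P * (1 / V) * (S ^ m * Y / Z) = S ^ m * Y * X / (V * X\<^sup>2)"
       unfolding XZ using P V Z by (simp add: power2_eq_square)
      also have "... = 1 / S * X * Y / A" unfolding VX using S A by (simp add: mult_ac)
      finally show ?thesis .
     qed
     have "F v = f v * ennreal (1 / V)"
      unfolding F_def using vp sumv S by (simp add: V_def prod_dividef del: sum.lessThan_Suc prod.lessThan_Suc)
     then have "ennreal (\<Prod>k<m. r k) * ?g g S y = f v * (ennreal (1 / P) * ennreal (1 / V) * ennreal (S ^ m * Y / Z))"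
      unfolding gv \<open>(\<Prod>k<m. r k) = 1 / P\<close> Y_def Z_def by (simp only: mult_ac)
     also have "ennreal (1 / P) * ennreal (1 / V) * ennreal (S ^ m * Y / Z) = ennreal (1 / S * X * Y / A)"
      unfolding eq[symmetric] using P V Z S Y by (simp add: ennreal_mult[symmetric])
     finally show ?thesis using il zb S by (simp add: v_def X_def Y_def A_def)
    next
     \<comment> \<open>Relative to the shifted points, \<open>zeros_below\<close> leaves the lowest
       zero free on the whole half-line below \<open>x 1\<close>. If it does not exceed
       \<open>x 0\<close>, the weight at \<open>x 0\<close> is not positive and the integrand
       vanishes.\<close>
     case nil: False
     have "F v = 0" if zb: "zeros_below m z y"
     proof -
      obtain k where k: "k < m" "\<not> (x k < y k & y k < x (Suc k))" using nil by (auto simp: interlacing_def)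
      have k0: "k = 0"
      proof (rule ccontr)
       assume "k ~= 0"
       then have "z (k - 1) < y k" "y k < z k" using zb k(1) by (auto simp: zeros_below_def)
       then show False using k(2) \<open>k ~= 0\<close> by (simp add: z_def)
      qed
      have "y 0 < x (Suc 0)" using zb k k0 by (auto simp: zeros_below_def z_def)
      then have y0: "y 0 \<le> x 0" using k k0 by simp
      obtain n where n: "m = Suc n" using k by (cases m) auto
      have "{..<Suc m} - {0} = Suc ` {..<m}" by (auto simp: lessThan_Suc_eq_insert_0)
      then have "v 0 = S * ((\<Prod>k<m. x 0 - y k) / (\<Prod>k<m. x 0 - z k))"
       using S by (simp add: v_def outer_weight_def prod.reindex z_def)
      also have "... = S * ((x 0 - y 0) / (x 0 - z 0) * (\<Prod>k<n. (x 0 - y (Suc k)) / (x 0 - z (Suc k))))"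
       unfolding n prod_dividef[symmetric] by (subst prod.lessThan_Suc_shift) simp
      also have "... \<le> 0"
      proof -
       have "(x 0 - y 0) / (x 0 - z 0) \<le> 0" using y0 z0[of 0] n by (intro divide_nonneg_neg) auto
       moreover have "0 \<le> (x 0 - y (Suc k)) / (x 0 - z (Suc k))" if "k < n" for k
       proof -
        have "z k < y (Suc k)" "x 0 < z k" "x 0 < z (Suc k)" using zb that n z0 by (auto simp: zeros_below_def)
        then show ?thesis by (intro divide_nonpos_nonpos) auto
       qed
       then have "0 \<le> (\<Prod>k<n. (x 0 - y (Suc k)) / (x 0 - z (Suc k)))" by (intro prod_nonneg) auto
       ultimately show ?thesis using S by (intro mult_nonneg_nonpos mult_nonpos_nonneg) auto
      qed
      finally have "\<not> (\<forall>i<Suc m. 0 < v i)" by (metis not_le zero_less_Suc)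
      then have "\<not> ((\<forall>i<Suc m. 0 < v i) & (\<Sum>i<Suc m. v i) < 1)" by blast
      then show ?thesis unfolding F_def by (rule if_not_P)
     qed
     then show ?thesis using nil gv by simp
    qed
   qed
   finally show ?thesis .
  qed
 qed
 finally show ?thesis unfolding F_def .
qed

lemma if_eq_of_bool: "(if P then u else 0 :: ennreal) = u * of_bool P"
 by simp

text \<open>The form of \<open>strip_b\<close> as a function of the total mass
  \<open>S = 1 / C\<close>, where \<open>\<sigma>\<close> collects the terms of the inner
  residues.\<close>

lemma nn_integral_reciprocal_shift:
 assumes [measurable]: "f \<in> borel_measurable borel"
 shows "(Leb b. if \<sigma> < b then f b else 0)
  = (Leb S. if 0 < S & S < 1 then f (1 / S - 1 + \<sigma>) * ennreal (1 / S\<^sup>2) else 0)"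
proof -
 define g where "g S = 1 / S - 1 + \<sigma>" for S :: real
 have img: "g ` einterval 0 1 = {\<sigma><..}"
 proof
  show "g ` einterval 0 1 \<subseteq> {\<sigma><..}" by (auto simp: g_def einterval_def zero_ereal_def one_ereal_def)
  show "{\<sigma><..} \<subseteq> g ` einterval 0 1"
  proof
   fix b assume b: "b \<in> {\<sigma><..}"
   show "b \<in> g ` einterval 0 1"
    by (rule image_eqI[of _ _ "1 / (b - \<sigma> + 1)"]) (use b in \<open>auto simp: g_def einterval_def zero_ereal_def one_ereal_def\<close>)
  qed
 qed
 have "(Leb S. f (g S) * ennreal (1 / S\<^sup>2) * indicator (einterval 0 1) S) = (Leb b. f b * indicator (g ` einterval 0 1) b)"
 proof (rule nn_integral_substitution_open_decreasing)
  show "(g has_real_derivative - (1 / x\<^sup>2)) (at x)" if "x \<in> einterval 0 1" for x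
   unfolding g_def using that
   by (auto intro!: derivative_eq_intros simp: einterval_def power2_eq_square)
  show "continuous_on (einterval 0 1) (%S. 1 / S\<^sup>2 :: real)"
   by (intro continuous_intros) (auto simp: einterval_def)
 qed (auto simp: g_def[abs_def])
 then show ?thesis unfolding img
  by (simp add: g_def indicator_def einterval_def zero_ereal_def one_ereal_def if_eq_of_bool)
qed

text \<open>The form of \<open>strip_a\<close> as a function of the highest outer point
  \<open>z\<close>, with the inner residues \<open>c k\<close> held fixed. To the right of the last
  pole it decreases and takes every real value once.\<close>

lemma nn_integral_pole_substitution:
 assumes y: "ordered m y" and c: "!!k. k < m ==> 0 < c k" and C: "0 < C"
  and [measurable]: "f \<in> borel_measurable borel"
 shows "(Leb a. f a)
  = (Leb z. if \<forall>k<m. y k < z then f (- C * z + (\<Sum>k<m. c k / (z - y k)) + K) * ennreal (C + (\<Sum>k<m. c k / (z - y k)\<^sup>2)) else 0)"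
proof -
 define g where "g z = - C * z + (\<Sum>k<m. c k / (z - y k)) + K" for z
 define g' where "g' z = C + (\<Sum>k<m. c k / (z - y k)\<^sup>2)" for z
 define a where "a = (if m = 0 then -\<infinity> else ereal (y (m - 1)))"
 have yle: "y k \<le> y (m - 1)" if "k < m" for k
 proof (cases "k = m - 1")
  case False
  then have "k < m - 1" "m - 1 < m" using that by auto
  then show ?thesis using ordered_less[OF y, of k "m - 1"] by simp
 qed simp
 have mem: "z \<in> einterval a \<infinity> \<longleftrightarrow> (\<forall>k<m. y k < z)" for z
  using yle by (cases "m = 0") (auto simp: a_def einterval_def intro: le_less_trans)
 have above: "y k < z" if "z \<in> einterval a \<infinity>" "k < m" for z k using that mem by simp
 have "s \<in> g ` einterval a \<infinity>" for s
 proof -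
  have sc: "0 \<le> sum c {..<m}" using c by (intro sum_nonneg) (auto intro: less_imp_le)
  obtain z1 where z1: "z1 \<in> einterval a \<infinity>" "s \<le> g z1"
  proof (cases "m = 0")
   case True
   show ?thesis by (rule that[of "(K - s) / C"]) (use True C in \<open>simp_all add: mem g_def\<close>)
  next
   case False
   define l e where "l = y (m - 1)" and "e = c (m - 1)"
   have e: "0 < e" using c[of "m - 1"] False by (simp add: e_def)
   \<comment> \<open>\<open>B\<close> outweighs everything that could keep \<open>g\<close> below
     \<open>s\<close>. At distance \<open>\<delta>\<close> above the highest pole the term of that
     pole is at least \<open>B\<close>.\<close>
   define B where "B = \<bar>s\<bar> + C * (\<bar>l\<bar> + 1) + \<bar>K\<bar> + 1"
   have B: "1 \<le> B" using C by (simp add: B_def)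
   define \<delta> where "\<delta> = min 1 (e / B)"
   have \<delta>: "0 < \<delta>" "\<delta> \<le> 1" "\<delta> \<le> e / B" using e B by (auto simp: \<delta>_def)
   define z where "z = l + \<delta>"
   have zm: "z \<in> einterval a \<infinity>" unfolding mem using \<delta>(1) by (auto simp: z_def l_def intro: le_less_trans[OF yle])
   have "e / (z - l) \<le> (\<Sum>k<m. c k / (z - y k))"
    unfolding e_def l_def using False above[OF zm] c
    by (intro member_le_sum[of "m - 1" "{..<m}" "%k. c k / (z - y k)"]) (auto intro!: divide_nonneg_pos less_imp_le[of 0])
   moreover have "B \<le> e / (z - l)" using \<delta> B e by (simp add: z_def field_simps)
   moreover have "C * z \<le> C * (\<bar>l\<bar> + 1)" using C \<delta> by (intro mult_left_mono) (auto simp: z_def)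
   ultimately have "s \<le> g z" unfolding g_def B_def by (simp add: abs_if split: if_splits)
   then show ?thesis using that zm by blast
  qed
  \<comment> \<open>Far enough to the right for each pole term to be at most \<open>c k\<close> and
    for the linear term to dominate the rest.\<close>
  define z2 where "z2 = max z1 (max (y (m - 1) + 1) ((sum c {..<m} + K - s) / C))"
  have z2y: "y k + 1 \<le> z2" if "k < m" for k using yle[OF that] by (simp add: z2_def le_max_iff_disj)
  have "c k / (z2 - y k) \<le> c k" if "k < m" for k
   using z2y[OF that] c[OF that] by (simp add: divide_le_eq mult_left_le)
  then have "(\<Sum>k<m. c k / (z2 - y k)) \<le> sum c {..<m}" by (intro sum_mono) auto
  moreover have "sum c {..<m} + K - s \<le> C * z2"
  proof -
   have "(sum c {..<m} + K - s) / C \<le> z2" by (simp add: z2_def)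
   then show ?thesis using C by (simp add: pos_divide_le_eq mult.commute)
  qed
  ultimately have g2: "g z2 \<le> s" by (simp add: g_def)
  have "continuous_on {z1..z2} g"
  proof -
   have "z ~= y k" if "z \<in> {z1..z2}" "k < m" for z k using above[OF z1(1) that(2)] that(1) by auto
   then show ?thesis unfolding g_def by (intro continuous_intros) auto
  qed
  then have "\<exists>z\<ge>z1. z \<le> z2 & g z = s"
   using z1(2) g2 by (intro IVT2') (auto simp: z2_def)
  then obtain z where z: "z1 \<le> z" "g z = s" by blast
  have "z \<in> einterval a \<infinity>" using above[OF z1(1)] z(1) by (auto simp: mem intro: less_le_trans)
  then show ?thesis using z(2) by blast
 qed
 then have img: "g ` einterval a \<infinity> = UNIV" by blast
 have "(Leb z. f (g z) * ennreal (g' z) * indicator (einterval a \<infinity>) z) = (Leb t. f t * indicator (g ` einterval a \<infinity>) t)"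
 proof (rule nn_integral_substitution_open_decreasing)
  show "g \<in> borel_measurable borel" "g' \<in> borel_measurable borel" unfolding g_def[abs_def] g'_def[abs_def] by measurable
  have ne: "z ~= y k" if "z \<in> einterval a \<infinity>" "k < m" for z k using above[OF that] by simp
  then show "continuous_on (einterval a \<infinity>) g'" unfolding g'_def by (intro continuous_intros) auto
  show "0 \<le> g' z" for z unfolding g'_def using C c by (intro add_nonneg_nonneg sum_nonneg divide_nonneg_nonneg) (auto intro: less_imp_le)
  show "(g has_real_derivative - g' z) (at z)" if "z \<in> einterval a \<infinity>" for z
  proof -
   have "(g has_real_derivative - C * 1 + (\<Sum>k<m. (0 * (z - y k) - c k * (1 - 0)) / ((z - y k) * (z - y k))) + 0) (at z)"
    unfolding g_def using ne[OF that] by (intro DERIV_mult DERIV_diff DERIV_add DERIV_sum DERIV_divide DERIV_const DERIV_ident DERIV_cmult) auto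
   then show ?thesis by (simp add: g'_def power2_eq_square sum_negf algebra_simps)
  qed
  show "a < \<infinity>" by (simp add: a_def)
 qed simp
 then show ?thesis unfolding img by (simp add: mem g_def g'_def indicator_def if_eq_of_bool)
qed

lemma config_measurable [measurable (raw)]:
 assumes x: "x \<in> M \<rightarrow>\<^sub>M leb a"
 shows "Measurable.pred M (%w. ordered k (x w))" "(%w. vandermonde k (x w)) \<in> borel_measurable M"
proof -
 have [measurable]: "(%w. x w i) \<in> borel_measurable M" for i by (rule measurable_compose[OF x measurable_coordinate])
 show "Measurable.pred M (%w. ordered k (x w))" unfolding ordered_def by measurable
 show "(%w. vandermonde k (x w)) \<in> borel_measurable M" unfolding vandermonde_def by measurable
qed

lemma config_measurable_pair [measurable (raw)]:
 assumes x: "x \<in> M \<rightarrow>\<^sub>M leb a" and y: "y \<in> M \<rightarrow>\<^sub>M leb b" and C: "C \<in> borel_measurable M"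
 shows "Measurable.pred M (%w. interlacing k (x w) (y w))" "(%w. cross_prod k (x w) (y w)) \<in> borel_measurable M"
  "(%w. strip_a k (C w) (x w) (y w)) \<in> borel_measurable M" "(%w. strip_b k (C w) (x w) (y w)) \<in> borel_measurable M"
  "(%w. inner_weight k (C w) (x w) (y w)) \<in> M \<rightarrow>\<^sub>M leb k"
  "(%w. outer_weight k (C w) (x w) (y w)) \<in> M \<rightarrow>\<^sub>M leb (Suc k)"
proof -
 have [measurable]: "(%w. x w i) \<in> borel_measurable M" for i by (rule measurable_compose[OF x measurable_coordinate])
 have [measurable]: "(%w. y w i) \<in> borel_measurable M" for i by (rule measurable_compose[OF y measurable_coordinate])
 note C[measurable]
 show "Measurable.pred M (%w. interlacing k (x w) (y w))" unfolding interlacing_def by measurable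
 show "(%w. cross_prod k (x w) (y w)) \<in> borel_measurable M" unfolding cross_prod_def by measurable
 have [measurable]: "(%w. inner_residue k (C w) (x w) (y w) i) \<in> borel_measurable M" for i
  unfolding inner_residue_def by measurable
 show "(%w. strip_a k (C w) (x w) (y w)) \<in> borel_measurable M" unfolding strip_a_def by measurable
 show [measurable]: "(%w. strip_b k (C w) (x w) (y w)) \<in> borel_measurable M" unfolding strip_b_def by measurable
 show "(%w. inner_weight k (C w) (x w) (y w)) \<in> M \<rightarrow>\<^sub>M leb k" unfolding inner_weight_def by measurable
 show "(%w. outer_weight k (C w) (x w) (y w)) \<in> M \<rightarrow>\<^sub>M leb (Suc k)" unfolding outer_weight_def by measurable
qed

lemma interlacing_upd_iff:
 assumes "ordered m y"
 shows "ordered (Suc m) (x(m := z)) & interlacing m (x(m := z)) y \<longleftrightarrow> zeros_below m y x & (\<forall>k<m. y k < z)"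
proof
 assume *: "ordered (Suc m) (x(m := z)) & interlacing m (x(m := z)) y"
 then have "zeros_below m y (x(m := z))" by (intro interlacing_zeros_below) auto
 then have "zeros_below m y x" by (auto simp: zeros_below_def)
 moreover have "y k < z" if "k < m" for k
  using interlacing_greater[of m "x(m := z)" y k m] * that by simp
 ultimately show "zeros_below m y x & (\<forall>k<m. y k < z)" by blast
next
 assume *: "zeros_below m y x & (\<forall>k<m. y k < z)"
 have "x k < z" if "k < m" for k using * that by (auto simp: zeros_below_def intro: less_trans)
 then have "ordered (Suc m) (x(m := z))"
  using zeros_below_ordered[of m y x] assms * unfolding ordered_Suc by (auto simp: ordered_def)
 moreover have "interlacing m (x(m := z)) y"
  unfolding interlacing_def
 proof (intro allI impI)
  fix k assume k: "k < m"
  have zb: "!!k. k < m ==> x k < y k" "!!k. Suc k < m ==> y k < x (Suc k)"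
   using * by (auto simp: zeros_below_def)
  show "(x(m := z)) k < y k & y k < (x(m := z)) (Suc k)"
  proof (cases "Suc k = m")
   case True
   then show ?thesis using * k zb(1)[OF k] by simp
  next
   case False
   then have "Suc k < m" using k by simp
   then show ?thesis using zb(1)[OF k] zb(2)[of k] by simp
  qed
 qed
 ultimately show "ordered (Suc m) (x(m := z)) & interlacing m (x(m := z)) y" by blast
qed

text \<open>At fixed inner points \<open>(a, b, v)\<close> is replaced by \<open>(S, x)\<close> in
  five substitutions: \<open>v\<close> is rescaled to the residues \<open>c\<close>,
  \<open>b\<close> becomes a function of \<open>S\<close>, \<open>a\<close> a function of the
  highest point \<open>z\<close>, \<open>c\<close> is divided by the \<open>z - y k\<close>, and the
  result is traded for the lower points. The order matters, since \<open>b\<close> and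
  \<open>a\<close> have to be substituted while \<open>c\<close> is still free.\<close>

lemma nn_integral_strip:
 assumes oy: "ordered m y" and G: "(%(a, b, v). G a b v) \<in> borel_measurable (borel \<Otimes>\<^sub>M (borel \<Otimes>\<^sub>M leb m))"
 shows "(Leb a. Leb b. Leb_n m (%v. if 0 < b & (\<forall>k<m. 0 < v k) & (\<Sum>k<m. v k) < 1 then G a b v * ennreal (\<Prod>k<m. 1 / v k) else 0))
  = (Leb S. Leb_n (Suc m) (%x. if 0 < S & S < 1 & ordered (Suc m) x & interlacing m x y
    then G (strip_a m (1 / S) x y) (strip_b m (1 / S) x y) (inner_weight m (1 / S) x y)
     * ennreal ((1 / S) ^ 3 * vandermonde (Suc m) x * vandermonde m y / cross_prod m x y) else 0))"
proof -
 note Gm[measurable (raw)] = measurable_curry3[OF G]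
 define Y2 where "Y2 k = 1 + (y k)\<^sup>2" for k
 have Y2: "0 < Y2 k" for k by (simp add: Y2_def)
 define \<sigma> where "\<sigma> c = (\<Sum>k<m. c k / Y2 k)" for c
 define V where "V b c = (\<lambda>k\<in>{..<m}. 1 / (b * Y2 k) * c k)" for b :: real and c
 define P where "P c = (\<Prod>k<m. 1 / c k)" for c :: "nat => real"
 define B where "B S c = 1 / S - 1 + \<sigma> c" for S c
 define A where "A S c z = - (1 / S) * z + (\<Sum>k<m. c k / (z - y k)) + (\<Sum>k<m. c k * y k / Y2 k)" for S c and z :: real
 define J where "J S c z = 1 / S + (\<Sum>k<m. c k / (z - y k)\<^sup>2)" for S c and z :: real
 let ?pos = "%c::nat=>real. \<forall>k<m. 0 < c k"
 have m1[measurable (raw)]: "(%w. c w k) \<in> borel_measurable M" if "c \<in> M \<rightarrow>\<^sub>M leb m" for M :: "'b measure" and c k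
  by (rule measurable_compose[OF that measurable_coordinate])
 have mS: "(%w. \<sigma> (c w)) \<in> borel_measurable M" "(%w. P (c w)) \<in> borel_measurable M"
  if [measurable]: "!!k. (%w. c w k) \<in> borel_measurable M" for M :: "'b measure" and c
  unfolding \<sigma>_def P_def by measurable
 let ?p = "%c b a. if \<sigma> c < b & ?pos c then G a b (V b c) * ennreal (P c) else 0"
 let ?q = "%b a. Leb_n m (%v. if 0 < b & ?pos v & (\<Sum>k<m. v k) < 1 then G a b v * ennreal (\<Prod>k<m. 1 / v k) else 0)"
 let ?s = "%b c a. if 0 < b & ?pos (V b c) & (\<Sum>k<m. V b c k) < 1 then G a b (V b c) * ennreal (\<Prod>k<m. 1 / V b c k) else 0"
 let ?v = "%b a. Leb_n m (%c. ?p c b a)"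
 \<comment> \<open>In terms of the residues \<open>c\<close>, the condition that the inner weights
   add up to less than 1 reads \<open>\<sigma> c < b\<close>; the product of reciprocals absorbs the
   Jacobian of the scaling.\<close>
 have step1: "?q b a = ?v b a" for a b
 proof (cases "0 < b")
  case False
  have "\<not> (\<sigma> c < b & ?pos c)" for c
  proof
   assume *: "\<sigma> c < b & ?pos c"
   then have "0 \<le> \<sigma> c" unfolding \<sigma>_def using Y2 by (intro sum_nonneg divide_nonneg_nonneg) (auto intro: less_imp_le)
   then show False using * False by simp
  qed
  note n = this
  show ?thesis using False by (simp only: if_not_P[OF n] simp_thms if_False)
 next
  case b: True
  define r where "r k = 1 / (b * Y2 k)" for k
  have r: "0 < r k" for k using b Y2 by (simp add: r_def)
  have R: "0 < (\<Prod>k<m. r k)" using r by (intro prod_pos) auto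
  have [measurable]: "V b \<in> leb m \<rightarrow>\<^sub>M leb m" unfolding V_def by measurable
  have [measurable]: "P \<in> borel_measurable (leb m)" "\<sigma> \<in> borel_measurable (leb m)" unfolding P_def \<sigma>_def by measurable
  have Vk[measurable]: "(%c. V b c k) \<in> borel_measurable (leb m)" for k
   by (rule measurable_compose[OF _ measurable_coordinate]) measurable
  have "?q b a = ennreal (\<Prod>k<m. r k) * Leb_n m (%c. ?s b c a)"
   unfolding V_def r_def[symmetric] by (rule nn_integral_lborel_scale) (use r in measurable)
  also have "... = Leb_n m (%c. ennreal (\<Prod>k<m. r k) * ?s b c a)"
   by (rule nn_integral_cmult[symmetric]) measurable
  also have "... = ?v b a"
  proof (rule nn_integral_cong)
   fix c
   have Vk: "V b c k = r k * c k" if "k < m" for k using that by (simp add: V_def r_def)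
   have 1: "?pos (V b c) \<longleftrightarrow> ?pos c" using r by (simp add: Vk zero_less_mult_iff) (metis less_asym)
   have "b * (\<Sum>k<m. V b c k) = \<sigma> c" unfolding \<sigma>_def sum_distrib_left using b by (intro sum.cong) (auto simp: Vk r_def)
   then have 2: "(\<Sum>k<m. V b c k) < 1 \<longleftrightarrow> \<sigma> c < b" using b by (metis mult.right_neutral mult_less_cancel_left_pos)
   have 3: "ennreal (\<Prod>k<m. r k) * ennreal (\<Prod>k<m. 1 / V b c k) = ennreal (P c)" if "?pos c"
   proof -
    have "(\<Prod>k<m. r k) * (\<Prod>k<m. 1 / V b c k) = P c"
     unfolding P_def prod.distrib[symmetric] using r by (intro prod.cong refl) (auto simp: Vk less_imp_neq[symmetric])
    moreover have "0 \<le> (\<Prod>k<m. 1 / V b c k)" using that 1 by (intro prod_nonneg) (auto intro: less_imp_le)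
    ultimately show ?thesis using R by (simp add: ennreal_mult[symmetric])
   qed
   show "ennreal (\<Prod>k<m. r k) * ?s b c a = ?p c b a"
   proof (cases "\<sigma> c < b & ?pos c")
    case True
    then have "ennreal (\<Prod>k<m. r k) * (G a b (V b c) * ennreal (\<Prod>k<m. 1 / V b c k)) = G a b (V b c) * ennreal (P c)"
     using 3 by (metis mult.left_commute)
    then show ?thesis using True b 1 2 by simp
   qed (use 1 2 in auto)
  qed
  finally show ?thesis .
 qed
 have mV[measurable (raw)]: "(%w. V (b w) (c w)) \<in> M \<rightarrow>\<^sub>M leb m"
  if [measurable]: "b \<in> borel_measurable M" "!!k. (%w. c w k) \<in> borel_measurable M" for M :: "(real \<times> (nat => real)) measure" and b c
  unfolding V_def by measurable
 let ?u = "%S c z. G (A S c z) (B S c) (V (B S c) c) * ennreal (P c) * ennreal (1 / S\<^sup>2) * ennreal (J S c z)"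
 have mP[measurable (raw)]: "(%w. P (c w)) \<in> borel_measurable M" "(%w. \<sigma> (c w)) \<in> borel_measurable M"
  if [measurable]: "!!k. (%w. c w k) \<in> borel_measurable M" for M :: "(real \<times> (nat => real)) measure" and c
  unfolding P_def \<sigma>_def by measurable
 let ?f = "%S x z. if 0 < S & S < 1 & ordered (Suc m) (x(m := z)) & interlacing m (x(m := z)) y then G (strip_a m (1 / S) (x(m := z)) y) (strip_b m (1 / S) (x(m := z)) y) (inner_weight m (1 / S) (x(m := z)) y) * ennreal ((1 / S) ^ 3 * vandermonde (Suc m) (x(m := z)) * vandermonde m y / cross_prod m (x(m := z)) y) else 0"
 let ?g = "%S z c. if 0 < S & S < 1 & (\<forall>k<m. y k < z) & ?pos c then ?u S c z else 0"
 let ?h = "%S c a. if 0 < S & S < 1 & ?pos c then G a (B S c) (V (B S c) c) * ennreal (P c) * ennreal (1 / S\<^sup>2) else 0"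
 let ?r = "%S x. if 0 < S & S < 1 & ordered (Suc m) x & interlacing m x y then G (strip_a m (1 / S) x y) (strip_b m (1 / S) x y) (inner_weight m (1 / S) x y) * ennreal ((1 / S) ^ 3 * vandermonde (Suc m) x * vandermonde m y / cross_prod m x y) else 0"
 let ?t = "%x Q s S. if zeros_below m y x then Q (s (residues_of m (1 / S) y x)) * ennreal ((1 / S) ^ m * vandermonde m x / vandermonde m y) else 0"
 let ?w = "%S z. Leb_n m (%c. ?g S z c)"
 let ?k = "%S z. Leb_n m (%x. ?f S x z)"
 let ?a = "%s Q. Leb_n m (%d. if ?pos (s d) then Q (s d) else 0)"
 have "(Leb a. Leb b. ?q b a) = (Leb a. Leb b. ?v b a)"
  unfolding step1 ..
 also have "... = (Leb a. Leb_n m (%c. Leb b. ?p c b a))"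
  unfolding \<sigma>_def V_def P_def
  by (intro nn_integral_cong nn_integral_lborel_swap) (measurable, intro_locales)
 also have "... = (Leb a. Leb_n m (%c. Leb S. ?h S c a))"
 proof (rule nn_integral_cong, rule nn_integral_cong)
  fix a and c assume c: "c \<in> space (leb m)"
  have [measurable]: "(%b. V b c) \<in> borel \<rightarrow>\<^sub>M leb m" unfolding V_def by measurable
  show "(Leb b. ?p c b a) = (Leb S. ?h S c a)"
  proof (cases "?pos c")
   case True
   have "(Leb b. if \<sigma> c < b then G a b (V b c) * ennreal (P c) else 0) = (Leb S. if 0 < S & S < 1 then G a (1 / S - 1 + \<sigma> c) (V (1 / S - 1 + \<sigma> c) c) * ennreal (P c) * ennreal (1 / S\<^sup>2) else 0)"
    by (rule nn_integral_reciprocal_shift) measurable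
   then show ?thesis unfolding B_def using True by simp
  next
   case False
   then show ?thesis by (simp only: simp_thms if_False nn_integral_const mult_zero_left)
  qed
 qed
 also have "... = (Leb a. Leb S. Leb_n m (%c. ?h S c a))"
  unfolding \<sigma>_def V_def P_def B_def
  by (intro nn_integral_cong nn_integral_lborel_swap) (measurable, intro_locales)
 also have "... = (Leb S. Leb a. Leb_n m (%c. ?h S c a))"
  unfolding \<sigma>_def V_def P_def B_def
  by (rule nn_integral_lborel_swap) (measurable, intro_locales)
 also have "... = (Leb S. Leb_n m (%c. Leb a. ?h S c a))"
  unfolding \<sigma>_def V_def P_def B_def
  by (intro nn_integral_cong nn_integral_lborel_swap) (measurable, intro_locales)
 also have "... = (Leb S. Leb_n m (%c. Leb z. ?g S z c))"
 proof (rule nn_integral_cong, rule nn_integral_cong)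
  fix S :: real and c assume c: "c \<in> space (leb m)"
  have [measurable]: "V (B S c) c \<in> space (leb m)" by (auto simp: V_def space_PiM)
  show "(Leb a. ?h S c a) = (Leb z. ?g S z c)"
  proof (cases "0 < S & S < 1 & ?pos c")
   case True
   have "(Leb a. G a (B S c) (V (B S c) c) * ennreal (P c) * ennreal (1 / S\<^sup>2)) = (Leb z. if \<forall>k<m. y k < z then ?u S c z else 0)"
    unfolding A_def J_def by (rule nn_integral_pole_substitution[OF oy]) (use True in \<open>auto intro!: borel_measurable_times_ennreal measurable_curry3[OF G] measurable_const\<close>, measurable)
   then show ?thesis using True by simp
  next
   case False
   then have "\<not> (0 < S & S < 1 & (\<forall>k<m. y k < z) & ?pos c)" for z by blast
   then show ?thesis by (simp only: if_not_P[OF False] if_not_P if_False nn_integral_const mult_zero_left)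
  qed
 qed
 also have "... = (Leb S. Leb z. ?w S z)"
  unfolding \<sigma>_def V_def P_def B_def A_def J_def
  by (intro nn_integral_cong nn_integral_lborel_swap) (measurable, intro_locales)
 also have "... = (Leb S. Leb z. ?k S z)"
 proof (rule nn_integral_cong, rule nn_integral_cong)
  fix S z :: real
  show "?w S z = ?k S z"
  proof (cases "0 < S & S < 1 & (\<forall>k<m. y k < z)")
   case False
   then show ?thesis unfolding interlacing_upd_iff[OF oy] by (auto intro!: nn_integral_cong)
  next
   case True
   then have S: "0 < S" "S < 1" and yz: "!!k. k < m ==> y k < z" by auto
   define Q where "Q c = ?u S c z" for c
   have Qm[measurable]: "Q \<in> borel_measurable (leb m)" unfolding Q_def \<sigma>_def V_def P_def B_def A_def J_def by measurable
   define r where "r k = z - y k" for k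
   define s where "s c = (\<lambda>k\<in>{..<m}. r k * c k)" for c :: "nat => real"
   have [measurable]: "s \<in> leb m \<rightarrow>\<^sub>M leb m" unfolding s_def by measurable
   have r: "0 < r k" if "k < m" for k using yz[OF that] by (simp add: r_def)
   have R: "0 < (\<Prod>k<m. r k)" using r by (intro prod_pos) auto
   have "?w S z = Leb_n m (%c. if ?pos c then Q c else 0)"
    unfolding Q_def using True by simp
   also have "... = ennreal (\<Prod>k<m. r k) * ?a s Q"
    unfolding s_def by (rule nn_integral_lborel_scale) (use r in measurable)
   also have "?a s Q = Leb_n m (%d. if ?pos d then Q (s d) else 0)"
   proof -
    have "0 < r k * d k \<longleftrightarrow> 0 < d k" if "k < m" for d :: "nat => real" and k
     using mult_less_cancel_left_pos[OF r[OF that], of 0 "d k"] by simp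
    then have "?pos (s d) \<longleftrightarrow> ?pos d" for d by (simp add: s_def)
    then show ?thesis by simp
   qed
   also have "... = Leb_n m (%x. ?t x Q s S)"
    using S by (intro nn_integral_residues_to_zeros oy) auto
   also have "ennreal (\<Prod>k<m. r k) * ... = Leb_n m (%x. ennreal (\<Prod>k<m. r k) * ?t x Q s S)"
    unfolding zeros_below_def by (rule nn_integral_cmult[symmetric]) measurable
   also have "... = ?k S z"
   proof (rule nn_integral_cong)
    fix x assume x: "x \<in> space (leb m)"
    show "ennreal (\<Prod>k<m. r k) * ?t x Q s S = ?f S x z"
    proof (cases "zeros_below m y x")
     case False
     then show ?thesis unfolding interlacing_upd_iff[OF oy] by simp
    next
     case zb: True
     define C where "C = 1 / S"
     define X where "X = x(m := z)"
     have C: "1 < C" using S by (simp add: C_def)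
     have "ordered (Suc m) X & interlacing m X y" unfolding X_def interlacing_upd_iff[OF oy] using zb yz by blast
     then have ox: "ordered (Suc m) X" and il: "interlacing m X y" by auto
     define d c where "d = residues_of m C y x" and "c = s d"
     have "residues_of m C y X = d"
      unfolding d_def residues_of_def X_def by (intro restrict_ext) (auto intro!: arg_cong2[where f="(/)"] arg_cong2[where f="(*)"] prod.cong)
     then have ck: "c k = inner_residue m C X y k" if "k < m" for k
      using that by (simp add: c_def s_def r_def inner_residue_eq X_def mult.commute)
     have cd: "c k = (z - y k) * d k" if "k < m" for k using that by (simp add: c_def s_def r_def)
     have e1: "A S c z = strip_a m C X y"
      unfolding A_def strip_a_def by (simp add: ck C_def Y2_def) (simp add: X_def)
     have e2: "B S c = strip_b m C X y"
      unfolding B_def strip_b_def \<sigma>_def by (simp add: ck C_def Y2_def)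
     have e3: "V (B S c) c = inner_weight m C X y"
      unfolding e2 V_def inner_weight_def by (intro restrict_ext) (simp add: ck Y2_def)
     have zne: "z ~= y k" if "k < m" for k using yz[OF that] by simp
     have "J S c z = C + (\<Sum>k<m. d k / (z - y k))"
      unfolding J_def C_def[symmetric] using zne by (intro arg_cong2[where f="(+)"] sum.cong refl) (auto simp: cd power2_eq_square)
     also have "... = C * (\<Prod>i<m. z - x i) / (\<Prod>i<m. z - y i)"
      unfolding d_def using zne by (intro residues_sum ordered_inj oy) auto
     finally have J: "J S c z = C * (\<Prod>i<m. z - x i) / (\<Prod>k<m. r k)" by (simp add: r_def)
     define K where "K = (\<Prod>i<m. z - x i)"
     have K: "0 < K" unfolding K_def
     proof (intro prod_pos ballI)
      fix i assume "i \<in> {..<m}"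
      then have "X i < X m" using ordered_less[OF ox, of i m] by simp
      then show "0 < z - x i" using \<open>i \<in> {..<m}\<close> by (simp add: X_def)
     qed
     define Rr where "Rr = (\<Prod>k<m. r k)"
     define Z where "Z = cross_prod m X y"
     have Z: "0 < Z" unfolding Z_def by (rule cross_prod_pos[OF il ox C])
     define Vy where "Vy = vandermonde m y"
     have Vy: "0 < Vy" unfolding Vy_def by (rule vandermonde_pos[OF oy])
     define Vx where "Vx = vandermonde m x"
     have Vx: "0 < Vx" unfolding Vx_def by (rule vandermonde_pos[OF zeros_below_ordered[OF zb oy]])
     have VX: "vandermonde (Suc m) X = Vx * K"
      unfolding vandermonde_Suc Vx_def K_def by (auto simp: X_def intro!: arg_cong2[where f="(*)"] vandermonde_cong prod.cong)
     define PIc where "PIc = (\<Prod>k<m. c k)"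
     have PIc: "PIc * Vy\<^sup>2 = C ^ m * Z"
      using prod_inner_residue[OF il ox C] by (simp add: PIc_def Vy_def Z_def ck)
     have PIc_pos: "0 < PIc" unfolding PIc_def using inner_residue_pos[OF il ox C] by (intro prod_pos) (auto simp: ck)
     have P: "P c = 1 / PIc" by (simp add: P_def PIc_def prod_dividef)
     \<comment> \<open>The third power of \<open>C\<close> arises from \<open>1 / S\<^sup>2\<close>
       in the substitution for \<open>b\<close> and from one factor \<open>C\<close> in the
       derivative of \<open>strip_a\<close>; the power \<open>C ^ m\<close> of the residue
       substitution cancels against the product of the residues.\<close>
     have "Rr * (1 / PIc) * (1 / S\<^sup>2) * (C * K / Rr) * (C ^ m * Vx / Vy) = C ^ 3 * (Vx * K) * Vy / Z"
     proof -
      have "1 / S\<^sup>2 = C\<^sup>2" by (simp add: C_def power_divide)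
      then have "Rr * (1 / PIc) * (1 / S\<^sup>2) * (C * K / Rr) * (C ^ m * Vx / Vy) = C ^ 3 * (Vx * K) * Vy * C ^ m / (PIc * Vy\<^sup>2)"
       using R PIc_pos Vy by (simp add: Rr_def[symmetric] power2_eq_square power3_eq_cube)
      also have "... = C ^ 3 * (Vx * K) * Vy / Z" unfolding PIc using C Z by simp
      finally show ?thesis .
     qed
     then have "ennreal Rr * (ennreal (1 / PIc) * ennreal (1 / S\<^sup>2) * ennreal (C * K / Rr) * ennreal (C ^ m * Vx / Vy)) = ennreal (C ^ 3 * (Vx * K) * Vy / Z)"
      using R PIc_pos S C K Vx Vy by (simp add: Rr_def[symmetric] ennreal_mult[symmetric] mult.assoc)
     note jac = this
     have "ennreal Rr * (Q c * ennreal (C ^ m * Vx / Vy)) = G (strip_a m C X y) (strip_b m C X y) (inner_weight m C X y) * ennreal (C ^ 3 * (Vx * K) * Vy / Z)"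
     proof -
      have "a * (g * b * c * d * e) = g * (a * (b * c * d * e))" for a b c d e g :: ennreal by (simp only: mult_ac)
      then show ?thesis unfolding jac[symmetric] Q_def e3 unfolding e1 e2 P J K_def[symmetric] Rr_def[symmetric] by simp
     qed
     then show ?thesis
      using S zb ox il unfolding VX[symmetric] unfolding Rr_def Vx_def Vy_def Z_def c_def d_def C_def X_def by simp
    qed
   qed
   finally show ?thesis .
  qed
 qed
 also have "... = (Leb S. Leb_n (Suc m) (%x. ?r S x))"
 proof (intro nn_integral_cong nn_integral_lborel_Suc_rev[symmetric])
  fix S :: real
  have [measurable]: "Measurable.pred (leb (Suc m)) (%x. interlacing m x y)" "(%x. cross_prod m x y) \<in> borel_measurable (leb (Suc m))"
   unfolding interlacing_def cross_prod_def by measurable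
  have [measurable]: "(%x. inner_residue m C x y k) \<in> borel_measurable (leb (Suc m))" for k C
   unfolding inner_residue_def by measurable
  have [measurable]: "(%x. strip_a m C x y) \<in> borel_measurable (leb (Suc m))" "(%x. strip_b m C x y) \<in> borel_measurable (leb (Suc m))"
   for C unfolding strip_a_def strip_b_def by measurable
  have [measurable]: "(%x. inner_weight m C x y) \<in> leb (Suc m) \<rightarrow>\<^sub>M leb m" for C
   unfolding inner_weight_def by measurable
  show "(%x. ?r S x) \<in> borel_measurable (leb (Suc m))"
   by measurable
 qed
 finally show ?thesis .
qed

section \<open>Measurability of the coefficients\<close>

lemma borel_measurable_cnj [measurable (raw)]:
 assumes "f \<in> borel_measurable M" shows "(%w. cnj (f w)) \<in> borel_measurable M"
proof -
 have "cnj \<in> borel_measurable borel" by (intro borel_measurable_continuous_onI continuous_intros)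
 from measurable_compose[OF assms this] show ?thesis .
qed

lemma measurable_szego_coeff:
 assumes [measurable]: "!!j. (%w. c w j) \<in> borel_measurable M"
 shows "(%w. coeff (szego (c w) k) i) \<in> borel_measurable M"
  and "(%w. szego_alpha (c w) k) \<in> borel_measurable M"
proof -
 have *: "(%w. szego_alpha (c w) k) \<in> borel_measurable M"
  if [measurable]: "!!i. (%w. coeff (szego (c w) k) i) \<in> borel_measurable M" for k
 proof -
  have 1: "moment_functional (c w) (pCons 0 (szego (c w) k)) = (\<Sum>i\<le>k. coeff (szego (c w) k) i * c w (Suc i))" for w
   using degree_pCons_le[of 0 "szego (c w) k"]
   by (subst moment_functional_le[of _ "Suc k"]) (simp_all add: degree_szego sum.atMost_Suc_shift del: sum.atMost_Suc)
  have 2: "moment_functional (c w) (reversed_poly k (szego (c w) k)) = (\<Sum>i\<le>k. cnj (coeff (szego (c w) k) (k - i)) * c w i)" for w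
   by (subst moment_functional_le[OF degree_reversed_poly]) (simp add: coeff_reversed_poly)
  show ?thesis unfolding szego_alpha_def 1 2 by measurable
 qed
 have co: "(%w. coeff (szego (c w) k) i) \<in> borel_measurable M" for i k
 proof (induction k arbitrary: i)
  case (Suc k)
  note [measurable] = Suc *[OF Suc]
  show ?case unfolding szego_Suc_alpha
   by (cases i) (simp_all add: coeff_reversed_poly)
 qed simp
 show "(%w. coeff (szego (c w) k) i) \<in> borel_measurable M" by (rule co)
 show "(%w. szego_alpha (c w) k) \<in> borel_measurable M" by (rule *[OF co])
qed

lemma measurable_modified_coeffs:
 assumes "!!j. j \<le> k ==> (%w. \<alpha> w j) \<in> borel_measurable M"
 shows "(%w. modified_coeffs (\<alpha> w) k) \<in> borel_measurable M"
 using assms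
proof (induction k rule: less_induct)
 case (less k)
 have [measurable]: "(%w. modified_coeffs (\<alpha> w) j) \<in> borel_measurable M" if "j \<in> {..<k}" for j
  using less that by auto
 have [measurable]: "(%w. \<alpha> w k) \<in> borel_measurable M" using less.prems by simp
 show ?case by (subst modified_coeffs.simps) measurable
qed

lemma measurable_cayley [measurable]: "cayley \<in> borel_measurable borel"
 unfolding cayley_def[abs_def] by measurable

lemma measurable_config_coeff [measurable (raw)]:
 assumes x: "x \<in> M \<rightarrow>\<^sub>M leb a" and v: "v \<in> M \<rightarrow>\<^sub>M leb b"
 shows "(%w. config_coeff m (x w) (v w) k) \<in> borel_measurable M"
proof -
 have [measurable]: "(%w. x w i) \<in> borel_measurable M" for i by (rule measurable_compose[OF x measurable_coordinate])
 have [measurable]: "(%w. v w i) \<in> borel_measurable M" for i by (rule measurable_compose[OF v measurable_coordinate])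
 have "(%w. config_moment m (x w) (v w) j) \<in> borel_measurable M" for j
  unfolding config_moment_def by measurable
 then show ?thesis
  unfolding config_coeff_def by (intro measurable_modified_coeffs measurable_szego_coeff)
qed

lemma measurable_halfplane_coeff [measurable (raw)]:
 assumes [measurable]: "a \<in> borel_measurable M" "b \<in> borel_measurable M"
 shows "(%w. halfplane_coeff (a w) (b w)) \<in> borel_measurable M"
proof -
 have [measurable]: "(%w. Complex (- a w) (b w)) \<in> borel_measurable M"
  unfolding Complex_eq by measurable
 show ?thesis unfolding halfplane_coeff_def by measurable
qed

section \<open>Integrating over configurations\<close>

text \<open>A reference integral free of \<open>\<beta>\<close>. Against it the random measure has a
  density that is a product of functions of single coefficients, so \<open>\<beta>\<close> enters
  only through the test functions \<open>h k\<close>.\<close>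

definition config_integral :: "nat => (nat => complex => ennreal) => ennreal" where
 "config_integral m h = Leb_n m (%x. Leb_n m (%v. if ordered m x & (\<forall>i<m. 0 < v i) & (\<Sum>i<m. v i) < 1
   then ennreal (\<Prod>i<m. 1 / (1 + (x i)\<^sup>2)) * ((\<Prod>k<m. h k (config_coeff m x v k)) * ennreal (\<Prod>i<m. 1 / v i)) else 0))"

definition halfplane_integral :: "(complex => ennreal) => ennreal" where
 "halfplane_integral h = (Leb a. Leb b. if 0 < b then h (halfplane_coeff a b) * ennreal (1 / (a\<^sup>2 + (b + 1)\<^sup>2)) else 0)"

text \<open>Both sides are one integral over a total mass \<open>S\<close> and interlacing outer and
  inner points. On the left the outer weights are replaced by \<open>(S, y)\<close>; on the right
  the parameters of the first coefficient and the inner weights are replaced by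
  \<open>(S, x)\<close>.\<close>

lemma config_integral_Suc:
 assumes h: "!!k. h k \<in> borel_measurable borel"
 shows "config_integral (Suc m) h = halfplane_integral (h 0) * config_integral m (%k. h (Suc k))"
proof -
 note h[measurable]
 have [measurable (raw)]: "(%w. \<Prod>k<n. h (f k) (config_coeff l (x w) (v w) (g k))) \<in> borel_measurable M"
  if [measurable]: "x \<in> M \<rightarrow>\<^sub>M leb a" "v \<in> M \<rightarrow>\<^sub>M leb b" for M :: "((nat => real) \<times> (nat => real)) measure" and x v a b n f l g
  by measurable
 let ?X = "%x. ennreal (\<Prod>i<Suc m. 1 / (1 + (x i)\<^sup>2))"
 let ?Y = "%y. ennreal (\<Prod>i<m. 1 / (1 + (y i)\<^sup>2))"
 let ?C = "%S x y. h 0 (config_coeff (Suc m) x (outer_weight m (1 / S) x y) 0)"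
 define H where "H x v = (\<Prod>k<Suc m. h k (config_coeff (Suc m) x v k))" for x v
 define H' where "H' y v = (\<Prod>k<m. h (Suc k) (config_coeff m y v k))" for y v
 define T where "T S x y = ennreal (1 / S * vandermonde (Suc m) x * vandermonde m y / cross_prod m x y)" for S x y
 let ?r = "%S x y. 0 < S & S < 1 & ordered (Suc m) x & interlacing m x y"
 define mid where "mid S x y = (if ?r S x y then ?X x * (H x (outer_weight m (1 / S) x y) * T S x y) else 0)" for S x y
 have mmid[measurable]: "(%p. mid (fst p) (fst (snd p)) (snd (snd p))) \<in> borel_measurable (lborel \<Otimes>\<^sub>M (leb (Suc m) \<Otimes>\<^sub>M leb m))"
  unfolding mid_def H_def T_def by measurable
 have mid3[measurable (raw)]: "(%w. mid (S w) (x w) (y w)) \<in> borel_measurable M"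
  if [measurable]: "S \<in> borel_measurable M" "x \<in> M \<rightarrow>\<^sub>M leb (Suc m)" "y \<in> M \<rightarrow>\<^sub>M leb m" for M :: "'b measure" and S x y
 proof -
  have "(%w. (S w, x w, y w)) \<in> M \<rightarrow>\<^sub>M lborel \<Otimes>\<^sub>M (leb (Suc m) \<Otimes>\<^sub>M leb m)" by measurable
  from measurable_compose[OF this mmid] show ?thesis by simp
 qed
 let ?h = "%x. Leb S. Leb_n m (%y. mid S x y)"
 have left: "config_integral (Suc m) h = Leb_n (Suc m) (%x. ?h x)"
  unfolding config_integral_def
 proof (rule nn_integral_cong)
  fix x assume x[measurable]: "x \<in> space (leb (Suc m))"
  show "Leb_n (Suc m) (%v. if ordered (Suc m) x & (\<forall>i<Suc m. 0 < v i) & (\<Sum>i<Suc m. v i) < 1 then ?X x * ((\<Prod>k<Suc m. h k (config_coeff (Suc m) x v k)) * ennreal (\<Prod>i<Suc m. 1 / v i)) else 0) = ?h x"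
  proof (cases "ordered (Suc m) x")
   case False
   then show ?thesis by (simp add: mid_def)
  next
   case True
   have [measurable]: "(%v. config_coeff (Suc m) x v k) \<in> borel_measurable (leb (Suc m))" for k
    by (rule measurable_config_coeff[OF measurable_const[OF x] measurable_ident_sets[OF refl]])
   have "Leb_n (Suc m) (%v. if (\<forall>i<Suc m. 0 < v i) & (\<Sum>i<Suc m. v i) < 1 then ?X x * H x v * ennreal (\<Prod>i<Suc m. 1 / v i) else 0) = (Leb S. Leb_n m (%y. if 0 < S & S < 1 & interlacing m x y then ?X x * H x (outer_weight m (1 / S) x y) * T S x y else 0))"
    unfolding T_def by (rule nn_integral_weights_to_zeros[OF True]) (unfold H_def, measurable)
   then show ?thesis using True unfolding mid_def H_def[symmetric] by (simp only: mult.assoc simp_thms)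
  qed
 qed
 define G where "G y a b v = h 0 (halfplane_coeff a b) * ennreal (1 / (a\<^sup>2 + (b + 1)\<^sup>2)) * (?Y y * H' y v)" for y v and a b :: real
 let ?f = "%y. Leb S. Leb_n (Suc m) (%x. mid S x y)"
 let ?g = "%S x y. if ?r S x y then G y (strip_a m (1 / S) x y) (strip_b m (1 / S) x y) (inner_weight m (1 / S) x y) * ennreal ((1 / S) ^ 3 * vandermonde (Suc m) x * vandermonde m y / cross_prod m x y) else 0"
 let ?p = "%F y. Leb_n m (%v. F y v)"
 let ?q = "%w F y. Leb a. Leb b. Leb_n m (%v. w a b * F y v)"
 let ?s = "Leb_n m (%y. ?f y)"
 let ?t = "halfplane_integral (h 0) * config_integral m (%k. h (Suc k))"
 have right: "?t = ?s"
 proof -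
  define w where "w a b = (if 0 < b then h 0 (halfplane_coeff a b) * ennreal (1 / (a\<^sup>2 + (b + 1)\<^sup>2)) else 0)" for a b :: real
  have [measurable]: "(%p. w (fst p) (snd p)) \<in> borel_measurable (borel \<Otimes>\<^sub>M borel)" unfolding w_def by measurable
  have w2[measurable]: "(%b. w a b) \<in> borel_measurable borel" for a unfolding w_def by measurable
  have w1[measurable]: "(%a. Leb b. w a b) \<in> borel_measurable borel" unfolding w_def by measurable
  define F where "F y v = (if ordered m y & (\<forall>i<m. 0 < v i) & (\<Sum>i<m. v i) < 1 then ?Y y * (H' y v * ennreal (\<Prod>i<m. 1 / v i)) else 0)" for y v
  have [measurable]: "(%p. F (fst p) (snd p)) \<in> borel_measurable (leb m \<Otimes>\<^sub>M leb m)"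
   unfolding F_def H'_def by measurable
  have Fy: "(%y. ?p F y) \<in> borel_measurable (leb m)" unfolding F_def H'_def by measurable
  have "?t = Leb_n m (%y. halfplane_integral (h 0) * ?p F y)"
   unfolding config_integral_def F_def H'_def[symmetric] by (rule nn_integral_cmult[symmetric]) (unfold F_def[symmetric], rule Fy)
  also have "... = ?s"
  proof (rule nn_integral_cong)
   fix y assume y[measurable]: "y \<in> space (leb m)"
   have [measurable]: "(%v. config_coeff m y v k) \<in> borel_measurable (leb m)" for k
    by (rule measurable_config_coeff[OF measurable_const[OF y] measurable_ident_sets[OF refl]])
   have Fm[measurable]: "F y \<in> borel_measurable (leb m)" unfolding F_def H'_def by measurable
   have "halfplane_integral (h 0) * ?p F y = (Leb a. (Leb b. w a b) * ?p F y)"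
    unfolding halfplane_integral_def w_def[symmetric] by (rule nn_integral_multc[symmetric]) (use w1 in simp)
   also have "... = ?q w F y"
    by (simp add: nn_integral_multc nn_integral_cmult)
   also have "... = ?f y"
   proof (cases "ordered m y")
    case False
    have "\<not> (?r S x y)" for S x
     using interlacing_ordered_inner False by blast
    then have "mid S x y = 0" for S x unfolding mid_def by (rule if_not_P)
    then show ?thesis using False by (simp add: F_def)
   next
    case oy: True
    have "?q w F y = (Leb a. Leb b. Leb_n m (%v. if 0 < b & (\<forall>k<m. 0 < v k) & (\<Sum>k<m. v k) < 1 then G y a b v * ennreal (\<Prod>k<m. 1 / v k) else 0))"
     using oy by (intro nn_integral_cong) (auto simp: w_def F_def G_def mult.assoc)
    also have "... = (Leb S. Leb_n (Suc m) (%x. ?g S x y))"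
    proof (rule nn_integral_strip[OF oy])
     have [measurable]: "(%p. config_coeff m y (snd (snd p)) k) \<in> borel_measurable (borel \<Otimes>\<^sub>M (borel \<Otimes>\<^sub>M leb m))" for k
      by (rule measurable_config_coeff[OF measurable_const[OF y]]) measurable
     show "(%(a, b, v). G y a b v) \<in> borel_measurable (borel \<Otimes>\<^sub>M borel \<Otimes>\<^sub>M leb m)"
      unfolding G_def H'_def split_beta by measurable
    qed
    also have "... = ?f y"
    proof (rule nn_integral_cong, rule nn_integral_cong)
     fix S :: real and x
     show "?g S x y = mid S x y"
     proof (cases "0 < S & S < 1 & ordered (Suc m) x & interlacing m x y")
      case True
      then have S: "0 < S" "S < 1" and ox: "ordered (Suc m) x" and il: "interlacing m x y" by auto
      define C where "C = 1 / S"
      have C: "1 < C" using S by (simp add: C_def)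
      define a b where "a = strip_a m C x y" and "b = strip_b m C x y"
      have b: "0 < b" unfolding b_def by (rule strip_b_pos[OF il ox C])
      define q where "q = a\<^sup>2 + (b + 1)\<^sup>2"
      have q: "0 < q" unfolding q_def using b by (intro add_nonneg_pos) auto
      define PX PY where "PX = (\<Prod>i<Suc m. 1 + (x i)\<^sup>2)" and "PY = (\<Prod>i<m. 1 + (y i)\<^sup>2)"
      have P: "0 < PX" "0 < PY" unfolding PX_def PY_def by (auto intro!: prod_pos simp del: prod.lessThan_Suc)
      have CX: "C\<^sup>2 * PX = q * PY" unfolding PX_def PY_def q_def a_def b_def by (rule prod_square_strip[OF il ox C])
      define V where "V = vandermonde (Suc m) x * vandermonde m y / cross_prod m x y"
      have V: "0 < V" unfolding V_def
       using vandermonde_pos[OF ox] vandermonde_pos[OF interlacing_ordered_inner[OF il ox]] cross_prod_pos[OF il ox C] by simp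
      have T: "T S x y = ennreal (C * V)" "ennreal ((1 / S) ^ 3 * vandermonde (Suc m) x * vandermonde m y / cross_prod m x y) = ennreal (C ^ 3 * V)"
       by (simp_all add: T_def C_def V_def mult.assoc)
      have XX: "?X x = ennreal (1 / PX)" "?Y y = ennreal (1 / PY)" by (simp_all add: PX_def PY_def prod_dividef del: prod.lessThan_Suc)
      have HH: "H x (outer_weight m C x y) = h 0 (halfplane_coeff a b) * H' y (inner_weight m C x y)"
       unfolding H_def H'_def prod.lessThan_Suc_shift using config_coeff_strip[OF il ox C] by (simp add: a_def b_def)
      \<comment> \<open>The inner Jacobian exceeds the outer one by the factor
        \<open>C\<^sup>2\<close>, which is exactly the discrepancy between the products over
        \<open>1 + (x i)\<^sup>2\<close> and \<open>1 + (y i)\<^sup>2\<close> found by evaluating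
        the stripping identity at \<i>.\<close>
      have "1 / q * (1 / PY) * (C ^ 3 * V) = 1 / PX * (C * V)"
      proof -
       have "1 / q * (1 / PY) * (C ^ 3 * V) = C ^ 3 * V / (C\<^sup>2 * PX)" unfolding CX by simp
       also have "... = 1 / PX * (C * V)" using C P by (simp add: power2_eq_square power3_eq_cube)
       finally show ?thesis .
      qed
      then have "ennreal (1 / q) * ennreal (1 / PY) * ennreal (C ^ 3 * V) = ennreal (1 / PX) * ennreal (C * V)"
       using q P C V by (simp add: ennreal_mult[symmetric])
      note jac = this
      have "(h0 * Q * (Y * H1)) * Z = X * (h0 * H1 * T')" if "Q * Y * Z = X * T'" for h0 Q Y H1 Z X T' :: ennreal
       using that by (metis (no_types, opaque_lifting) mult.assoc mult.commute)
      from this[OF jac] have "G y a b (inner_weight m C x y) * ennreal (C ^ 3 * V) = ?X x * (H x (outer_weight m C x y) * T S x y)"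
       unfolding G_def q_def[symmetric] XX HH T by blast
      then show ?thesis using True by (simp only: mid_def if_True simp_thms T C_def a_def b_def)
     next
      case False
      then show ?thesis unfolding mid_def by (simp only: if_False)
     qed
    qed
    finally show ?thesis .
   qed
   finally show "halfplane_integral (h 0) * ?p F y = ?f y" .
  qed
  finally show ?thesis .
 qed
 have "Leb_n (Suc m) (%x. ?h x) = (Leb S. Leb_n (Suc m) (%x. Leb_n m (%y. mid S x y)))"
  by (rule nn_integral_lborel_swap) (measurable, intro_locales)
 also have "... = (Leb S. Leb_n m (%y. Leb_n (Suc m) (%x. mid S x y)))"
  by (rule nn_integral_cong, rule nn_integral_lborel_swap) (measurable, intro_locales)
 also have "... = ?s"
  by (rule nn_integral_lborel_swap) (measurable, intro_locales)
 finally show ?thesis unfolding left right .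
qed

theorem config_integral_eq_prod:
 assumes "!!k. h k \<in> borel_measurable borel"
 shows "config_integral m h = (\<Prod>k<m. halfplane_integral (h k))"
 using assms
proof (induction m arbitrary: h)
 case 0
 show ?case unfolding config_integral_def nn_integral_lborel_0 by (simp add: ordered_def)
next
 case (Suc m)
 show ?case unfolding config_integral_Suc[OF Suc.prems] prod.lessThan_Suc_shift using Suc.IH[of "%k. h (Suc k)"] Suc.prems by simp
qed

section \<open>Orthogonal polynomials of measures on the circle\<close>

lemma space_circle_borel [simp]: "space circle_borel = sphere 0 1"
 by (simp add: circle_borel_def space_restrict_space)

lemma borel_measurable_circle_borel [measurable (raw)]:
 "f \<in> borel_measurable borel ==> f \<in> borel_measurable circle_borel"
 unfolding circle_borel_def by (rule measurable_restrict_space1)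

lemma borel_measurable_circle_continuous:
 "continuous_on (sphere 0 1) f ==> f \<in> borel_measurable circle_borel"
 unfolding circle_borel_def by (rule borel_measurable_continuous_on_restrict)

lemma circle_measuresD:
 assumes "m \<in> space circle_measures"
 shows "prob_space m" "sets m = sets circle_borel" "space m = sphere 0 1"
 using assms by (auto simp: space_prob_algebra dest: sets_eq_imp_space_eq)

lemma open_Int_space_circle:
 assumes "m \<in> space circle_measures" "open U"
 shows "U \<inter> space m \<in> sets m"
proof -
 have "sphere 0 1 \<inter> U \<in> sets circle_borel" using assms(2) unfolding circle_borel_def sets_restrict_space by auto
 then show ?thesis using circle_measuresD[OF assms(1)] by (simp add: Int_commute)
qed

lemma integrable_circle:
 fixes f :: "complex => 'b :: {banach, second_countable_topology}"
 assumes m: "m \<in> space circle_measures" and f: "continuous_on (sphere 0 1) f"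
 shows "integrable m f"
proof -
 interpret prob_space m using circle_measuresD[OF m] by simp
 have "compact (f ` sphere 0 1)" by (intro compact_continuous_image f) simp
 then obtain B where "!!z. z \<in> sphere 0 1 ==> norm (f z) \<le> B"
  using compact_imp_bounded bounded_iff by (metis imageI)
 moreover have "f \<in> borel_measurable m"
  using borel_measurable_circle_continuous[OF f] circle_measuresD[OF m] by (simp cong: measurable_cong_sets)
 ultimately show ?thesis
  using circle_measuresD(3)[OF m] by (intro integrable_const_bound[of _ B]) auto
qed

definition circle_moment :: "complex measure => nat => complex" where
 "circle_moment m j = (\<integral>z. z ^ j \<partial>m)"

lemma measurable_integral_circle:
 fixes f :: "complex => 'b :: {banach, second_countable_topology}"
 assumes f: "continuous_on (sphere 0 1) f"
 shows "(%m. \<integral>z. f z \<partial>m) \<in> borel_measurable circle_measures"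
 unfolding prob_algebra_def
 by (intro measurable_restrict_space1 integral_measurable_subprob_algebra borel_measurable_circle_continuous f)

context
 fixes m :: "complex measure"
 assumes m: "m \<in> space circle_measures"
begin

lemma moment_functional_circle: "moment_functional (circle_moment m) p = (\<integral>z. poly p z \<partial>m)"
proof -
 have "(\<integral>z. poly p z \<partial>m) = (\<integral>z. (\<Sum>i\<le>degree p. coeff p i * z ^ i) \<partial>m)" by (simp add: poly_altdef)
 also have "... = (\<Sum>i\<le>degree p. \<integral>z. coeff p i * z ^ i \<partial>m)"
  by (intro Bochner_Integration.integral_sum integrable_circle[OF m] continuous_intros)
 finally show ?thesis by (simp add: moment_functional_def circle_moment_def)
qed

lemma integral_cnj_poly:
 assumes "degree q \<le> k" and f: "continuous_on (sphere 0 1) f"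
 shows "(\<integral>z. f z * cnj (poly q z) \<partial>m) = (\<Sum>j\<le>k. cnj (coeff q j) * (\<integral>z. f z * cnj (z ^ j) \<partial>m))"
proof -
 have "(\<integral>z. f z * cnj (poly q z) \<partial>m) = (\<integral>z. (\<Sum>j\<le>k. cnj (coeff q j) * (f z * cnj (z ^ j))) \<partial>m)"
  by (simp add: poly_altdef_le[OF assms(1)] sum_distrib_left mult_ac)
 also have "... = (\<Sum>j\<le>k. \<integral>z. cnj (coeff q j) * (f z * cnj (z ^ j)) \<partial>m)"
  using f by (intro Bochner_Integration.integral_sum integrable_circle[OF m] continuous_intros)
 finally show ?thesis by simp
qed

lemma integral_norm_poly_eq_0:
 assumes "(\<integral>z. (cmod (poly p z))\<^sup>2 \<partial>m) = 0" shows "supp m \<subseteq> {z. poly p z = 0}"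
proof
 fix x assume x: "x \<in> supp m"
 have "integrable m (%z. (cmod (poly p z))\<^sup>2)" by (intro integrable_circle[OF m] continuous_intros)
 then have ae: "AE z in m. (cmod (poly p z))\<^sup>2 = 0" using assms by (subst (asm) integral_nonneg_eq_0_iff_AE) auto
 show "x \<in> {z. poly p z = 0}"
 proof (rule ccontr)
  assume "x \<notin> {z. poly p z = 0}"
  moreover have "open {z. poly p z ~= 0}" by (intro open_Collect_neq continuous_intros)
  ultimately have "emeasure m ({z. poly p z ~= 0} \<inter> space m) > 0" using x by (auto simp: supp_def)
  moreover have "{z. poly p z ~= 0} \<inter> space m \<in> sets m"
   using open_Int_space_circle[OF m \<open>open {z. poly p z ~= 0}\<close>] .
  then have "emeasure m ({z. poly p z ~= 0} \<inter> space m) = 0"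
   using ae by (subst (asm) AE_iff_measurable[where N="{z. poly p z ~= 0} \<inter> space m"]) auto
  ultimately show False by simp
 qed
qed

text \<open>The complement of the support is a union of null basic open sets, and a countable basis
  keeps this union null.\<close>

lemma emeasure_outside_supp: "AE z in m. z \<in> supp m"
proof -
 obtain B :: "complex set set" where B: "countable B" "topological_basis B"
  using ex_countable_basis by blast
 define N where "N = {b \<in> B. emeasure m (b \<inter> space m) = 0}"
 have sets: "b \<inter> space m \<in> sets m" if "b \<in> B" for b
  using open_Int_space_circle[OF m topological_basis_open[OF B(2) that]] .
 let ?f = "\<Union>b\<in>N. b \<inter> space m"
 have "?f \<in> null_sets m"
  using B(1) sets by (intro null_sets_UN') (auto simp: N_def null_sets_def intro: countable_subset)
 moreover have "{z \<in> space m. z \<notin> supp m} \<subseteq> ?f"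
 proof
  fix z assume z: "z \<in> {z \<in> space m. z \<notin> supp m}"
  then obtain U where U: "open U" "z \<in> U" "emeasure m (U \<inter> space m) = 0" by (auto simp: supp_def not_gr_zero)
  then obtain b where b: "b \<in> B" "z \<in> b" "b \<subseteq> U" using topological_basisE[OF B(2)] by metis
  have "U \<inter> space m \<in> sets m" by (rule open_Int_space_circle[OF m U(1)])
  then have "emeasure m (b \<inter> space m) \<le> emeasure m (U \<inter> space m)" using b by (intro emeasure_mono) auto
  then show "z \<in> ?f" using U z b by (auto simp: N_def)
 qed
 ultimately show ?thesis by (intro AE_I'[of "\<Union>b\<in>N. b \<inter> space m"]) auto
qed

lemma poly_eq_0_of_supp:
 assumes "(\<integral>z. (cmod (poly p z))\<^sup>2 \<partial>m) = 0" "finite (supp m)" "card (supp m) = n" "p = 0 \<or> degree p < n"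
 shows "p = 0"
proof (rule ccontr)
 assume p: "p ~= 0"
 then have "card (supp m) \<le> card {z. poly p z = 0}"
  using integral_norm_poly_eq_0[OF assms(1)] by (intro card_mono poly_roots_finite)
 also have "... \<le> degree p" using p by (rule card_poly_roots_bound)
 finally show False using assms p by simp
qed

definition circle_orthogonal :: "complex poly => nat => bool" where
 "circle_orthogonal p k \<longleftrightarrow> (\<forall>j<k. (\<integral>z. poly p z * cnj (z ^ j) \<partial>m) = 0)"

lemma norm_sq_integral: "(\<integral>z. poly p z * cnj (poly p z) \<partial>m) = of_real (\<integral>z. (cmod (poly p z))\<^sup>2 \<partial>m)"
 by (simp only: complex_norm_square[symmetric] integral_complex_of_real)

lemma AE_circle: "AE z in m. cmod z = 1"
 using circle_measuresD[OF m] by (intro AE_I2) simp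

lemma circle_pow_cnj: "cmod z = 1 ==> z * cnj z = 1"
 by (metis complex_norm_square of_real_1 one_power2)

context
 fixes n :: nat
 assumes fin: "finite (supp m)" and card: "card (supp m) = n"
begin

text \<open>Below degree \<open>n\<close> no monic polynomial vanishes on the support, so the norm
  of \<open>p\<close> is positive and the denominator in the recursion is nonzero. Orthogonality to
  1 is the choice of the quotient. Orthogonality to higher powers is inherited, since multiplication
  by \<open>z\<close> is an isometry and the reversed polynomial is orthogonal to the powers from 1
  to \<open>k\<close>.\<close>

lemma szego_orthogonal:
 assumes "k \<le> n" shows "circle_orthogonal (szego (circle_moment m) k) k"
 using assms
proof (induction k)
 case 0
 then show ?case by (simp add: circle_orthogonal_def)
next
 case (Suc k)
 define c where "c = circle_moment m"
 define p where "p = szego c k"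
 define r where "r = reversed_poly k p"
 have IH: "(\<integral>z. poly p z * cnj (z ^ j) \<partial>m) = 0" if "j < k" for j
  using Suc that by (auto simp: circle_orthogonal_def p_def c_def)
 have dp: "degree p = k" "coeff p k = 1" by (simp_all add: p_def degree_szego lead_coeff_szego)
 have "p ~= 0" using dp by auto
 then have np: "(\<integral>z. (cmod (poly p z))\<^sup>2 \<partial>m) ~= 0"
  using poly_eq_0_of_supp[OF _ fin card] dp Suc.prems by auto
 have "(\<integral>z. poly p z * cnj (poly p z) \<partial>m) = (\<Sum>j\<le>k. cnj (coeff p j) * (\<integral>z. poly p z * cnj (z ^ j) \<partial>m))"
  by (intro integral_cnj_poly) (auto simp: dp intro!: continuous_intros)
 also have "... = (\<integral>z. poly p z * cnj (z ^ k) \<partial>m)"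
  by (subst sum.remove[of _ k]) (auto intro!: sum.neutral simp: dp IH simp del: complex_cnj_power)
 finally have pk: "(\<integral>z. poly p z * cnj (z ^ k) \<partial>m) ~= 0" using np unfolding norm_sq_integral by (metis of_real_eq_0_iff)
 \<comment> \<open>On the circle the reversed polynomial is \<open>z ^ k\<close> times the conjugate
   of \<open>p\<close>, which turns its inner product with \<open>z ^ j\<close> into the conjugate
   of that of \<open>p\<close> with \<open>z ^ (k - j)\<close>.\<close>
 have r: "(\<integral>z. poly r z * cnj (z ^ j) \<partial>m) = cnj (\<integral>z. poly p z * cnj (z ^ (k - j)) \<partial>m)" if "j \<le> k" for j
 proof -
  have "(\<integral>z. poly r z * cnj (z ^ j) \<partial>m) = (\<integral>z. cnj (poly p z * cnj (z ^ (k - j))) \<partial>m)"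
  proof (rule integral_cong_AE)
   show "AE z in m. poly r z * cnj (z ^ j) = cnj (poly p z * cnj (z ^ (k - j)))"
    using AE_circle
   proof eventually_elim
    case (elim z)
    have "poly r z = z ^ k * cnj (poly p z)" unfolding r_def by (rule poly_reversed_poly_circle) (use elim dp in auto)
    moreover have "z ^ k = z ^ (k - j) * z ^ j" using that by (simp flip: power_add)
    moreover have "z ^ j * cnj z ^ j = 1" using circle_pow_cnj[OF elim] by (simp flip: power_mult_distrib)
    ultimately show ?case by (simp add: mult_ac)
   qed
   show "(%z. poly r z * cnj (z ^ j)) \<in> borel_measurable m" "(%z. cnj (poly p z * cnj (z ^ (k - j)))) \<in> borel_measurable m"
    by (intro borel_measurable_integrable integrable_circle[OF m] continuous_intros)+
  qed
  then show ?thesis by (simp only: Bochner_Integration.integral_cnj)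
 qed
 have Lr: "moment_functional c r ~= 0"
  using r[of 0] pk unfolding c_def moment_functional_circle by simp
 define a where "a = moment_functional c (pCons 0 p) / moment_functional c r"
 have S: "szego c (Suc k) = pCons 0 p - smult a r" by (simp add: p_def r_def a_def)
 have "(\<integral>z. poly (szego c (Suc k)) z * cnj (z ^ j) \<partial>m) = 0" if "j < Suc k" for j
 proof -
  let ?f = "%r j. \<integral>z. poly r z * cnj (z ^ j) \<partial>m"
  have "(\<integral>z. poly (szego c (Suc k)) z * cnj (z ^ j) \<partial>m) = (\<integral>z. z * poly p z * cnj (z ^ j) - a * (poly r z * cnj (z ^ j)) \<partial>m)"
   unfolding S by (simp add: algebra_simps)
  also have "... = (\<integral>z. z * poly p z * cnj (z ^ j) \<partial>m) - a * ?f r j"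
   by (subst Bochner_Integration.integral_diff) (auto intro!: integrable_circle[OF m] continuous_intros)
  also have "... = 0"
  proof (cases j)
   case 0
   have "(\<integral>z. z * poly p z \<partial>m) = moment_functional c (pCons 0 p)" "(\<integral>z. poly r z \<partial>m) = moment_functional c r"
    unfolding c_def moment_functional_circle by (auto intro!: Bochner_Integration.integral_cong)
   then show ?thesis using 0 Lr by (simp add: a_def)
  next
   case (Suc l)
   have "(\<integral>z. z * poly p z * cnj (z ^ j) \<partial>m) = ?f p l"
   proof (rule integral_cong_AE)
    show "AE z in m. z * poly p z * cnj (z ^ j) = poly p z * cnj (z ^ l)"
     using AE_circle
    proof eventually_elim
     case (elim z)
     have "z * poly p z * cnj (z ^ j) = (z * cnj z) * (poly p z * cnj (z ^ l))" by (simp add: Suc mult_ac)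
     then show ?case by (simp add: circle_pow_cnj[OF elim])
    qed
    show "(%z. z * poly p z * cnj (z ^ j)) \<in> borel_measurable m" "(%z. poly p z * cnj (z ^ l)) \<in> borel_measurable m"
     by (intro borel_measurable_integrable integrable_circle[OF m] continuous_intros)+
   qed
   also have "... = 0" using IH[of l] that Suc by simp
   moreover have "?f r j = 0" using r[of j] IH[of "k - j"] that Suc by simp
   ultimately show ?thesis by simp
  qed
  finally show ?thesis .
 qed
 then show ?case by (simp add: circle_orthogonal_def c_def del: szego.simps)
qed

lemma monic_orthogonal_unique:
 assumes k: "k \<le> n" and p: "degree p = k" "lead_coeff p = 1" "circle_orthogonal p k"
 shows "p = szego (circle_moment m) k"
proof -
 define q where "q = szego (circle_moment m) k"
 have q: "degree q = k" "coeff q k = 1" "circle_orthogonal q k"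
  using szego_orthogonal[OF k] by (simp_all add: q_def degree_szego lead_coeff_szego)
 define d where "d = p - q"
 have "coeff d k = 0" using p q by (simp add: d_def)
 moreover have "degree d \<le> k" unfolding d_def using p q by (intro degree_diff_le) auto
 ultimately have dd: "d = 0 \<or> degree d < k" by (metis leading_coeff_0_iff le_neq_implies_less)
 let ?f = "%d j. \<integral>z. poly d z * cnj (z ^ j) \<partial>m"
 have "?f d j = 0" if "j < k" for j
 proof -
  have "?f d j = (\<integral>z. poly p z * cnj (z ^ j) - poly q z * cnj (z ^ j) \<partial>m)"
   by (simp add: d_def algebra_simps)
  also have "... = (\<integral>z. poly p z * cnj (z ^ j) \<partial>m) - (?f q j)"
   by (intro Bochner_Integration.integral_diff integrable_circle[OF m] continuous_intros)
  finally show ?thesis using that p(3) q(3) by (simp add: circle_orthogonal_def)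
 qed
 note dorth = this
 have "d = 0"
 proof (rule ccontr)
  assume nz: "d ~= 0"
  then have dk: "degree d < k" using dd by simp
  have "(\<integral>z. poly d z * cnj (poly d z) \<partial>m) = (\<Sum>j\<le>degree d. cnj (coeff d j) * ?f d j)"
   by (intro integral_cnj_poly) (auto intro!: continuous_intros)
  also have "... = 0" using dk by (intro sum.neutral) (auto simp: dorth simp del: complex_cnj_power)
  finally have "(\<integral>z. (cmod (poly d z))\<^sup>2 \<partial>m) = 0" unfolding norm_sq_integral by (metis of_real_eq_0_iff)
  then show False using poly_eq_0_of_supp[OF _ fin card] dk k nz by auto
 qed
 then show ?thesis by (simp add: d_def q_def)
qed

lemma monic_ortho_poly_eq: "k \<le> n ==> monic_ortho_poly m k = szego (circle_moment m) k"
 unfolding monic_ortho_poly_def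
 using szego_orthogonal[of k] monic_orthogonal_unique[of k]
 by (intro the_equality) (auto simp: degree_szego lead_coeff_szego circle_orthogonal_def)

text \<open>The recursion determines its coefficient because the reversed polynomial, having
  constant coefficient 1, is nonzero at some nonzero point.\<close>

lemma verblunsky_eq:
 assumes "k < n" shows "verblunsky m k = szego_alpha (circle_moment m) k"
proof -
 define c where "c = circle_moment m"
 have e: "monic_ortho_poly m (Suc k) = szego c (Suc k)" "monic_ortho_poly m k = szego c k"
  using assms by (simp_all add: monic_ortho_poly_eq c_def del: szego.simps)
 define r where "r = reversed_poly k (szego c k)"
 let ?f = "%z. z ^ k * cnj (poly (szego c k) (1 / cnj z))"
 have r: "poly r z = ?f z" if "z ~= 0" for z
  unfolding r_def by (rule poly_reversed_poly) (auto simp: degree_szego that)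
 have "coeff r 0 = 1" by (simp add: r_def coeff_reversed_poly lead_coeff_szego)
 then have "r ~= 0" by auto
 then have "finite (insert 0 {z. poly r z = 0})" using poly_roots_finite by blast
 from ex_new_if_finite[OF infinite_UNIV_char_0 this]
 obtain z0 where z0: "z0 ~= 0" "poly r z0 ~= 0" by auto
 show ?thesis
  unfolding verblunsky_def e c_def[symmetric]
 proof (rule the_equality)
  show "\<forall>z. z ~= 0 --> poly (szego c (Suc k)) z = z * poly (szego c k) z - cnj (szego_alpha c k) * ?f z"
   unfolding szego_Suc_alpha r_def[symmetric] by (simp add: r)
  fix \<alpha> assume *: "\<forall>z. z ~= 0 --> poly (szego c (Suc k)) z = z * poly (szego c k) z - cnj \<alpha> * ?f z"
  have "cnj (szego_alpha c k) * poly r z0 = cnj \<alpha> * poly r z0"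
   using *[rule_format, OF z0(1)] unfolding szego_Suc_alpha r_def[symmetric] r[OF z0(1), symmetric] by simp
  then show "\<alpha> = szego_alpha c k" using z0 by simp
 qed
qed

text \<open>The product over the support is monic of degree \<open>n\<close> and vanishes almost
  everywhere, hence it is orthogonal to every power; uniqueness does the rest.\<close>

lemma poly_szego_full: "poly (szego (circle_moment m) n) z = (\<Prod>s\<in>supp m. z - s)"
proof -
 define q where "q = (\<Prod>s\<in>supp m. [:- s, 1:])"
 have q0: "poly q s = 0" if "s \<in> supp m" for s
  unfolding q_def poly_prod using fin that by (intro prod_zero) auto
 have "degree q = n" unfolding q_def using fin card by (subst degree_prod_eq_sum_degree) auto
 moreover have "lead_coeff q = 1" by (simp add: q_def lead_coeff_prod)
 moreover have "circle_orthogonal q n"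
  unfolding circle_orthogonal_def
 proof (intro allI impI)
  fix j
  have "(\<integral>z. poly q z * cnj (z ^ j) \<partial>m) = (\<integral>z. 0 \<partial>m)"
  proof (rule integral_cong_AE)
   show "AE z in m. poly q z * cnj (z ^ j) = 0" using emeasure_outside_supp by eventually_elim (simp add: q0)
   show "(%z. poly q z * cnj (z ^ j)) \<in> borel_measurable m"
    by (intro borel_measurable_integrable integrable_circle[OF m] continuous_intros)
  qed simp
  then show "(\<integral>z. poly q z * cnj (z ^ j) \<partial>m) = 0" by simp
 qed
 ultimately have "q = szego (circle_moment m) n" by (intro monic_orthogonal_unique) auto
 then have "poly (szego (circle_moment m) n) z = poly q z" by simp
 then show ?thesis by (simp add: q_def poly_prod)
qed

text \<open>If \<open>p = (z - 1) q\<close> is orthogonal to \<open>q\<close>, then \<open>z q\<close> and \<open>q\<close> have equal norms and inner product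
 equal to its square, so \<open>p\<close> vanishes almost everywhere.\<close>
lemma poly_szego_1_nz:
 assumes k: "k < n" shows "poly (szego (circle_moment m) k) 1 ~= 0"
proof
 define p where "p = szego (circle_moment m) k"
 assume "poly (szego (circle_moment m) k) 1 = 0"
 then have "[:- 1, 1:] dvd p" unfolding p_def poly_eq_0_iff_dvd by simp
 then obtain q where q: "p = [:- 1, 1:] * q" by (auto elim: dvdE)
 have p0: "p ~= 0" using lead_coeff_szego[of "circle_moment m" k] by (auto simp: p_def)
 then have "q ~= 0" using q by auto
 then have "degree p = Suc (degree q)" unfolding q by (subst degree_mult_eq) auto
 then have dq: "degree q < k" by (simp add: p_def degree_szego)
 let ?f = "\<integral>z. poly p z * cnj (poly q z) \<partial>m"
 have "?f = (\<Sum>j\<le>degree q. cnj (coeff q j) * (\<integral>z. poly p z * cnj (z ^ j) \<partial>m))"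
  by (intro integral_cnj_poly) (auto intro!: continuous_intros)
 also have "... = 0" using szego_orthogonal[of k] k dq by (intro sum.neutral) (auto simp: circle_orthogonal_def p_def)
 finally have pq: "?f = 0" .
 have "(\<integral>z. (cmod (poly p z))\<^sup>2 \<partial>m) = (\<integral>z. - 2 * Re (poly p z * cnj (poly q z)) \<partial>m)"
 proof (rule integral_cong_AE)
  show "AE z in m. (cmod (poly p z))\<^sup>2 = - 2 * Re (poly p z * cnj (poly q z))"
   using AE_circle
  proof eventually_elim
   case (elim z)
   define u where "u = poly q z"
   have pz: "poly p z = (z - 1) * u" by (simp add: q u_def algebra_simps)
   have n: "(Re z)\<^sup>2 + (Im z)\<^sup>2 = 1" using elim by (metis cmod_power2 one_power2)
   have "(cmod ((z - 1) * u))\<^sup>2 = (cmod (z - 1))\<^sup>2 * (cmod u)\<^sup>2" by (simp add: norm_mult power_mult_distrib)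
   also have "(cmod (z - 1))\<^sup>2 = - 2 * Re (z - 1)"       proof -
    have "(cmod (z - 1))\<^sup>2 = (Re z - 1)\<^sup>2 + (Im z)\<^sup>2" by (simp add: cmod_power2)
    also have "... = - 2 * Re (z - 1)" using n by (simp add: power2_eq_square algebra_simps)
    finally show ?thesis .
   qed
   also have "- 2 * Re (z - 1) * (cmod u)\<^sup>2 = - 2 * Re ((z - 1) * u * cnj u)"
   proof -
    have "(z - 1) * u * cnj u = (z - 1) * of_real ((cmod u)\<^sup>2)" by (simp only: mult.assoc complex_norm_square)
    moreover have "Re ((z - 1) * of_real r) = Re (z - 1) * r" for r by simp
    ultimately show ?thesis by (simp only: mult.assoc)
   qed
   finally show ?case by (simp add: pz u_def)
  qed
  show "(%z. (cmod (poly p z))\<^sup>2) \<in> borel_measurable m" "(%z. - 2 * Re (poly p z * cnj (poly q z))) \<in> borel_measurable m"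
   by (intro borel_measurable_integrable integrable_circle[OF m] continuous_intros)+
 qed
 also have "... = - 2 * Re ?f"
  by (subst integral_mult_right_zero, subst integral_Re) (auto intro!: integrable_circle[OF m] continuous_intros)
 finally have "(\<integral>z. (cmod (poly p z))\<^sup>2 \<partial>m) = 0" using pq by simp
 then have "p = 0" using poly_eq_0_of_supp[OF _ fin card] k by (auto simp: p_def degree_szego)
 then show False using p0 by simp
qed

lemma modified_verblunsky_eq:
 assumes "k < n" shows "modified_verblunsky n m k = modified_coeffs (szego_alpha (circle_moment m)) k"
proof -
 have "modified_coeffs (verblunsky m) j = modified_coeffs (szego_alpha (circle_moment m)) j" if "j < n" for j
  using that
 proof (induction j rule: less_induct)
  case (less j)
  then have "(\<Prod>i<j. (1 - cnj (modified_coeffs (verblunsky m) i)) / (1 - modified_coeffs (verblunsky m) i))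
   = (\<Prod>i<j. (1 - cnj (modified_coeffs (szego_alpha (circle_moment m)) i)) / (1 - modified_coeffs (szego_alpha (circle_moment m)) i))"
   by (intro prod.cong) auto
  then show ?case using less.prems by (subst (1 2) modified_coeffs.simps) (simp add: verblunsky_eq)
 qed
 then show ?thesis using assms fin card by (simp add: modified_verblunsky_def)
qed

text \<open>The values \<open>P k\<close> at 1 satisfy \<open>P (Suc k) = P k * (1 - g k)\<close>,
  because the modified coefficient absorbs the phase of \<open>P k\<close>. They are nonzero below
  \<open>n\<close> and the value at \<open>n\<close> is 0, which forces the last factor to
  vanish.\<close>

lemma modified_verblunsky_last:
 assumes "1 \<in> supp m" shows "modified_verblunsky n m (n - 1) = 1"
proof -
 define c where "c = circle_moment m"
 define g where "g = modified_coeffs (szego_alpha c)"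
 define P where "P k = poly (szego c k) 1" for k
 have nz: "P k ~= 0" if "k < n" for k using poly_szego_1_nz[OF that] by (simp add: P_def c_def)
 have n: "0 < n" using assms fin card by (metis card_gt_0_iff empty_iff)
 have rec: "P (Suc k) = P k - cnj (szego_alpha c k) * cnj (P k)" for k
  unfolding P_def szego_Suc_alpha using poly_reversed_poly_circle[of "szego c k" k 1] by (simp add: degree_szego)
 have PG: "P (Suc k) = P k * (1 - g k) & P k = (\<Prod>j<k. 1 - g j)" if "k < n" for k
  using that
 proof (induction k rule: less_induct)
  case (less k)
  have Pk: "P k = (\<Prod>j<k. 1 - g j)"
  proof (cases k)
   case (Suc l)
   then have "P k = P l * (1 - g l)" "P l = (\<Prod>j<l. 1 - g j)" using less.IH[of l] less.prems by auto
   then show ?thesis by (simp add: Suc)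
  qed (simp add: P_def)
  have "(\<Prod>j<k. (1 - cnj (g j)) / (1 - g j)) = cnj (P k) / P k" by (simp add: Pk prod_dividef)
  then have "g k = cnj (szego_alpha c k) * (cnj (P k) / P k)" unfolding g_def by (subst modified_coeffs.simps) simp
  then have "P k * (1 - g k) = P (Suc k)" using nz[OF less.prems] by (simp add: rec algebra_simps)
  then show ?case using Pk by simp
 qed
 have "P n = 0" unfolding P_def c_def poly_szego_full using assms fin by (intro prod_zero) auto
 moreover have "P n = P (n - 1) * (1 - g (n - 1))" using PG[of "n - 1"] n by simp
 ultimately have "g (n - 1) = 1" using nz[of "n - 1"] n by simp
 then show ?thesis using modified_verblunsky_eq[of "n - 1"] n by (simp add: g_def c_def)
qed

end

text \<open>A measure has exactly \<open>n\<close> support points when the norms of its Szego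
  polynomials vanish for the first time at degree \<open>n\<close>. Norms depend measurably on the
  measure, and so the number of support points does.\<close>

lemma card_supp_iff:
 "finite (supp m) & card (supp m) = n \<longleftrightarrow>
   (\<forall>k<n. (\<integral>z. (cmod (poly (szego (circle_moment m) k) z))\<^sup>2 \<partial>m) ~= 0) & (\<integral>z. (cmod (poly (szego (circle_moment m) n) z))\<^sup>2 \<partial>m) = 0"
proof -
 let ?e = "%k. \<integral>z. (cmod (poly (szego (circle_moment m) k) z))\<^sup>2 \<partial>m"
 have fwd: "(\<forall>k<n. ?e k ~= 0) & ?e n = 0" if fc: "finite (supp m)" "card (supp m) = n" for n
 proof (intro conjI allI impI notI)
  fix k assume k: "k < n" "?e k = 0"
  then have "szego (circle_moment m) k = 0"
   using poly_eq_0_of_supp[OF k(2) fc] by (simp add: degree_szego)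
  then show False using lead_coeff_szego[of "circle_moment m" k] by simp
 next
  have "?e n = (\<integral>z. 0 \<partial>m)"
  proof (rule integral_cong_AE)
   show "AE z in m. (cmod (poly (szego (circle_moment m) n) z))\<^sup>2 = 0"
    using emeasure_outside_supp
   proof eventually_elim
    case (elim z)
    then show ?case unfolding poly_szego_full[OF fc] using fc(1) by (auto intro!: prod_zero)
   qed
   show "(%z. (cmod (poly (szego (circle_moment m) n) z))\<^sup>2) \<in> borel_measurable m"
    by (intro borel_measurable_integrable integrable_circle[OF m] continuous_intros)
  qed simp
  then show "?e n = 0" by simp
 qed
 show ?thesis
 proof
  assume "finite (supp m) & card (supp m) = n"
  then show "(\<forall>k<n. ?e k ~= 0) & ?e n = 0" using fwd by blast
 next
  assume e: "(\<forall>k<n. ?e k ~= 0) & ?e n = 0"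
  have nz: "szego (circle_moment m) n ~= 0" using lead_coeff_szego[of "circle_moment m" n] by auto
  have sub: "supp m \<subseteq> {z. poly (szego (circle_moment m) n) z = 0}" by (rule integral_norm_poly_eq_0) (use e in simp)
  then have fin: "finite (supp m)" using poly_roots_finite[OF nz] finite_subset by blast
  have "card (supp m) \<le> card {z. poly (szego (circle_moment m) n) z = 0}" by (intro card_mono poly_roots_finite nz sub)
  also have "... \<le> n" using card_poly_roots_bound[OF nz] by (simp add: degree_szego)
  finally have le: "card (supp m) \<le> n" .
  have "\<not> card (supp m) < n"
  proof
   assume lt: "card (supp m) < n"
   have "?e (card (supp m)) = 0" using fwd[OF fin refl] by simp
   then show False using e lt by blast
  qed
  then show "finite (supp m) & card (supp m) = n" using fin le by simp
 qed
qed

end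

lemma measurable_szego_circle:
 "(%m. coeff (szego (circle_moment m) k) i) \<in> borel_measurable circle_measures"
 "(%m. szego_alpha (circle_moment m) k) \<in> borel_measurable circle_measures"
proof -
 have "(%m. circle_moment m j) \<in> borel_measurable circle_measures" for j
  unfolding circle_moment_def by (intro measurable_integral_circle continuous_intros)
 then show "(%m. coeff (szego (circle_moment m) k) i) \<in> borel_measurable circle_measures"
  "(%m. szego_alpha (circle_moment m) k) \<in> borel_measurable circle_measures"
  by (auto intro: measurable_szego_coeff)
qed

lemma measurable_card_supp: "Measurable.pred circle_measures (%m. finite (supp m) & card (supp m) = n)"
proof -
 let ?f = "%m k. \<integral>z. (cmod (poly (szego (circle_moment m) k) z))\<^sup>2 \<partial>m"
 let ?g = "%k m I. Re (\<Sum>j\<le>k. cnj (coeff (szego (circle_moment m) k) j) * (\<Sum>i\<le>k. coeff (szego (circle_moment m) k) i * I m i j))"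
 have [measurable]: "(%m. ?f m k) \<in> borel_measurable circle_measures" for k
 proof -
  define I where "I m i j = (\<integral>z. z ^ i * cnj (z ^ j) \<partial>m)" for m :: "complex measure" and i j
  note measurable_szego_circle(1)[measurable]
  have [measurable]: "(%m. I m i j) \<in> borel_measurable circle_measures" for i j
   unfolding I_def by (intro measurable_integral_circle continuous_intros)
  have "?f m k = ?g k m I"
   if m: "m \<in> space circle_measures" for m
  proof -
   let ?p = "szego (circle_moment m) k"
   let ?h = "%m. of_real (\<integral>z. (cmod (poly ?p z))\<^sup>2 \<partial>m)"
   let ?q = "%j m. \<integral>z. poly ?p z * cnj (z ^ j) \<partial>m"
   have "?h m = (\<integral>z. poly ?p z * cnj (poly ?p z) \<partial>m)" by (rule norm_sq_integral[OF m, symmetric])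
   also have "... = (\<Sum>j\<le>k. cnj (coeff ?p j) * ?q j m)"
    by (intro integral_cnj_poly[OF m]) (auto simp: degree_szego intro!: continuous_intros)
   finally have eq: "?h m = (\<Sum>j\<le>k. cnj (coeff ?p j) * ?q j m)" .
   have "?q j m = (\<Sum>i\<le>k. coeff ?p i * I m i j)" for j
   proof -
    have "?q j m = (\<integral>z. (\<Sum>i\<le>k. coeff ?p i * (z ^ i * cnj (z ^ j))) \<partial>m)"
     by (simp add: poly_altdef_le[of ?p k] degree_szego sum_distrib_left mult_ac)
    also have "... = (\<Sum>i\<le>k. \<integral>z. coeff ?p i * (z ^ i * cnj (z ^ j)) \<partial>m)"
     by (intro Bochner_Integration.integral_sum integrable_circle[OF m] continuous_intros)
    finally show ?thesis by (simp add: I_def)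
   qed
   then have "?h m = (\<Sum>j\<le>k. cnj (coeff ?p j) * (\<Sum>i\<le>k. coeff ?p i * I m i j))"
    unfolding eq by simp
   then have "Re (?h m) = Re (\<Sum>j\<le>k. cnj (coeff ?p j) * (\<Sum>i\<le>k. coeff ?p i * I m i j))"
    by (rule arg_cong)
   then show ?thesis by (simp only: Re_complex_of_real)
  qed
  moreover have "(%m. ?g k m I) \<in> borel_measurable circle_measures"
   by measurable
  ultimately show ?thesis by (simp cong: measurable_cong)
 qed
 have "Measurable.pred circle_measures (%m. (\<forall>k<n. (?f m k) ~= 0) & (\<integral>z. (cmod (poly (szego (circle_moment m) n) z))\<^sup>2 \<partial>m) = 0)" by measurable
 then show ?thesis by (subst measurable_cong[OF card_supp_iff]) auto
qed

lemma measurable_modified_verblunsky: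
 assumes "k < n" shows "(%m. modified_verblunsky n m k) \<in> borel_measurable circle_measures"
proof -
 note measurable_card_supp[measurable]
 have [measurable]: "(%m. modified_coeffs (szego_alpha (circle_moment m)) k) \<in> borel_measurable circle_measures"
  by (intro measurable_modified_coeffs measurable_szego_circle)
 let ?f = "%m. if finite (supp m) & card (supp m) = n then modified_coeffs (szego_alpha (circle_moment m)) k else 0"
 have "(%m. ?f m) \<in> borel_measurable circle_measures"
  by measurable
 moreover have "modified_verblunsky n m k = ?f m"
  if "m \<in> space circle_measures" for m
  using modified_verblunsky_eq[OF that _ _ assms] by (auto simp: modified_verblunsky_def)
 ultimately show ?thesis by (simp cong: measurable_cong)
qed

section \<open>The half-plane integral in the disk\<close>

lemma measurable_Complex [measurable (raw)]:
 assumes [measurable]: "f \<in> borel_measurable M" "g \<in> borel_measurable M"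
 shows "(%w. Complex (f w) (g w)) \<in> borel_measurable M"
 unfolding Complex_eq by measurable

lemma nn_integral_lborel_complex:
 assumes [measurable]: "f \<in> borel_measurable borel"
 shows "(Leb z. f z) = (Leb x. Leb y. f (Complex x y))"
proof -
 let ?f = "lborel \<Otimes>\<^sub>M lborel"
 let ?g = "%p. Complex (fst p) (snd p)"
 have "lborel = distr ?f borel ?g"
 proof (rule lborel_eqI)
  fix l u :: complex assume "!!b. b \<in> Basis ==> l \<bullet> b \<le> u \<bullet> b"
  from this[of 1] this[of \<i>] have lu: "Re l \<le> Re u" "Im l \<le> Im u" by (auto simp: Basis_complex_def)
  have "?g -` box l u \<inter> space ?f = {Re l<..<Re u} \<times> {Im l<..<Im u}"
   by (auto simp: in_box_complex_iff space_pair_measure)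
  then have "emeasure (distr ?f borel ?g) (box l u) = emeasure ?f ({Re l<..<Re u} \<times> {Im l<..<Im u})"
   by (subst emeasure_distr) auto
  also have "... = ennreal (Re u - Re l) * ennreal (Im u - Im l)"
   using lu by (subst lborel.emeasure_pair_measure_Times) auto
  also have "... = ennreal (\<Prod>b\<in>Basis. (u - l) \<bullet> b)"
   using lu by (simp add: Basis_complex_def ennreal_mult)
  finally show "emeasure (distr ?f borel ?g) (box l u) = (\<Prod>b\<in>Basis. (u - l) \<bullet> b)" .
 qed simp
 then have "(Leb z. f z) = (\<integral>\<^sup>+z. f z \<partial>distr ?f borel ?g)" by simp
 also have "... = (\<integral>\<^sup>+p. f (Complex (fst p) (snd p)) \<partial>?f)"
  by (rule nn_integral_distr) (auto intro!: measurable_Complex)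
 also have "... = (Leb x. Leb y. f (Complex x y))"
  by (subst lborel.nn_integral_fst[symmetric]) simp_all
 finally show ?thesis .
qed

lemma nn_integral_inversion:
 assumes c: "0 < c" and [measurable]: "f \<in> borel_measurable borel"
 shows "(Leb q. if 1 < q then f q else 0)
  = (Leb r. if 0 < r & r * c < 1 then f (1 / (r * c)) * ennreal (1 / (r\<^sup>2 * c)) else 0)"
proof -
 define g where "g r = 1 / (r * c)" for r :: real
 have mem: "r \<in> einterval 0 (1 / c) \<longleftrightarrow> 0 < r & r * c < 1" for r
  using c by (auto simp: einterval_def zero_ereal_def pos_less_divide_eq)
 have img: "g ` einterval 0 (1 / c) = {1<..}"
 proof
  show "g ` einterval 0 (1 / c) \<subseteq> {1<..}" using c by (auto simp: mem g_def)
  show "{1<..} \<subseteq> g ` einterval 0 (1 / c)"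
  proof
   fix q :: real assume "q \<in> {1<..}"
   then show "q \<in> g ` einterval 0 (1 / c)"
    using c by (intro image_eqI[of _ _ "1 / (q * c)"]) (auto simp: mem g_def)
  qed
 qed
 have "(Leb r. f (g r) * ennreal (1 / (r\<^sup>2 * c)) * indicator (einterval 0 (1 / c)) r) = (Leb q. f q * indicator (g ` einterval 0 (1 / c)) q)"
 proof (rule nn_integral_substitution_open_decreasing)
  show "(g has_real_derivative - (1 / (r\<^sup>2 * c))) (at r)" if "r \<in> einterval 0 (1 / c)" for r
  proof -
   have "r ~= 0" using that by (simp add: mem)
   then have "((%r. inverse r * (1 / c)) has_real_derivative - (inverse r * 1 * inverse r) * (1 / c)) (at r)"
    by (intro DERIV_cmult_right DERIV_inverse') (auto intro: derivative_eq_intros)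
   then show ?thesis by (simp add: g_def[abs_def] field_simps power2_eq_square)
  qed
  show "continuous_on (einterval 0 (1 / c)) (%r. 1 / (r\<^sup>2 * c))"
   using c by (intro continuous_intros) (auto simp: mem)
  show "0 < ereal (1 / c)" using c by simp
 qed (use c in \<open>auto simp: g_def[abs_def]\<close>)
 then show ?thesis unfolding img by (simp add: mem g_def indicator_def if_eq_of_bool)
qed

text \<open>The coefficient is 1 - 2 \<i> / (p + \<i> q) with p = - a and q = b + 1 > 1, so an
  inversion has to be performed. It is done one variable at a time: the slope s = p / q replaces p,
  then q = 1 / (r (1 + s^2)), then a new p = r s, and finally X = 1 - 2 r and Y = - 2 p. The
  half-plane q > 1 becomes the unit disk; the Jacobian 1/4 of the last two steps cancels against the
  4 from rewriting the density in X and Y.\<close>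

lemma halfplane_integral_disk:
 assumes h[measurable]: "h \<in> borel_measurable borel"
 shows "halfplane_integral h = (Leb z. h z * ennreal (1 / (cmod (1 - z))\<^sup>2) * indicator (ball 0 1) z)"
proof -
 define k where "k p q = 1 - 2 * \<i> / Complex p q" for p q
 have [measurable (raw)]: "(%w. k (f w) (g w)) \<in> borel_measurable M" if [measurable]: "f \<in> borel_measurable M" "g \<in> borel_measurable M"
  for M :: "(real \<times> real) measure" and f g unfolding k_def by measurable
 have k1[measurable (raw)]: "(%w. k (f w) (g w)) \<in> borel_measurable borel" if [measurable]: "f \<in> borel_measurable borel" "g \<in> borel_measurable borel"
  for f g :: "real => real" unfolding k_def by measurable
 define F where "F p q = h (k p q) * ennreal (1 / (p\<^sup>2 + q\<^sup>2))" for p q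
 have [measurable (raw)]: "(%w. F (f w) (g w)) \<in> borel_measurable M" if [measurable]: "f \<in> borel_measurable M" "g \<in> borel_measurable M"
  for M :: "(real \<times> real) measure" and f g unfolding F_def by measurable
 have F1[measurable (raw)]: "(%w. F (f w) (g w)) \<in> borel_measurable borel" if [measurable]: "f \<in> borel_measurable borel" "g \<in> borel_measurable borel"
  for f g :: "real => real" unfolding F_def by measurable
 have [measurable]: "F p \<in> borel_measurable borel" for p unfolding F_def[abs_def] k_def by measurable
 let ?f = "%X Y. h (Complex X Y) * ennreal (1 / (cmod (1 - Complex X Y))\<^sup>2) * indicator (ball 0 1) (Complex X Y)"
 let ?g = "%r s. if 0 < r & r * (1 + s\<^sup>2) < 1 then h (Complex (1 - 2 * r) (- 2 * (r * s))) * ennreal (1 / (r * (1 + s\<^sup>2))) else 0"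
 let ?h = "%X. Leb p. if (1 / 2 + - 1 / 2 * X)\<^sup>2 + p\<^sup>2 < 1 / 2 + - 1 / 2 * X then h (Complex (1 - 2 * (1 / 2 + - 1 / 2 * X)) (- 2 * p)) * ennreal (1 / ((1 / 2 + - 1 / 2 * X)\<^sup>2 + p\<^sup>2)) else 0"
 let ?p = "%X. Leb Y. ?f X Y"
 let ?q = "%r p. if r\<^sup>2 + p\<^sup>2 < r then h (Complex (1 - 2 * r) (- 2 * p)) * ennreal (1 / (r\<^sup>2 + p\<^sup>2)) else 0"
 let ?r = "%p. Leb q. if 1 < q then F p q else 0"
 let ?s = "%a. Leb b. if 1 < 1 + 1 * b then F (- a) (1 + 1 * b) else 0"
 let ?t = "%s. Leb q. if 1 < q then F (q * s) q * ennreal q else 0"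
 let ?u = "%a. Leb q. if 1 < q then F (0 + - 1 * a) q else 0"
 let ?v = "%r Y X. if r\<^sup>2 + (0 + - 1 / 2 * Y)\<^sup>2 < r then h (Complex X (- 2 * (0 + - 1 / 2 * Y))) * ennreal (1 / (r\<^sup>2 + (0 + - 1 / 2 * Y)\<^sup>2)) else 0"
 let ?w = "%z. h z * ennreal (1 / (cmod (1 - z))\<^sup>2) * indicator (ball 0 1) z"
 let ?k = "Leb X. ennreal 2 * ?p X"
 let ?a = "%r c s. if 0 < r & r * c < 1 then F (1 / (r * c) * s) (1 / (r * c)) * ennreal (1 / (r * c)) * ennreal (1 / (r\<^sup>2 * c)) else 0"
 let ?b = "%X Y. (1 - X)\<^sup>2 + Y\<^sup>2"
 let ?c = "%s. Leb r. ?g r s"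
 let ?d = "%r. Leb s. ?g r s"
 let ?F = "%q. Leb s. if 1 < q then F (q * s) q * ennreal q else 0"
 let ?G = "%r. Leb p. ?q r p"
 have "halfplane_integral h = (Leb a. ?s a)"
  unfolding halfplane_integral_def
 proof (rule nn_integral_cong, rule nn_integral_cong)
  fix a b :: real
  have "halfplane_coeff a b = k (- a) (b + 1)" if "0 < b"
  proof -
   have "Complex (- a) b + \<i> = Complex (- a) (b + 1)" by (simp add: complex_eq_iff)
   then show ?thesis using one_minus_halfplane_coeff[OF that, of a] by (simp add: k_def algebra_simps)
  qed
  then show "(if 0 < b then h (halfplane_coeff a b) * ennreal (1 / (a\<^sup>2 + (b + 1)\<^sup>2)) else 0) = (if 1 < 1 + 1 * b then F (- a) (1 + 1 * b) else 0)"
   by (simp add: F_def add.commute)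
 qed
 also have "... = (Leb a. ?u a)"
 proof (rule nn_integral_cong)
  fix a :: real
  have "(Leb q. if 1 < q then F (- a) q else 0) = ennreal \<bar>1\<bar> * ?s a"
   by (rule nn_integral_real_affine) auto
  moreover have "0 + - 1 * a = - a" by simp
  ultimately show "?s a = ?u a"
   by (simp only: abs_one ennreal_1 mult_1_left)
 qed
 also have "... = (Leb p. ?r p)"
 proof -
  have "(Leb p. ?r p) = ennreal \<bar>- 1\<bar> * (Leb a. ?u a)"
  proof (rule nn_integral_real_affine)
   have "(%p. ?r p) \<in> borel_measurable lborel" unfolding F_def k_def by measurable
   then show "(%p. ?r p) \<in> borel_measurable borel" by simp
  qed simp
  then show ?thesis by simp
 qed
 also have "... = (Leb q. Leb p. if 1 < q then F p q else 0)"
  unfolding F_def k_def by (rule nn_integral_lborel_swap) (measurable, intro_locales)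
 also have "... = (Leb q. ?F q)"
 proof (rule nn_integral_cong)
  fix q :: real
  show "(Leb p. if 1 < q then F p q else 0) = ?F q"
  proof (cases "1 < q")
   case True
   have "(Leb p. F p q) = ennreal \<bar>q\<bar> * (Leb s. F (0 + q * s) q)"
    using True by (intro nn_integral_real_affine) auto
   also have "... = (Leb s. ennreal \<bar>q\<bar> * F (0 + q * s) q)"
   proof (rule nn_integral_cmult[symmetric])
    have "(%s. F (0 + q * s) q) \<in> borel_measurable borel"
     by (rule F1[of "%s. 0 + q * s" "%_. q"]) measurable
    then show "(%s. F (0 + q * s) q) \<in> borel_measurable lborel" by simp
   qed
   finally show ?thesis using True by (simp add: mult.commute)
  qed simp
 qed
 also have "... = (Leb s. ?t s)"
  unfolding F_def k_def by (rule nn_integral_lborel_swap) (measurable, intro_locales)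
 also have "... = (Leb s. ?c s)"
 proof (rule nn_integral_cong)
  fix s :: real
  define c where "c = 1 + s\<^sup>2"
  have c: "0 < c" by (simp add: c_def)
  have "?t s = (Leb r. ?a r c s)"
   by (rule nn_integral_inversion[OF c]) measurable
  also have "... = ?c s"
  proof (rule nn_integral_cong)
   fix r :: real
   show "?a r c s = ?g r s"
   proof (cases "0 < r & r * c < 1")
    case True
    then have r: "0 < r" by simp
    define q where "q = 1 / (r * c)"
    have q: "0 < q" using r c by (simp add: q_def)
    have "Complex (q * s) q = of_real q * (of_real s + \<i>)" by (simp add: complex_eq_iff)
    then have "2 * \<i> / Complex (q * s) q = 2 * \<i> / (of_real q * (of_real s + \<i>))" by simp
    also have "... = 2 * \<i> * of_real r * (of_real s - \<i>)"
    proof -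
     have "(of_real s + \<i>) * (of_real s - \<i>) = complex_of_real c" by (simp add: c_def algebra_simps power2_eq_square)
     moreover have "complex_of_real q * of_real r * of_real c = 1" using r c by (simp add: q_def)
     ultimately have "of_real q * (of_real s + \<i>) * (of_real r * (of_real s - \<i>)) = 1"
      by (metis (no_types, lifting) mult.assoc mult.left_commute)
     moreover have "of_real q * (of_real s + \<i>) ~= 0" using q by simp
     moreover have "2 * \<i> / D = 2 * \<i> * R * E" if "D * (R * E) = 1" "D ~= 0" for D R E :: complex
     proof -
      have "R * E = 1 / D" using that by (simp add: nonzero_eq_divide_eq mult.commute)
      then have "2 * \<i> * (R * E) = 2 * \<i> / D" by simp
      then show ?thesis by (simp only: mult.assoc)
     qed
     ultimately show ?thesis by blast
    qed
    finally have "k (q * s) q = Complex (1 - 2 * r) (- 2 * (r * s))" by (simp add: k_def complex_eq_iff)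
    moreover have "1 / ((q * s)\<^sup>2 + q\<^sup>2) * q * (1 / (r\<^sup>2 * c)) = 1 / (r * c)"
    proof -
     have "(q * s)\<^sup>2 + q\<^sup>2 = q\<^sup>2 * c" by (simp add: c_def power_mult_distrib algebra_simps)
     then have "1 / ((q * s)\<^sup>2 + q\<^sup>2) * q = 1 / (q * c)" using q c by (simp add: power2_eq_square)
     also have "... = r" using r c by (simp add: q_def)
     finally show ?thesis using r c by (simp add: power2_eq_square)
    qed
    then have "ennreal (1 / ((q * s)\<^sup>2 + q\<^sup>2)) * ennreal q * ennreal (1 / (r\<^sup>2 * c)) = ennreal (1 / (r * c))"
     using q r c by (simp add: ennreal_mult[symmetric])
    ultimately show ?thesis using True by (simp add: F_def q_def[symmetric] c_def[symmetric] mult.assoc)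
   next
    case False
    then show ?thesis by (simp only: c_def if_False)
   qed
  qed
  finally show "?t s = ?c s" .
 qed
 also have "... = (Leb r. ?d r)"
  by (rule nn_integral_lborel_swap) (measurable, intro_locales)
 also have "... = (Leb r. ?G r)"
 proof (rule nn_integral_cong)
  fix r :: real
  define L where "L p = ?q r p" for p
  show "?d r = (Leb p. L p)"
  proof (cases "0 < r")
   case True
   have "(Leb p. L p) = ennreal \<bar>r\<bar> * (Leb s. L (0 + r * s))"
    using True by (intro nn_integral_real_affine) (auto simp: L_def)
   also have "... = (Leb s. ennreal \<bar>r\<bar> * L (0 + r * s))"
   proof (rule nn_integral_cmult[symmetric])
    have "(%s. L (0 + r * s)) \<in> borel_measurable borel" unfolding L_def by measurable
    then show "(%s. L (0 + r * s)) \<in> borel_measurable lborel" by simp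
   qed
   also have "... = ?d r"
   proof (rule nn_integral_cong)
    fix s :: real
    have e: "r\<^sup>2 + (r * s)\<^sup>2 = r * (r * (1 + s\<^sup>2))" by (simp add: power2_eq_square algebra_simps)
    have 1: "r\<^sup>2 + (r * s)\<^sup>2 < r \<longleftrightarrow> r * (1 + s\<^sup>2) < 1" unfolding e using True mult_less_cancel_left_pos[OF True, of "r * (1 + s\<^sup>2)" 1] by simp
    have "r * (1 / (r * (r * (1 + s\<^sup>2)))) = 1 / (r * (1 + s\<^sup>2))" using True by simp
    then have 2: "ennreal r * ennreal (1 / (r\<^sup>2 + (r * s)\<^sup>2)) = ennreal (1 / (r * (1 + s\<^sup>2)))"
     unfolding e using True by (simp add: ennreal_mult[symmetric] del: distrib_left)
    show "ennreal \<bar>r\<bar> * L (0 + r * s) = ?g r s"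
     unfolding L_def add_0 1 2[symmetric] using True by (simp add: mult_ac)
   qed
   finally show ?thesis by simp
  next
   case False
   have "\<not> r\<^sup>2 + p\<^sup>2 < r" for p using False zero_le_power2[of r] zero_le_power2[of p] by linarith
   then show ?thesis using False by (simp add: L_def)
  qed
 qed
 also have "... = ennreal \<bar>- 1 / 2\<bar> * (Leb X. ?h X)"
 proof (rule nn_integral_real_affine)
  have "(%r. ?G r) \<in> borel_measurable lborel" by measurable
  then show "(%r. ?G r) \<in> borel_measurable borel" by simp
 qed simp
 also have "(Leb X. ?h X) = ?k"
 proof (rule nn_integral_cong)
  fix X :: real
  define r where "r = 1 / 2 + - 1 / 2 * X"
  have X: "1 - 2 * r = X" by (simp add: r_def)
  have "(Leb p. if r\<^sup>2 + p\<^sup>2 < r then h (Complex X (- 2 * p)) * ennreal (1 / (r\<^sup>2 + p\<^sup>2)) else 0) = ennreal \<bar>- 1 / 2\<bar> * (Leb Y. ?v r Y X)"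
   by (rule nn_integral_real_affine) auto
  also have "... = ennreal (1 / 2) * (Leb Y. ennreal 4 * ?f X Y)"
  proof (intro arg_cong2[where f="(*)"] nn_integral_cong)
   fix Y :: real
   have a: "(cmod (1 - Complex X Y))\<^sup>2 = ?b X Y" by (simp add: cmod_power2)
   have b: "r\<^sup>2 + (0 + - 1 / 2 * Y)\<^sup>2 = ?b X Y / 4" by (simp add: r_def power2_eq_square field_simps)
   have c: "Complex X Y \<in> ball 0 1 \<longleftrightarrow> X\<^sup>2 + Y\<^sup>2 < 1"
    by (simp add: dist_norm complex_norm)
   have d: "?b X Y / 4 < r \<longleftrightarrow> Complex X Y \<in> ball 0 1"
   proof -
    have "?b X Y / 4 < r \<longleftrightarrow> (1 - X)\<^sup>2 + Y\<^sup>2 < 4 * r" by (simp add: pos_divide_less_eq mult.commute)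
    also have "4 * r = 2 - 2 * X" by (simp add: r_def)
    finally show ?thesis unfolding c by (simp add: power2_eq_square algebra_simps)
   qed
   have e: "ennreal (1 / (?b X Y / 4)) = ennreal 4 * ennreal (1 / ?b X Y)"
    by (subst ennreal_mult[symmetric]) auto
   show "?v r Y X = ennreal 4 * ?f X Y"
    unfolding b d a e by (simp add: mult_ac)
  qed simp
  also have "... = ennreal 2 * ?p X"
  proof -
   have cm: "(%Y. Complex X Y) \<in> borel_measurable borel" by (rule measurable_Complex) auto
   have fm: "(%z. ?w z) \<in> borel_measurable borel"
    using borel_measurable_indicator[of "ball (0::complex) 1" borel] by (intro borel_measurable_times_ennreal) (measurable, simp_all)
   have "(%Y. ?f X Y) \<in> borel_measurable borel"
    by (rule measurable_compose[OF cm fm])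
   then have "(Leb Y. ennreal 4 * ?f X Y) = ennreal 4 * ?p X"
    by (intro nn_integral_cmult) simp
   moreover have "ennreal (1 / 2) * ennreal 4 = ennreal 2" by (subst ennreal_mult[symmetric]) auto
   ultimately show ?thesis by (simp only: mult.assoc[symmetric])
  qed
  finally show "?h X = ennreal 2 * ?p X"
   unfolding r_def[symmetric] X .
 qed
 also have "ennreal \<bar>- 1 / 2\<bar> * ?k = (Leb X. ?p X)"
 proof -
  have "(%X. ?p X) \<in> borel_measurable lborel"
  proof (rule lborel.borel_measurable_nn_integral)
   have "(%z. ?w z) \<in> borel_measurable borel"
    using borel_measurable_indicator[of "ball (0::complex) 1" borel] by (intro borel_measurable_times_ennreal) (measurable, simp_all)
   from measurable_compose[OF measurable_Complex[OF measurable_fst measurable_snd] this]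
   show "(%(X, Y). ?f X Y) \<in> borel_measurable (lborel \<Otimes>\<^sub>M lborel)"
    by (simp add: split_beta' cong: measurable_cong_sets)
  qed
  then have "?k = ennreal 2 * (Leb X. ?p X)"
   by (intro nn_integral_cmult)
  moreover have "ennreal \<bar>- 1 / 2\<bar> * ennreal 2 = 1" by (subst ennreal_mult[symmetric]) auto
  ultimately show ?thesis by (simp only: mult.assoc[symmetric] mult_1_left)
 qed
 also have "... = (Leb z. ?w z)"
  using borel_measurable_indicator[of "ball (0::complex) 1" borel]
  by (intro nn_integral_lborel_complex[symmetric] borel_measurable_times_ennreal) (measurable, simp_all)
 finally show ?thesis .
qed

section \<open>Uniform measure on the circle\<close>

abbreviation unif_nn (binder "Unif " 10) where "unif_nn \<equiv> nn_integral circle_uniform"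

lemma measurable_cis_circle [measurable]: "cis \<in> borel \<rightarrow>\<^sub>M circle_borel"
 unfolding circle_borel_def
 by (rule measurable_restrict_space2) (auto intro!: borel_measurable_continuous_onI continuous_intros)

lemma measurable_cayley_circle [measurable]: "cayley \<in> borel \<rightarrow>\<^sub>M circle_borel"
 unfolding circle_borel_def by (rule measurable_restrict_space2) auto

lemma sets_circle_uniform [simp, measurable_cong]: "sets circle_uniform = sets circle_borel"
 by (simp add: circle_uniform_def)

lemma space_circle_uniform [simp]: "space circle_uniform = sphere 0 1"
 by (simp add: circle_uniform_def)

lemma measurable_cis_uniform: "cis \<in> uniform_measure lborel {0..<2 * pi} \<rightarrow>\<^sub>M circle_borel"
 by (subst measurable_cong_sets[OF sets_uniform_measure refl]) simp

lemma nn_integral_circle_uniform: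
 assumes [measurable]: "f \<in> borel_measurable circle_borel"
 shows "(Unif z. f z) = (Leb t. f (cis t) * indicator {0..<2 * pi} t) / ennreal (2 * pi)"
 unfolding circle_uniform_def
 by (subst nn_integral_distr[OF measurable_cis_uniform], simp, subst nn_integral_uniform_measure) simp_all

interpretation circ: prob_space circle_uniform
 unfolding circle_uniform_def
 by (rule prob_space.prob_space_distr, rule prob_space_uniform_measure) (auto simp: measurable_cis_uniform)

lemma exists_cis: "cmod u = 1 ==> \<exists>t\<in>{0..<2 * pi}. u = cis t"
 using Arg2pi[of u] complex_norm_eq_1_exp[of u] by (intro bexI[of _ "Arg2pi u"]) (auto simp: cis_conv_exp)

lemma measurable_circle_mult [measurable (raw)]:
 assumes f: "f \<in> M \<rightarrow>\<^sub>M circle_borel" and g: "g \<in> M \<rightarrow>\<^sub>M circle_borel"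
 shows "(%w. f w * g w) \<in> M \<rightarrow>\<^sub>M circle_borel" "(%w. f w / g w) \<in> M \<rightarrow>\<^sub>M circle_borel"
proof -
 have [measurable]: "f \<in> borel_measurable M" "g \<in> borel_measurable M"
  using f g unfolding circle_borel_def by (auto simp: measurable_restrict_space2_iff)
 have "cmod (f w) = 1" "cmod (g w) = 1" if "w \<in> space M" for w
  using measurable_space[OF f that] measurable_space[OF g that] by auto
 then show "(%w. f w * g w) \<in> M \<rightarrow>\<^sub>M circle_borel" "(%w. f w / g w) \<in> M \<rightarrow>\<^sub>M circle_borel"
  unfolding circle_borel_def by (auto intro!: measurable_restrict_space2 simp: norm_mult norm_divide)
qed

text \<open>The angle is shifted, and the part of the interval that sticks out beyond a full turn is
  brought back by periodicity.\<close>

lemma circle_uniform_rotate: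
 assumes u: "cmod u = 1" and f[measurable]: "f \<in> borel_measurable circle_borel"
 shows "(Unif z. f (u * z)) = (Unif z. f z)"
proof -
 obtain a where a: "0 \<le> a" "a < 2 * pi" "u = cis a" using exists_cis[OF u] by auto
 have [measurable]: "(%z. u * z) \<in> circle_borel \<rightarrow>\<^sub>M circle_borel"
  using u by (intro measurable_circle_mult) auto
 let ?f = "Leb t. f (cis t) * indicator {2 * pi..<2 * pi + a} t"
 let ?g = "Leb t. f (cis t) * indicator {a..<2 * pi} t"
 let ?h = "%t. f (cis (2 * pi + 1 * t)) * indicator {2 * pi..<2 * pi + a} (2 * pi + 1 * t)"
 have "(Leb t. f (u * cis t) * indicator {0..<2 * pi} t) = (Leb t. f (cis (a + 1 * t)) * indicator {a..<2 * pi + a} (a + 1 * t))"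
  by (intro nn_integral_cong) (auto simp: a cis_mult indicator_def)
 also have "... = (Leb t. f (cis t) * indicator {a..<2 * pi + a} t)"
  by (subst (2) nn_integral_real_affine[where c=1 and t=a]) auto
 also have "... = (Leb t. f (cis t) * indicator {a..<2 * pi} t + f (cis t) * indicator {2 * pi..<2 * pi + a} t)"
  using a by (intro nn_integral_cong) (auto simp: indicator_def)
 also have "... = ?g + ?f"
  by (intro nn_integral_add) auto
 also have "?f = (Leb t. ?h t)"
  by (subst nn_integral_real_affine[where c=1 and t="2 * pi"]) auto
 also have "... = (Leb t. f (cis t) * indicator {0..<a} t)"
 proof (intro nn_integral_cong)
  fix t
  have "cis (2 * pi + t) = cis t" by (simp add: cis_mult[symmetric])
  then show "?h t = f (cis t) * indicator {0..<a} t"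
   by (simp add: indicator_def)
 qed
 also have "?g + ... = (Leb t. f (cis t) * indicator {a..<2 * pi} t + f (cis t) * indicator {0..<a} t)"
  by (intro nn_integral_add[symmetric]) auto
 also have "... = (Leb t. f (cis t) * indicator {0..<2 * pi} t)"
  using a by (intro nn_integral_cong) (auto simp: indicator_def)
 finally show ?thesis by (simp add: nn_integral_circle_uniform)
qed

text \<open>The half-angle form of the Cayley transform: the angle 0, that is the point 1, sits at
  infinity of the line.\<close>

lemma cayley_tan:
 assumes "0 < t" "t < 2 * pi" shows "cayley (tan ((t - pi) / 2)) = cis t"
proof -
 define s where "s = (t - pi) / 2"
 have c: "cos s > 0" using assms by (intro cos_gt_zero_pi) (auto simp: s_def)
 have "cayley (tan s) = (of_real (sin s) - \<i> * of_real (cos s)) / (of_real (sin s) + \<i> * of_real (cos s))"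
 proof -
  have "(S / K - \<i>) / (S / K + \<i>) = (S - \<i> * K) / (S + \<i> * K)" if "K ~= 0" for S K :: complex
  proof -
   have "S / K - \<i> = (S - \<i> * K) / K" "S / K + \<i> = (S + \<i> * K) / K" using that by (simp_all add: field_simps)
   then show ?thesis using that by simp
  qed
  from this[of "of_real (cos s)" "of_real (sin s)"] show ?thesis using c by (simp add: cayley_def tan_def)
 qed
 also have "of_real (sin s) - \<i> * of_real (cos s) = - \<i> * cis s" by (simp add: complex_eq_iff)
 also have "of_real (sin s) + \<i> * of_real (cos s) = \<i> * cis (- s)" by (simp add: complex_eq_iff)
 also have "- \<i> * cis s / (\<i> * cis (- s)) = - cis (2 * s)"
  by (simp add: cis_divide)
 also have "... = cis (2 * s + pi)" by (simp add: cis_mult[symmetric])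
 also have "2 * s + pi = t" by (simp add: s_def field_simps)
 finally show ?thesis by (simp add: s_def)
qed

text \<open>On the line the uniform distribution of the circle is the Cauchy distribution.\<close>

lemma nn_integral_circle_uniform_cayley:
 assumes [measurable]: "f \<in> borel_measurable circle_borel"
 shows "(Unif z. f z) = (Leb x. f (cayley x) * ennreal (1 / (pi * (1 + x\<^sup>2))))"
proof -
 define g where "g t = tan ((t - pi) / 2)" for t
 define g' where "g' t = (1 + (g t)\<^sup>2) / 2" for t
 define F where "F x = f (cayley x) * ennreal (1 / (pi * (1 + x\<^sup>2)))" for x
 have mem: "t \<in> einterval 0 (2 * pi) \<longleftrightarrow> 0 < t & t < 2 * pi" for t
  unfolding einterval_def by (simp add: zero_ereal_def times_ereal.simps(1)[symmetric] del: times_ereal.simps)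
    (metis ereal_less(2) less_ereal.simps(1) numeral_eq_ereal times_ereal.simps(1) zero_ereal_def)
 have cpos: "cos ((t - pi) / 2) > 0" if "t \<in> einterval 0 (2 * pi)" for t
  using that by (intro cos_gt_zero_pi) (auto simp: mem)
 have cne: "cos ((t - pi) / 2) ~= 0" if "t \<in> einterval 0 (2 * pi)" for t using cpos[OF that] by simp
 have img: "g ` einterval 0 (2 * pi) = UNIV"
 proof -
  have "x \<in> g ` einterval 0 (2 * pi)" for x
  proof (rule image_eqI)
   show "x = g (2 * arctan x + pi)" by (simp add: g_def tan_arctan)
   show "2 * arctan x + pi \<in> einterval 0 (2 * pi)" using arctan_bounded[of x] by (simp add: mem)
  qed
  then show ?thesis by blast
 qed
 have der: "(g has_real_derivative g' t) (at t)" if "t \<in> einterval 0 (2 * pi)" for t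
 proof -
  have "(g has_real_derivative inverse ((cos ((t - pi) / 2))\<^sup>2) * (1 / 2)) (at t)"
   unfolding g_def[abs_def] using cpos[OF that]
   by (intro DERIV_chain2[OF DERIV_tan]) (auto intro!: derivative_eq_intros)
  moreover have "inverse ((cos ((t - pi) / 2))\<^sup>2) = 1 + (g t)\<^sup>2"
   using cpos[OF that] tan_sec[of "(t - pi) / 2"] by (simp add: g_def power_inverse)
  ultimately show ?thesis by (simp add: g'_def)
 qed
 have [measurable]: "g \<in> borel_measurable borel" unfolding g_def[abs_def] tan_def by measurable
 have [measurable]: "g' \<in> borel_measurable borel" unfolding g'_def[abs_def] by measurable
 have [measurable]: "F \<in> borel_measurable borel" unfolding F_def[abs_def] by measurable
 have "(Leb x. F x * indicator (g ` einterval 0 (2 * pi)) x) = (Leb t. F (g t) * ennreal (g' t) * indicator (einterval 0 (2 * pi)) t)"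
 proof (rule nn_integral_substitution_open[symmetric])
  show "continuous_on (einterval 0 (2 * pi)) g'"
   unfolding g'_def g_def using cne by (intro continuous_intros) auto
  show "0 < ereal (2 * pi)" by simp
 qed (use der in \<open>auto simp: g'_def\<close>)
 also have "... = (Leb t. f (cis t) * indicator {0..<2 * pi} t * ennreal (1 / (2 * pi)))"
 proof (rule nn_integral_cong_AE)
  have "AE t in lborel. t ~= (0::real)" by (rule AE_lborel_singleton)
  then show "AE t in lborel. F (g t) * ennreal (g' t) * indicator (einterval 0 (2 * pi)) t = f (cis t) * indicator {0..<2 * pi} t * ennreal (1 / (2 * pi))"
  proof eventually_elim
   case (elim t)
   show ?case
   proof (cases "t \<in> einterval 0 (2 * pi)")
    case True
    then have "0 < t" "t < 2 * pi" by (auto simp: mem)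
    then have "cayley (g t) = cis t" unfolding g_def by (rule cayley_tan)
    moreover have "1 / (pi * (1 + (g t)\<^sup>2)) * g' t = 1 / (2 * pi)"
     proof -
      have "1 / (pi * u) * (u / 2) = 1 / (2 * pi)" if "u ~= 0" for u using that by simp
      then show ?thesis by (simp only: g'_def one_plus_square_nz not_False_eq_True)
     qed
    moreover have "ennreal (1 / (pi * (1 + (g t)\<^sup>2))) * ennreal (g' t) = ennreal (1 / (pi * (1 + (g t)\<^sup>2)) * g' t)"
     by (intro ennreal_mult[symmetric]) (auto simp: g'_def)
    ultimately show ?thesis using True \<open>0 < t\<close> \<open>t < 2 * pi\<close> by (simp add: F_def mult.assoc)
   next
    case False
    then have "\<not> (0 < t & t < 2 * pi)" by (simp add: mem)
    then have "t \<notin> {0..<2 * pi}" using elim by auto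
    then show ?thesis using False by simp
   qed
  qed
 qed
 also have "... = (Unif z. f z)"
  by (simp add: nn_integral_multc nn_integral_circle_uniform divide_ennreal_def inverse_ennreal inverse_eq_divide)
 finally show ?thesis unfolding img by (simp add: F_def)
qed

section \<open>Independent uniform points on the circle\<close>

abbreviation circle_n :: "nat => (nat => complex) measure" where
 "circle_n m \<equiv> PiM {..<m} (%_. circle_uniform)"

abbreviation Unif_n where "Unif_n m \<equiv> nn_integral (circle_n m)"

interpretation circP: product_sigma_finite "%_::nat. circle_uniform"
 by standard

interpretation circn: prob_space "circle_n m" for m
 by (intro prob_space_PiM circ.prob_space_axioms)

lemma measurable_circle_coordinate [measurable]: "i < m ==> (%z. z i) \<in> circle_n m \<rightarrow>\<^sub>M circle_borel"
proof -
 assume "i < m"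
 then have "(%z. z i) \<in> circle_n m \<rightarrow>\<^sub>M circle_uniform" by (intro measurable_component_singleton) simp
 then show ?thesis by (subst (asm) measurable_cong_sets[OF refl sets_circle_uniform])
qed

lemma circle_coordinate_complex [measurable]:
 "(%z. z i) \<in> borel_measurable (circle_n m)"
proof (cases "i < m")
 case True
 have "(%z::complex. z) \<in> borel_measurable circle_borel" by measurable
 then show ?thesis by (rule measurable_compose[OF measurable_circle_coordinate[OF True]])
next
 case False
 have "(%z. z i) \<in> borel_measurable (circle_n m) \<longleftrightarrow> (%z. undefined :: complex) \<in> borel_measurable (circle_n m)"
  using False by (intro measurable_cong) (auto simp: space_PiM PiE_def extensional_def)
 then show ?thesis by simp
qed

lemma measurable_to_circle_n:
 assumes "!!i. i < m ==> (%x. f x i) \<in> M \<rightarrow>\<^sub>M circle_borel"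
  and "!!x i. x \<in> space M ==> \<not> i < m ==> f x i = undefined"
 shows "f \<in> M \<rightarrow>\<^sub>M circle_n m"
proof (rule measurable_PiM_single')
 show "(%x. f x i) \<in> M \<rightarrow>\<^sub>M circle_uniform" if "i \<in> {..<m}" for i using assms(1) that by simp
 show "f \<in> space M \<rightarrow> (\<Pi>\<^sub>E i\<in>{..<m}. space circle_uniform)"
  using assms(2) measurable_space[OF assms(1)] by (fastforce simp: PiE_def extensional_def)
qed

lemma measurable_fun_upd_circle [measurable (raw)]:
 assumes "g \<in> M \<rightarrow>\<^sub>M circle_n m" "t \<in> M \<rightarrow>\<^sub>M circle_borel"
 shows "(%w. (g w)(m := t w)) \<in> M \<rightarrow>\<^sub>M circle_n (Suc m)"
proof (rule measurable_to_circle_n)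
 show "(%w. ((g w)(m := t w)) i) \<in> M \<rightarrow>\<^sub>M circle_borel" if "i < Suc m" for i
 proof (cases "i = m")
  case False
  then have "i < m" using that by simp
  from measurable_compose[OF assms(1) measurable_circle_coordinate[OF this]] show ?thesis using False by simp
 qed (use assms in simp)
 show "((g x)(m := t x)) i = undefined" if "x \<in> space M" "\<not> i < Suc m" for x i
  using measurable_space[OF assms(1) that(1)] that(2) by (auto simp: space_PiM PiE_def extensional_def)
qed

lemma nn_integral_circle_Suc_rev:
 assumes [measurable]: "f \<in> borel_measurable (circle_n (Suc m))"
 shows "Unif_n (Suc m) (%z. f z) = (Unif u. Unif_n m (%z. f (z(m := u))))"
 unfolding lessThan_Suc by (rule circP.product_nn_integral_insert_rev) (use assms in \<open>auto simp: lessThan_Suc\<close>)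

lemma circle_n_rotate:
 assumes u: "cmod u = 1" and f[measurable]: "f \<in> borel_measurable (circle_n m)"
 shows "(Unif_n m (%z. f (\<lambda>i\<in>{..<m}. u * z i))) = Unif_n m (%z. f z)"
proof -
 have um[measurable]: "(%z. u * z) \<in> circle_uniform \<rightarrow>\<^sub>M circle_uniform"
 proof -
  have "(%z. u * z) \<in> circle_borel \<rightarrow>\<^sub>M circle_borel" using u by (intro measurable_circle_mult) auto
  then show ?thesis by (simp cong: measurable_cong_sets)
 qed
 let ?f = "distr circle_uniform circle_uniform (%z. u * z)"
 have "?f = circle_uniform"
 proof (rule measure_eqI)
  fix A assume "A \<in> sets ?f"
  then have A[measurable]: "A \<in> sets circle_borel" by simp
  have "emeasure ?f A = (\<integral>\<^sup>+z. indicator A z \<partial>distr circle_uniform circle_uniform (%z. u * z))"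
   by (simp add: nn_integral_indicator)
  also have "... = (Unif z. indicator A (u * z))" by (rule nn_integral_distr[OF um borel_measurable_indicator]) (simp add: A)
  also have "... = (Unif z. indicator A z)" by (rule circle_uniform_rotate[OF u borel_measurable_indicator[OF A]])
  finally show "emeasure ?f A = emeasure circle_uniform A"
   by (simp add: nn_integral_indicator)
 qed simp
 then have d: "distr (circle_n m) (circle_n m) (compose {..<m} (%z. u * z)) = circle_n m"
  using distr_PiM_finite_prob_space'[of "{..<m}" "%_. circle_uniform" "%_. circle_uniform" "%z. u * z"]
  by (simp add: circ.prob_space_axioms um)
 have [measurable]: "compose {..<m} (%z. u * z) \<in> circle_n m \<rightarrow>\<^sub>M circle_n m"
  unfolding compose_def by (intro measurable_restrict) measurable
 have "Unif_n m (%z. f z) = (\<integral>\<^sup>+z. f z \<partial>distr (circle_n m) (circle_n m) (compose {..<m} (%z. u * z)))"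
  unfolding d ..
 also have "... = (Unif_n m (%z. f (compose {..<m} (%z. u * z) z)))" by (rule nn_integral_distr) measurable
 finally show ?thesis by (simp add: compose_def)
qed

lemma measurable_cayley_n [measurable]: "(%x. \<lambda>i\<in>{..<m}. cayley (x i)) \<in> leb m \<rightarrow>\<^sub>M circle_n m"
 by (rule measurable_to_circle_n) auto

lemma nn_integral_circle_n_cayley:
 assumes "f \<in> borel_measurable (circle_n m)"
 shows "Unif_n m (%z. f z) = (Leb_n m (%x. f (\<lambda>i\<in>{..<m}. cayley (x i)) * ennreal (\<Prod>i<m. 1 / (pi * (1 + (x i)\<^sup>2)))))"
 using assms
proof (induction m arbitrary: f)
 case 0
 show ?case by (simp add: PiM_empty nn_integral_count_space_finite restrict_def)
next
 case (Suc m)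
 note [measurable] = Suc.prems
 let ?p = "%x. ennreal (\<Prod>i<m. 1 / (pi * (1 + (x i)\<^sup>2)))"
 have "Unif_n (Suc m) (%z. f z) = (Unif u. Unif_n m (%z. f (z(m := u))))"
  by (rule nn_integral_circle_Suc_rev) measurable
 also have "... = (Leb t. Unif_n m (%z. f (z(m := cayley t))) * ennreal (1 / (pi * (1 + t\<^sup>2))))"
  by (rule nn_integral_circle_uniform_cayley) measurable
 also have "... = (Leb t. (Leb_n m (%x. f ((\<lambda>i\<in>{..<m}. cayley (x i))(m := cayley t)) * ?p x)) * ennreal (1 / (pi * (1 + t\<^sup>2))))"
  by (intro nn_integral_cong arg_cong2[where f="(*)"] refl Suc.IH) measurable
 also have "... = (Leb t. Leb_n m (%x. f ((\<lambda>i\<in>{..<m}. cayley (x i))(m := cayley t)) * ?p x * ennreal (1 / (pi * (1 + t\<^sup>2)))))"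
  by (intro nn_integral_cong nn_integral_multc[symmetric]) measurable
 also have "... = (Leb t. Leb_n m (%x. f (\<lambda>i\<in>{..<Suc m}. cayley ((x(m := t)) i)) * ennreal (\<Prod>i<Suc m. 1 / (pi * (1 + ((x(m := t)) i)\<^sup>2)))))"
 proof (rule nn_integral_cong, rule nn_integral_cong)
  fix t and x :: "nat => real"
  have "(\<lambda>i\<in>{..<m}. cayley (x i))(m := cayley t) = (\<lambda>i\<in>{..<Suc m}. cayley ((x(m := t)) i))" by (auto simp: fun_eq_iff restrict_def)
  moreover have "?p x * ennreal (1 / (pi * (1 + t\<^sup>2))) = ennreal (\<Prod>i<Suc m. 1 / (pi * (1 + ((x(m := t)) i)\<^sup>2)))"
   by (subst ennreal_mult[symmetric]) (auto intro!: prod_nonneg)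
  ultimately show "f ((\<lambda>i\<in>{..<m}. cayley (x i))(m := cayley t)) * ?p x * ennreal (1 / (pi * (1 + t\<^sup>2))) = f (\<lambda>i\<in>{..<Suc m}. cayley ((x(m := t)) i)) * ennreal (\<Prod>i<Suc m. 1 / (pi * (1 + ((x(m := t)) i)\<^sup>2)))"
   by (simp only: mult.assoc)
 qed
 also have "... = (Leb_n (Suc m) (%x. f (\<lambda>i\<in>{..<Suc m}. cayley (x i)) * ennreal (\<Prod>i<Suc m. 1 / (pi * (1 + (x i)\<^sup>2)))))"
  by (rule nn_integral_lborel_Suc_rev[symmetric]) measurable
 finally show ?case .
qed

section \<open>Symmetrisation\<close>

lemma nn_integral_lborel_permute:
 assumes tau: "bij_betw tau {..<m} {..<m}" and f[measurable]: "f \<in> borel_measurable (leb m)"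
 shows "(Leb_n m (%x. f (\<lambda>i\<in>{..<m}. x (tau i)))) = Leb_n m (%x. f x)"
proof -
 define T where "T x = (\<lambda>i\<in>{..<m}. x (tau i))" for x :: "nat => real"
 have [measurable]: "T \<in> leb m \<rightarrow>\<^sub>M leb m" unfolding T_def by measurable
 have "distr (leb m) (leb m) T = leb m"
 proof (rule lebP.PiM_eqI)
  fix A assume A: "!!i. i \<in> {..<m} ==> A i \<in> sets (lborel :: real measure)"
  define B where "B j = A (the_inv_into {..<m} tau j)" for j
  have inv: "the_inv_into {..<m} tau (tau i) = i" if "i < m" for i
   using tau that by (intro the_inv_into_f_f) (auto simp: bij_betw_def)
  have taum: "tau i < m" if "i < m" for i using tau that by (auto simp: bij_betw_def)
  have surj: "\<exists>i<m. j = tau i" if "j < m" for j using tau that by (auto simp: bij_betw_def image_iff)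
  have Bs: "B j \<in> sets lborel" if "j \<in> {..<m}" for j
   using surj[of j] that A inv by (auto simp: B_def)
  have "T -` Pi\<^sub>E {..<m} A \<inter> space (leb m) = Pi\<^sub>E {..<m} B"
  proof (intro equalityI subsetI)
   fix x assume x: "x \<in> T -` Pi\<^sub>E {..<m} A \<inter> space (leb m)"
   then have "x (tau i) \<in> A i" if "i < m" for i using that by (auto simp: T_def PiE_iff)
   then have "x j \<in> B j" if "j < m" for j using surj[OF that] inv by (auto simp: B_def)
   then show "x \<in> Pi\<^sub>E {..<m} B" using x by (auto simp: space_PiM PiE_iff)
  next
   fix x assume x: "x \<in> Pi\<^sub>E {..<m} B"
   then have "x (tau i) \<in> A i" if "i < m" for i using taum[OF that] inv[OF that] by (auto simp: PiE_iff B_def dest!: bspec[of _ _ "tau i"])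
   then show "x \<in> T -` Pi\<^sub>E {..<m} A \<inter> space (leb m)" using x by (auto simp: T_def space_PiM PiE_iff)
  qed
  then have "emeasure (distr (leb m) (leb m) T) (Pi\<^sub>E {..<m} A) = emeasure (leb m) (Pi\<^sub>E {..<m} B)"
   using A by (subst emeasure_distr) (auto intro!: sets_PiM_I_finite)
  also have "... = (\<Prod>j<m. emeasure lborel (B j))" using Bs by (intro lebP.emeasure_PiM) auto
  also have "... = (\<Prod>i<m. emeasure lborel (B (tau i)))" by (rule prod.reindex_bij_betw[OF tau, symmetric])
  also have "... = (\<Prod>i<m. emeasure lborel (A i))" by (intro prod.cong) (auto simp: B_def inv)
  finally show "emeasure (distr (leb m) (leb m) T) (Pi\<^sub>E {..<m} A) = (\<Prod>i<m. emeasure lborel (A i))" .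
 qed auto
 then have "Leb_n m (%x. f x) = (\<integral>\<^sup>+x. f x \<partial>distr (leb m) (leb m) T)" by simp
 also have "... = Leb_n m (%x. f (T x))" by (rule nn_integral_distr) measurable
 finally show ?thesis by (simp add: T_def)
qed

definition swap_coords :: "nat => nat => (nat => 'a) => nat => 'a" where
 "swap_coords i j x = (%k. if k = i then x j else if k = j then x i else x k)"

lemma swap_coords_restrict:
 "x \<in> space (leb m) ==> i < m ==> j < m ==> swap_coords i j x = (\<lambda>k\<in>{..<m}. x (if k = i then j else if k = j then i else k))"
 by (auto simp: swap_coords_def fun_eq_iff restrict_def space_PiM PiE_def extensional_def)

lemma bij_swap: "i < m ==> j < m ==> bij_betw (%k. if k = i then j else if k = j then i else k) {..<m} {..<m}"
 by (rule bij_betwI[where g="%k. if k = i then j else if k = j then i else k"]) auto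

lemma nn_integral_lborel_swap_coords:
 assumes "i < m" "j < m" and f[measurable]: "f \<in> borel_measurable (leb m)"
 shows "Leb_n m (%x. f (swap_coords i j x)) = Leb_n m (%x. f x)"
proof -
 have "Leb_n m (%x. f (swap_coords i j x)) = (Leb_n m (%x. f (\<lambda>k\<in>{..<m}. x (if k = i then j else if k = j then i else k))))"
  using assms by (intro nn_integral_cong arg_cong[where f=f] swap_coords_restrict)
 also have "... = Leb_n m (%x. f x)" by (rule nn_integral_lborel_permute[OF bij_swap[OF assms(1,2)]]) measurable
 finally show ?thesis .
qed

lemma measurable_swap_coords [measurable]:
 assumes "i < m" "j < m" shows "swap_coords i j \<in> leb m \<rightarrow>\<^sub>M leb m"
proof -
 have "(%x. \<lambda>k\<in>{..<m}. x (if k = i then j else if k = j then i else k)) \<in> leb m \<rightarrow>\<^sub>M leb m" by measurable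
 then show ?thesis by (subst measurable_cong[OF swap_coords_restrict]) (use assms in auto)
qed

text \<open>The domain splits according to which coordinate is largest; by symmetry the
  \<open>Suc m\<close> parts have equal integrals, and the coordinates below the largest one are
  covered by the induction hypothesis. The integrand vanishes where coordinates coincide, so the
  splitting is exact and not merely up to null sets.\<close>

lemma nn_integral_symmetric_ordered:
 assumes f: "f \<in> borel_measurable (leb m)"
  and sym: "!!i j x. i < m ==> j < m ==> x \<in> space (leb m) ==> f (swap_coords i j x) = f x"
  and inj: "!!x. \<not> inj_on x {..<m} ==> f x = 0"
 shows "Leb_n m (%x. f x) = of_nat (fact m) * Leb_n m (%x. if ordered m x then f x else 0)"
 using assms
proof (induction m arbitrary: f)
 case 0
 then show ?case unfolding nn_integral_lborel_0 by (simp add: ordered_def)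
next
 case (Suc m)
 note [measurable] = Suc.prems(1)
 let ?max = "%i x. \<forall>j<Suc m. j ~= i --> x j < (x i :: real)"
 have split: "f x = (\<Sum>i<Suc m. if ?max i x then f x else 0)" for x
 proof (cases "inj_on x {..<Suc m}")
  case True
  define i where "i = the_inv_into {..<Suc m} x (Max (x ` {..<Suc m}))"
  have "Max (x ` {..<Suc m}) \<in> x ` {..<Suc m}" by (intro Max_in) auto
  then have i: "i < Suc m" "x i = Max (x ` {..<Suc m})"
   using True by (auto simp: i_def the_inv_into_f_f f_the_inv_into_f simp del: lessThan_Suc)
  have max: "?max i x"
  proof (intro allI impI)
   fix j assume j: "j < Suc m" "j ~= i"
   have "x j \<le> x i" unfolding i(2) using j by (intro Max_ge) auto
   moreover have "x j ~= x i" using True j i(1) by (auto simp: inj_on_def)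
   ultimately show "x j < x i" by simp
  qed
  have "?max k x \<longleftrightarrow> k = i" if "k < Suc m" for k
   using max that i(1) by (metis less_asym)
  then have "(\<Sum>k<Suc m. if ?max k x then f x else 0) = (\<Sum>k<Suc m. if k = i then f x else 0)" by (intro sum.cong) auto
  also have "... = f x" using i(1) by (simp del: sum.lessThan_Suc)
  finally show ?thesis by simp
 next
  case False
  then show ?thesis using Suc.prems(3) by simp
 qed
 have "Leb_n (Suc m) (%x. f x) = Leb_n (Suc m) (%x. \<Sum>i<Suc m. if ?max i x then f x else 0)"
  using split by simp
 also have "... = (\<Sum>i<Suc m. Leb_n (Suc m) (%x. if ?max i x then f x else 0))"
  by (rule nn_integral_sum) measurable
 also have "... = (\<Sum>i<Suc m. Leb_n (Suc m) (%x. if ?max m x then f x else 0))"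
 proof (intro sum.cong refl)
  fix i assume i: "i \<in> {..<Suc m}"
  let ?f = "%i x. if ?max i x then f x else 0"
  have "Leb_n (Suc m) (%x. ?f i x) = Leb_n (Suc m) (%x. if ?max i (swap_coords i m x) then f (swap_coords i m x) else 0)"
   by (rule nn_integral_lborel_swap_coords[symmetric]) (use i in \<open>auto, measurable\<close>)
  also have "... = Leb_n (Suc m) (%x. ?f m x)"
  proof (rule nn_integral_cong)
   fix x assume x: "x \<in> space (leb (Suc m))"
   have "?max i (swap_coords i m x) \<longleftrightarrow> ?max m x"
   proof
    assume *: "?max i (swap_coords i m x)"
    show "?max m x"
    proof (intro allI impI)
     fix j assume "j < Suc m" "j ~= m"
     then show "x j < x m"
      using *[rule_format, of "if j = i then m else j"] i by (cases "j = i"; cases "i = m") (auto simp: swap_coords_def)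
    qed
   next
    assume *: "?max m x"
    show "?max i (swap_coords i m x)"
    proof (intro allI impI)
     fix j assume "j < Suc m" "j ~= i"
     then show "swap_coords i m x j < swap_coords i m x i"
      using *[rule_format, of "if j = m then i else j"] i by (cases "j = m"; cases "i = m") (auto simp: swap_coords_def)
    qed
   qed
   moreover have "f (swap_coords i m x) = f x" using Suc.prems(2)[of i m x] i x by simp
   ultimately show "(if ?max i (swap_coords i m x) then f (swap_coords i m x) else 0) = ?f m x"
    by (simp only:)
  qed
  finally show "Leb_n (Suc m) (%x. ?f i x) = Leb_n (Suc m) (%x. ?f m x)" .
 qed
 also have "... = of_nat (Suc m) * Leb_n (Suc m) (%x. if ?max m x then f x else 0)" by simp
 also have "Leb_n (Suc m) (%x. if ?max m x then f x else 0) = (Leb t. Leb_n m (%x. if ?max m (x(m := t)) then f (x(m := t)) else 0))"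
  by (rule nn_integral_lborel_Suc_rev) measurable
 also have "... = (Leb t. of_nat (fact m) * Leb_n m (%x. if ordered (Suc m) (x(m := t)) then f (x(m := t)) else 0))"
 proof (rule nn_integral_cong)
  fix t :: real
  define F where "F x = (if \<forall>j<m. x j < t then f (x(m := t)) else 0)" for x
  let ?g = "%m x t. if ordered (Suc m) (x(m := t)) then f (x(m := t)) else 0"
  let ?h = "%m t. Leb_n m (%x. if ?max m (x(m := t)) then f (x(m := t)) else 0)"
  let ?p = "%m. Leb_n m (%x. if ordered m x then F x else 0)"
  have "?h m t = Leb_n m (%x. F x)"
   by (intro nn_integral_cong) (auto simp: F_def less_Suc_eq)
  also have "... = of_nat (fact m) * ?p m"
  proof (rule Suc.IH)
   show "F \<in> borel_measurable (leb m)" unfolding F_def by measurable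
   show "F (swap_coords i j x) = F x" if ij: "i < m" "j < m" "x \<in> space (leb m)" for i j x
   proof -
    have "(swap_coords i j x)(m := t) = swap_coords i j (x(m := t))" using ij by (auto simp: swap_coords_def fun_eq_iff)
    moreover have "x(m := t) \<in> space (leb (Suc m))" using ij(3) by (auto simp: space_PiM PiE_def extensional_def)
    moreover have "f (swap_coords i j (x(m := t))) = f (x(m := t))"
     by (rule Suc.prems(2)[OF _ _ calculation(2)]) (use ij in auto)
    ultimately have "f ((swap_coords i j x)(m := t)) = f (x(m := t))" by (simp only:)
    moreover have "(\<forall>k<m. swap_coords i j x k < t) \<longleftrightarrow> (\<forall>k<m. x k < t)"
     using ij by (auto simp: swap_coords_def split: if_splits)
    ultimately show ?thesis unfolding F_def by (simp only:)
   qed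
   show "F x = 0" if "\<not> inj_on x {..<m}" for x
   proof -
    have "\<not> inj_on (x(m := t)) {..<Suc m}"
    proof
     assume "inj_on (x(m := t)) {..<Suc m}"
     then have "inj_on (x(m := t)) {..<m}" by (rule inj_on_subset) auto
     then show False using that inj_on_cong[of "{..<m}" "x(m := t)" x] by simp
    qed
    then have "f (x(m := t)) = 0" by (rule Suc.prems(3))
    then show ?thesis unfolding F_def by (simp only: if_cancel)
   qed
  qed
  also have "?p m = Leb_n m (%x. ?g m x t)"
  proof (rule nn_integral_cong)
   fix x
   have "ordered (Suc m) (x(m := t)) \<longleftrightarrow> ordered m x & (\<forall>j<m. x j < t)" unfolding ordered_Suc by (auto simp: ordered_def)
   then show "(if ordered m x then F x else 0) = ?g m x t"
    unfolding F_def by (cases "\<forall>j<m. x j < t"; cases "ordered m x") (simp_all only: if_True if_False simp_thms)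
  qed
  finally show "?h m t = of_nat (fact m) * Leb_n m (%x. ?g m x t)" .
 qed
 also have "... = of_nat (fact m) * (Leb t. Leb_n m (%x. if ordered (Suc m) (x(m := t)) then f (x(m := t)) else 0))"
  by (rule nn_integral_cmult) measurable
 also have "(Leb t. Leb_n m (%x. if ordered (Suc m) (x(m := t)) then f (x(m := t)) else 0)) = Leb_n (Suc m) (%x. if ordered (Suc m) x then f x else 0)"
  by (rule nn_integral_lborel_Suc_rev[symmetric]) measurable
 finally have "Leb_n (Suc m) (%x. f x) = of_nat (Suc m) * (of_nat (fact m) * Leb_n (Suc m) (%x. if ordered (Suc m) x then f x else 0))" .
 moreover have "of_nat (fact (Suc m)) = (of_nat (Suc m) * of_nat (fact m) :: ennreal)"
  unfolding fact_Suc of_nat_mult by simp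
 ultimately show ?case by (simp only: mult.assoc)
qed

section \<open>The Killip--Nenciu law in coordinates\<close>

lemma sets_normalized_density [simp, measurable_cong]: "sets (normalized_density M f) = sets M"
 by (simp add: normalized_density_def)

lemma nn_integral_normalized_density:
 assumes [measurable]: "f \<in> borel_measurable M" "g \<in> borel_measurable M"
 shows "(\<integral>\<^sup>+x. g x \<partial>normalized_density M f) = (\<integral>\<^sup>+x. f x * g x \<partial>M) / (\<integral>\<^sup>+x. f x \<partial>M)"
proof -
 have "(\<integral>\<^sup>+x. g x \<partial>normalized_density M f) = (\<integral>\<^sup>+x. f x / (\<integral>\<^sup>+y. f y \<partial>M) * g x \<partial>M)"
  unfolding normalized_density_def by (rule nn_integral_density) measurable
 also have "... = (\<integral>\<^sup>+x. f x * g x * inverse (\<integral>\<^sup>+y. f y \<partial>M) \<partial>M)"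
  by (simp add: divide_ennreal_def mult_ac)
 also have "... = (\<integral>\<^sup>+x. f x * g x \<partial>M) / (\<integral>\<^sup>+x. f x \<partial>M)"
  unfolding divide_ennreal_def by (rule nn_integral_multc) measurable
 finally show ?thesis .
qed

text \<open>If the normalising integral is \<open>0\<close> or \<open>\<infinity>\<close>, then the normalised density is the null measure.\<close>
lemma finite_measure_normalized_density:
 assumes [measurable]: "f \<in> borel_measurable M" shows "finite_measure (normalized_density M f)"
proof
 have "emeasure (normalized_density M f) (space (normalized_density M f)) = (\<integral>\<^sup>+x. f x \<partial>M) / (\<integral>\<^sup>+x. f x \<partial>M)"
  using nn_integral_normalized_density[OF assms, of "%_. 1"] by simp
 also have "... \<le> 1"
  by (metis divide_ennreal_def ennreal_divide_self ennreal_inverse_top infinity_ennreal_def mult_zero_left mult_zero_right order.refl zero_le_one top.not_eq_extremum)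
 finally show "emeasure (normalized_density M f) (space (normalized_density M f)) ~= \<infinity>"
  by (auto simp: top_unique)
qed

lemma sets_weighted_points [simp]: "sets (weighted_points n z w) = sets circle_borel"
 by (simp add: weighted_points_def)

lemma nn_integral_weighted_points:
 assumes z: "!!i. i < n ==> cmod (z i) = 1" and f: "f \<in> borel_measurable circle_borel"
 shows "(\<integral>\<^sup>+x. f x \<partial>weighted_points n z w) = (\<Sum>i<n. ennreal (w i) * f (z i))"
proof -
 have "z \<in> point_measure {..<n} (%i. ennreal (w i)) \<rightarrow>\<^sub>M circle_borel"
  using z unfolding point_measure_def by auto
 then show ?thesis unfolding weighted_points_def
  using f by (subst nn_integral_distr) (auto simp: nn_integral_point_measure_finite mult.commute)
qed

lemma emeasure_weighted_points:
 assumes z: "!!i. i < n ==> cmod (z i) = 1" and B: "B \<in> sets circle_borel"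
 shows "emeasure (weighted_points n z w) B = (\<Sum>i<n. ennreal (w i) * indicator B (z i))"
proof -
 have "emeasure (weighted_points n z w) B = (\<integral>\<^sup>+x. indicator B x \<partial>weighted_points n z w)"
  using B by (simp add: nn_integral_indicator)
 also have "... = (\<Sum>i<n. ennreal (w i) * indicator B (z i))"
  by (rule nn_integral_weighted_points[OF z borel_measurable_indicator[OF B]])
 finally show ?thesis .
qed

lemma weighted_points_in_circle_measures:
 assumes z: "!!i. i < n ==> cmod (z i) = 1" and w: "!!i. i < n ==> 0 \<le> w i" "(\<Sum>i<n. w i) = 1"
 shows "weighted_points n z w \<in> space circle_measures"
proof -
 have "space (weighted_points n z w) = sphere 0 1" by (simp add: weighted_points_def)
 then have "emeasure (weighted_points n z w) (space (weighted_points n z w)) = (\<Sum>i<n. ennreal (w i) * indicator (sphere 0 1) (z i))"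
  using emeasure_weighted_points[OF z, where B="sphere 0 1" and w=w] sets.top[of circle_borel] by simp
 also have "... = (\<Sum>i<n. ennreal (w i))" using z by (intro sum.cong) auto
 also have "... = 1" using w by (subst sum_ennreal) auto
 finally show ?thesis by (auto simp: space_prob_algebra intro: prob_spaceI)
qed

lemma weighted_points_permute:
 assumes "bij_betw tau {..<n} {..<n}" and z: "!!i. i < n ==> cmod (z i) = 1"
 shows "weighted_points n (%i. z (tau i)) (%i. w (tau i)) = weighted_points n z w"
proof (rule measure_eqI)
 fix B assume "B \<in> sets (weighted_points n (%i. z (tau i)) (%i. w (tau i)))"
 then have B: "B \<in> sets circle_borel" by simp
 have "cmod (z (tau i)) = 1" if "i < n" for i using assms that by (auto simp: bij_betw_def)
 then show "emeasure (weighted_points n (%i. z (tau i)) (%i. w (tau i))) B = emeasure (weighted_points n z w) B"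
  using B z sum.reindex_bij_betw[OF assms(1), of "%i. ennreal (w i) * indicator B (z i)"]
  by (simp add: emeasure_weighted_points)
qed simp

lemma weighted_points_cong:
 assumes z: "!!i. i < n ==> cmod (z i) = 1" and "!!i. i < n ==> z i = z' i" "!!i. i < n ==> w i = w' i"
 shows "weighted_points n z w = weighted_points n z' w'"
proof (rule measure_eqI)
 fix B assume "B \<in> sets (weighted_points n z w)"
 then have B: "B \<in> sets circle_borel" by simp
 have "cmod (z' i) = 1" if "i < n" for i using assms that by metis
 then show "emeasure (weighted_points n z w) B = emeasure (weighted_points n z' w') B"
  using assms B by (simp add: emeasure_weighted_points)
qed simp

lemma supp_weighted_points:
 assumes z: "!!i. i < n ==> cmod (z i) = 1" and w: "!!i. i < n ==> 0 < w i"
 shows "supp (weighted_points n z w) = z ` {..<n}"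
proof -
 have sp: "space (weighted_points n z w) = sphere 0 1" by (simp add: weighted_points_def)
 let ?f = "%U. \<Sum>i<n. ennreal (w i) * indicator U (z i)"
 have em: "emeasure (weighted_points n z w) (U \<inter> sphere 0 1) = ?f U" if "open U" for U
 proof -
  have "U \<inter> sphere 0 1 \<in> sets circle_borel"
   using that unfolding circle_borel_def by (auto simp: sets_restrict_space)
  then show ?thesis using z by (subst emeasure_weighted_points) (auto intro!: sum.cong simp: indicator_def)
 qed
 have pos: "0 < (?f U) \<longleftrightarrow> (\<exists>i<n. z i \<in> U)" for U
 proof -
  have "?f U = 0 \<longleftrightarrow> (\<forall>i<n. z i \<notin> U)"
   using w by (subst sum_eq_0_iff) (force simp: indicator_def not_le)+
  then show ?thesis by (metis not_gr_zero)
 qed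
 have "x \<in> supp (weighted_points n z w) \<longleftrightarrow> x \<in> z ` {..<n}" for x
 proof
  assume x: "x \<in> supp (weighted_points n z w)"
  show "x \<in> z ` {..<n}"
  proof (rule ccontr)
   assume "x \<notin> z ` {..<n}"
   moreover have "open (- (z ` {..<n}))" by (intro open_Compl finite_imp_closed) auto
   ultimately have "\<exists>i<n. z i \<in> - (z ` {..<n})"
    using x em pos by (auto simp: supp_def sp)
   then show False by auto
  qed
 next
  assume "x \<in> z ` {..<n}"
  then show "x \<in> supp (weighted_points n z w)" using z em pos by (auto simp: supp_def sp)
 qed
 then show ?thesis by blast
qed

section \<open>Point configurations with Dirichlet weights\<close>

definition open_simplex :: "nat => (nat => real) set" where
 "open_simplex m = {v. (\<forall>i<m. 0 < v i) & (\<Sum>i<m. v i) < 1}"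

text \<open>Outside the open simplex the weights are those of the point mass at the last index; this keeps
 the map total with values in probability vectors.\<close>
definition full_weights :: "nat => (nat => real) => nat => real" where
 "full_weights m v = (if v \<in> open_simplex m then v(m := 1 - (\<Sum>i<m. v i)) else (%i. if i = m then 1 else 0))"

text \<open>The symmetric Dirichlet density in the \<open>m\<close> free weights, unnormalised and
  extended by 0; \<open>a\<close> is the exponent, one less than the Dirichlet parameter.\<close>

definition simplex_density :: "nat => real => (nat => real) => real" where
 "simplex_density m a v = (if v \<in> open_simplex m then \<Prod>i\<le>m. full_weights m v i powr a else 0)"

definition circle_density :: "nat => real => (nat => complex) => real" where
 "circle_density n beta z = (\<Prod>k<n. \<Prod>j<k. cmod (z j - z k) powr beta)"

definition point_config :: "nat => (nat => complex) => (nat => real) => complex measure" where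
 "point_config m z v = weighted_points (Suc m) z (full_weights m v)"

lemma full_weights_nonneg: "0 \<le> full_weights m v i" if "i \<le> m"
 using that by (auto simp: full_weights_def open_simplex_def less_imp_le)

lemma full_weights_pos: "0 < full_weights m v i" if "i \<le> m" "v \<in> open_simplex m"
 using that by (auto simp: full_weights_def open_simplex_def)

lemma sum_full_weights: "(\<Sum>i\<le>m. full_weights m v i) = 1"
proof (cases "v \<in> open_simplex m")
 case True
 have "(\<Sum>i\<le>m. full_weights m v i) = (\<Sum>i<m. full_weights m v i) + full_weights m v m"
  by (simp only: lessThan_Suc_atMost[symmetric] sum.lessThan_Suc)
 then show ?thesis using True by (simp add: full_weights_def)
qed (simp add: full_weights_def)

lemma sum_full_weights_ennreal: "(\<Sum>i\<le>m. ennreal (full_weights m v i)) = 1"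
 using sum_full_weights[of m v] by (subst sum_ennreal) (auto simp: full_weights_nonneg)

lemma open_simplex_pred [measurable]: "Measurable.pred (leb m) (%v. v \<in> open_simplex m)"
 unfolding open_simplex_def mem_Collect_eq by measurable

lemma measurable_full_weights [measurable]: "i \<le> m ==> (%v. full_weights m v i) \<in> borel_measurable (leb m)"
 unfolding full_weights_def if_distrib[where f="%f. f i"] by (cases "i = m") (simp_all, measurable)

lemma measurable_simplex_density [measurable]: "simplex_density m a \<in> borel_measurable (leb m)"
 unfolding simplex_density_def[abs_def] by measurable

lemma measurable_circle_density [measurable]: "circle_density n beta \<in> borel_measurable (circle_n n)"
 unfolding circle_density_def[abs_def] by measurable

lemma simplex_density_nonneg: "0 \<le> simplex_density m a v"
 unfolding simplex_density_def by (auto intro!: prod_nonneg)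

lemma circle_density_nonneg: "0 \<le> circle_density n beta z"
 unfolding circle_density_def by (auto intro!: prod_nonneg)

lemma space_circle_n: "z \<in> space (circle_n n) ==> i < n ==> cmod (z i) = 1"
 by (auto simp: space_PiM PiE_iff)

lemma point_config_in_space: "z \<in> space (circle_n (Suc m)) ==> point_config m z v \<in> space circle_measures"
 unfolding point_config_def
 by (rule weighted_points_in_circle_measures, erule space_circle_n)
   (auto simp: full_weights_nonneg lessThan_Suc_atMost sum_full_weights)

lemma nn_integral_point_config:
 assumes "z \<in> space (circle_n (Suc m))" "f \<in> borel_measurable circle_borel"
 shows "(\<integral>\<^sup>+x. f x \<partial>point_config m z v) = (\<Sum>i\<le>m. ennreal (full_weights m v i) * f (z i))"
proof -
 have "cmod (z i) = 1" if "i < Suc m" for i by (rule space_circle_n[OF assms(1) that])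
 from nn_integral_weighted_points[of "Suc m" z, OF this assms(2)] show ?thesis
  unfolding point_config_def by (simp only: lessThan_Suc_atMost)
qed

lemma measurable_weighted_points:
 assumes z: "!!i. i < n ==> (%x. z x i) \<in> M \<rightarrow>\<^sub>M circle_borel"
  and w: "!!i. i < n ==> (%x. w x i) \<in> borel_measurable M"
  and p: "!!x. x \<in> space M ==> (\<forall>i<n. 0 \<le> w x i) & (\<Sum>i<n. w x i) = 1"
 shows "(%x. weighted_points n (z x) (w x)) \<in> M \<rightarrow>\<^sub>M circle_measures"
proof (rule measurable_prob_algebra_generated[where G="sets circle_borel" and \<Omega>="space circle_borel"])
 note [measurable] = z w
 have n1: "cmod (z x i) = 1" if "x \<in> space M" "i < n" for x i
  using measurable_space[OF z that(1)] that(2) by auto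
 show "prob_space (weighted_points n (z x) (w x))" if "x \<in> space M" for x
  using weighted_points_in_circle_measures[of n "z x" "w x"] p[OF that] n1[OF that] by (simp add: space_prob_algebra)
 fix B assume B[measurable]: "B \<in> sets circle_borel"
 have "(%x. \<Sum>i<n. ennreal (w x i) * indicator B (z x i)) \<in> borel_measurable M" by measurable
 then show "(%x. emeasure (weighted_points n (z x) (w x)) B) \<in> borel_measurable M"
  by (subst measurable_cong[OF emeasure_weighted_points[OF n1 B]])
qed (use sets.sigma_sets_eq[of circle_borel] sets.space_closed[of circle_borel] in \<open>simp_all add: sets.Int_stable\<close>)

lemma measurable_point_config [measurable (raw)]:
 assumes [measurable]: "f \<in> M \<rightarrow>\<^sub>M circle_n (Suc m)" "g \<in> M \<rightarrow>\<^sub>M leb m"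
 shows "(%x. point_config m (f x) (g x)) \<in> M \<rightarrow>\<^sub>M circle_measures"
 unfolding point_config_def
proof (rule measurable_weighted_points)
 show "(%x. f x i) \<in> M \<rightarrow>\<^sub>M circle_borel" if "i < Suc m" for i
  using measurable_compose[OF assms(1) measurable_circle_coordinate[OF that]] .
 show "(%x. full_weights m (g x) i) \<in> borel_measurable M" if "i < Suc m" for i
  using measurable_compose[OF assms(2) measurable_full_weights[of i m]] that by simp
 show "(\<forall>i<Suc m. 0 \<le> full_weights m (g x) i) & (\<Sum>i<Suc m. full_weights m (g x) i) = 1" for x
  using sum_full_weights[of m "g x"] full_weights_nonneg[of _ m "g x"] by (auto simp: lessThan_Suc_atMost)
qed

lemma measurable_to_prob_simplex:
 assumes "!!i. i < n ==> (%x. f x i) \<in> borel_measurable M"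
  and "!!x i. x \<in> space M ==> \<not> i < n ==> f x i = undefined"
  and "!!x. x \<in> space M ==> (\<forall>i<n. 0 \<le> f x i) & (\<Sum>i<n. f x i) = 1"
 shows "f \<in> M \<rightarrow>\<^sub>M prob_simplex n"
 unfolding prob_simplex_def
proof (rule measurable_restrict_space2)
 show "f \<in> M \<rightarrow>\<^sub>M (\<Pi>\<^sub>M i\<in>{..<n}. borel)"
  by (rule measurable_PiM_single') (use assms in \<open>auto simp: PiE_iff extensional_def\<close>)
qed (use assms in auto)

lemma nn_integral_dirichlet:
 assumes g[measurable]: "g \<in> borel_measurable (prob_simplex (Suc m))" and "a + 1 = b"
 shows "(\<integral>\<^sup>+w. g w \<partial>dirichlet (Suc m) (%_. b)) =
   Leb_n m (%v. ennreal (simplex_density m a v) * g (v(m := 1 - (\<Sum>i<m. v i)))) / Leb_n m (%v. ennreal (simplex_density m a v))"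
  and "finite_measure (dirichlet (Suc m) (%_. b))"
proof -
 let ?D = "%v. ennreal ((\<Prod>i<m. v i powr a) * (1 - (\<Sum>i<m. v i)) powr a)"
 let ?R = "restrict_space (leb m) (open_simplex m)"
 let ?F = "%v::nat => real. v(m := 1 - (\<Sum>i<m. v i))"
 have S: "open_simplex m \<inter> space (leb m) \<in> sets (leb m)"
  using open_simplex_pred[of m] by (simp add: pred_def Int_def conj_commute)
 have [measurable]: "?D \<in> borel_measurable ?R" by (rule measurable_restrict_space1) measurable
 have F[measurable]: "?F \<in> ?R \<rightarrow>\<^sub>M prob_simplex (Suc m)"
 proof (rule measurable_to_prob_simplex)
  show "(%v. ?F v i) \<in> borel_measurable ?R" if "i < Suc m" for i
   using that by (intro measurable_restrict_space1) (cases "i = m"; simp)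
  show "?F v i = undefined" if "v \<in> space ?R" "\<not> i < Suc m" for v i
   using that by (auto simp: space_restrict_space space_PiM PiE_iff extensional_def)
  show "(\<forall>i<Suc m. 0 \<le> ?F v i) & (\<Sum>i<Suc m. ?F v i) = 1" if "v \<in> space ?R" for v
   using that by (auto simp: space_restrict_space open_simplex_def less_imp_le)
 qed
 have eq: "dirichlet (Suc m) (%_. b) = distr (normalized_density ?R ?D) (prob_simplex (Suc m)) ?F"
  by (simp add: dirichlet_def open_simplex_def assms(2)[symmetric])
 have Fn: "?F \<in> normalized_density ?R ?D \<rightarrow>\<^sub>M prob_simplex (Suc m)"
  using F by (simp cong: measurable_cong_sets)
 have D: "?D v * indicator (open_simplex m) v = ennreal (simplex_density m a v)" for v
 proof (cases "v \<in> open_simplex m")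
  case True
  then have "(\<Prod>i\<le>m. full_weights m v i powr a) = (\<Prod>i<m. v i powr a) * (1 - (\<Sum>i<m. v i)) powr a"
   by (simp add: full_weights_def lessThan_Suc_atMost[symmetric])
  then show ?thesis using True by (simp add: simplex_density_def)
 qed (simp add: simplex_density_def)
 have I: "(\<integral>\<^sup>+v. ?D v * h v \<partial>?R) = Leb_n m (%v. ennreal (simplex_density m a v) * h v)" for h
  unfolding nn_integral_restrict_space[OF S] by (intro nn_integral_cong) (simp add: D[symmetric] mult_ac)
 let ?f = "(\<integral>\<^sup>+w. g w \<partial>dirichlet (Suc m) (%_. b))"
 have "?f = (\<integral>\<^sup>+v. g (?F v) \<partial>normalized_density ?R ?D)"
  unfolding eq by (rule nn_integral_distr[OF Fn]) measurable
 also have "... = (\<integral>\<^sup>+v. ?D v * g (?F v) \<partial>?R) / (\<integral>\<^sup>+v. ?D v \<partial>?R)"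
  by (rule nn_integral_normalized_density) measurable
 also have "(\<integral>\<^sup>+v. ?D v \<partial>?R) = (\<integral>\<^sup>+v. ?D v * 1 \<partial>?R)" by simp
 finally show "?f = Leb_n m (%v. ennreal (simplex_density m a v) * g (v(m := 1 - (\<Sum>i<m. v i)))) / Leb_n m (%v. ennreal (simplex_density m a v))"
  unfolding I by simp
 show "finite_measure (dirichlet (Suc m) (%_. b))"
  unfolding eq by (intro finite_measure.finite_measure_distr finite_measure_normalized_density Fn) measurable
qed

lemma nn_integral_circular_beta:
 assumes "g \<in> borel_measurable (circle_n n)"
 shows "(\<integral>\<^sup>+z. g z \<partial>circular_beta_ensemble n beta) = Unif_n n (%z. ennreal (circle_density n beta z) * g z) / Unif_n n (%z. ennreal (circle_density n beta z))"
proof -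
 note [measurable] = assms
 show ?thesis
  unfolding circular_beta_ensemble_def circle_density_def[symmetric]
  by (rule nn_integral_normalized_density) measurable
qed

text \<open>The expectation of \<open>G\<close> under the Killip-Nenciu law, up to
  normalisation.\<close>

definition kn_integral :: "nat => real => (complex measure => ennreal) => ennreal" where
 "kn_integral m beta G = Unif_n (Suc m) (%z. ennreal (circle_density (Suc m) beta z) *
   Leb_n m (%v. ennreal (simplex_density m (beta / 2 - 1) v) * G (point_config m z v)))"

text \<open>Only the existence of the constant is established. Total mass 1 rules out that one of
  the two normalising integrals is 0 or infinite, since the product of both integrals and their
  inverses would then be 0 instead of 1.\<close>

lemma killip_nenciu_eq:
 assumes "prob_space (killip_nenciu (Suc m) beta)"
 obtains c :: real where "0 < c"
  "!!G. G \<in> borel_measurable circle_measures ==> (\<integral>\<^sup>+mu. G mu \<partial>killip_nenciu (Suc m) beta) = ennreal c * kn_integral m beta G"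
proof -
 let ?C = "circular_beta_ensemble (Suc m) beta" and ?E = "dirichlet (Suc m) (%_. beta / 2)"
 let ?ZC = "Unif_n (Suc m) (%z. ennreal (circle_density (Suc m) beta z))"
 let ?ZD = "Leb_n m (%v. ennreal (simplex_density m (beta / 2 - 1) v))"
 interpret E: finite_measure ?E by (rule nn_integral_dirichlet(2)[where a="beta / 2 - 1" and g="%_. 0"]) auto
 have sC: "sets ?C = sets (circle_n (Suc m))" by (simp add: circular_beta_ensemble_def)
 have sE: "sets ?E = sets (prob_simplex (Suc m))" by (simp add: dirichlet_def)
 have coordw: "(%w. w i) \<in> borel_measurable (prob_simplex (Suc m))" if "i < Suc m" for i
  unfolding prob_simplex_def using that by (intro measurable_restrict_space1 measurable_component_singleton) auto
 let ?f = "circle_n (Suc m) \<Otimes>\<^sub>M prob_simplex (Suc m)"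
 let ?h = "%z w. weighted_points (Suc m) z w"
 have [measurable]: "(%(z, w). ?h z w) \<in> circle_n (Suc m) \<Otimes>\<^sub>M prob_simplex (Suc m) \<rightarrow>\<^sub>M circle_measures"
  unfolding split_beta'
 proof (rule measurable_weighted_points)
  show "(%x. fst x i) \<in> circle_n (Suc m) \<Otimes>\<^sub>M prob_simplex (Suc m) \<rightarrow>\<^sub>M circle_borel" if "i < Suc m" for i
   using measurable_compose[OF measurable_fst measurable_circle_coordinate[OF that]] .
  show "(%x. snd x i) \<in> borel_measurable ?f" if "i < Suc m" for i
   using measurable_compose[OF measurable_snd coordw[OF that]] .
  show "(\<forall>i<Suc m. 0 \<le> snd x i) & (\<Sum>i<Suc m. snd x i) = 1" if "x \<in> space ?f" for x
   using that by (auto simp: space_pair_measure prob_simplex_def space_restrict_space)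
 qed
 have sCE: "sets (?C \<Otimes>\<^sub>M ?E) = sets ?f" by (intro sets_pair_measure_cong sC sE)
 let ?g = "%p z w. case p of (z, w) => weighted_points (Suc m) z w"
 let ?p = "%G. \<integral>\<^sup>+mu. G mu \<partial>killip_nenciu (Suc m) beta"
 have formula: "?p G = inverse ?ZC * inverse ?ZD * kn_integral m beta G"
  if G[measurable]: "G \<in> borel_measurable circle_measures" for G
 proof -
  let ?H = "%z. Leb_n m (%v. ennreal (simplex_density m (beta / 2 - 1) v) * G (point_config m z v))"
  have GW: "(%p. G (?g p z w)) \<in> borel_measurable ?f" by measurable
  have GW': "(%p. G (?g p z w)) \<in> borel_measurable (?C \<Otimes>\<^sub>M ?E)"
   by (subst measurable_cong_sets[OF sCE refl]) (rule GW)
  let ?q = "Unif_n (Suc m) (%z. ennreal (circle_density (Suc m) beta z) * (?H z * inverse ?ZD))"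
  let ?r = "%G z. \<integral>\<^sup>+w. G (?h z w) \<partial>?E"
  have "?p G = (\<integral>\<^sup>+p. G (?g p z w) \<partial>(?C \<Otimes>\<^sub>M ?E))"
   unfolding killip_nenciu_def by (rule nn_integral_distr) (subst measurable_cong_sets[OF sCE refl], measurable)
  also have "... = (\<integral>\<^sup>+z. ?r G z \<partial>?C)"
   using E.nn_integral_fst[OF GW', symmetric] by simp
  also have "... = (\<integral>\<^sup>+z. ?H z * inverse ?ZD \<partial>?C)"
  proof (rule nn_integral_cong)
   fix z assume "z \<in> space ?C"
   then have z: "z \<in> space (circle_n (Suc m))" using sets_eq_imp_space_eq[OF sC] by simp
   have "(%w. G (?h z w)) \<in> borel_measurable (prob_simplex (Suc m))"
    using measurable_compose[OF measurable_Pair1'[OF z] GW] by simp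
   then have "?r G z = Leb_n m (%v. ennreal (simplex_density m (beta / 2 - 1) v) * G (weighted_points (Suc m) z (v(m := 1 - (\<Sum>i<m. v i))))) / ?ZD"
    by (rule nn_integral_dirichlet(1)) simp
   also have "Leb_n m (%v. ennreal (simplex_density m (beta / 2 - 1) v) * G (weighted_points (Suc m) z (v(m := 1 - (\<Sum>i<m. v i))))) = ?H z"
    by (intro nn_integral_cong) (auto simp: simplex_density_def point_config_def full_weights_def)
   finally show "?r G z = ?H z * inverse ?ZD" by (simp add: divide_ennreal_def)
  qed
  also have "... = ?q / ?ZC"
   by (rule nn_integral_circular_beta) measurable
  also have "?q = kn_integral m beta G * inverse ?ZD"
   unfolding kn_integral_def mult.assoc[symmetric] by (rule nn_integral_multc) measurable
  finally show ?thesis by (simp add: divide_ennreal_def mult_ac)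
 qed
 have "kn_integral m beta (%_. 1) = ?ZC * ?ZD"
  unfolding kn_integral_def by (simp add: nn_integral_multc)
 moreover have "(\<integral>\<^sup>+mu. 1 \<partial>killip_nenciu (Suc m) beta) = 1"
  using prob_space.emeasure_space_1[OF assms] by simp
 ultimately have one: "inverse ?ZC * inverse ?ZD * (?ZC * ?ZD) = 1" using formula[of "%_. 1"] by simp
 then have nz: "?ZC ~= 0" "?ZD ~= 0" by auto
 have nt: "?ZC ~= top" "?ZD ~= top" using one by auto
 let ?c = "inverse ?ZC * inverse ?ZD"
 have "?c ~= top" "?c ~= 0" using nz nt by (auto simp: ennreal_mult_eq_top_iff)
 then obtain c where c: "?c = ennreal c" "0 < c" by (cases ?c) (auto simp: less_le)
 from c(2) formula show ?thesis unfolding c(1) by (rule that)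
qed

section \<open>Exchangeability and rotation invariance\<close>

text \<open>Squaring turns the product over pairs with \<open>j < k\<close> into one over all
  ordered pairs, which is visibly invariant under permutations. This yields the symmetry of the
  circular density without counting inversions.\<close>

lemma prod_off_diagonal:
 fixes f :: "nat => nat => real"
 assumes "!!j k. f j k = f k j"
 shows "(\<Prod>k<n. \<Prod>j<n. if j = k then 1 else f j k) = (\<Prod>k<n. \<Prod>j<k. f j k)\<^sup>2"
proof (induction n)
 case (Suc n)
 let ?f = "%j k. if j = k then 1 else f j k"
 have "(\<Prod>k<Suc n. \<Prod>j<Suc n. ?f j k) = (\<Prod>k<n. (\<Prod>j<n. ?f j k) * f n k) * (\<Prod>j<n. f j n)"
 proof -
  have "(\<Prod>j<Suc n. ?f j k) = (\<Prod>j<n. ?f j k) * f n k" if "k < n" for k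
   using that by simp
  moreover have "(\<Prod>j<Suc n. ?f j n) = (\<Prod>j<n. f j n)"
   unfolding prod.lessThan_Suc by (subst prod.cong[of "{..<n}" "{..<n}" _ "%j. f j n"]) auto
  ultimately show ?thesis unfolding prod.lessThan_Suc[of _ n] by (metis (no_types, lifting) lessThan_iff prod.cong)
 qed
 also have "... = (\<Prod>k<n. \<Prod>j<k. f j k)\<^sup>2 * (\<Prod>j<n. f j n)\<^sup>2"
  using assms by (simp add: prod.distrib Suc power2_eq_square mult_ac)
 finally show ?case by (simp add: power_mult_distrib)
qed simp

lemma circle_density_permute:
 assumes "bij_betw tau {..<n} {..<n}"
 shows "circle_density n beta (%i. z (tau i)) = circle_density n beta z"
proof -
 let ?g = "%z j k. if j = k then 1 else cmod (z j - z k) powr beta"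
 have "(circle_density n beta (%i. z (tau i)))\<^sup>2 = (\<Prod>k<n. \<Prod>j<n. ?g (%i. z (tau i)) j k)"
  unfolding circle_density_def by (rule prod_off_diagonal[symmetric]) (simp add: norm_minus_commute)
 also have "... = (\<Prod>k<n. \<Prod>j<n. ?g z (tau j) (tau k))"
  using assms by (intro prod.cong refl) (auto simp: bij_betw_def inj_on_eq_iff)
 also have "... = (\<Prod>k<n. \<Prod>j<n. ?g z j (tau k))"
  by (intro prod.cong refl prod.reindex_bij_betw[OF assms])
 also have "... = (\<Prod>k<n. \<Prod>j<n. ?g z j k)"
  by (rule prod.reindex_bij_betw[OF assms, of "%k. \<Prod>j<n. ?g z j k"])
 also have "... = (circle_density n beta z)\<^sup>2"
  unfolding circle_density_def by (rule prod_off_diagonal) (simp add: norm_minus_commute)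
 finally show ?thesis using circle_density_nonneg by (metis power2_eq_imp_eq)
qed

lemma circle_density_cong: "(!!i. i < n ==> z i = z' i) ==> circle_density n beta z = circle_density n beta z'"
 unfolding circle_density_def by (intro prod.cong refl) auto

lemma circle_density_rotate: "cmod u = 1 ==> circle_density n beta (%i. u * z i) = circle_density n beta z"
 unfolding circle_density_def by (simp add: right_diff_distrib[symmetric] norm_mult)

lemma circle_density_inj:
 assumes "circle_density n beta z ~= 0" shows "inj_on z {..<n}"
proof -
 have ne: "z j ~= z k" if "j < k" "k < n" for j k
  using assms that unfolding circle_density_def by (force simp: prod_zero_iff)
 show ?thesis
 proof (rule inj_onI)
  fix j k assume "j \<in> {..<n}" "k \<in> {..<n}" "z j = z k"
  then show "j = k" using ne[of j k] ne[of k j] by (cases j k rule: linorder_cases) auto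
 qed
qed

lemma nn_integral_circle_n_permute:
 assumes "bij_betw tau {..<n} {..<n}" and f[measurable]: "f \<in> borel_measurable (circle_n n)"
 shows "(Unif_n n (%z. f (\<lambda>i\<in>{..<n}. z (tau i)))) = Unif_n n (%z. f z)"
proof -
 let ?f = "%z. \<lambda>i\<in>{..<n}. z (tau i)"
 have [measurable]: "?f \<in> circle_n n \<rightarrow>\<^sub>M circle_n n"
  by (rule measurable_to_circle_n) (use assms in \<open>auto simp: bij_betw_def intro!: measurable_circle_coordinate\<close>)
 have "distr (circle_n n) (circle_n n) ?f = circle_n n"
  using assms(1) distr_PiM_reindex[of "{..<n}" "%_. circle_uniform" tau "{..<n}"]
  by (auto simp: bij_betw_def circ.prob_space_axioms)
 then have "Unif_n n (%z. f z) = (\<integral>\<^sup>+z. f z \<partial>distr (circle_n n) (circle_n n) ?f)" by simp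
 also have "... = (Unif_n n (%z. f (\<lambda>i\<in>{..<n}. z (tau i))))" by (rule nn_integral_distr) measurable
 finally show ?thesis by simp
qed

text \<open>Exchanges the weight \<open>v i\<close> with the dependent last weight. With the other
  free weights fixed it is the reflection of \<open>t\<close> to \<open>s - t\<close>, which
  preserves Lebesgue measure.\<close>

definition reflect_coord :: "nat => nat => (nat => real) => nat => real" where
 "reflect_coord m i v = (if i < m then v(i := 1 - (\<Sum>j<m. v j)) else v)"

lemma measurable_reflect_coord [measurable]: "reflect_coord m i \<in> leb m \<rightarrow>\<^sub>M leb m"
 by (rule measurable_to_lborel_n)
   (auto simp: reflect_coord_def space_PiM PiE_iff extensional_def if_distrib[where f="%f. f _"] fun_upd_def)

lemma nn_integral_reflect_coord:
 assumes [measurable]: "F \<in> borel_measurable (leb m)"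
 shows "Leb_n m (%v. F (reflect_coord m i v)) = Leb_n m (%v. F v)"
proof (cases "i < m")
 case True
 let ?I = "{..<m} - {i}"
 have I: "insert i ?I = {..<m}" using True by auto
 have ins: "Leb_n m (%v. G v) = (\<integral>\<^sup>+x. (Leb t. G (x(i := t))) \<partial>PiM ?I (%_. lborel))"
  if "G \<in> borel_measurable (leb m)" for G :: "(nat => real) => ennreal"
  using lebP.product_nn_integral_insert[of ?I i G] that unfolding I by simp
 let ?f = "%x. Leb t. F (reflect_coord m i (x(i := t)))"
 let ?g = "%x. Leb t. F (x(i := t))"
 have "Leb_n m (%v. F (reflect_coord m i v)) = (\<integral>\<^sup>+x. ?f x \<partial>PiM ?I (%_. lborel))"
  by (rule ins) measurable
 also have "... = (\<integral>\<^sup>+x. ?g x \<partial>PiM ?I (%_. lborel))"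
 proof (rule nn_integral_cong)
  fix x assume x: "x \<in> space (PiM ?I (%_. lborel :: real measure))"
  define s where "s = 1 - (\<Sum>j\<in>?I. x j)"
  have "reflect_coord m i (x(i := t)) = x(i := s + - 1 * t)" for t
  proof -
   have "(\<Sum>j<m. (x(i := t)) j) = (\<Sum>j\<in>?I. (x(i := t)) j) + t"
    using True by (subst sum.remove[of _ i]) (auto simp: add.commute)
   also have "(\<Sum>j\<in>?I. (x(i := t)) j) = (\<Sum>j\<in>?I. x j)" by (intro sum.cong) auto
   finally show ?thesis using True by (simp add: reflect_coord_def s_def algebra_simps)
  qed
  then have "?f x = (Leb t. F (x(i := s + - 1 * t)))" by simp
  also have "... = ?g x"
  proof -
   have "(%t. x(i := t)) \<in> lborel \<rightarrow>\<^sub>M leb m"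
   proof (rule measurable_to_lborel_n)
    show "(%t. (x(i := t)) k) \<in> borel_measurable lborel" for k by (cases "k = i") auto
   qed (use x True in \<open>auto simp: space_PiM PiE_iff extensional_def\<close>)
   then have "(%t. F (x(i := t))) \<in> borel_measurable borel" using measurable_compose[OF _ assms] by simp
   then show ?thesis by (subst (2) nn_integral_real_affine[where c="-1" and t=s]) auto
  qed
  finally show "?f x = ?g x" .
 qed
 also have "... = Leb_n m (%v. F v)" by (rule ins[symmetric]) measurable
 finally show ?thesis .
qed (simp add: reflect_coord_def)

abbreviation "swap_last m i \<equiv> (%k. if k = i then m else if k = m then i else k)"

lemma bij_swap_last: "i \<le> m ==> bij_betw (swap_last m i) {..<Suc m} {..<Suc m}"
 by (rule bij_swap) auto

lemma reflect_coord_simplex: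
 assumes "i \<le> m"
 shows "reflect_coord m i v \<in> open_simplex m \<longleftrightarrow> v \<in> open_simplex m"
  and "v \<in> open_simplex m ==> k \<le> m ==> full_weights m (reflect_coord m i v) k = full_weights m v (swap_last m i k)"
proof -
 have sum: "(\<Sum>j<m. reflect_coord m i v j) = 1 - v i" if "i < m"
 proof -
  have "(\<Sum>j<m. reflect_coord m i v j) = (1 - (\<Sum>j<m. v j)) + (\<Sum>j\<in>{..<m} - {i}. v j)"
   using that by (subst sum.remove[of _ i]) (auto simp: reflect_coord_def)
  also have "(\<Sum>j<m. v j) = v i + (\<Sum>j\<in>{..<m} - {i}. v j)" using that by (subst sum.remove[of _ i]) auto
  finally show ?thesis by simp
 qed
 show 1: "reflect_coord m i v \<in> open_simplex m \<longleftrightarrow> v \<in> open_simplex m"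
 proof (cases "i < m")
  case True
  then show ?thesis unfolding open_simplex_def mem_Collect_eq sum[OF True]
   by (auto simp: reflect_coord_def)
 qed (simp add: reflect_coord_def)
 show "full_weights m (reflect_coord m i v) k = full_weights m v (swap_last m i k)" if "v \<in> open_simplex m" "k \<le> m"
 proof (cases "i < m")
  case True
  then show ?thesis using 1 that sum by (auto simp: full_weights_def) (auto simp: reflect_coord_def)
 qed (use assms in \<open>auto simp: reflect_coord_def\<close>)
qed

lemma simplex_density_reflect:
 assumes "i \<le> m" shows "simplex_density m a (reflect_coord m i v) = simplex_density m a v"
proof (cases "v \<in> open_simplex m")
 case True
 have "(\<Prod>k\<le>m. full_weights m (reflect_coord m i v) k powr a) = (\<Prod>k\<le>m. full_weights m v (swap_last m i k) powr a)"
  using reflect_coord_simplex(2)[OF assms True] by (intro prod.cong) auto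
 also have "... = (\<Prod>k\<le>m. full_weights m v k powr a)"
  using prod.reindex_bij_betw[OF bij_swap_last[OF assms], of "%k. full_weights m v k powr a"] by (simp only: lessThan_Suc_atMost)
 finally show ?thesis using True by (simp add: simplex_density_def reflect_coord_simplex(1)[OF assms])
qed (simp add: simplex_density_def reflect_coord_simplex(1)[OF assms])

text \<open>By exchangeability all \<open>Suc m\<close> weights have the same integral, and the
  weights add up to 1.\<close>

lemma nn_integral_simplex_weight:
 assumes "i \<le> m"
 shows "of_nat (Suc m) * Leb_n m (%v. ennreal (simplex_density m a v) * ennreal (full_weights m v i))
  = Leb_n m (%v. ennreal (simplex_density m a v))"
proof -
 let ?J = "%i. Leb_n m (%v. ennreal (simplex_density m a v) * ennreal (full_weights m v i))"
 let ?f = "%i v. ennreal (simplex_density m a (reflect_coord m i v)) * ennreal (full_weights m (reflect_coord m i v) m)"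
 have eq: "?J i = ?J m" if "i \<le> m" for i
 proof -
  have "?J m = Leb_n m (%v. ?f i v)"
   by (rule nn_integral_reflect_coord[symmetric]) measurable
  also have "... = ?J i"
  proof (rule nn_integral_cong)
   fix v
   show "?f i v = ennreal (simplex_density m a v) * ennreal (full_weights m v i)"
    using that reflect_coord_simplex(2)[OF that, of v m] simplex_density_reflect[OF that, of a v]
    by (cases "v \<in> open_simplex m") (auto simp: simplex_density_def)
  qed
  finally show ?thesis ..
 qed
 have "Leb_n m (%v. ennreal (simplex_density m a v)) = Leb_n m (%v. \<Sum>i\<le>m. ennreal (simplex_density m a v) * ennreal (full_weights m v i))"
  by (simp add: sum_distrib_left[symmetric] sum_full_weights_ennreal)
 also have "... = (\<Sum>i\<le>m. ?J i)" by (rule nn_integral_sum) measurable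
 also have "... = (\<Sum>k\<le>m. ?J i)"
 proof (rule sum.cong)
  fix k assume "k \<in> {..m}"
  then have "k \<le> m" by simp
  then show "?J k = ?J i" unfolding eq[OF assms] by (rule eq)
 qed simp
 also have "... = of_nat (Suc m) * ?J i" by (simp only: sum_constant card_atMost)
 finally show ?thesis ..
qed

text \<open>Exchanging the indices \<open>i\<close> and \<open>m\<close> among the points and among
  the weights at once leaves the configuration unchanged as a measure and preserves both
  densities.\<close>

lemma point_config_exchange:
 assumes i: "i \<le> m" and G[measurable]: "G \<in> borel_measurable (circle_measures \<Otimes>\<^sub>M circle_borel)"
 shows "Unif_n (Suc m) (%z. ennreal (circle_density (Suc m) beta z) * Leb_n m (%v. ennreal (simplex_density m a v) * (ennreal (full_weights m v i) * G (point_config m z v, z i))))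
  = Unif_n (Suc m) (%z. ennreal (circle_density (Suc m) beta z) * Leb_n m (%v. ennreal (simplex_density m a v) * (ennreal (full_weights m v m) * G (point_config m z v, z m))))"
  (is "_ = (\<integral>\<^sup>+z. ?F z \<partial>_)")
proof -
 let ?tau = "swap_last m i"
 let ?z = "%z. \<lambda>k\<in>{..<Suc m}. z (?tau k) :: complex"
 let ?h = "%v z. ennreal (simplex_density m a v) * (ennreal (full_weights m v i) * G (point_config m z v, z i))"
 note [measurable] = measurable_circle_coordinate[of m "Suc m", OF lessI]
 let ?f = "%z. Leb_n m (%v. ?h v z)"
 have "Unif_n (Suc m) (%z. ?F z) = Unif_n (Suc m) (%z. ?F (?z z))"
  by (rule nn_integral_circle_n_permute[OF bij_swap_last[OF i], symmetric]) measurable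
 also have "... = Unif_n (Suc m) (%z. ennreal (circle_density (Suc m) beta z) * ?f z)"
 proof (rule nn_integral_cong)
  fix z assume z: "z \<in> space (circle_n (Suc m))"
  have zz: "?z z \<in> space (circle_n (Suc m))" using z i by (auto simp: space_PiM PiE_iff)
  have cd: "circle_density (Suc m) beta (?z z) = circle_density (Suc m) beta z"
   unfolding circle_density_permute[OF bij_swap_last[OF i], of beta z, symmetric] by (rule circle_density_cong) simp
  have zm: "?z z m = z i" using i by auto
  let ?g = "%v. ennreal (simplex_density m a v) * (ennreal (full_weights m v m) * G (point_config m (?z z) v, ?z z m))"
  have "Leb_n m (%v. ?g v) = Leb_n m (%v. ?g (reflect_coord m i v))"
  proof (rule nn_integral_reflect_coord[symmetric])
   note [measurable] = measurable_const[OF zz]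
   have [measurable]: "?z z m \<in> space circle_borel" using z i by (auto simp: space_PiM PiE_iff)
   show "?g \<in> borel_measurable (leb m)" by measurable
  qed
  also have "... = ?f z"
  proof (rule nn_integral_cong)
   fix v
   show "?g (reflect_coord m i v) = ?h v z"
   proof (cases "v \<in> open_simplex m")
    case True
    note w = reflect_coord_simplex(2)[OF i True]
    have "point_config m (?z z) (reflect_coord m i v) = weighted_points (Suc m) (%k. z (?tau k)) (%k. full_weights m v (?tau k))"
     unfolding point_config_def
     by (rule weighted_points_cong) (use space_circle_n[OF zz] w in auto)
    also have "... = point_config m z v"
     unfolding point_config_def by (rule weighted_points_permute[OF bij_swap_last[OF i] space_circle_n[OF z]])
    finally have "point_config m (?z z) (reflect_coord m i v) = point_config m z v" .
    moreover have "full_weights m (reflect_coord m i v) m = full_weights m v i" using w[of m] by auto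
    ultimately show ?thesis by (simp only: zm simplex_density_reflect[OF i])
   next
    case False
    then have "simplex_density m a v = 0" by (simp add: simplex_density_def)
    then show ?thesis by (simp only: simplex_density_reflect[OF i] ennreal_0 mult_zero_left)
   qed
  qed
  finally show "?F (?z z) = ennreal (circle_density (Suc m) beta z) * ?f z"
   by (simp only: cd)
 qed
 finally show ?thesis ..
qed

section \<open>The Palm formula\<close>

text \<open>Inverse to \<open>rotate_measure\<close> on the circle: it carries a point at 1 to
  \<open>u\<close>.\<close>

definition turn :: "complex => complex measure => complex measure" where
 "turn u nu = distr nu circle_borel (%z. u * z)"

lemma measurable_mult_circle: "cmod u = 1 ==> (%z. u * z) \<in> circle_borel \<rightarrow>\<^sub>M circle_borel"
 by (intro measurable_circle_mult) auto

lemma measurable_turn [measurable (raw)]: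
 assumes [measurable]: "f \<in> M \<rightarrow>\<^sub>M circle_borel" "g \<in> M \<rightarrow>\<^sub>M circle_measures"
 shows "(%x. turn (f x) (g x)) \<in> M \<rightarrow>\<^sub>M circle_measures"
 unfolding turn_def by measurable

lemma measurable_rotate_measure [measurable (raw)]:
 assumes [measurable]: "f \<in> M \<rightarrow>\<^sub>M circle_borel" "g \<in> M \<rightarrow>\<^sub>M circle_measures"
 shows "(%x. rotate_measure (f x) (g x)) \<in> M \<rightarrow>\<^sub>M circle_measures"
 unfolding rotate_measure_def by measurable

lemma turn_1: "nu \<in> space circle_measures ==> turn 1 nu = nu"
 unfolding turn_def mult_1_left using distr_id2[of circle_borel nu] by (simp add: circle_measuresD)

lemma rotate_turn:
 assumes u: "cmod u = 1" and nu: "nu \<in> space circle_measures"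
 shows "rotate_measure u (turn u nu) = nu"
proof -
 have nz: "u ~= 0" using u by auto
 have m: "(%z. u * z) \<in> nu \<rightarrow>\<^sub>M circle_borel"
  using measurable_mult_circle[OF u] by (simp add: circle_measuresD(2)[OF nu] cong: measurable_cong_sets)
 have d: "(%z. z / u) \<in> circle_borel \<rightarrow>\<^sub>M circle_borel" using u by (intro measurable_circle_mult) auto
 show ?thesis unfolding rotate_measure_def turn_def distr_distr[OF d m] comp_def
  using nz distr_id2[of circle_borel nu] nu by (simp add: circle_measuresD)
qed

lemma point_config_rotate:
 assumes u: "cmod u = 1" and z: "z \<in> space (circle_n (Suc m))" and z': "z' \<in> space (circle_n (Suc m))"
  and eq: "!!i. i \<le> m ==> z' i = u * z i"
 shows "point_config m z' v = turn u (point_config m z v)"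
proof (rule measure_eqI)
 have sz: "sets (point_config m x v) = sets circle_borel" for x by (simp add: point_config_def)
 show "sets (point_config m z' v) = sets (turn u (point_config m z v))" by (simp add: sz turn_def)
 fix B assume "B \<in> sets (point_config m z' v)"
 then have B: "B \<in> sets circle_borel" by (simp add: sz)
 have C: "(%z. u * z) -` B \<inter> sphere 0 1 \<in> sets circle_borel"
  using measurable_sets[OF measurable_mult_circle[OF u] B] by simp
 have "(%z. u * z) \<in> point_config m z v \<rightarrow>\<^sub>M circle_borel"
  using measurable_mult_circle[OF u] by (simp add: sz cong: measurable_cong_sets)
 then have "emeasure (turn u (point_config m z v)) B = emeasure (point_config m z v) ((%z. u * z) -` B \<inter> sphere 0 1)"
  unfolding turn_def using sets_eq_imp_space_eq[OF sz] B by (subst emeasure_distr) auto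
 also have "... = (\<Sum>i<Suc m. ennreal (full_weights m v i) * indicator ((%z. u * z) -` B \<inter> sphere 0 1) (z i))"
  unfolding point_config_def by (rule emeasure_weighted_points[OF space_circle_n[OF z] C])
 also have "... = (\<Sum>i<Suc m. ennreal (full_weights m v i) * indicator B (z' i))"
  using eq space_circle_n[OF z] by (intro sum.cong) (auto simp: indicator_def less_Suc_eq_le)
 also have "... = emeasure (point_config m z' v) B"
  unfolding point_config_def by (rule emeasure_weighted_points[OF space_circle_n[OF z'] B, symmetric])
 finally show "emeasure (point_config m z' v) B = emeasure (turn u (point_config m z v)) B" ..
qed

text \<open>The last point is placed at 1 and the factor \<open>full_weights m v m\<close> is the
  size bias by its weight. The factor \<open>Suc m\<close> counts the indices that the point moved
  to 1 may have had.\<close>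

definition biased_density :: "nat => real => real => (nat => complex) \<times> (nat => real) => ennreal" where
 "biased_density m beta c = (%(z, v). ennreal (c * Suc m) * (ennreal (circle_density (Suc m) beta (z(m := 1))) *
   (ennreal (simplex_density m (beta / 2 - 1) v) * ennreal (full_weights m v m))))"

definition biased_law :: "nat => real => real => complex measure measure" where
 "biased_law m beta c = distr (density (circle_n m \<Otimes>\<^sub>M leb m) (biased_density m beta c)) circle_measures
   (%(z, v). point_config m (z(m := 1)) v)"

lemma sets_biased_law [simp, measurable_cong]: "sets (biased_law m beta c) = sets circle_measures"
 by (simp add: biased_law_def)

lemma measurable_const_circle [measurable]: "cmod u = 1 ==> (%_. u) \<in> M \<rightarrow>\<^sub>M circle_borel"
 by simp

lemma measurable_upd_one [measurable]: "(%z. z(m := 1)) \<in> circle_n m \<rightarrow>\<^sub>M circle_n (Suc m)"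
 by (rule measurable_fun_upd_circle) auto

lemma measurable_biased_density [measurable]: "biased_density m beta c \<in> borel_measurable (circle_n m \<Otimes>\<^sub>M leb m)"
 unfolding biased_density_def split_beta' by measurable

lemma measurable_biased_config [measurable]:
 "(%(z, v). point_config m (z(m := 1)) v) \<in> circle_n m \<Otimes>\<^sub>M leb m \<rightarrow>\<^sub>M circle_measures"
 unfolding split_beta' by measurable

lemma nn_integral_biased_law:
 assumes [measurable]: "G \<in> borel_measurable circle_measures"
 shows "(\<integral>\<^sup>+nu. G nu \<partial>biased_law m beta c) = ennreal (c * Suc m) * Unif_n m (%z. ennreal (circle_density (Suc m) beta (z(m := 1))) *
   Leb_n m (%v. ennreal (simplex_density m (beta / 2 - 1) v) * (ennreal (full_weights m v m) * G (point_config m (z(m := 1)) v))))"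
proof -
 let ?f = "%v z. ennreal (simplex_density m (beta / 2 - 1) v) * (ennreal (full_weights m v m) * G (point_config m (z(m := 1)) v))"
 let ?g = "%z. ennreal (circle_density (Suc m) beta (z(m := 1))) * Leb_n m (%v. ?f v z)"
 let ?h = "%z. Leb_n m (%v. ennreal (c * Suc m) * (ennreal (circle_density (Suc m) beta (z(m := 1))) * ?f v z))"
 let ?p = "%p z v. biased_density m beta c p * G (case p of (z, v) => point_config m (z(m := 1)) v)"
 have "(\<integral>\<^sup>+nu. G nu \<partial>biased_law m beta c) = (\<integral>\<^sup>+p. ?p p z v \<partial>(circle_n m \<Otimes>\<^sub>M leb m))"
  unfolding biased_law_def by (subst nn_integral_distr, measurable) (subst nn_integral_density, measurable)
 also have "... = Unif_n m (%z. Leb_n m (%v. biased_density m beta c (z, v) * G (point_config m (z(m := 1)) v)))"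
 proof -
  have "(%p. ?p p z v) \<in> borel_measurable (circle_n m \<Otimes>\<^sub>M leb m)"
   by measurable
  from lebn.nn_integral_fst[OF this] show ?thesis by (simp only: split_conv)
 qed
 also have "... = Unif_n m (%z. ?h z)"
  by (simp only: biased_density_def split_conv mult.assoc)
 also have "... = Unif_n m (%z. ennreal (c * Suc m) * ?g z)"
 proof (rule nn_integral_cong)
  fix z assume z: "z \<in> space (circle_n m)"
  have "z(m := 1) \<in> space (circle_n (Suc m))" using measurable_space[OF measurable_upd_one z] .
  note [measurable] = measurable_const[OF this]
  have A: "(%v. ?f v z) \<in> borel_measurable (leb m)"
   by measurable
  show "?h z = ennreal (c * Suc m) * ?g z"
   unfolding nn_integral_cmult[OF borel_measurable_times_ennreal[OF borel_measurable_const A]] nn_integral_cmult[OF A] ..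
 qed
 also have "... = ennreal (c * Suc m) * Unif_n m (%z. ?g z)"
  by (rule nn_integral_cmult) measurable
 finally show ?thesis .
qed

lemma circle_measures_integral_measurable:
 assumes [measurable]: "G \<in> borel_measurable (circle_measures \<Otimes>\<^sub>M circle_borel)"
 shows "(%mu. \<integral>\<^sup>+x. G (mu, x) \<partial>mu) \<in> borel_measurable circle_measures"
proof (rule nn_integral_measurable_subprob_algebra2)
 show "(%mu. mu) \<in> circle_measures \<rightarrow>\<^sub>M subprob_algebra circle_borel"
  by (rule measurable_prob_algebraD) simp
qed simp

text \<open>For a fixed last point \<open>u\<close> only the other \<open>m\<close> points are
  multiplied by \<open>u\<close>, which preserves their uniform reference law. As the density
  depends only on the distances between points, the configuration is then one with last point 1,
  turned by \<open>u\<close>.\<close>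

lemma palm_formula:
 assumes c: "0 < c"
  and KN: "!!G. G \<in> borel_measurable circle_measures ==> (\<integral>\<^sup>+mu. G mu \<partial>KN) = ennreal c * kn_integral m beta G"
  and G[measurable]: "G \<in> borel_measurable (circle_measures \<Otimes>\<^sub>M circle_borel)"
 shows "(\<integral>\<^sup>+mu. (\<integral>\<^sup>+x. G (mu, x) \<partial>mu) \<partial>KN) = (Unif u. \<integral>\<^sup>+nu. G (turn u nu, u) \<partial>biased_law m beta c)"
proof -
 let ?s = "simplex_density m (beta / 2 - 1)" and ?d = "circle_density (Suc m) beta" and ?w = "full_weights m"
 note [measurable] = circle_measures_integral_measurable[OF G]
 let ?T = "%i z. ennreal (?d z) * Leb_n m (%v. ennreal (?s v) * (ennreal (?w v i) * G (point_config m z v, z i)))"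
 have T[measurable]: "?T i \<in> borel_measurable (circle_n (Suc m))" if "i \<le> m" for i
 proof -
  note [measurable] = measurable_circle_coordinate[of i "Suc m"]
  have [measurable]: "i < Suc m" using that by simp
  show ?thesis using that by measurable
 qed
 let ?f = "%v G z. ennreal (?s v) * (\<integral>\<^sup>+x. G (point_config m z v, x) \<partial>point_config m z v)"
 let ?g = "Unif_n (Suc m) (%z. \<Sum>i\<le>m. ?T i z)"
 let ?h = "%z v. point_config m (z(m := 1)) v"
 let ?p = "Unif_n (Suc m) (%z. ?T m z)"
 let ?q = "%u. Unif_n m (%z. ?T m (z(m := u)))"
 let ?r = "%G u. \<integral>\<^sup>+nu. G (turn u nu, u) \<partial>biased_law m beta c"
 have "(\<integral>\<^sup>+mu. (\<integral>\<^sup>+x. G (mu, x) \<partial>mu) \<partial>KN) = ennreal c * ?g"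
 proof -
  let ?t = "%v i G z. ennreal (?s v) * (ennreal (?w v i) * G (point_config m z v, z i))"
  have "kn_integral m beta (%mu. \<integral>\<^sup>+x. G (mu, x) \<partial>mu) = ?g"
   unfolding kn_integral_def
  proof (rule nn_integral_cong)
   fix z assume z: "z \<in> space (circle_n (Suc m))"
   note [measurable] = measurable_const[OF z]
   have zi: "z i \<in> space circle_borel" if "i \<le> m" for i using space_circle_n[OF z, of i] that by simp
   have "Leb_n m (%v. ?f v G z) = Leb_n m (%v. \<Sum>i\<le>m. ?t v i G z)"
   proof (rule nn_integral_cong)
    fix v
    have "(%x. G (point_config m z v, x)) \<in> borel_measurable circle_borel"
     by (rule measurable_compose[OF measurable_Pair1'[OF point_config_in_space[OF z]] G])
    from nn_integral_point_config[OF z this]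
    show "?f v G z = (\<Sum>i\<le>m. ?t v i G z)"
     by (simp add: sum_distrib_left)
   qed
   also have "... = (\<Sum>i\<le>m. Leb_n m (%v. ?t v i G z))"
   proof (rule nn_integral_sum)
    fix i assume "i \<in> {..m}"
    then have i: "i \<le> m" by simp
    note [measurable] = measurable_const[OF zi[OF i]]
    show "(%v. ?t v i G z) \<in> borel_measurable (leb m)"
     using i by measurable
   qed
   finally show "ennreal (?d z) * Leb_n m (%v. ?f v G z) = (\<Sum>i\<le>m. ?T i z)"
    by (simp only: sum_distrib_left)
  qed
  then show ?thesis by (subst KN) simp_all
 qed
 also have "?g = (\<Sum>i\<le>m. Unif_n (Suc m) (%z. ?T i z))"
  by (rule nn_integral_sum) (use T in auto)
 also have "... = (\<Sum>i\<le>m. ?p)"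
  by (intro sum.cong refl point_config_exchange G) simp
 also have "... = of_nat (Suc m) * ?p" by (simp only: sum_constant card_atMost)
 also have "?p = (Unif u. ?q u)"
  by (rule nn_integral_circle_Suc_rev) (use T in auto)
 also have "... = (Unif u. Unif_n m (%z. ennreal (?d (z(m := 1))) * Leb_n m (%v. ennreal (?s v) * (ennreal (?w v m) * G (turn u (?h z v), u)))))"
 proof (rule nn_integral_cong)
  fix u assume "u \<in> space circle_uniform"
  then have u: "cmod u = 1" by simp
  note [measurable] = measurable_const_circle[OF u]
  have [measurable]: "(%z. z(m := u)) \<in> circle_n m \<rightarrow>\<^sub>M circle_n (Suc m)"
   by (rule measurable_fun_upd_circle) auto
  let ?u = "%z G u. ennreal (?d (z(m := 1))) * Leb_n m (%v. ennreal (?s v) * (ennreal (?w v m) * G (turn u (?h z v), u)))"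
  have "?q u = (Unif_n m (%z. ?T m ((\<lambda>i\<in>{..<m}. u * z i)(m := u))))"
   by (rule circle_n_rotate[OF u, symmetric]) (rule measurable_compose[OF _ T], measurable)
  also have "... = Unif_n m (%z. ?u z G u)"
  proof (rule nn_integral_cong)
   fix z assume z: "z \<in> space (circle_n m)"
   let ?z = "(\<lambda>i\<in>{..<m}. u * z i)(m := u)"
   have z1: "z(m := 1) \<in> space (circle_n (Suc m))" using measurable_space[OF measurable_upd_one z] .
   have z2: "?z \<in> space (circle_n (Suc m))"
    using z u by (auto simp: space_PiM PiE_iff norm_mult extensional_def)
   have eq: "?z i = u * (z(m := 1)) i" if "i \<le> m" for i using that by auto
   have "?d ?z = ?d (z(m := 1))"
    using circle_density_cong[of "Suc m" ?z "%i. u * (z(m := 1)) i" beta] eq circle_density_rotate[OF u] by (simp only: less_Suc_eq_le)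
   moreover have "point_config m ?z v = turn u (?h z v)" for v
    by (rule point_config_rotate[OF u z1 z2 eq])
   moreover have "?z m = u" by simp
   ultimately show "?T m ?z = ?u z G u"
    by (simp only:)
  qed
  finally show "?q u = Unif_n m (%z. ?u z G u)" .
 qed
 also have "ennreal c * (of_nat (Suc m) * ...) = ennreal (c * Suc m) * ..."
  using c by (simp add: ennreal_mult mult.assoc ennreal_of_nat_eq_real_of_nat del: of_nat_Suc)
 also have "... = (Unif u. ennreal (c * Suc m) * Unif_n m (%z. ennreal (?d (z(m := 1))) * Leb_n m (%v. ennreal (?s v) * (ennreal (?w v m) * G (turn u (?h z v), u)))))"
  by (rule nn_integral_cmult[symmetric]) measurable
 also have "... = (Unif u. ?r G u)"
 proof (rule nn_integral_cong)
  fix u assume "u \<in> space circle_uniform"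
  then have u: "cmod u = 1" by simp
  note [measurable] = measurable_const_circle[OF u]
  show "ennreal (c * Suc m) * Unif_n m (%z. ennreal (?d (z(m := 1))) * Leb_n m (%v. ennreal (?s v) * (ennreal (?w v m) * G (turn u (?h z v), u)))) = ?r G u"
   by (rule nn_integral_biased_law[symmetric]) measurable
 qed
 finally show ?thesis .
qed

text \<open>The total mass is read off from the Palm formula for the constant function 1.\<close>

lemma prob_space_biased_law:
 assumes "0 < c" "prob_space KN" and sets: "sets KN = sets circle_measures"
  and KN: "!!G. G \<in> borel_measurable circle_measures ==> (\<integral>\<^sup>+mu. G mu \<partial>KN) = ennreal c * kn_integral m beta G"
 shows "prob_space (biased_law m beta c)"
proof
 interpret KN: prob_space KN by fact
 have "(\<integral>\<^sup>+mu. (\<integral>\<^sup>+x. 1 \<partial>mu) \<partial>KN) = (\<integral>\<^sup>+mu. 1 \<partial>KN)"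
  by (intro nn_integral_cong) (auto simp: sets_eq_imp_space_eq[OF sets] prob_space.emeasure_space_1 circle_measuresD(1))
 then have "1 = (Unif u. \<integral>\<^sup>+nu. 1 \<partial>biased_law m beta c)"
  using palm_formula[OF assms(1) KN, of "%_. 1"] KN.emeasure_space_1 by simp
 then show "emeasure (biased_law m beta c) (space (biased_law m beta c)) = 1"
  by (simp add: circ.emeasure_space_1[simplified])
qed

section \<open>Biasing by the weight of one\<close>

text \<open>Dominated convergence with the bound of \<open>f\<close> on the compact circle. Since
  such integrals generate the weak topology, this is weak continuity of turning in the
  angle.\<close>

lemma circle_continuous_integral_turn:
 fixes f :: "complex => real"
 assumes nu: "nu \<in> space circle_measures" and f: "continuous_on (sphere 0 1) f"
 shows "continuous_on (sphere 0 1) (%u. \<integral>z. f z \<partial>turn u nu)"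
proof -
 interpret nu: prob_space nu by (rule circle_measuresD(1)[OF nu])
 have s: "sets nu = sets circle_borel" "space nu = sphere 0 1" using circle_measuresD[OF nu] by auto
 have fm[measurable]: "f \<in> borel_measurable circle_borel" by (rule borel_measurable_circle_continuous[OF f])
 have um: "(%z. u * z) \<in> nu \<rightarrow>\<^sub>M circle_borel" if "cmod u = 1" for u
  using measurable_mult_circle[OF that] by (simp add: s cong: measurable_cong_sets)
 have eq: "(\<integral>z. f z \<partial>turn u nu) = (\<integral>z. f (u * z) \<partial>nu)" if "cmod u = 1" for u
  unfolding turn_def by (rule integral_distr[OF um[OF that] fm])
 obtain K where K: "!!z. cmod z = 1 ==> norm (f z) \<le> K"
  using compact_imp_bounded[OF compact_continuous_image[OF f compact_sphere]] by (force simp: bounded_iff)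
 have "continuous_on (sphere 0 1) (%u. \<integral>z. f (u * z) \<partial>nu)"
  unfolding continuous_on_sequentially comp_def
 proof (intro allI ballI impI, elim conjE)
  fix x :: "nat => complex" and a assume a: "a \<in> sphere 0 1" and x: "\<forall>n. x n \<in> sphere 0 1" "x \<longlonglongrightarrow> a"
  show "(%n. \<integral>z. f (x n * z) \<partial>nu) \<longlonglongrightarrow> (\<integral>z. f (a * z) \<partial>nu)"
  proof (rule integral_dominated_convergence[where w="%_. K"])
   show "AE z in nu. (%n. f (x n * z)) \<longlonglongrightarrow> f (a * z)"
   proof (rule AE_I2)
    fix z assume "z \<in> space nu"
    then have z: "cmod z = 1" by (simp add: s)
    have "(%n. x n * z) \<longlonglongrightarrow> a * z" using x(2) by (intro tendsto_intros)
    then show "(%n. f (x n * z)) \<longlonglongrightarrow> f (a * z)"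
     using f a x z unfolding continuous_on_sequentially comp_def
     by (elim allE[of _ "%n. x n * z"] ballE[of _ _ "a * z"]) (auto simp: norm_mult)
   qed
   show "(%z. f (a * z)) \<in> borel_measurable nu" using a by (intro measurable_compose[OF um fm]) simp
   show "(%z. f (x n * z)) \<in> borel_measurable nu" for n using x by (intro measurable_compose[OF um fm]) simp
   show "AE z in nu. norm (f (x n * z)) \<le> K" for n
    using x(1) by (intro AE_I2 K) (auto simp: s norm_mult)
  qed simp
 qed
 then show ?thesis by (rule continuous_on_eq) (simp add: eq)
qed

lemma turn_in_space: "cmod u = 1 ==> nu \<in> space circle_measures ==> turn u nu \<in> space circle_measures"
 using measurable_space[OF measurable_turn[of "%_. u" "count_space UNIV" "%_. nu"]] by simp

lemma topspace_weak_topology [simp]: "topspace weak_topology = space circle_measures"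
proof -
 have "\<exists>(f :: complex => real) V. {m \<in> space circle_measures. (\<integral>z. f z \<partial>m) \<in> V} = space circle_measures & continuous_on (sphere 0 1) f & open V"
  by (intro exI[of _ "%_. 0"] exI[of _ UNIV]) auto
 then show ?thesis unfolding weak_topology_def topology_generated_by_topspace by blast
qed

lemma continuous_map_turn:
 assumes nu: "nu \<in> space circle_measures"
 shows "continuous_map (top_of_set (sphere 0 1)) weak_topology (%u. turn u nu)"
 unfolding weak_topology_def continuous_on_generated_topo_iff
proof (intro conjI allI impI)
 fix U :: "complex measure set"
 assume "U \<in> {{m \<in> space circle_measures. (\<integral>z. f z \<partial>m) \<in> V} | (f :: complex => real) V. continuous_on (sphere 0 1) f & open V}"
 then obtain f :: "complex => real" and V where U: "U = {m \<in> space circle_measures. (\<integral>z. f z \<partial>m) \<in> V}" and f: "continuous_on (sphere 0 1) f" "open V"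
  by blast
 have "(%u. turn u nu) -` U \<inter> topspace (top_of_set (sphere 0 1)) = sphere 0 1 \<inter> (%u. \<integral>z. f z \<partial>turn u nu) -` V"
  using turn_in_space[OF _ nu] by (auto simp: U)
 then show "openin (top_of_set (sphere 0 1)) ((%u. turn u nu) -` U \<inter> topspace (top_of_set (sphere 0 1)))"
  using continuous_openin_preimage_gen[OF circle_continuous_integral_turn[OF nu f(1)] f(2)] by simp
next
 show "(%u. turn u nu) ` topspace (top_of_set (sphere 0 1)) \<subseteq> \<Union> {{m \<in> space circle_measures. (\<integral>z. f z \<partial>m) \<in> V} | (f :: complex => real) V. continuous_on (sphere 0 1) f & open V}"
  using turn_in_space[OF _ nu] topspace_weak_topology unfolding weak_topology_def topology_generated_by_topspace by auto
qed

lemma continuous_on_integral_turn_law: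
 fixes g :: "complex measure => real"
 assumes "prob_space N" and sets: "sets N = sets circle_measures"
  and g: "continuous_map weak_topology euclideanreal g" and gm[measurable]: "g \<in> borel_measurable circle_measures"
  and K: "!!m. m \<in> space circle_measures ==> norm (g m) \<le> K"
 shows "continuous_on (sphere 0 1) (%u. \<integral>nu. g (turn u nu) \<partial>N)"
 unfolding continuous_on_sequentially comp_def
proof (intro allI ballI impI, elim conjE)
 interpret N: prob_space N by fact
 have sp: "space N = space circle_measures" by (rule sets_eq_imp_space_eq[OF sets])
 fix x :: "nat => complex" and a assume a: "a \<in> sphere 0 1" and x: "\<forall>n. x n \<in> sphere 0 1" "x \<longlonglongrightarrow> a"
 have gt: "(%nu. g (turn u nu)) \<in> borel_measurable N" if "cmod u = 1" for u
 proof -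
  note [measurable] = measurable_const_circle[OF that]
  have "(%nu. g (turn u nu)) \<in> borel_measurable circle_measures" by measurable
  then show ?thesis by (simp add: sets cong: measurable_cong_sets)
 qed
 show "(%n. \<integral>nu. g (turn (x n) nu) \<partial>N) \<longlonglongrightarrow> (\<integral>nu. g (turn a nu) \<partial>N)"
 proof (rule integral_dominated_convergence[where w="%_. K"])
  show "AE nu in N. (%n. g (turn (x n) nu)) \<longlonglongrightarrow> g (turn a nu)"
  proof (rule AE_I2)
   fix nu assume "nu \<in> space N"
   then have nu: "nu \<in> space circle_measures" by (simp add: sp)
   have "continuous_map (top_of_set (sphere 0 1)) euclideanreal (g \<circ> (%u. turn u nu))"
    by (rule continuous_map_compose[OF continuous_map_turn[OF nu] g])
   then have "continuous_on (sphere 0 1) (%u. g (turn u nu))" by (simp add: comp_def)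
   then show "(%n. g (turn (x n) nu)) \<longlonglongrightarrow> g (turn a nu)"
    using a x unfolding continuous_on_sequentially comp_def by blast
  qed
  show "AE nu in N. norm (g (turn (x n) nu)) \<le> K" for n
   using x(1) by (intro AE_I2 K turn_in_space) (auto simp: sp)
  show "(%nu. g (turn a nu)) \<in> borel_measurable N" using a by (intro gt) simp
  show "(%nu. g (turn (x n) nu)) \<in> borel_measurable N" for n using x(1) by (intro gt) simp
 qed simp
qed

lemma nbhd_of_one_sets [measurable]: "nbhd_of_one \<epsilon> \<in> sets circle_borel"
proof -
 have "nbhd_of_one \<epsilon> = sphere 0 1 \<inter> ball 1 \<epsilon>" by (auto simp: nbhd_of_one_def dist_commute)
 then show ?thesis unfolding circle_borel_def by (auto simp: sets_restrict_space)
qed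

text \<open>By continuity of \<open>cis\<close> at 0 the neighbourhood contains the points of a
  short interval of angles to the right of 0, which has positive length.\<close>

lemma emeasure_nbhd_of_one:
 assumes "0 < \<epsilon>" shows "emeasure circle_uniform (nbhd_of_one \<epsilon>) ~= 0"
proof -
 have "isCont cis 0" using continuous_on_cis[OF continuous_on_id, of UNIV] by (simp add: continuous_on_eq_continuous_at)
 then obtain d where d: "0 < d" "!!t. \<bar>t\<bar> < d ==> dist (cis t) (cis 0) < \<epsilon>"
  using assms by (auto simp: continuous_at_eps_delta dist_real_def)
 define r where "r = min d (2 * pi)"
 have r: "0 < r" using d by (simp add: r_def)
 let ?f = "Leb t. indicator {0..<r} t"
 have "emeasure circle_uniform (nbhd_of_one \<epsilon>) = (Unif z. indicator (nbhd_of_one \<epsilon>) z)"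
  by (simp add: nn_integral_indicator)
 also have "... = (Leb t. indicator (nbhd_of_one \<epsilon>) (cis t) * indicator {0..<2 * pi} t) / ennreal (2 * pi)"
  by (rule nn_integral_circle_uniform) measurable
 also have "... \<ge> ?f / ennreal (2 * pi)"
 proof (intro divide_right_mono_ennreal nn_integral_mono)
  fix t
  show "indicator {0..<r} t \<le> (indicator (nbhd_of_one \<epsilon>) (cis t) * indicator {0..<2 * pi} t :: ennreal)"
   using d(2)[of t] by (auto simp: indicator_def r_def nbhd_of_one_def)
 qed
 also have "?f = ennreal r" using r by simp
 finally have "ennreal r / ennreal (2 * pi) \<le> emeasure circle_uniform (nbhd_of_one \<epsilon>)" .
 moreover have "0 < ennreal r / ennreal (2 * pi)" using r by (simp add: divide_ennreal)
 ultimately show ?thesis by auto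
qed

context
 fixes KN :: "complex measure measure" and m :: nat and beta c :: real
 assumes c: "0 < c" and prob_KN: "prob_space KN" and sets_KN: "sets KN = sets circle_measures"
  and KN: "!!G. G \<in> borel_measurable circle_measures ==> (\<integral>\<^sup>+mu. G mu \<partial>KN) = ennreal c * kn_integral m beta G"
begin

interpretation N: prob_space "biased_law m beta c" by (rule prob_space_biased_law[OF c prob_KN sets_KN KN])

text \<open>In the Palm formula the mass of the neighbourhood becomes the condition that the angle
  \<open>u\<close> lies in it. The approximating law is therefore that of a configuration from
  \<open>biased_law\<close> turned by an independent uniform point of the neighbourhood.\<close>

lemma biased_approx_eq:
 assumes "0 < \<epsilon>"
 shows "biased_approx \<epsilon> KN = distr (uniform_measure circle_uniform (nbhd_of_one \<epsilon>) \<Otimes>\<^sub>M biased_law m beta c) circle_measures (%(u, nu). turn u nu)"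
proof (rule measure_eqI)
 let ?B = "nbhd_of_one \<epsilon>" and ?N = "biased_law m beta c"
 let ?f = "%(u, nu). turn u nu"
 let ?g = "biased_approx \<epsilon> KN"
 show "sets ?g = sets (distr (uniform_measure circle_uniform ?B \<Otimes>\<^sub>M ?N) circle_measures ?f)"
  by (simp add: biased_approx_def sets_KN)
 fix A assume "A \<in> sets ?g"
 then have A[measurable]: "A \<in> sets circle_measures" by (simp add: biased_approx_def sets_KN)
 have cong: "borel_measurable KN = borel_measurable circle_measures" by (rule measurable_cong_sets[OF sets_KN refl])
 have emB: "emeasure mu ?B = (\<integral>\<^sup>+x. indicator ?B x \<partial>mu)" if "mu \<in> space circle_measures" for mu
  using circle_measuresD(2)[OF that] by (subst nn_integral_indicator) auto
 have [measurable]: "(%mu. emeasure mu ?B) \<in> borel_measurable circle_measures"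
  by (rule measurable_compose[OF measurable_prob_algebraD[OF measurable_ident_sets[OF refl], unfolded id_def] measurable_emeasure_subprob_algebra]) measurable
 have sp: "space KN = space circle_measures" by (rule sets_eq_imp_space_eq[OF sets_KN])
 let ?h = "\<integral>\<^sup>+mu. emeasure mu ?B * indicator A mu \<partial>KN"
 let ?p = "%u nu. indicator ?B u * indicator A (turn u nu)"
 let ?q = "\<integral>\<^sup>+mu. emeasure mu ?B \<partial>KN"
 have "emeasure ?g A = (\<integral>\<^sup>+mu. indicator A mu \<partial>biased_approx \<epsilon> KN)"
  by (subst nn_integral_indicator) (auto simp: biased_approx_def sets_KN)
 also have "... = ?h / ?q"
  unfolding biased_approx_def by (rule nn_integral_normalized_density) (simp_all add: cong)
 also have "?h = (\<integral>\<^sup>+mu. (\<integral>\<^sup>+x. indicator ?B x * indicator A mu \<partial>mu) \<partial>KN)"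
 proof (rule nn_integral_cong)
  fix mu assume "mu \<in> space KN"
  then have mu: "mu \<in> space circle_measures" by (simp add: sp)
  show "emeasure mu ?B * indicator A mu = (\<integral>\<^sup>+x. indicator ?B x * indicator A mu \<partial>mu)"
   unfolding emB[OF mu] by (rule nn_integral_multc[symmetric])
    (intro borel_measurable_indicator, simp add: circle_measuresD(2)[OF mu])
 qed
 also have "... = (Unif u. \<integral>\<^sup>+nu. ?p u nu \<partial>?N)"
  using palm_formula[OF c KN, of "%(mu, x). indicator ?B x * indicator A mu"] by (simp add: split_beta')
 also have "?q = (\<integral>\<^sup>+mu. (\<integral>\<^sup>+x. indicator ?B x \<partial>mu) \<partial>KN)"
  by (rule nn_integral_cong) (simp add: emB sp)
 also have "... = (Unif u. \<integral>\<^sup>+nu. indicator ?B u \<partial>?N)"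
  using palm_formula[OF c KN, of "%(mu, x). indicator ?B x"] by (simp add: split_beta')
 also have "... = emeasure circle_uniform ?B"
  by (simp add: N.emeasure_space_1 nn_integral_indicator)
 also have "(Unif u. \<integral>\<^sup>+nu. ?p u nu \<partial>?N) / emeasure circle_uniform ?B = (\<integral>\<^sup>+u. (\<integral>\<^sup>+nu. indicator A (turn u nu) \<partial>?N) \<partial>uniform_measure circle_uniform ?B)"
 proof -
  let ?r = "%A u. \<integral>\<^sup>+nu. indicator A (turn u nu) \<partial>?N"
  have "(Unif u. \<integral>\<^sup>+nu. ?p u nu \<partial>?N) = (Unif u. ?r A u * indicator ?B u)"
  proof (rule nn_integral_cong)
   fix u assume "u \<in> space circle_uniform"
   then have "cmod u = 1" by simp
   note [measurable] = measurable_const_circle[OF this]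
   show "(\<integral>\<^sup>+nu. ?p u nu \<partial>?N) = ?r A u * indicator ?B u"
    by (subst nn_integral_cmult) (measurable, simp add: mult.commute)
  qed
  moreover have "(%u. ?r A u) \<in> borel_measurable circle_borel" by measurable
  ultimately show ?thesis by (subst nn_integral_uniform_measure) (simp_all cong: measurable_cong_sets)
 qed
 also have "... = (\<integral>\<^sup>+p. indicator A (case p of (u, nu) => turn u nu) \<partial>(uniform_measure circle_uniform ?B \<Otimes>\<^sub>M ?N))"
 proof -
  have "(%p. indicator A (case p of (u, nu) => turn u nu) :: ennreal) \<in> borel_measurable (uniform_measure circle_uniform ?B \<Otimes>\<^sub>M ?N)"
   by measurable
  from N.nn_integral_fst[OF this] show ?thesis by (simp only: split_conv)
 qed
 also have "... = (\<integral>\<^sup>+mu. indicator A mu \<partial>distr (uniform_measure circle_uniform ?B \<Otimes>\<^sub>M ?N) circle_measures ?f)"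
  by (rule nn_integral_distr[symmetric]) measurable
 also have "... = emeasure (distr (uniform_measure circle_uniform ?B \<Otimes>\<^sub>M ?N) circle_measures ?f) A"
  by (rule nn_integral_indicator) simp
 finally show "emeasure ?g A = emeasure (distr (uniform_measure circle_uniform ?B \<Otimes>\<^sub>M ?N) circle_measures ?f) A" .
qed

lemma is_biased_law: "is_biased_by_weight_of_one KN (biased_law m beta c)"
 unfolding is_biased_by_weight_of_one_def converges_in_distribution_def
proof (intro conjI allI impI, rule N.prob_space_axioms, simp, elim conjE)
 let ?N = "biased_law m beta c"
 fix g :: "complex measure => real"
 assume g: "continuous_map weak_topology euclideanreal g" and "bounded (g ` topspace weak_topology)"
 then obtain K where K: "!!m. m \<in> space circle_measures ==> norm (g m) \<le> K" by (auto simp: bounded_iff)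
 let ?f = "%\<epsilon>. \<integral>m. g m \<partial>biased_approx \<epsilon> KN"
 let ?g = "\<integral>m. g m \<partial>?N"
 show "((%\<epsilon>. ?f \<epsilon>) \<longlongrightarrow> ?g) (at_right 0)"
 proof (cases "g \<in> borel_measurable circle_measures")
  \<comment> \<open>If \<open>g\<close> is not measurable, it is not integrable for any of these
    laws, all integrals take the default value 0, and the convergence is trivial.\<close>
  case False
  have "(\<integral>m. g m \<partial>M) = 0" if "sets M = sets circle_measures" for M
   using False that by (intro not_integrable_integral_eq) (auto dest!: borel_measurable_integrable cong: measurable_cong_sets)
  then show ?thesis by (simp add: biased_approx_def sets_KN)
 next
  case gm[measurable]: True
  \<comment> \<open>The expectation as a function of the turning point. It is continuous, so its
    averages over shrinking neighbourhoods of 1 tend to its value at 1.\<close>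
  define psi where "psi u = (\<integral>nu. g (turn u nu) \<partial>?N)" for u
  have cont: "continuous_on (sphere 0 1) psi"
   unfolding psi_def by (rule continuous_on_integral_turn_law[OF N.prob_space_axioms sets_biased_law g gm K])
  have sp: "space ?N = space circle_measures" by (rule sets_eq_imp_space_eq) simp
  have psi1: "psi 1 = ?g"
   unfolding psi_def by (intro Bochner_Integration.integral_cong refl) (simp add: turn_1 sp)
  have avg: "(?f \<epsilon>) = (\<integral>u. psi u \<partial>uniform_measure circle_uniform (nbhd_of_one \<epsilon>)) & integrable (uniform_measure circle_uniform (nbhd_of_one \<epsilon>)) psi & prob_space (uniform_measure circle_uniform (nbhd_of_one \<epsilon>))" if "0 < \<epsilon>" for \<epsilon>
  proof -
   let ?U = "uniform_measure circle_uniform (nbhd_of_one \<epsilon>)"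
   interpret U: prob_space ?U
    by (rule prob_space_uniform_measure) (use emeasure_nbhd_of_one[OF that] in auto)
   interpret UN: pair_prob_space ?U ?N ..
   have [measurable]: "(%(u, nu). turn u nu) \<in> ?U \<Otimes>\<^sub>M ?N \<rightarrow>\<^sub>M circle_measures" by measurable
   have int: "integrable (?U \<Otimes>\<^sub>M ?N) (%p. g (case p of (u, nu) => turn u nu))"
   proof (rule UN.integrable_const_bound[where B=K])
    show "AE p in ?U \<Otimes>\<^sub>M ?N. norm (g (case p of (u, nu) => turn u nu)) \<le> K"
     by (intro AE_I2 K) (auto simp: space_pair_measure sp intro: turn_in_space)
   qed measurable
   have "(?f \<epsilon>) = (\<integral>p. g (case p of (u, nu) => turn u nu) \<partial>(?U \<Otimes>\<^sub>M ?N))"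
    unfolding biased_approx_eq[OF that] by (rule integral_distr) measurable
   also have "... = (\<integral>u. psi u \<partial>?U)"
    using UN.integral_fst'[OF int] by (simp add: psi_def)
   finally show ?thesis using UN.integrable_fst'[OF int] U.prob_space_axioms by (simp add: psi_def[abs_def])
  qed
  show ?thesis
  proof (rule tendstoI)
   fix e :: real assume e: "0 < e"
   from cont have "continuous (at 1 within sphere 0 1) psi" by (simp add: continuous_on_eq_continuous_within)
   then obtain d where d: "0 < d" "!!u. u \<in> sphere 0 1 ==> dist u 1 < d ==> dist (psi u) (psi 1) < e / 2"
    using e unfolding continuous_within_eps_delta by (metis half_gt_zero)
   have "dist (?f \<epsilon>) ?g < e" if \<epsilon>: "0 < \<epsilon>" "\<epsilon> < d" for \<epsilon>
   proof -
    let ?U = "uniform_measure circle_uniform (nbhd_of_one \<epsilon>)"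
    interpret U: prob_space ?U using avg[OF \<epsilon>(1)] by blast
    have int: "integrable ?U psi" using avg[OF \<epsilon>(1)] by blast
    have ae: "AE u in ?U. psi 1 - e / 2 \<le> psi u & psi u \<le> psi 1 + e / 2"
    proof (rule AE_uniform_measureI)
     show "AE u in circle_uniform. u \<in> nbhd_of_one \<epsilon> --> psi 1 - e / 2 \<le> psi u & psi u \<le> psi 1 + e / 2"
     proof (intro AE_I2 impI)
      fix u assume "u \<in> nbhd_of_one \<epsilon>"
      then have "dist (psi u) (psi 1) < e / 2" using \<epsilon> by (intro d) (auto simp: nbhd_of_one_def)
      then show "psi 1 - e / 2 \<le> psi u & psi u \<le> psi 1 + e / 2" unfolding dist_real_def by linarith
     qed
    qed simp
    have "psi 1 - e / 2 \<le> (\<integral>u. psi u \<partial>?U)" using ae by (intro U.integral_ge_const[OF int]) auto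
    moreover have "(\<integral>u. psi u \<partial>?U) \<le> psi 1 + e / 2" using ae by (intro U.integral_le_const[OF int]) auto
    ultimately show ?thesis using avg[OF \<epsilon>(1)] e unfolding psi1[symmetric] dist_real_def by linarith
   qed
   then show "\<forall>\<^sub>F \<epsilon> in at_right 0. dist (?f \<epsilon>) ?g < e"
    using d(1) unfolding eventually_at_right_field by blast
  qed
 qed
qed

end

section \<open>Supports\<close>

lemma supp_alt:
 assumes "m \<in> space circle_measures"
 shows "supp m = {x \<in> sphere 0 1. \<forall>U. open U --> x \<in> U --> emeasure m (U \<inter> sphere 0 1) > 0}"
 unfolding supp_def circle_measuresD(3)[OF assms] ..

lemma open_Int_sphere_sets: "open U ==> U \<inter> sphere 0 1 \<in> sets circle_borel"
 unfolding circle_borel_def sets_restrict_space by (rule image_eqI[of _ _ U]) auto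

text \<open>One direction is the definition of the support; the other uses that the complement of
  the support is null. Hitting events thereby become conditions on masses, which makes the support
  measurable.\<close>

lemma supp_Int_open:
 assumes m: "m \<in> space circle_measures" and U: "open U"
 shows "supp m \<inter> U ~= {} \<longleftrightarrow> emeasure m (U \<inter> sphere 0 1) ~= 0"
proof
 assume "supp m \<inter> U ~= {}"
 then show "emeasure m (U \<inter> sphere 0 1) ~= 0" using U unfolding supp_alt[OF m] by fastforce
next
 assume nz: "emeasure m (U \<inter> sphere 0 1) ~= 0"
 show "supp m \<inter> U ~= {}"
 proof
  assume "supp m \<inter> U = {}"
  then have "AE z in m. z \<notin> U \<inter> space m" using emeasure_outside_supp[OF m] by (auto elim!: eventually_mono)
  then have "emeasure m (U \<inter> space m) = emeasure m {}"
   using open_Int_space_circle[OF m U] by (intro emeasure_eq_AE) auto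
  then show False using nz unfolding circle_measuresD(3)[OF m] by simp
 qed
qed

lemma closed_supp: assumes m: "m \<in> space circle_measures" shows "closed (supp m)" "supp m \<subseteq> sphere 0 1"
proof -
 show sub: "supp m \<subseteq> sphere 0 1" unfolding supp_alt[OF m] by auto
 have "closure (supp m) \<subseteq> supp m"
 proof
  fix x assume x: "x \<in> closure (supp m)"
  then have "x \<in> sphere 0 1" using closure_mono[OF sub] by auto
  moreover have "emeasure m (U \<inter> sphere 0 1) > 0" if "open U" "x \<in> U" for U
  proof -
   have "supp m \<inter> U ~= {}" using x that closure_iff_nhds_not_empty[of x "supp m"] by blast
   then show ?thesis using supp_Int_open[OF m that(1)] by (simp add: zero_less_iff_neq_zero)
  qed
  ultimately show "x \<in> supp m" unfolding supp_alt[OF m] by blast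
 qed
 then show "closed (supp m)" by (metis closed_closure closure_subset subset_antisym)
qed

lemma measurable_supp [measurable]: "supp \<in> circle_measures \<rightarrow>\<^sub>M closed_subsets"
 unfolding closed_subsets_def
proof (rule measurable_measure_of)
 show "supp \<in> space circle_measures \<rightarrow> {S. closed S & S \<subseteq> sphere 0 1}" using closed_supp by auto
 fix B assume "B \<in> {{S :: complex set. closed S & S \<subseteq> sphere 0 1 & S \<inter> U ~= {}} | U. open U}"
 then obtain U where U: "open U" and B: "B = {S. closed S & S \<subseteq> sphere 0 1 & S \<inter> U ~= {}}" by blast
 have "supp -` B \<inter> space circle_measures = {m \<in> space circle_measures. emeasure m (U \<inter> sphere 0 1) ~= 0}"
  using supp_Int_open[OF _ U] closed_supp unfolding B by auto
 moreover have "U \<inter> sphere 0 1 \<in> sets circle_borel" using U by (rule open_Int_sphere_sets)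
 then have "(%m. emeasure m (U \<inter> sphere 0 1)) \<in> borel_measurable circle_measures"
  by (intro measurable_compose[OF measurable_prob_algebraD[OF measurable_ident_sets[OF refl], unfolded id_def] measurable_emeasure_subprob_algebra])
 then have "{m \<in> space circle_measures. emeasure m (U \<inter> sphere 0 1) ~= 0} \<in> sets circle_measures" by measurable
 ultimately show "supp -` B \<inter> space circle_measures \<in> sets circle_measures" by simp
qed auto

lemma rotate_in_space: "cmod x = 1 ==> m \<in> space circle_measures ==> rotate_measure x m \<in> space circle_measures"
 using measurable_space[OF measurable_rotate_measure[of "%_. x" "count_space UNIV" "%_. m"]] by simp

lemma supp_rotate:
 assumes x: "cmod x = 1" and m: "m \<in> space circle_measures"
 shows "supp (rotate_measure x m) = {y. y * x \<in> supp m}"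
proof -
 have nz: "x ~= 0" using x by auto
 have d: "(%z. z / x) \<in> m \<rightarrow>\<^sub>M circle_borel"
  using measurable_circle_mult(2)[of "%z. z" circle_borel "%_. x"] x by (simp add: circle_measuresD(2)[OF m] cong: measurable_cong_sets)
 have em: "emeasure (rotate_measure x m) (U \<inter> sphere 0 1) = emeasure m ({z. z / x \<in> U} \<inter> sphere 0 1)" if "open U" for U
 proof -
  have "U \<inter> sphere 0 1 \<in> sets circle_borel" using that by (rule open_Int_sphere_sets)
  then show ?thesis unfolding rotate_measure_def using x circle_measuresD(3)[OF m]
   by (subst emeasure_distr[OF d]) (auto intro!: arg_cong[where f="emeasure m"] simp: norm_divide)
 qed
 have op: "open {z. z / x \<in> U}" if "open U" for U
  using open_vimage[OF that, of "%z. z / x"] nz by (simp add: vimage_def continuous_intros)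
 have op': "open {z. z * x \<in> U}" if "open U" for U
  using open_vimage[OF that, of "%z. z * x"] by (simp add: vimage_def continuous_intros)
 show ?thesis
 proof (intro equalityI subsetI CollectI)
  fix y assume y: "y \<in> supp (rotate_measure x m)"
  have "emeasure m (V \<inter> sphere 0 1) > 0" if V: "open V" "y * x \<in> V" for V
  proof -
   have "{z. z / x \<in> {z. z * x \<in> V}} = V" using nz by auto
   then show ?thesis using y V em[OF op'[OF V(1)]] op'[OF V(1)] unfolding supp_alt[OF rotate_in_space[OF x m]] by force
  qed
  then show "y * x \<in> supp m" using y x unfolding supp_alt[OF m] supp_alt[OF rotate_in_space[OF x m]] by (auto simp: norm_mult)
 next
  fix y assume "y \<in> {y. y * x \<in> supp m}"
  then have y: "y * x \<in> supp m" by simp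
  have "emeasure m ({z. z / x \<in> U} \<inter> sphere 0 1) > 0" if "open U" "y \<in> U" for U
   using y op[OF that(1)] that(2) nz unfolding supp_alt[OF m] by simp
  then show "y \<in> supp (rotate_measure x m)"
   using y x unfolding supp_alt[OF m] supp_alt[OF rotate_in_space[OF x m]] by (auto simp: norm_mult em)
 qed
qed

section \<open>Measures with finite support\<close>

context
 fixes m :: "complex measure"
 assumes m: "m \<in> space circle_measures" and fin: "finite (supp m)"
begin

lemma singleton_sets_circle: "x \<in> sphere 0 1 ==> {x} \<in> sets m"
 unfolding circle_measuresD(2)[OF m] circle_borel_def by (auto simp: sets_restrict_space)

lemma nn_integral_finite_supp:
 assumes F: "F \<in> borel_measurable circle_borel"
 shows "(\<integral>\<^sup>+x. F x \<partial>m) = (\<Sum>x\<in>supp m. F x * emeasure m {x})"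
proof -
 have "(\<integral>\<^sup>+x. F x \<partial>m) = (\<integral>\<^sup>+x. (\<Sum>s\<in>supp m. F s * indicator {s} x) \<partial>m)"
 proof (rule nn_integral_cong_AE)
  show "AE x in m. F x = (\<Sum>s\<in>supp m. F s * indicator {s} x)"
   using emeasure_outside_supp[OF m]
  proof eventually_elim
   case (elim x)
   then show ?case using fin by (simp add: indicator_def if_distrib[where f="(*) _"] cong: if_cong)
  qed
 qed
 also have "... = (\<Sum>s\<in>supp m. \<integral>\<^sup>+x. F s * indicator {s} x \<partial>m)"
  using singleton_sets_circle closed_supp(2)[OF m] by (intro nn_integral_sum) auto
 also have "... = (\<Sum>s\<in>supp m. F s * emeasure m {s})"
  using singleton_sets_circle closed_supp(2)[OF m] by (intro sum.cong refl nn_integral_cmult_indicator) auto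
 finally show ?thesis .
qed

text \<open>Removing the finitely many other support points leaves an open neighbourhood of
  \<open>x\<close> whose mass is that of the atom.\<close>

lemma emeasure_supp_point: assumes x: "x \<in> supp m" shows "emeasure m {x} ~= 0"
proof -
 let ?U = "- (supp m - {x})"
 have U: "open ?U" using fin by (intro open_Compl finite_imp_closed) auto
 have x1: "x \<in> sphere 0 1" using x closed_supp(2)[OF m] by auto
 have "emeasure m (?U \<inter> sphere 0 1) = emeasure m {x}"
 proof (rule emeasure_eq_AE)
  show "AE z in m. z \<in> ?U \<inter> sphere 0 1 \<longleftrightarrow> z \<in> {x}"
   using emeasure_outside_supp[OF m] by eventually_elim (use x1 in auto)
  show "?U \<inter> sphere 0 1 \<in> sets m" using open_Int_space_circle[OF m U] by (simp add: circle_measuresD(3)[OF m])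
 qed (rule singleton_sets_circle[OF x1])
 moreover have "supp m \<inter> ?U ~= {}" using x by auto
 ultimately show ?thesis using supp_Int_open[OF m U] by simp
qed

context
 fixes n :: nat
 assumes card: "card (supp m) = n" and n: "0 < n"
begin

lemma uniform_on_supp_weighted:
 obtains z where "bij_betw z {..<n} (supp m)" "uniform_on_supp m = weighted_points n z (%_. 1 / n)"
proof -
 obtain z where z: "bij_betw z {..<n} (supp m)"
  using ex_bij_betw_nat_finite[OF fin] card by (auto simp: atLeast0LessThan)
 have zs: "cmod (z i) = 1" if "i < n" for i
  using bij_betwE[OF z] that closed_supp(2)[OF m] by (metis lessThan_iff mem_sphere_0 subsetD)
 have id: "(%z. z) \<in> uniform_count_measure (supp m) \<rightarrow>\<^sub>M circle_borel"
  using closed_supp(2)[OF m] by (auto simp: uniform_count_measure_def point_measure_def)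
 let ?f = "%z. weighted_points n z (%_. 1 / n)"
 have "uniform_on_supp m = ?f z"
 proof (rule measure_eqI)
  show "sets (uniform_on_supp m) = sets (?f z)" by (simp add: uniform_on_supp_def fin)
  fix B assume "B \<in> sets (uniform_on_supp m)"
  then have B: "B \<in> sets circle_borel" by (simp add: uniform_on_supp_def fin)
  have "emeasure (uniform_on_supp m) B = emeasure (uniform_count_measure (supp m)) (B \<inter> supp m)"
   using fin B by (simp add: uniform_on_supp_def emeasure_distr[OF id] space_uniform_count_measure)
  also have "... = (\<Sum>x\<in>B \<inter> supp m. ennreal (1 / n))"
   unfolding uniform_count_measure_def card by (rule emeasure_point_measure_finite[OF fin]) auto
  also have "... = (\<Sum>x\<in>supp m. ennreal (1 / n) * indicator B x)"
   unfolding Int_commute[of B] sum.inter_restrict[OF fin] by (intro sum.cong) (auto simp: indicator_def)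
  also have "... = (\<Sum>i<n. ennreal (1 / n) * indicator B (z i))" by (rule sum.reindex_bij_betw[OF z, symmetric])
  also have "... = emeasure (?f z) B" by (rule emeasure_weighted_points[OF zs B, symmetric])
  finally show "emeasure (uniform_on_supp m) B = emeasure (?f z) B" .
 qed
 with z show ?thesis by (rule that)
qed

lemma uniform_on_supp_facts:
 shows "uniform_on_supp m \<in> space circle_measures" "supp (uniform_on_supp m) = supp m"
  and "F \<in> borel_measurable circle_borel ==> (\<integral>\<^sup>+x. F x \<partial>uniform_on_supp m) = (\<Sum>x\<in>supp m. F x * ennreal (1 / n))"
proof -
 obtain z where z: "bij_betw z {..<n} (supp m)" "uniform_on_supp m = weighted_points n z (%_. 1 / n)"
  by (rule uniform_on_supp_weighted)
 have zs: "cmod (z i) = 1" if "i < n" for i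
  using bij_betwE[OF z(1)] that closed_supp(2)[OF m] by (metis lessThan_iff mem_sphere_0 subsetD)
 show "uniform_on_supp m \<in> space circle_measures"
  unfolding z(2) by (rule weighted_points_in_circle_measures) (use zs n in auto)
 show "supp (uniform_on_supp m) = supp m"
  unfolding z(2) using z(1) n by (subst supp_weighted_points) (auto simp: zs bij_betw_def)
 show "(\<integral>\<^sup>+x. F x \<partial>uniform_on_supp m) = (\<Sum>x\<in>supp m. F x * ennreal (1 / n))" if F: "F \<in> borel_measurable circle_borel"
  using nn_integral_weighted_points[of n z F "%_. 1 / n"] zs F
   sum.reindex_bij_betw[OF z(1), of "%x. F x * ennreal (1 / n)"] by (simp add: mult.commute z(2))
qed

text \<open>The uniform measure has density \<open>1 / (n * m {x})\<close> with respect to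
  \<open>m\<close>, and the rotated supports of the two measures agree. Integrals over uniformly
  picked points thereby come within reach of the Palm formula.\<close>

lemma integral_uniform_on_supp:
 assumes [measurable]: "A \<in> sets closed_subsets"
 shows "(\<integral>\<^sup>+x. indicator A (supp (rotate_measure x (uniform_on_supp m))) \<partial>uniform_on_supp m)
  = (\<integral>\<^sup>+x. indicator A (supp (rotate_measure x m)) * inverse (of_nat n * emeasure m {x}) \<partial>m)"
proof -
 interpret m: prob_space m by (rule circle_measuresD(1)[OF m])
 have s1: "cmod x = 1" if "x \<in> supp m" for x using that closed_supp(2)[OF m] by auto
 \<comment> \<open>Setting the mass to 0 outside the support turns it into a finite sum of
   indicators, whose measurability is clear.\<close>
 let ?p = "%x m. if x \<in> supp m then emeasure m {x} else 0"
 have meas[measurable]: "(%x. indicator A (supp (rotate_measure x nu)) :: ennreal) \<in> borel_measurable circle_borel" if "nu \<in> space circle_measures" for nu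
 proof -
  note [measurable] = measurable_const[OF that]
  show ?thesis by measurable
 qed
 let ?f = "%x m. indicator A (supp (rotate_measure x m)) * inverse (of_nat n * ?p x m)"
 let ?g = "%x m. supp (rotate_measure x (uniform_on_supp m))"
 let ?h = "%x m. indicator A (supp (rotate_measure x m)) * inverse (of_nat n * emeasure m {x}) * emeasure m {x}"
 have "(\<integral>\<^sup>+x. indicator A (?g x m) \<partial>uniform_on_supp m) = (\<Sum>x\<in>supp m. indicator A (?g x m) * ennreal (1 / n))"
  by (rule uniform_on_supp_facts(3)[OF meas[OF uniform_on_supp_facts(1)]])
 also have "... = (\<Sum>x\<in>supp m. ?h x m)"
 proof (rule sum.cong)
  fix x assume x: "x \<in> supp m"
  have "?g x m = supp (rotate_measure x m)"
   using s1[OF x] m uniform_on_supp_facts(1,2) by (simp add: supp_rotate)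
  moreover have "inverse (of_nat n * emeasure m {x}) * emeasure m {x} = ennreal (1 / n)"
  proof -
   obtain r where r: "emeasure m {x} = ennreal r" "0 \<le> r" by (cases "emeasure m {x}") auto
   then have "0 < r" using emeasure_supp_point[OF x] by (auto simp: less_le)
   moreover have "of_nat n * ennreal r = ennreal (real n * r)" using r by (simp add: ennreal_mult ennreal_of_nat_eq_real_of_nat)
   ultimately show ?thesis using n r by (simp add: inverse_ennreal ennreal_mult[symmetric] field_simps)
  qed
  ultimately show "indicator A (?g x m) * ennreal (1 / n) = ?h x m"
   by (simp add: mult.assoc)
 qed simp
 also have "... = (\<Sum>x\<in>supp m. ?f x m * emeasure m {x})"
  by (intro sum.cong) auto
 also have "... = (\<integral>\<^sup>+x. ?f x m \<partial>m)"
 proof (rule nn_integral_finite_supp[symmetric])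
  have e: "(%x. ?p x m) = (%x. \<Sum>s\<in>supp m. emeasure m {s} * indicator {s} x)"
   using fin by (auto simp: fun_eq_iff indicator_def if_distrib[where f="(*) _"] cong: if_cong)
  have "(%x. ?p x m) \<in> borel_measurable circle_borel"
   unfolding e using singleton_sets_circle s1 circle_measuresD(2)[OF m]
   by (intro borel_measurable_sum borel_measurable_times_ennreal borel_measurable_const borel_measurable_indicator) auto
  then show "(%x. ?f x m) \<in> borel_measurable circle_borel"
   using meas[OF m] by measurable
 qed
 also have "... = (\<integral>\<^sup>+x. indicator A (supp (rotate_measure x m)) * inverse (of_nat n * emeasure m {x}) \<partial>m)"
  by (rule nn_integral_cong_AE) (use emeasure_outside_supp[OF m] in eventually_elim, simp)
 finally show ?thesis .
qed

end

end

text \<open>\<open>picked_from\<close> prescribes the joint law on rectangles only. Rectangles are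
  stable under intersection and generate the product, so the joint law is that of the kernel
  \<open>K\<close>, and integrals can be evaluated in two stages.\<close>

lemma picked_from_integral:
 assumes P: "picked_from \<Omega> X kappa" and "prob_space \<Omega>"
  and H[measurable]: "H \<in> borel_measurable (circle_measures \<Otimes>\<^sub>M circle_borel)"
 shows "(\<integral>\<^sup>+omega. H (kappa omega, X omega) \<partial>\<Omega>) = (\<integral>\<^sup>+omega. (\<integral>\<^sup>+x. H (kappa omega, x) \<partial>kappa omega) \<partial>\<Omega>)"
proof -
 interpret \<Omega>: prob_space \<Omega> by fact
 let ?P = "circle_measures \<Otimes>\<^sub>M circle_borel"
 let ?h = "%kappa omega B A. emeasure (kappa omega) B * indicator {omega \<in> space \<Omega>. kappa omega \<in> A} omega"
 have kappa[measurable]: "kappa \<in> \<Omega> \<rightarrow>\<^sub>M circle_measures" and X[measurable]: "X \<in> \<Omega> \<rightarrow>\<^sub>M circle_borel"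
  and eq: "!!A B. A \<in> sets circle_measures ==> B \<in> sets circle_borel ==> emeasure \<Omega> {omega \<in> space \<Omega>. kappa omega \<in> A & X omega \<in> B} = (\<integral>\<^sup>+ omega. ?h kappa omega B A \<partial>\<Omega>)"
  using P unfolding picked_from_def by auto
 define K where "K omega = distr (kappa omega) ?P (%x. (kappa omega, x))" for omega
 have K[measurable]: "K \<in> \<Omega> \<rightarrow>\<^sub>M prob_algebra ?P" unfolding K_def by measurable
 have Ks: "K \<in> \<Omega> \<rightarrow>\<^sub>M subprob_algebra ?P" by (rule measurable_prob_algebraD[OF K])
 have kappas: "kappa omega \<in> space circle_measures" if "omega \<in> space \<Omega>" for omega using measurable_space[OF kappa that] .
 have pm: "(%x. (kappa omega, x)) \<in> kappa omega \<rightarrow>\<^sub>M ?P" if "omega \<in> space \<Omega>" for omega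
  using kappas[OF that] circle_measuresD(2)[OF kappas[OF that]] by (simp cong: measurable_cong_sets)
 have sets_bind: "sets (\<Omega> \<bind> K) = sets ?P"
  by (rule sets_bind_measurable[OF Ks \<Omega>.not_empty])
 have emb: "emeasure (\<Omega> \<bind> K) C = (\<integral>\<^sup>+omega. emeasure (K omega) C \<partial>\<Omega>)" if "C \<in> sets ?P" for C
  by (rule emeasure_bind[OF \<Omega>.not_empty Ks that])
 let ?g = "%kappa. %omega. (kappa omega, X omega)"
 have rect: "emeasure (\<Omega> \<bind> K) (A \<times> B) = emeasure (distr \<Omega> ?P (?g kappa)) (A \<times> B)"
  if A[measurable]: "A \<in> sets circle_measures" and B[measurable]: "B \<in> sets circle_borel" for A B
 proof -
  have "emeasure (K omega) (A \<times> B) = ?h kappa omega B A" if w: "omega \<in> space \<Omega>" for omega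
  proof -
   have "emeasure (K omega) (A \<times> B) = emeasure (kappa omega) ((%x. (kappa omega, x)) -` (A \<times> B) \<inter> space (kappa omega))"
    unfolding K_def by (rule emeasure_distr[OF pm[OF w]]) measurable
   also have "(%x. (kappa omega, x)) -` (A \<times> B) \<inter> space (kappa omega) = (if kappa omega \<in> A then B else {})"
    using sets.sets_into_space[OF B] circle_measuresD(3)[OF kappas[OF w]] by auto
   finally show ?thesis using w by simp
  qed
  then have "emeasure (\<Omega> \<bind> K) (A \<times> B) = (\<integral>\<^sup>+ omega. ?h kappa omega B A \<partial>\<Omega>)"
   using A B by (simp add: emb cong: nn_integral_cong)
  also have "... = emeasure (distr \<Omega> ?P (?g kappa)) (A \<times> B)"
   unfolding eq[OF A B, symmetric] using A B by (subst emeasure_distr) (auto intro!: arg_cong[where f="emeasure \<Omega>"])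
  finally show ?thesis .
 qed
 let ?f = "space circle_measures \<times> space circle_borel"
 let ?p = "sigma_sets ?f {a \<times> b |a b. a \<in> sets circle_measures & b \<in> sets circle_borel}"
 have law: "\<Omega> \<bind> K = distr \<Omega> ?P (?g kappa)"
 proof (rule measure_eqI_generator_eq[OF Int_stable_pair_measure_generator[of circle_measures circle_borel], where \<Omega>="space circle_measures \<times> space circle_borel" and A="%_. space circle_measures \<times> space circle_borel"])
  show "sets (\<Omega> \<bind> K) = ?p"
   unfolding sets_bind sets_pair_measure ..
  show "sets (distr \<Omega> ?P (?g kappa)) = ?p"
   unfolding sets_distr sets_pair_measure ..
  show "emeasure (\<Omega> \<bind> K) ?f ~= \<infinity>" for i :: nat
  proof -
   interpret D: prob_space "distr \<Omega> ?P (?g kappa)" by (rule \<Omega>.prob_space_distr) measurable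
   show ?thesis unfolding rect[OF sets.top sets.top] by simp
  qed
  show "{a \<times> b |a b. a \<in> sets circle_measures & b \<in> sets circle_borel} \<subseteq> Pow ?f"
   using sets.space_closed[of circle_measures] sets.space_closed[of circle_borel] by blast
  show "range (%_::nat. ?f) \<subseteq> {a \<times> b |a b. a \<in> sets circle_measures & b \<in> sets circle_borel}"
   by blast
 qed (use rect in auto)
 have "(\<integral>\<^sup>+omega. H (kappa omega, X omega) \<partial>\<Omega>) = (\<integral>\<^sup>+p. H p \<partial>distr \<Omega> ?P (?g kappa))"
  by (rule nn_integral_distr[symmetric]) measurable
 also have "... = (\<integral>\<^sup>+omega. (\<integral>\<^sup>+p. H p \<partial>K omega) \<partial>\<Omega>)"
  unfolding law[symmetric] by (rule nn_integral_bind[OF H Ks])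
 also have "... = (\<integral>\<^sup>+omega. (\<integral>\<^sup>+x. H (kappa omega, x) \<partial>kappa omega) \<partial>\<Omega>)"
  unfolding K_def by (intro nn_integral_cong nn_integral_distr pm) (simp_all add: H)
 finally show ?thesis .
qed

section \<open>Almost sure properties of configurations and the laws of the supports\<close>

lemma supp_point_config:
 assumes z: "z \<in> space (circle_n (Suc m))" and v: "v \<in> open_simplex m"
 shows "supp (point_config m z v) = z ` {..m}"
 unfolding point_config_def using supp_weighted_points[of "Suc m" z "full_weights m v"] space_circle_n[OF z] full_weights_pos[OF _ v]
 by (simp add: lessThan_Suc_atMost less_Suc_eq_le)

lemma card_supp_point_config:
 assumes z: "z \<in> space (circle_n (Suc m))" and v: "v \<in> open_simplex m" and "circle_density (Suc m) beta z ~= 0"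
 shows "finite (supp (point_config m z v))" "card (supp (point_config m z v)) = Suc m"
 using circle_density_inj[OF assms(3)] unfolding supp_point_config[OF z v] lessThan_Suc_atMost by (simp_all add: card_image)

lemma emeasure_point_config_last:
 assumes z: "z \<in> space (circle_n (Suc m))" and "circle_density (Suc m) beta z ~= 0"
 shows "emeasure (point_config m z v) {z m} = ennreal (full_weights m v m)"
proof -
 have zs: "cmod (z i) = 1" if "i < Suc m" for i using space_circle_n[OF z that] .
 have "{z m} \<in> sets circle_borel" using zs[of m] unfolding circle_borel_def sets_restrict_space by (intro image_eqI[of _ _ "{z m}"]) auto
 then have "emeasure (point_config m z v) {z m} = (\<Sum>i<Suc m. ennreal (full_weights m v i) * indicator {z m} (z i))"
  unfolding point_config_def by (intro emeasure_weighted_points zs)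
 also have "... = (\<Sum>i<Suc m. if i = m then ennreal (full_weights m v m) else 0)"
  using circle_density_inj[OF assms(2)] by (intro sum.cong) (auto simp: indicator_def inj_on_def)
 also have "... = ennreal (full_weights m v m)" by simp
 finally show ?thesis .
qed

lemma nn_integral_fun_cong:
 "(!!x. x \<in> space M ==> f x = 0) ==> (\<integral>\<^sup>+x. f x \<partial>M) = 0"
 by (simp add: nn_integral_cong[of M f "%_. 0"])

context
 fixes KN :: "complex measure measure" and m :: nat and beta c :: real
 assumes c: "0 < c" and prob_KN: "prob_space KN" and sets_KN: "sets KN = sets circle_measures"
  and KN: "!!G. G \<in> borel_measurable circle_measures ==> (\<integral>\<^sup>+mu. G mu \<partial>KN) = ennreal c * kn_integral m beta G"
begin

interpretation N: prob_space "biased_law m beta c" by (rule prob_space_biased_law[OF c prob_KN sets_KN KN])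

text \<open>Coinciding points have density 0, and positive weights make every point a support
  point.\<close>

lemma AE_card_supp: "AE mu in KN. finite (supp mu) & card (supp mu) = Suc m"
proof -
 let ?Q = "%mu. finite (supp mu) & card (supp mu) = Suc m"
 have [measurable]: "Measurable.pred circle_measures ?Q" by (rule measurable_card_supp)
 have sp: "space KN = space circle_measures" by (rule sets_eq_imp_space_eq[OF sets_KN])
 let ?G = "%mu. if ?Q mu then 0 else 1 :: ennreal"
 have G: "?G \<in> borel_measurable circle_measures" by measurable
 let ?f = "%z. Leb_n m (%v. ennreal (simplex_density m (beta / 2 - 1) v) * ?G (point_config m z v))"
 have "kn_integral m beta ?G = 0"
  unfolding kn_integral_def
 proof (intro nn_integral_fun_cong)
  fix z assume z: "z \<in> space (circle_n (Suc m))"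
  show "ennreal (circle_density (Suc m) beta z) * ?f z = 0"
  proof (cases "circle_density (Suc m) beta z = 0")
   case False
   have "?f z = 0"
    using card_supp_point_config[OF z _ False] by (intro nn_integral_fun_cong) (auto simp: simplex_density_def)
   then show ?thesis by (simp only: mult_zero_right)
  qed simp
 qed
 then have "(\<integral>\<^sup>+mu. ?G mu \<partial>KN) = 0" by (simp only: KN[OF G] mult_zero_right)
 moreover have "?G \<in> borel_measurable KN" using G by (simp cong: measurable_cong_sets add: sets_KN)
 ultimately have "AE mu in KN. ?G mu = 0" by (simp add: nn_integral_0_iff_AE)
 then show ?thesis by eventually_elim (simp split: if_splits)
qed

lemma AE_biased_law:
 assumes [measurable]: "Measurable.pred circle_measures Q"
  and Q: "!!z v. z \<in> space (circle_n (Suc m)) ==> z m = 1 ==> v \<in> open_simplex m ==> circle_density (Suc m) beta z ~= 0 ==> Q (point_config m z v)"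
 shows "AE nu in biased_law m beta c. Q nu"
proof -
 let ?G = "%mu. if Q mu then 0 else 1 :: ennreal"
 have G: "?G \<in> borel_measurable circle_measures" by measurable
 let ?f = "%z. Leb_n m (%v. ennreal (simplex_density m (beta / 2 - 1) v) * (ennreal (full_weights m v m) * ?G (point_config m (z(m := 1)) v)))"
 let ?g = "%z. circle_density (Suc m) beta (z(m := 1))"
 have "Unif_n m (%z. ennreal (?g z) * ?f z) = 0"
 proof (intro nn_integral_fun_cong)
  fix z assume "z \<in> space (circle_n m)"
  then have z: "z(m := 1) \<in> space (circle_n (Suc m))" by (rule measurable_space[OF measurable_upd_one])
  show "ennreal (?g z) * ?f z = 0"
  proof (cases "?g z = 0")
   case False
   have "?f z = 0"
    using Q[OF z _ _ False] by (intro nn_integral_fun_cong) (auto simp: simplex_density_def)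
   then show ?thesis by (simp only: mult_zero_right)
  qed simp
 qed
 then have "(\<integral>\<^sup>+nu. ?G nu \<partial>biased_law m beta c) = 0" by (simp only: nn_integral_biased_law[OF G] mult_zero_right)
 moreover have "?G \<in> borel_measurable (biased_law m beta c)" using G by (simp cong: measurable_cong_sets)
 ultimately have "AE nu in biased_law m beta c. ?G nu = 0" by (simp add: nn_integral_0_iff_AE)
 then show ?thesis by eventually_elim (simp split: if_splits)
qed

lemma AE_card_supp_biased: "AE nu in biased_law m beta c. finite (supp nu) & card (supp nu) = Suc m"
 by (rule AE_biased_law[OF measurable_card_supp]) (blast intro: card_supp_point_config)

lemma AE_modified_verblunsky_last: "AE nu in biased_law m beta c. modified_verblunsky (Suc m) nu m = 1"
proof (rule AE_biased_law)
 note [measurable] = measurable_modified_verblunsky[of m "Suc m", OF lessI]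
 show "Measurable.pred circle_measures (%nu. modified_verblunsky (Suc m) nu m = 1)" by measurable
 fix z v assume z: "z \<in> space (circle_n (Suc m))" "z m = 1" and v: "v \<in> open_simplex m" and d: "circle_density (Suc m) beta z ~= 0"
 have "1 \<in> supp (point_config m z v)" unfolding supp_point_config[OF z(1) v] using z(2) by (metis atMost_iff image_eqI order_refl)
 from modified_verblunsky_last[OF point_config_in_space[OF z(1)] card_supp_point_config[OF z(1) v d] this]
 show "modified_verblunsky (Suc m) (point_config m z v) m = 1" by simp
qed

context
 fixes \<Omega> :: "'w measure" and mu :: "'w => complex measure"
 assumes prob_\<Omega>: "prob_space \<Omega>" and mu: "mu \<in> \<Omega> \<rightarrow>\<^sub>M circle_measures" and law: "distr \<Omega> circle_measures mu = KN"
begin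

lemma support_law_picked:
 assumes X: "picked_from \<Omega> X mu"
 shows "distr \<Omega> closed_subsets (%omega. supp (rotate_measure (X omega) (mu omega))) = distr (biased_law m beta c) closed_subsets supp"
proof (rule measure_eqI)
 have [measurable]: "X \<in> \<Omega> \<rightarrow>\<^sub>M circle_borel" using X by (simp add: picked_from_def)
 note [measurable] = mu
 let ?N = "biased_law m beta c"
 let ?f = "%omega. supp (rotate_measure (X omega) (mu omega))"
 let ?h = "distr \<Omega> closed_subsets ?f"
 fix A assume "A \<in> sets ?h"
 then have A[measurable]: "A \<in> sets closed_subsets" by simp
 define H where "H = (%(nu, x). indicator A (supp (rotate_measure x nu)) :: ennreal)"
 have H[measurable]: "H \<in> borel_measurable (circle_measures \<Otimes>\<^sub>M circle_borel)" unfolding H_def split_beta' by measurable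
 let ?g = "(\<integral>\<^sup>+nu. indicator A (supp nu) \<partial>?N)"
 have "emeasure ?h A = (\<integral>\<^sup>+S. indicator A S \<partial>distr \<Omega> closed_subsets ?f)"
  by (simp add: nn_integral_indicator)
 also have "... = (\<integral>\<^sup>+omega. indicator A (supp (rotate_measure (X omega) (mu omega))) \<partial>\<Omega>)"
  by (rule nn_integral_distr) measurable
 also have "... = (\<integral>\<^sup>+omega. H (mu omega, X omega) \<partial>\<Omega>)" by (simp add: H_def)
 also have "... = (\<integral>\<^sup>+omega. (\<integral>\<^sup>+x. H (mu omega, x) \<partial>mu omega) \<partial>\<Omega>)"
  by (rule picked_from_integral[OF X prob_\<Omega> H])
 also have "... = (\<integral>\<^sup>+nu. (\<integral>\<^sup>+x. H (nu, x) \<partial>nu) \<partial>KN)"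
  unfolding law[symmetric] by (rule nn_integral_distr[symmetric, OF mu]) (simp add: circle_measures_integral_measurable[OF H])
 also have "... = (Unif u. \<integral>\<^sup>+nu. H (turn u nu, u) \<partial>?N)"
  by (rule palm_formula[OF c KN H])
 also have "... = (Unif u. ?g)"
  by (rule nn_integral_cong, rule nn_integral_cong) (simp add: H_def rotate_turn sets_eq_imp_space_eq[OF sets_biased_law])
 also have "... = ?g" by (simp add: circ.emeasure_space_1[simplified])
 also have "... = (\<integral>\<^sup>+S. indicator A S \<partial>distr ?N closed_subsets supp)"
  by (rule nn_integral_distr[symmetric]) measurable
 also have "... = emeasure (distr ?N closed_subsets supp) A" by (simp add: nn_integral_indicator)
 finally show "emeasure ?h A = emeasure (distr ?N closed_subsets supp) A" .
qed simp

text \<open>Uniform picking inserts the reciprocal of \<open>n\<close> times the mass at 1 into the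
  Palm formula, which cancels the size bias of \<open>biased_law\<close>. For fixed points the
  support is the same for all weights, and the biased and the unbiased weight integrals differ by
  exactly the factor \<open>n\<close>.\<close>

lemma support_law_uniform:
 assumes Y: "picked_from \<Omega> Y (%omega. uniform_on_supp (mu omega))"
 shows "distr \<Omega> closed_subsets (%omega. supp (rotate_measure (Y omega) (uniform_on_supp (mu omega)))) = distr (biased_law m beta c) closed_subsets supp"
proof (rule measure_eqI)
 have [measurable]: "Y \<in> \<Omega> \<rightarrow>\<^sub>M circle_borel" "(%omega. uniform_on_supp (mu omega)) \<in> \<Omega> \<rightarrow>\<^sub>M circle_measures"
  using Y by (simp_all add: picked_from_def)
 note [measurable] = mu
 let ?N = "biased_law m beta c" and ?n = "of_nat (Suc m) :: ennreal"
 let ?g = "%omega. supp (rotate_measure (Y omega) (uniform_on_supp (mu omega)))"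
 let ?t = "distr \<Omega> closed_subsets ?g"
 fix A assume "A \<in> sets ?t"
 then have A[measurable]: "A \<in> sets closed_subsets" by simp
 define H where "H = (%(nu, x). indicator A (supp (rotate_measure x nu)) :: ennreal)"
 let ?f = "circle_measures \<Otimes>\<^sub>M circle_borel"
 have H[measurable]: "H \<in> borel_measurable ?f" unfolding H_def split_beta' by measurable
 define J where "J = (%(nu, x). H (nu, x) * inverse (?n * emeasure nu {x}))"
 let ?h = "?f \<Otimes>\<^sub>M circle_borel"
 \<comment> \<open>Joint measurability in the measure and the point comes from measurability of the
   diagonal.\<close>
 have atom[measurable]: "(%p. emeasure (fst p) {snd p}) \<in> borel_measurable ?f"
 proof (rule emeasure_measurable_subprob_algebra2[where N=circle_borel])
  have "{p \<in> space ?h. snd p = snd (fst p)} \<in> sets ?h"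
  proof -
   have [measurable]: "(%z::complex. z) \<in> borel_measurable circle_borel" by measurable
   have [measurable]: "(%p. snd p) \<in> borel_measurable ?h"
    by (rule measurable_compose[OF measurable_snd]) measurable
   have [measurable]: "(%p. snd (fst p)) \<in> borel_measurable ?h"
    by (rule measurable_compose[OF measurable_fst], rule measurable_compose[OF measurable_snd]) measurable
   show ?thesis by measurable
  qed
  also have "{p \<in> space ?h. snd p = snd (fst p)} = (SIGMA p:space ?f. {snd p})"
   by (auto simp: space_pair_measure)
  finally show "(SIGMA p:space ?f. {snd p}) \<in> sets ?h" .
  show "fst \<in> circle_measures \<Otimes>\<^sub>M circle_borel \<rightarrow>\<^sub>M subprob_algebra circle_borel"
   by (rule measurable_prob_algebraD) simp
 qed
 have J[measurable]: "J \<in> borel_measurable ?f" unfolding J_def split_beta' by measurable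
 have [measurable]: "(%nu. emeasure nu {1}) \<in> borel_measurable circle_measures"
 proof -
  have "(%nu. (nu, 1)) \<in> circle_measures \<rightarrow>\<^sub>M circle_measures \<Otimes>\<^sub>M circle_borel" by simp
  from measurable_compose[OF this atom] show ?thesis by simp
 qed
 let ?p = "%v z. ennreal (full_weights m v m) * indicator A (supp (point_config m z v))"
 let ?q = "%omega. \<integral>\<^sup>+x. H (uniform_on_supp (mu omega), x) \<partial>uniform_on_supp (mu omega)"
 let ?r = "%z. circle_density (Suc m) beta (z(m := 1))"
 have "emeasure ?t A = (\<integral>\<^sup>+S. indicator A S \<partial>distr \<Omega> closed_subsets ?g)"
  by (simp add: nn_integral_indicator)
 also have "... = (\<integral>\<^sup>+omega. indicator A (supp (rotate_measure (Y omega) (uniform_on_supp (mu omega)))) \<partial>\<Omega>)"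
  by (rule nn_integral_distr) measurable
 also have "... = (\<integral>\<^sup>+omega. H (uniform_on_supp (mu omega), Y omega) \<partial>\<Omega>)" by (simp add: H_def)
 also have "... = (\<integral>\<^sup>+omega. ?q omega \<partial>\<Omega>)"
  by (rule picked_from_integral[OF Y prob_\<Omega> H])
 also have "... = (\<integral>\<^sup>+omega. (\<integral>\<^sup>+x. J (mu omega, x) \<partial>mu omega) \<partial>\<Omega>)"
 proof (rule nn_integral_cong_AE)
  have "AE omega in \<Omega>. finite (supp (mu omega)) & card (supp (mu omega)) = Suc m"
   using AE_card_supp unfolding law[symmetric] by (rule AE_distrD[OF mu])
  then show "AE omega in \<Omega>. ?q omega = (\<integral>\<^sup>+x. J (mu omega, x) \<partial>mu omega)"
   using AE_space
  proof eventually_elim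
   case (elim omega)
   then have "mu omega \<in> space circle_measures" using measurable_space[OF mu] by simp
   from integral_uniform_on_supp[OF this, of "Suc m" A] elim A show ?case by (simp add: H_def J_def del: of_nat_Suc)
  qed
 qed
 also have "... = (\<integral>\<^sup>+nu. (\<integral>\<^sup>+x. J (nu, x) \<partial>nu) \<partial>KN)"
  unfolding law[symmetric] by (rule nn_integral_distr[symmetric, OF mu]) (simp add: circle_measures_integral_measurable[OF J])
 also have "... = (Unif u. \<integral>\<^sup>+nu. J (turn u nu, u) \<partial>?N)"
  by (rule palm_formula[OF c KN J])
 also have "... = (Unif u. \<integral>\<^sup>+nu. indicator A (supp nu) * inverse (?n * emeasure nu {1}) \<partial>?N)"
 proof (rule nn_integral_cong, rule nn_integral_cong)
  fix u nu assume "u \<in> space circle_uniform" "nu \<in> space ?N"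
  then have u: "cmod u = 1" and nu: "nu \<in> space circle_measures" by (simp_all add: sets_eq_imp_space_eq[OF sets_biased_law])
  have "(%z. u * z) \<in> nu \<rightarrow>\<^sub>M circle_borel"
   using measurable_mult_circle[OF u] by (simp add: circle_measuresD(2)[OF nu] cong: measurable_cong_sets)
  moreover have "{u} \<in> sets circle_borel" using u unfolding circle_borel_def sets_restrict_space by (intro image_eqI[of _ _ "{u}"]) auto
  moreover have "(%z. u * z) -` {u} \<inter> space nu = {1}"
  proof -
   have nz: "u ~= 0" using u by auto
   have "u * z = u \<longleftrightarrow> z = 1" for z using mult_cancel_left[of u z 1] nz by simp
   then have "(%z. u * z) -` {u} = {1}" by (simp add: vimage_def)
   then show ?thesis unfolding circle_measuresD(3)[OF nu] by simp
  qed
  ultimately have "emeasure (turn u nu) {u} = emeasure nu {1}" unfolding turn_def by (simp add: emeasure_distr)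
  then show "J (turn u nu, u) = indicator A (supp nu) * inverse (?n * emeasure nu {1})"
   by (simp add: J_def H_def rotate_turn[OF u nu])
 qed
 also have "... = (\<integral>\<^sup>+nu. indicator A (supp nu) * inverse (?n * emeasure nu {1}) \<partial>?N)" by (simp add: circ.emeasure_space_1[simplified])
 also have "... = (\<integral>\<^sup>+nu. indicator A (supp nu) \<partial>?N)"
 proof -
  let ?s = "simplex_density m (beta / 2 - 1)"
  let ?u = "%v A z. ennreal (?s v) * (ennreal (full_weights m v m) * (indicator A (supp (point_config m z v)) * inverse (?n * emeasure (point_config m z v) {1})))"
  let ?v = "Leb_n m (%v. ennreal (?s v) * ennreal (full_weights m v m))"
  let ?w = "%A z. indicator A (z ` {..m}) * inverse ?n"
  let ?k = "Leb_n m (%v. ennreal (?s v))"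
  have "Leb_n m (%v. ?u v A z) = Leb_n m (%v. ennreal (?s v) * ?p v z)"
   if z: "z \<in> space (circle_n (Suc m))" "z m = 1" and d: "circle_density (Suc m) beta z ~= 0" for z
  proof -
   have "Leb_n m (%v. ?u v A z) = Leb_n m (%v. ennreal (?s v) * ?w A z)"
   proof (rule nn_integral_cong)
    fix v
    show "?u v A z = ennreal (?s v) * ?w A z"
    proof (cases "v \<in> open_simplex m")
     case True
     have e1: "emeasure (point_config m z v) {1} = ennreal (full_weights m v m)" using emeasure_point_config_last[OF z(1) d, of v] by (simp only: z(2))
     have w: "0 < full_weights m v m" using full_weights_pos[OF order_refl True] .
     have "ennreal (full_weights m v m) * inverse (?n * ennreal (full_weights m v m)) = inverse ?n"
     proof -
      have "?n = ennreal (real (Suc m))" by (simp only: ennreal_of_nat_eq_real_of_nat)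
      moreover have "inverse (ennreal (real (Suc m))) = ennreal (inverse (real (Suc m)))" by (rule inverse_ennreal) simp
      moreover have "inverse (ennreal (real (Suc m) * full_weights m v m)) = ennreal (inverse (real (Suc m) * full_weights m v m))"
       by (rule inverse_ennreal) (use w in simp)
      ultimately show ?thesis using w by (simp add: ennreal_mult[symmetric] field_simps del: of_nat_Suc)
     qed
     then show ?thesis unfolding e1 supp_point_config[OF z(1) True] by (simp only: mult.left_commute[of "ennreal (full_weights m v m)"])
    qed (simp add: simplex_density_def)
   qed
   also have "... = ?k * ?w A z"
    by (rule nn_integral_multc) measurable
   \<comment> \<open>Each of the \<open>Suc m\<close> weights carries the same share of the total,
     so the factor \<open>1 / n\<close> left by the cancellation is traded for the weight
     itself.\<close>
   also have "?k = ?n * ?v"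
    by (rule nn_integral_simplex_weight[symmetric]) simp
   also have "?n * ?v * ?w A z = ?v * indicator A (z ` {..m})"
   proof -
    have "?n * inverse ?n = 1" unfolding ennreal_of_nat_eq_real_of_nat
     by (subst inverse_ennreal) (simp_all add: ennreal_mult[symmetric] del: of_nat_Suc)
    then show ?thesis by (simp only: mult.assoc mult.left_commute[of ?n] mult_1_right)
   qed
   also have "... = (Leb_n m (%v. ennreal (?s v) * ennreal (full_weights m v m) * indicator A (z ` {..m})))"
    by (rule nn_integral_multc[symmetric]) measurable
   also have "... = Leb_n m (%v. ennreal (?s v) * ?p v z)"
   proof (rule nn_integral_cong)
    fix v
    show "ennreal (?s v) * ennreal (full_weights m v m) * indicator A (z ` {..m}) = ennreal (?s v) * ?p v z"
     by (cases "v \<in> open_simplex m") (simp_all only: supp_point_config[OF z(1)] simplex_density_def mult.assoc if_False ennreal_0 mult_zero_left)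
   qed
   finally show ?thesis .
  qed
  note key = this
  have m1: "(%nu. indicator A (supp nu) * inverse (?n * emeasure nu {1}) :: ennreal) \<in> borel_measurable circle_measures"
   "(%nu. indicator A (supp nu) :: ennreal) \<in> borel_measurable circle_measures" by measurable
  show ?thesis unfolding nn_integral_biased_law[OF m1(1)] nn_integral_biased_law[OF m1(2)]
  proof (rule arg_cong2[where f="(*)"], rule refl, rule nn_integral_cong)
   fix z assume "z \<in> space (circle_n m)"
   then have z: "z(m := 1) \<in> space (circle_n (Suc m))" by (rule measurable_space[OF measurable_upd_one])
   show "ennreal (?r z) * (Leb_n m (%v. ennreal (?s v) * (ennreal (full_weights m v m) * (indicator A (supp (point_config m (z(m := 1)) v)) * inverse (?n * emeasure (point_config m (z(m := 1)) v) {1}))))) = ennreal (?r z) * Leb_n m (%v. ennreal (?s v) * (ennreal (full_weights m v m) * indicator A (supp (point_config m (z(m := 1)) v))))"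
   proof (cases "?r z = 0")
    case True
    show ?thesis unfolding True by (simp only: ennreal_0 mult_zero_left)
   next
    case False
    show ?thesis by (simp only: key[OF z fun_upd_same False])
   qed
  qed
 qed
 also have "... = (\<integral>\<^sup>+S. indicator A S \<partial>distr ?N closed_subsets supp)"
  by (rule nn_integral_distr[symmetric]) measurable
 also have "... = emeasure (distr ?N closed_subsets supp) A" by (simp add: nn_integral_indicator)
 finally show "emeasure ?t A = emeasure (distr ?N closed_subsets supp) A" .
qed simp

end

end

section \<open>The law of the coefficients\<close>

definition cayley_points :: "nat => (nat => real) => nat => complex" where
 "cayley_points m x = (\<lambda>i\<in>{..<m}. cayley (x i))(m := 1)"

lemma measurable_cayley_points [measurable (raw)]:
 assumes [measurable]: "f \<in> M \<rightarrow>\<^sub>M leb m" shows "(%w. cayley_points m (f w)) \<in> M \<rightarrow>\<^sub>M circle_n (Suc m)"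
 unfolding cayley_points_def by measurable

lemma cayley_points_in_space: "cayley_points m x \<in> space (circle_n (Suc m))"
 by (auto simp: cayley_points_def space_PiM PiE_iff extensional_def)

lemma circle_moment_point_config:
 assumes v: "v \<in> open_simplex m"
 shows "circle_moment (point_config m (cayley_points m x) v) = config_moment m x v"
proof
 fix j
 let ?z = "cayley_points m x" and ?w = "full_weights m v"
 have z: "?z \<in> point_measure {..<Suc m} (%i. ennreal (?w i)) \<rightarrow>\<^sub>M circle_borel"
  using space_circle_n[OF cayley_points_in_space] unfolding point_measure_def by auto
 have "circle_moment (point_config m ?z v) j = (\<integral>i. ?z i ^ j \<partial>point_measure {..<Suc m} (%i. ennreal (?w i)))"
  unfolding circle_moment_def point_config_def weighted_points_def
  by (rule integral_distr[OF z]) (intro borel_measurable_circle_continuous continuous_intros)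
 also have "... = (\<Sum>i<Suc m. ?w i *\<^sub>R ?z i ^ j)"
  by (rule lebesgue_integral_point_measure_finite) (auto simp: full_weights_nonneg)
 also have "... = config_moment m x v j"
  using v by (simp add: config_moment_def full_weights_def cayley_points_def scaleR_conv_of_real)
 finally show "circle_moment (point_config m ?z v) j = config_moment m x v j" .
qed

lemma cayley_inj: "cayley s = cayley t ==> s = t"
 using norm_diff_cayley[of s t] one_plus_square_nz by (simp add: divide_eq_0_iff)

lemma cayley_ne_1: "cayley t ~= 1"
 using norm_one_minus_cayley[of t] one_plus_square_nz[of t] by (auto simp: divide_eq_0_iff)

lemma power_powr: "((x::real) ^ k) powr b = (x powr b) ^ k"
 by (induction k) (auto simp: powr_mult)

text \<open>The size bias raises the exponent of the last weight from \<open>beta / 2 - 1\<close> to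
  \<open>beta / 2\<close>, the power at which every weight enters the right-hand side. The other
  \<open>m\<close> weights each lack one power, whence the factors \<open>1 / v i\<close>.\<close>

lemma densities_eq_config_disc:
 assumes v: "v \<in> open_simplex m"
 shows "circle_density (Suc m) beta (cayley_points m x) * (simplex_density m (beta / 2 - 1) v * full_weights m v m)
  = config_disc m x v powr (beta / 2) * (\<Prod>i<m. 1 / v i)"
proof -
 define b where "b = beta / 2"
 have sq: "(y\<^sup>2) powr b = y powr beta" for y :: real
  unfolding power2_eq_square powr_mult powr_add[symmetric] by (simp add: b_def)
 define S where "S = 1 - (\<Sum>i<m. v i)"
 have S: "0 < S" and vp: "!!i. i < m ==> 0 < v i" using v by (auto simp: open_simplex_def S_def)
 let ?f = "\<Prod>j<m. cmod (1 - cayley (x j)) powr beta * (\<Prod>i<j. cmod (cayley (x j) - cayley (x i)) powr beta)"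
 have "circle_density (Suc m) beta (cayley_points m x) = (\<Prod>k<m. \<Prod>j<k. cmod (cayley (x j) - cayley (x k)) powr beta) * (\<Prod>j<m. cmod (cayley (x j) - 1) powr beta)"
  unfolding circle_density_def prod.lessThan_Suc
  by (intro arg_cong2[where f="(*)"] prod.cong refl) (auto simp: cayley_points_def)
 also have "... = ?f"
  by (simp add: prod.distrib norm_minus_commute mult.commute)
 finally have d: "circle_density (Suc m) beta (cayley_points m x) = ?f" .
 have "simplex_density m (b - 1) v * full_weights m v m = (\<Prod>i<m. v i powr (b - 1)) * S powr (b - 1) * S"
  using v by (simp add: simplex_density_def full_weights_def S_def lessThan_Suc_atMost[symmetric])
 also have "... = (\<Prod>i<m. v i powr b * (1 / v i)) * S powr b"
 proof -
  have "v i powr (b - 1) = v i powr b * (1 / v i)" if "i < m" for i using vp[OF that] by (simp add: powr_diff)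
  then have "(\<Prod>i<m. v i powr (b - 1)) = (\<Prod>i<m. v i powr b * (1 / v i))" by (intro prod.cong) auto
  moreover have "S powr (b - 1) * S = S powr b" using S by (simp add: powr_diff)
  ultimately show ?thesis by (simp only: mult.assoc)
 qed
 finally have s: "simplex_density m (b - 1) v * full_weights m v m = (\<Prod>i<m. v i powr b) * S powr b * (\<Prod>i<m. 1 / v i)"
  by (simp only: prod.distrib mult_ac)
 have "config_disc m x v powr b = ?f * (\<Prod>i<m. v i powr b) * S powr b"
  unfolding config_disc_def powr_mult prod_powr_distrib sq S_def[symmetric] ..
 then show ?thesis unfolding b_def[symmetric] d s by (simp only: mult.assoc)
qed

text \<open>Only indices below \<open>m\<close> are exchanged, so that the point 1 and its weight
  keep the index \<open>m\<close>. This is the symmetry needed for ordering the points on the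
  line.\<close>

lemma point_config_swap:
 assumes "i < m" "j < m" and v: "v \<in> space (leb m)"
 shows "simplex_density m a (swap_coords i j v) = simplex_density m a v"
  and "full_weights m (swap_coords i j v) m = full_weights m v m"
  and "circle_density (Suc m) beta (cayley_points m (swap_coords i j x)) = circle_density (Suc m) beta (cayley_points m x)"
  and "point_config m (cayley_points m (swap_coords i j x)) (swap_coords i j v) = point_config m (cayley_points m x) v"
proof -
 let ?tau = "%k. if k = i then j else if k = j then i else k"
 have tau: "bij_betw ?tau {..<m} {..<m}" "bij_betw ?tau {..<Suc m} {..<Suc m}" using assms by (auto intro!: bij_swap)
 have sum: "(\<Sum>k<m. swap_coords i j v k) = (\<Sum>k<m. v k)"
  using sum.reindex_bij_betw[OF tau(1), of v] unfolding swap_coords_def by (simp only: if_distrib[of v])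
 have "(\<forall>k<m. 0 < swap_coords i j v k) \<longleftrightarrow> (\<forall>k<m. 0 < v k)"
  using assms by (auto simp: swap_coords_def split: if_splits)
 then have simp: "swap_coords i j v \<in> open_simplex m \<longleftrightarrow> v \<in> open_simplex m" by (simp add: open_simplex_def sum)
 show w: "full_weights m (swap_coords i j v) m = full_weights m v m" by (simp add: full_weights_def simp sum)
 have wk: "full_weights m (swap_coords i j v) k = full_weights m v (?tau k)" if "k \<le> m" for k
  unfolding full_weights_def simp sum using assms that by (cases "v \<in> open_simplex m") (auto simp: swap_coords_def)
 have "(\<Prod>k\<le>m. full_weights m (swap_coords i j v) k powr a) = (\<Prod>k\<le>m. full_weights m v (?tau k) powr a)"
  by (rule prod.cong) (simp_all only: wk atMost_iff)
 also have "... = (\<Prod>k\<le>m. full_weights m v k powr a)"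
  using prod.reindex_bij_betw[OF tau(2), of "%k. full_weights m v k powr a"] unfolding lessThan_Suc_atMost .
 finally show "simplex_density m a (swap_coords i j v) = simplex_density m a v" by (simp only: simplex_density_def simp)
 have zk: "cayley_points m (swap_coords i j x) k = cayley_points m x (?tau k)" if "k \<le> m" for k
  using assms that by (auto simp: cayley_points_def swap_coords_def)
 show "circle_density (Suc m) beta (cayley_points m (swap_coords i j x)) = circle_density (Suc m) beta (cayley_points m x)"
  unfolding circle_density_permute[OF tau(2), of beta "cayley_points m x", symmetric]
  by (rule circle_density_cong) (simp only: zk less_Suc_eq_le)
 let ?f = "point_config m (cayley_points m (swap_coords i j x)) (swap_coords i j v)"
 have "?f = weighted_points (Suc m) (%k. cayley_points m x (?tau k)) (%k. full_weights m v (?tau k))"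
  unfolding point_config_def
  by (rule weighted_points_cong, rule space_circle_n[OF cayley_points_in_space]) (simp_all only: zk wk less_Suc_eq_le)
 also have "... = point_config m (cayley_points m x) v"
  unfolding point_config_def by (rule weighted_points_permute[OF tau(2) space_circle_n[OF cayley_points_in_space]])
 finally show "?f = point_config m (cayley_points m x) v" .
qed

text \<open>The points other than 1 are exchangeable and almost surely distinct, so they may be
  ordered at the price of the factor \<open>fact m\<close>.\<close>

lemma nn_integral_biased_law_cayley:
 assumes [measurable]: "G \<in> borel_measurable circle_measures"
 shows "(\<integral>\<^sup>+nu. G nu \<partial>biased_law m beta c) = ennreal (c * Suc m) * (of_nat (fact m) * Leb_n m (%x. if ordered m x then
   ennreal (circle_density (Suc m) beta (cayley_points m x)) * Leb_n m (%v. ennreal (simplex_density m (beta / 2 - 1) v) *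
    (ennreal (full_weights m v m) * G (point_config m (cayley_points m x) v))) * ennreal (\<Prod>i<m. 1 / (pi * (1 + (x i)\<^sup>2))) else 0))"
proof -
 let ?I = "%z. Leb_n m (%v. ennreal (simplex_density m (beta / 2 - 1) v) * (ennreal (full_weights m v m) * G (point_config m z v)))"
 let ?p = "%x. ennreal (\<Prod>i<m. 1 / (pi * (1 + (x i)\<^sup>2)))"
 let ?h = "%x. circle_density (Suc m) beta (cayley_points m x)"
 define T where "T x = ennreal (?h x) * ?I (cayley_points m x) * ?p x" for x
 have [measurable]: "?I \<in> borel_measurable (circle_n (Suc m))" by measurable
 let ?f = "%i j x. %v. ennreal (simplex_density m (beta / 2 - 1) v) * (ennreal (full_weights m v m) * G (point_config m (cayley_points m (swap_coords i j x)) v))"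
 let ?g = "Unif_n m (%z. ennreal (circle_density (Suc m) beta (z(m := 1))) * ?I (z(m := 1)))"
 have "(\<integral>\<^sup>+nu. G nu \<partial>biased_law m beta c) = ennreal (c * Suc m) * ?g"
  by (rule nn_integral_biased_law) measurable
 also have "?g = Leb_n m (%x. T x)"
  unfolding T_def cayley_points_def by (rule nn_integral_circle_n_cayley) measurable
 also have "... = of_nat (fact m) * Leb_n m (%x. if ordered m x then T x else 0)"
 proof (rule nn_integral_symmetric_ordered)
  have [measurable]: "(%x. cayley_points m x) \<in> leb m \<rightarrow>\<^sub>M circle_n (Suc m)" by measurable
  have "(%x. ?h x) \<in> borel_measurable (leb m)"
   by (rule measurable_compose[OF _ measurable_circle_density]) measurable
  moreover have "(%x. ?I (cayley_points m x)) \<in> borel_measurable (leb m)"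
   by (rule measurable_compose[where f="cayley_points m" and g="?I"]) measurable
  ultimately show "T \<in> borel_measurable (leb m)" unfolding T_def by measurable
  show "T (swap_coords i j x) = T x" if ij: "i < m" "j < m" and x: "x \<in> space (leb m)" for i j x
  proof -
   have "?I (cayley_points m (swap_coords i j x)) = Leb_n m (%v. (?f i j x) (swap_coords i j v))"
   proof (rule nn_integral_lborel_swap_coords[OF ij, symmetric])
    note [measurable] = measurable_const[OF cayley_points_in_space]
    show "?f i j x \<in> borel_measurable (leb m)"
     by measurable
   qed
   also have "... = ?I (cayley_points m x)"
    by (rule nn_integral_cong) (simp only: point_config_swap[OF ij])
   finally have "?I (cayley_points m (swap_coords i j x)) = ?I (cayley_points m x)" .
   moreover have "(\<Prod>k<m. 1 / (pi * (1 + (swap_coords i j x k)\<^sup>2))) = (\<Prod>k<m. 1 / (pi * (1 + (x k)\<^sup>2)))"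
    using prod.reindex_bij_betw[OF bij_swap[OF ij], of "%k. 1 / (pi * (1 + (x k)\<^sup>2))"]
    unfolding swap_coords_def by (simp only: if_distrib[of x])
   ultimately show ?thesis unfolding T_def by (simp only: point_config_swap(3)[OF ij x])
  qed
  show "T x = 0" if "\<not> inj_on x {..<m}" for x
  proof -
   have "?h x = 0"
   proof (rule ccontr)
    assume "circle_density (Suc m) beta (cayley_points m x) ~= 0"
    note inj = circle_density_inj[OF this]
    have "inj_on x {..<m}"
    proof (rule inj_onI)
     fix i k assume i: "i \<in> {..<m}" "k \<in> {..<m}" "x i = x k"
     then have "cayley_points m x i = cayley_points m x k" by (simp add: cayley_points_def)
     then show "i = k" using inj_onD[OF inj] i by simp
    qed
    with that show False by simp
   qed
   then show ?thesis unfolding T_def by (simp only: ennreal_0 mult_zero_left)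
  qed
 qed
 finally show ?thesis unfolding T_def .
qed

text \<open>With \<open>b = beta / 2\<close> and \<open>j = m - k\<close>, the unnormalised
  expectation of \<open>h\<close> under the density claimed for the coefficient of index
  \<open>k\<close>.\<close>

definition disk_integral :: "real => nat => (complex => ennreal) => ennreal" where
 "disk_integral b j h = (Leb z. h z * ennreal (((1 - (cmod z)\<^sup>2) powr b) ^ j) * ennreal (1 / (cmod (1 - z))\<^sup>2) * indicator (ball 0 1) z)"

text \<open>Against the reference integral the law has density \<open>config_disc\<close> to the
  power \<open>beta / 2\<close>, a product over \<open>k\<close> of powers of 1 minus the squared
  modulus of the coefficient. Each factor concerns a single coefficient and is absorbed into
  \<open>h k\<close>, after which the reference integral factorises.\<close>

lemma biased_law_coefficients:
 assumes c: "0 \<le> c" and h[measurable]: "!!k. h k \<in> borel_measurable borel"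
 shows "(\<integral>\<^sup>+nu. (\<Prod>k<m. h k (modified_verblunsky (Suc m) nu k)) \<partial>biased_law m beta c)
  = ennreal (c * Suc m * fact m / pi ^ m) * (\<Prod>k<m. disk_integral (beta / 2) (m - k) (h k))"
proof -
 define b where "b = beta / 2"
 define h' where "h' k z = h k z * ennreal (((1 - (cmod z)\<^sup>2) powr b) ^ (m - k))" for k z
 have h'm: "h' k \<in> borel_measurable borel" for k unfolding h'_def by measurable
 let ?u = "%v. simplex_density m (beta / 2 - 1) v"
 have mv: "(%nu. modified_verblunsky (Suc m) nu k) \<in> borel_measurable circle_measures" if "k < m" for k
  using that by (intro measurable_modified_verblunsky) simp
 let ?G = "%nu. \<Prod>k<m. h k (modified_verblunsky (Suc m) nu k)"
 let ?f = "%v x. ennreal (?u v) * (ennreal (full_weights m v m) * ?G (point_config m (cayley_points m x) v))"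
 let ?r = "%x v. (\<Prod>k<m. h' k (config_coeff m x v k)) * ennreal (\<Prod>i<m. 1 / v i)"
 let ?v = "%x. \<Prod>i<m. 1 / (1 + (x i)\<^sup>2)"
 have G: "?G \<in> borel_measurable circle_measures"
  by (intro borel_measurable_prod_ennreal measurable_compose[OF mv h]) simp
 let ?p = "ennreal (1 / pi ^ m)"
 let ?E = "%x v. if ordered m x & (\<forall>i<m. 0 < v i) & (\<Sum>i<m. v i) < 1 then ennreal (?v x) * ?r x v else 0"
 let ?L = "%x. Leb_n m (%v. ?f v x)"
 let ?g = "%x v k. ((1 - (cmod (config_coeff m x v k))\<^sup>2) powr b) ^ (m - k)"
 let ?h = "%x. Leb_n m (%v. ?E x v)"
 let ?t = "%v. simplex_density m (beta / 2 - 1) v * full_weights m v m"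
 have main: "(if ordered m x then ennreal (circle_density (Suc m) beta (cayley_points m x)) * ?L x * ennreal (\<Prod>i<m. 1 / (pi * (1 + (x i)\<^sup>2))) else 0) = ?p * ?h x" if x: "x \<in> space (leb m)" for x
 proof (cases "ordered m x")
  case ox: True
  let ?d = "circle_density (Suc m) beta (cayley_points m x)" and ?q = "\<Prod>i<m. 1 / (pi * (1 + (x i)\<^sup>2))"
  note [measurable] = measurable_const[OF cayley_points_in_space] measurable_const[OF x] G h'm
  \<comment> \<open>Distinct real points have distinct Cayley images, none of them 1. Hence the
    configuration has \<open>Suc m\<close> support points and its coefficients can be
    identified.\<close>
  have dnz: "?d ~= 0"
  proof -
   have "cayley_points m x j ~= cayley_points m x k" if "j < k" "k < Suc m" for j k
    using that ordered_less[OF ox, of j k] cayley_inj[of "x j" "x k"] cayley_ne_1[of "x j"]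
    by (auto simp: cayley_points_def)
   then show ?thesis unfolding circle_density_def by simp
  qed
  have q: "?q = 1 / pi ^ m * ?v x"
   by (simp add: prod_dividef prod.distrib)
  have A: "(%v. ?f v x) \<in> borel_measurable (leb m)"
   by measurable
  have "ennreal ?d * ?L x * ennreal ?q = Leb_n m (%v. ennreal ?d * ?f v x * ennreal ?q)"
   unfolding nn_integral_multc[OF borel_measurable_times_ennreal[OF borel_measurable_const A]] nn_integral_cmult[OF A] ..
  also have "... = Leb_n m (%v. ?p * ?E x v)"
  proof (rule nn_integral_cong)
   fix v
   show "ennreal ?d * ?f v x * ennreal ?q = ?p * ?E x v"
   proof (cases "v \<in> open_simplex m")
    case True
    then have vp: "!!i. i < m ==> 0 < v i" "(\<Sum>i<m. v i) < 1" by (auto simp: open_simplex_def)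
    note pc = point_config_in_space[OF cayley_points_in_space, of m x v]
    have mvk: "modified_verblunsky (Suc m) (point_config m (cayley_points m x) v) k = config_coeff m x v k" if "k < m" for k
     using modified_verblunsky_eq[OF pc card_supp_point_config[OF cayley_points_in_space True dnz], of k] that
     by (simp add: config_coeff_def circle_moment_point_config[OF True])
    have "config_disc m x v = (\<Prod>k<m. (1 - (cmod (config_coeff m x v k))\<^sup>2) ^ (m - k))"
     by (rule config_disc_coeff[OF ox]) (use vp in auto)
    then have "config_disc m x v powr b = (\<Prod>k<m. ?g x v k)"
     by (simp only: prod_powr_distrib power_powr)
    then have "?d * ?t v = (\<Prod>k<m. ?g x v k) * (\<Prod>i<m. 1 / v i)"
     unfolding densities_eq_config_disc[OF True] b_def by (simp only:)
    then have "ennreal ?d * (ennreal (?u v) * ennreal (full_weights m v m)) = (\<Prod>k<m. ennreal (?g x v k)) * ennreal (\<Prod>i<m. 1 / v i)"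
    proof -
     assume eq: "?d * ?t v = (\<Prod>k<m. ?g x v k) * (\<Prod>i<m. 1 / v i)"
     have "ennreal ?d * (ennreal (?u v) * ennreal (full_weights m v m)) = ennreal (?d * ?t v)"
      by (simp add: ennreal_mult circle_density_nonneg simplex_density_nonneg full_weights_nonneg)
     also have "... = ennreal (\<Prod>k<m. ?g x v k) * ennreal (\<Prod>i<m. 1 / v i)"
      unfolding eq by (intro ennreal_mult prod_nonneg ballI) (use vp(1) in \<open>auto simp: less_imp_le\<close>)
     also have "ennreal (\<Prod>k<m. ?g x v k) = (\<Prod>k<m. ennreal (?g x v k))"
      by (rule prod_ennreal[symmetric]) simp
     finally show ?thesis .
    qed
    moreover have "?G (point_config m (cayley_points m x) v) = (\<Prod>k<m. h k (config_coeff m x v k))"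
     by (intro prod.cong refl) (simp add: mvk)
    moreover have "d * (s * (w * g)) = (g' * p) * r" if "d * (s * w) = p * r" "g = g'" for d s w g g' p r :: ennreal
    proof -
     have "d * (s * (w * g)) = (d * (s * w)) * g" by (simp only: mult.assoc)
     then show ?thesis unfolding that by (simp only: mult.commute mult.left_commute)
    qed
    ultimately have "ennreal ?d * ?f v x = ?r x v"
     unfolding h'_def prod.distrib by blast
    moreover have "ennreal ?q = ?p * ennreal (?v x)"
     unfolding q by (rule ennreal_mult) (auto intro!: prod_nonneg)
    moreover have "?E x v = ennreal (?v x) * ?r x v"
     using ox vp by simp
    ultimately show ?thesis by (simp only: mult_ac)
   next
    case False
    then have "\<not> ((\<forall>i<m. 0 < v i) & (\<Sum>i<m. v i) < 1)" "?u v = 0" by (auto simp: open_simplex_def simplex_density_def)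
    then show ?thesis by (simp only: simp_thms if_False ennreal_0 mult_zero_left mult_zero_right)
   qed
  qed
  also have "... = ?p * ?h x"
   by (rule nn_integral_cmult) measurable
  finally show ?thesis using ox by simp
 qed simp
 let ?s = "\<Prod>k<m. disk_integral (beta / 2) (m - k) (h k)"
 have "(\<integral>\<^sup>+nu. ?G nu \<partial>biased_law m beta c) = ennreal (c * Suc m) * (of_nat (fact m) * Leb_n m (%x. ?p * ?h x))"
  unfolding nn_integral_biased_law_cayley[OF G] by (intro arg_cong2[where f="(*)"] refl nn_integral_cong main)
 also have "Leb_n m (%x. ?p * ?h x) = ?p * config_integral m h'"
 proof -
  note [measurable] = h'm
  have "(%x. ?h x) \<in> borel_measurable (leb m)" by measurable
  then show ?thesis unfolding config_integral_def by (rule nn_integral_cmult)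
 qed
 also have "config_integral m h' = ?s"
  unfolding config_integral_eq_prod[of h', OF h'm] disk_integral_def b_def[symmetric]
  by (intro prod.cong refl) (simp add: halfplane_integral_disk[OF h'm] h'_def)
 also have "ennreal (c * Suc m) * (of_nat (fact m) * (?p * ?s)) = ennreal (c * Suc m * fact m / pi ^ m) * ?s"
 proof -
  have "ennreal (c * Suc m * fact m / pi ^ m) = ennreal (c * Suc m) * ennreal (fact m) * ?p"
   using c by (simp add: ennreal_mult[symmetric] del: of_nat_Suc)
  moreover have "ennreal (fact m) = of_nat (fact m)" by (metis ennreal_of_nat_eq_real_of_nat of_nat_fact)
  ultimately show ?thesis by (simp only: mult.assoc)
 qed
 finally show ?thesis .
qed

section \<open>Marginal densities and independence\<close>

lemma measurable_disk_weight:
 "(%z. ennreal (((1 - (cmod z)\<^sup>2) powr b) ^ j) * ennreal (1 / (cmod (1 - z))\<^sup>2) * indicator (ball 0 1) z) \<in> borel_measurable borel"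
 using borel_measurable_indicator[of "ball (0::complex) 1" borel] by (intro borel_measurable_times_ennreal) (measurable, simp_all)

context
 fixes m :: nat and beta c :: real
 assumes c: "0 < c" and prob: "prob_space (biased_law m beta c)"
begin

interpretation N: prob_space "biased_law m beta c" by (rule prob)

abbreviation (input) "NN \<equiv> biased_law m beta c"
abbreviation (input) "gamma k nu \<equiv> modified_verblunsky (Suc m) nu k"

text \<open>The total mass of the law is 1, so the constant times the product of the disk integrals
  is 1, and no factor can be 0 or infinite.\<close>

lemma disk_integral_1:
 assumes "k < m" shows "disk_integral (beta / 2) (m - k) (%_. 1) ~= 0" "disk_integral (beta / 2) (m - k) (%_. 1) ~= top"
  and "ennreal (c * Suc m * fact m / pi ^ m) * (\<Prod>k<m. disk_integral (beta / 2) (m - k) (%_. 1)) = 1"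
proof -
 let ?I = "%k. disk_integral (beta / 2) (m - k) (%_. 1)"
 let ?K = "ennreal (c * Suc m * fact m / pi ^ m)"
 show one: "?K * (\<Prod>k<m. ?I k) = 1"
  using biased_law_coefficients[of c "%_ _. 1" m beta] c N.emeasure_space_1 by simp
 have K: "?K ~= 0" using c by (simp del: of_nat_Suc)
 have "?K * (?I k * (\<Prod>j\<in>{..<m} - {k}. ?I j)) = 1" using one assms by (subst (asm) prod.remove[of _ k]) auto
 then show "?I k ~= 0" "?I k ~= top" using K by (auto simp: ennreal_top_mult ennreal_mult_top split: if_splits)
qed

definition coeff_prob :: "nat => (complex => ennreal) => ennreal" where
 "coeff_prob k h = disk_integral (beta / 2) (m - k) h / disk_integral (beta / 2) (m - k) (%_. 1)"

lemma coeff_prob_1: "k < m ==> coeff_prob k (%_. 1) = 1"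
 unfolding coeff_prob_def using disk_integral_1 by (simp add: ennreal_divide_self less_top zero_less_iff_neq_zero)

lemma biased_law_product:
 assumes h: "!!k. h k \<in> borel_measurable borel"
 shows "(\<integral>\<^sup>+nu. (\<Prod>k<m. h k (gamma k nu)) \<partial>NN) = (\<Prod>k<m. coeff_prob k (h k))"
proof -
 let ?I = "%k. disk_integral (beta / 2) (m - k)"
 have eq: "?I k (h k) = coeff_prob k (h k) * ?I k (%_. 1)" if "k < m" for k
  unfolding coeff_prob_def ennreal_divide_times using disk_integral_1(1,2)[OF that]
  by (simp add: ennreal_divide_self less_top zero_less_iff_neq_zero)
 let ?f = "(\<integral>\<^sup>+nu. (\<Prod>k<m. h k (gamma k nu)) \<partial>NN)"
 have "?f = ennreal (c * Suc m * fact m / pi ^ m) * (\<Prod>k<m. coeff_prob k (h k) * ?I k (%_. 1))"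
  unfolding biased_law_coefficients[OF less_imp_le[OF c] h] by (intro arg_cong2[where f="(*)"] refl prod.cong eq) simp
 also have "... = (ennreal (c * Suc m * fact m / pi ^ m) * (\<Prod>k<m. ?I k (%_. 1))) * (\<Prod>k<m. coeff_prob k (h k))"
  by (simp only: prod.distrib mult_ac)
 also have "... = (\<Prod>k<m. coeff_prob k (h k))"
 \<comment> \<open>For \<open>m = 0\<close> there is no index at which the normalisation could be
   quoted; the products are empty.\<close>
 proof (cases m)
  case 0
  have "?f = 1" using 0 N.emeasure_space_1 by simp
  then show ?thesis using 0 biased_law_coefficients[OF less_imp_le[OF c] h, of m beta] by simp
 next
  case (Suc l)
  then show ?thesis using disk_integral_1(3)[of 0] by simp
 qed
 finally show ?thesis .
qed

lemma measurable_coeff [measurable]: "k \<le> m ==> gamma k \<in> borel_measurable NN"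
 using measurable_modified_verblunsky[of k "Suc m"] by (simp cong: measurable_cong_sets)

lemma biased_law_marginal:
 assumes k: "k < m" and A: "A \<in> sets borel"
 shows "emeasure (distr NN borel (gamma k)) A = coeff_prob k (indicator A)"
proof -
 have "emeasure (distr NN borel (gamma k)) A = (\<integral>\<^sup>+z. indicator A z \<partial>distr NN borel (gamma k))" using A by (simp add: nn_integral_indicator)
 also have "... = (\<integral>\<^sup>+nu. indicator A (gamma k nu) \<partial>NN)"
  by (rule nn_integral_distr) (use k A in \<open>auto intro: measurable_coeff\<close>)
 also have "... = (\<integral>\<^sup>+nu. (\<Prod>j<m. (if j = k then indicator A else (%_. 1)) (gamma j nu)) \<partial>NN)"
  using k by (intro nn_integral_cong) (simp add: if_distribR prod.delta)
 also have "... = (\<Prod>j<m. coeff_prob j (if j = k then indicator A else (%_. 1)))"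
  by (rule biased_law_product) (use A in auto)
 also have "... = (\<Prod>j<m. if j = k then coeff_prob k (indicator A) else 1)"
  by (intro prod.cong refl) (auto simp: coeff_prob_1)
 also have "... = coeff_prob k (indicator A)" using k by (simp add: prod.delta)
 finally show ?thesis .
qed

lemma biased_law_distributed:
 assumes k: "k < m"
 shows "\<exists>C>0. distributed NN lborel (gamma k)
  (%z. ennreal (C * (1 - (cmod z)\<^sup>2) powr (beta / 2 * (real (Suc m) - real k - 1)) * cmod (1 - z) powr (-2)) * indicator (ball 0 1) z)"
proof -
 let ?I = "disk_integral (beta / 2) (m - k)"
 have "inverse (?I (%_. 1)) ~= 0" "inverse (?I (%_. 1)) ~= top" using disk_integral_1(1,2)[OF k] by auto
 then obtain C where C: "inverse (?I (%_. 1)) = ennreal C" "0 < C"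
  by (cases "inverse (?I (%_. 1))") (auto simp: less_le)
 let ?g = "%z. ennreal (((1 - (cmod z)\<^sup>2) powr (beta / 2)) ^ (m - k)) * ennreal (1 / (cmod (1 - z))\<^sup>2) * indicator (ball 0 1) z"
 let ?f = "%z. ennreal (C * (1 - (cmod z)\<^sup>2) powr (beta / 2 * (real (Suc m) - real k - 1)) * cmod (1 - z) powr (-2)) * indicator (ball 0 1) z"
 have gm: "?g \<in> borel_measurable borel" by (rule measurable_disk_weight)
 have fg: "?f = (%z. ennreal C * ?g z)"
 proof
  fix z :: complex
  show "?f z = ennreal C * ?g z"
  proof (cases "z \<in> ball 0 1")
   case True
   then have z: "cmod z < 1" by simp
   then have y: "0 < 1 - (cmod z)\<^sup>2" by (simp add: power_less_one_iff)
   have j: "real (Suc m) - real k - 1 = real (m - k)" using k by simp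
   have "(1 - (cmod z)\<^sup>2) powr (beta / 2 * (real (Suc m) - real k - 1)) = ((1 - (cmod z)\<^sup>2) powr (beta / 2)) ^ (m - k)"
    unfolding j powr_powr[symmetric] by (rule powr_realpow) (use y in simp)
   moreover have "cmod (1 - z) powr (-2) = 1 / (cmod (1 - z))\<^sup>2"
   proof -
    have "z ~= 1" using z by auto
    then show ?thesis by (simp add: powr_minus_divide)
   qed
   moreover have "ennreal (C * p * q) = ennreal C * (ennreal p * ennreal q)" if "0 \<le> p" "0 \<le> q" for p q
    using C(2) that by (simp add: ennreal_mult mult.assoc)
   ultimately show ?thesis using True by (simp only: zero_le_power powr_ge_zero indicator_simps mult_1_right zero_le_divide_1_iff zero_le_power2)
  qed simp
 qed
 have fm: "?f \<in> borel_measurable lborel" unfolding fg using gm by simp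
 let ?h = "distr NN lborel (gamma k)"
 have "?h = density lborel ?f"
 proof (rule measure_eqI)
  fix A assume "A \<in> sets ?h"
  then have A: "A \<in> sets (borel :: complex measure)" by simp
  have "?h = distr NN borel (gamma k)" by (rule distr_cong) auto
  then have "emeasure ?h A = coeff_prob k (indicator A)" using biased_law_marginal[OF k A] by simp
  also have "... = ennreal C * ?I (indicator A)" by (simp add: coeff_prob_def divide_ennreal_def C(1) mult.commute)
  also have "?I (indicator A) = (Leb z. ?g z * indicator A z)"
   unfolding disk_integral_def by (intro nn_integral_cong) (simp only: mult_ac)
  also have "ennreal C * ... = (Leb z. ?f z * indicator A z)"
  proof -
   have "?f z * indicator A z = ennreal C * (?g z * indicator A z)" for z
    using fun_cong[OF fg, of z] by (simp only: mult.assoc)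
   moreover have "(%z. ?g z * indicator A z) \<in> borel_measurable lborel"
    using borel_measurable_times_ennreal[OF gm borel_measurable_indicator[OF A]] by simp
   ultimately show ?thesis by (simp only: nn_integral_cmult)
  qed
  also have "... = emeasure (density lborel ?f) A" by (rule emeasure_density[symmetric, OF fm]) (simp add: A)
  finally show "emeasure ?h A = emeasure (density lborel ?f) A" .
 qed simp
 moreover have "gamma k \<in> NN \<rightarrow>\<^sub>M lborel" using measurable_coeff[of k] k by simp
 ultimately have "distributed NN lborel (gamma k) ?f"
  using fm unfolding distributed_def by blast
 then show ?thesis using C(2) by blast
qed

text \<open>The last coefficient is almost surely constant and splits off from every rectangle. For
  the others the product formula, applied to indicators, gives the product law on
  rectangles.\<close>

lemma biased_law_indep:
 assumes last: "AE nu in NN. gamma m nu = 1"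
 shows "N.indep_vars (%_. borel) (%k. gamma k) {..<Suc m}"
proof -
 have rv: "gamma k \<in> borel_measurable NN" if "k \<in> {..<Suc m}" for k using that by (intro measurable_coeff) auto
 let ?q = "%k. distr NN borel (gamma k)"
 \<comment> \<open>The family must consist of probability measures at every natural index; beyond
   \<open>m\<close> point masses are inserted.\<close>
 interpret P: product_prob_space "%k. if k \<le> m then ?q k else return borel 0"
  by (rule product_prob_spaceI) (auto intro!: N.prob_space_distr measurable_coeff prob_space_return)
 let ?g = "%k. if k \<le> m then ?q k else return borel 0"
 let ?p = "%nu. \<lambda>k\<in>{..<Suc m}. gamma k nu"
 let ?r = "PiM {..<Suc m} (%k. ?g k)"
 have PiM: "?r = PiM {..<Suc m} (%k. ?q k)"
  by (rule PiM_cong) auto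
 let ?f = "distr NN (PiM {..<Suc m} (%_. borel)) (%nu. ?p nu)"
 let ?h = "%A nu. \<Prod>k<m. indicator (if k < m then A k else {}) (gamma k nu)"
 have "?f = ?r"
 proof (rule P.PiM_eqI)
  show "sets ?f = sets ?r"
   unfolding sets_distr by (rule sets_PiM_cong) auto
  fix A assume "!!i. i \<in> {..<Suc m} ==> A i \<in> sets (?g i)"
  then have A: "A i \<in> sets borel" if "i \<le> m" for i using that by (metis lessThan_iff less_Suc_eq_le sets_distr)
  have rvs: "(%nu. ?p nu) \<in> NN \<rightarrow>\<^sub>M PiM {..<Suc m} (%_. borel)"
   by (rule measurable_restrict) (rule rv)
  have "PiE {..<Suc m} A \<in> sets (PiM {..<Suc m} (%_. borel :: complex measure))"
   using A by (intro sets_PiM_I_finite) auto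
  then have "emeasure ?f (PiE {..<Suc m} A) = (\<integral>\<^sup>+nu. indicator (PiE {..<Suc m} A) (?p nu) \<partial>NN)"
   by (subst nn_integral_distr[OF rvs, symmetric]) (simp_all add: nn_integral_indicator del: lessThan_Suc)
  also have "... = (\<integral>\<^sup>+nu. ?h A nu * indicator (A m) 1 \<partial>NN)"
  proof (rule nn_integral_cong_AE)
   show "AE nu in NN. indicator (PiE {..<Suc m} A) (?p nu) = ?h A nu * (indicator (A m) 1 :: ennreal)"
    using last
   proof eventually_elim
    case (elim nu)
    show ?case
    proof (cases "\<forall>k<m. gamma k nu \<in> A k")
     case True
     have "?p nu \<in> PiE {..<Suc m} A \<longleftrightarrow> (\<forall>k<Suc m. gamma k nu \<in> A k)" by (auto simp: PiE_iff)
     also have "... \<longleftrightarrow> gamma m nu \<in> A m" using True by (metis less_Suc_eq)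
     finally have "?p nu \<in> PiE {..<Suc m} A \<longleftrightarrow> 1 \<in> A m" unfolding elim .
     moreover have "?h A nu = (1 :: ennreal)" using True by (intro prod.neutral) auto
     ultimately show ?thesis by (simp add: indicator_def del: lessThan_Suc)
    next
     case False
     then obtain k where k: "k < m" "gamma k nu \<notin> A k" by blast
     then have "(?p nu) \<notin> PiE {..<Suc m} A" by (auto simp: PiE_iff)
     moreover have "?h A nu = (0 :: ennreal)" by (rule prod_zero) (use k in \<open>auto intro!: bexI[of _ k]\<close>)
     ultimately show ?thesis by (simp add: indicator_def del: lessThan_Suc)
    qed
   qed
  qed
  also have "... = (\<integral>\<^sup>+nu. ?h A nu \<partial>NN) * indicator (A m) 1"
   by (rule nn_integral_multc) (intro borel_measurable_prod_ennreal measurable_compose[OF measurable_coeff borel_measurable_indicator], use A in auto)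
  also have "... = (\<Prod>k<m. coeff_prob k (indicator (if k < m then A k else {}))) * indicator (A m) 1"
   by (subst biased_law_product) (use A in auto)
  also have "(\<Prod>k<m. coeff_prob k (indicator (if k < m then A k else {}))) = (\<Prod>k<m. emeasure (?q k) (A k))"
   using A by (intro prod.cong refl) (simp add: biased_law_marginal)
  also have "indicator (A m) 1 = emeasure (distr NN borel (gamma m)) (A m)"
  proof -
   have "emeasure (distr NN borel (gamma m)) (A m) = (\<integral>\<^sup>+z. indicator (A m) z \<partial>distr NN borel (gamma m))" using A[of m] by (simp add: nn_integral_indicator)
   also have "... = (\<integral>\<^sup>+nu. indicator (A m) (gamma m nu) \<partial>NN)"
    by (rule nn_integral_distr[OF measurable_coeff]) (use A[of m] in auto)
   also have "... = (\<integral>\<^sup>+nu. indicator (A m) 1 \<partial>NN)" by (rule nn_integral_cong_AE) (use last in eventually_elim, simp)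
   finally show ?thesis using N.emeasure_space_1 by simp
  qed
  finally have "emeasure ?f (PiE {..<Suc m} A) = (\<Prod>k<Suc m. emeasure (?q k) (A k))"
   by (simp only: prod.lessThan_Suc)
  also have "... = (\<Prod>k<Suc m. emeasure (?g k) (A k))"
   by (intro prod.cong) auto
  finally show "emeasure ?f (PiE {..<Suc m} A) = (\<Prod>k<Suc m. emeasure (?g k) (A k))" .
 qed simp
 then show ?thesis unfolding PiM using rv by (subst N.indep_vars_iff_distr_eq_PiM') auto
qed

end

theorem proposition6:
  fixes n :: nat and \<beta> :: real
    and \<Omega> :: "'w measure" and \<mu> :: "'w \<Rightarrow> complex measure" and X Y :: "'w \<Rightarrow> complex"
  assumes "n \<ge> 1" and "\<beta> > 0"
    and "prob_space \<Omega>"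
    and "\<mu> \<in> \<Omega> \<rightarrow>\<^sub>M circle_measures"
    and "distr \<Omega> circle_measures \<mu> = killip_nenciu n \<beta>"
    and "picked_from \<Omega> X \<mu>"
    and "picked_from \<Omega> Y (\<lambda>\<omega>. uniform_on_supp (\<mu> \<omega>))"
  shows "\<exists>N. is_biased_by_weight_of_one (killip_nenciu n \<beta>) N \<and>
    distr \<Omega> closed_subsets (\<lambda>\<omega>. supp (rotate_measure (X \<omega>) (\<mu> \<omega>))) =
      distr N closed_subsets supp \<and>
    distr \<Omega> closed_subsets (\<lambda>\<omega>. supp (rotate_measure (Y \<omega>) (uniform_on_supp (\<mu> \<omega>)))) =
      distr N closed_subsets supp \<and>
    (AE \<nu> in N. finite (supp \<nu>) \<and> card (supp \<nu>) = n) \<and>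
    prob_space.indep_vars N (\<lambda>_. borel) (\<lambda>k \<nu>. modified_verblunsky n \<nu> k) {..<n} \<and>
    (\<forall>k. k + 2 \<le> n \<longrightarrow> (\<exists>C>0.
       distributed N lborel (\<lambda>\<nu>. modified_verblunsky n \<nu> k)
         (\<lambda>z. ennreal (C * (1 - (cmod z)\<^sup>2) powr (\<beta> / 2 * (real n - real k - 1))
                * cmod (1 - z) powr (-2)) * indicator (ball 0 1) z))) \<and>
    (AE \<nu> in N. modified_verblunsky n \<nu> (n - 1) = 1)"
proof -
 \<comment> \<open>\<open>m\<close> counts the points other than the one moved to 1, and the
   coefficients other than the constant last one.\<close>
 obtain m where n: "n = Suc m" using assms(1) by (cases n) auto
 interpret \<Omega>: prob_space \<Omega> by fact
 let ?KN = "killip_nenciu (Suc m) \<beta>"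
 have law: "distr \<Omega> circle_measures \<mu> = ?KN" using assms(5) n by simp
 \<comment> \<open>As the law of a random measure on a probability space it has mass 1; finiteness
   and positivity of the normalising integrals are drawn from this.\<close>
 have KNp: "prob_space ?KN" unfolding law[symmetric] by (rule \<Omega>.prob_space_distr) fact
 have KNs: "sets ?KN = sets circle_measures" by (simp add: killip_nenciu_def)
 obtain c where c: "0 < c" and KN: "\<And>G. G \<in> borel_measurable circle_measures \<Longrightarrow> (\<integral>\<^sup>+\<mu>. G \<mu> \<partial>?KN) = ennreal c * kn_integral m \<beta> G"
  using killip_nenciu_eq[OF KNp] by metis
 note hyp = c KNp KNs KN
 have Np: "prob_space (biased_law m \<beta> c)" by (rule prob_space_biased_law[OF hyp])
 have last: "AE \<nu> in biased_law m \<beta> c. modified_verblunsky (Suc m) \<nu> m = 1" by (rule AE_modified_verblunsky_last[OF hyp])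
 show ?thesis unfolding n
 proof (intro exI[of _ "biased_law m \<beta> c"] conjI allI impI)
  show "is_biased_by_weight_of_one ?KN (biased_law m \<beta> c)" by (rule is_biased_law[OF hyp])
  show "distr \<Omega> closed_subsets (\<lambda>\<omega>. supp (rotate_measure (X \<omega>) (\<mu> \<omega>))) = distr (biased_law m \<beta> c) closed_subsets supp"
   by (rule support_law_picked[OF hyp assms(3,4) law assms(6)])
  show "distr \<Omega> closed_subsets (\<lambda>\<omega>. supp (rotate_measure (Y \<omega>) (uniform_on_supp (\<mu> \<omega>)))) = distr (biased_law m \<beta> c) closed_subsets supp"
   by (rule support_law_uniform[OF hyp assms(3,4) law assms(7)])
  show "AE \<nu> in biased_law m \<beta> c. finite (supp \<nu>) \<and> card (supp \<nu>) = Suc m" by (rule AE_card_supp_biased[OF hyp])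
  show "prob_space.indep_vars (biased_law m \<beta> c) (\<lambda>_. borel) (\<lambda>k \<nu>. modified_verblunsky (Suc m) \<nu> k) {..<Suc m}"
   by (rule biased_law_indep[OF c Np last])
  show "\<exists>C>0. distributed (biased_law m \<beta> c) lborel (\<lambda>\<nu>. modified_verblunsky (Suc m) \<nu> k)
   (\<lambda>z. ennreal (C * (1 - (cmod z)\<^sup>2) powr (\<beta> / 2 * (real (Suc m) - real k - 1)) * cmod (1 - z) powr (-2)) * indicator (ball 0 1) z)"
   if "k + 2 \<le> Suc m" for k
   by (rule biased_law_distributed[OF c Np]) (use that in simp)
  show "AE \<nu> in biased_law m \<beta> c. modified_verblunsky (Suc m) \<nu> (Suc m - 1) = 1" using last by simp
 qed
qed

end
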